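(* Let $u$ be a weak solution of the inviscid Clark-$\alpha$ model with $u\in L^3((0,T);B^s_{3,\infty}(\mathbb{T}^3))$ with $s>1$. Then the solution conserves energy. In particular, it holds that $$\|u(\cdot,t_1)\|_{H^1}=\|u(\cdot,t_2)\|_{H^1}$$ for almost every $t_1,t_2\in(0,T)$.
   Context: Fix $\alpha>0$, $T>0$; $\mathbb{T}^3$ is the flat three-dimensional torus; repeated indices are summed; $\mathcal{D}$ denotes smooth compactly supported functions; $B^s_{3,\infty}$ is the usual Besov space. The $H^1$ norm used is $\|u\|_{H^1}^2=\|u\|_{L^2}^2+\alpha^2\|\nabla u\|_{L^2}^2$. The inviscid Clark-$\alpha$ model is $\partial_tv+\nabla\cdot(u\otimes v)+\nabla\cdot(v\otimes u)-\nabla\cdot(u\otimes u)-\alpha^2\nabla\cdot(\nabla u\cdot\nabla u^T)+\nabla p=0$, $v=u-\alpha^2\Delta u$, $\nabla\cdot u=\nabla\cdot v=0$, where $(\nabla u\cdot\nabla u^T)_{ij}=\partial_ku_i\partial_ku_j$. A pair $u\in L^\infty((0,T);H^1(\mathbb{T}^3))$ (vector-valued), $p\in L^\infty((0,T);L^1(\mathbb{T}^3))$ (scalar) is a weak solution if for all $\psi\in\mathcal{D}(\mathbb{T}^3\times(0,T);\mathbb{R}^3)$ and $\chi\in\mathcal{D}(\mathbb{T}^3\times(0,T);\mathbb{R})$ $$\begin{aligned}&\int_0^T\!\!\int_{\mathbb{T}^3}\Big[u\cdot\partial_t\psi+\alpha^2\nabla u:\nabla\partial_t\psi+u_iu_j\partial_i\psi_j+2\alpha^2\partial_ku_i\partial_ku_j\partial_i\psi_j+\alpha^2u_i\partial_ku_j\partial_i\partial_k\psi_j\\&\quad+\alpha^2\partial_ku_i\,u_j\,\partial_i\partial_k\psi_j-\alpha^2\partial_ku_i\partial_ku_j\partial_i\psi_j+p\,\nabla\cdot\psi\Big]dx\,dt=0,\end{aligned}$$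 and $\int_0^T\int_{\mathbb{T}^3}u_i\partial_i\chi\,dx\,dt=0$, with $\int_{\mathbb{T}^3}p(x,t)\,dx=0$. *)

theory Defs
  imports "HOL-Analysis.Analysis"
begin

section \<open>Functions on the flat torus\<close>

text \<open>The torus is \<open>\<real>\<^sup>3 / \<int>\<^sup>3\<close>: functions on it are functions on \<open>\<real>\<^sup>3\<close> with period 1 in every
  coordinate, and integrals over it are integrals over the unit cube.\<close>

abbreviation torus :: "(real^3) measure" where
  "torus \<equiv> lebesgue_on (cbox 0 1)"

definition periodic :: "(real^3 \<Rightarrow> 'b) \<Rightarrow> bool" where
  "periodic f \<longleftrightarrow> (\<forall>x i. f (x + axis i 1) = f x)"

definition torus_measurable :: "(real^3 \<Rightarrow> 'b::topological_space) \<Rightarrow> bool" where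
  "torus_measurable f \<longleftrightarrow> periodic f \<and> f \<in> borel_measurable lebesgue"

definition torus_integrable :: "(real^3 \<Rightarrow> 'b::{banach, second_countable_topology}) \<Rightarrow> bool" where
  "torus_integrable f \<longleftrightarrow> torus_measurable f \<and> integrable torus f"

text \<open>All norms below take the value \<open>\<infinity>\<close> on functions outside the space in question. They are norms
  only up to equality almost everywhere.\<close>

definition ennpowr :: "ennreal \<Rightarrow> real \<Rightarrow> ennreal" where
  "ennpowr a r = (if a = \<infinity> then \<infinity> else ennreal (enn2real a powr r))"

definition Lp_norm :: "real \<Rightarrow> (real^3 \<Rightarrow> 'b::real_normed_vector) \<Rightarrow> ennreal" where
  "Lp_norm p f =
    (if torus_measurable f then ennpowr (\<integral>\<^sup>+ x. ennreal (norm (f x) powr p) \<partial>torus) (1 / p) else \<infinity>)"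

section \<open>Smooth functions and derivatives\<close>

primrec Ck :: "nat \<Rightarrow> ('a::real_normed_vector \<Rightarrow> 'b::real_normed_vector) \<Rightarrow> bool" where
  "Ck 0 f \<longleftrightarrow> continuous_on UNIV f"
| "Ck (Suc n) f \<longleftrightarrow>
    (\<forall>x. f differentiable (at x)) \<and> (\<forall>v. Ck n (\<lambda>x. frechet_derivative f (at x) v))"

definition smooth :: "('a::real_normed_vector \<Rightarrow> 'b::real_normed_vector) \<Rightarrow> bool" where
  "smooth f \<longleftrightarrow> (\<forall>n. Ck n f)"

definition partial :: "3 \<Rightarrow> (real^3 \<Rightarrow> 'b::real_normed_vector) \<Rightarrow> real^3 \<Rightarrow> 'b" where
  "partial i f x = frechet_derivative f (at x) (axis i 1)"

definition time_deriv :: "(real \<Rightarrow> real^3 \<Rightarrow> 'b::real_normed_vector) \<Rightarrow> real \<Rightarrow> real^3 \<Rightarrow> 'b" where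
  "time_deriv \<psi> t x = vector_derivative (\<lambda>\<tau>. \<psi> \<tau> x) (at t)"

text \<open>Since the torus is compact, compact support in the product of the torus with
  \<open>(0,T)\<close> is a condition on \<open>t\<close> only.\<close>

definition test_function :: "real \<Rightarrow> (real \<Rightarrow> real^3 \<Rightarrow> 'b::real_normed_vector) \<Rightarrow> bool" where
  "test_function T \<psi> \<longleftrightarrow>
    smooth (\<lambda>(t, x). \<psi> t x) \<and> (\<forall>t. periodic (\<psi> t)) \<and>
    (\<exists>a b. 0 < a \<and> b < T \<and> (\<forall>t x. t \<notin> {a..b} \<longrightarrow> \<psi> t x = 0))"

definition has_weak_partial ::
  "3 \<Rightarrow> (real^3 \<Rightarrow> 'b::{banach, second_countable_topology}) \<Rightarrow> (real^3 \<Rightarrow> 'b) \<Rightarrow> bool" where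
  "has_weak_partial i f g \<longleftrightarrow>
    torus_integrable f \<and> torus_integrable g \<and>
    (\<forall>\<phi> :: real^3 \<Rightarrow> real. smooth \<phi> \<and> periodic \<phi> \<longrightarrow>
      (LINT x|torus. partial i \<phi> x *\<^sub>R f x) = - (LINT x|torus. \<phi> x *\<^sub>R g x))"

text \<open>The weak derivative is determined only up to a null set, so \<open>weak_partial i (u t)\<close> need not be
  jointly measurable in \<open>t\<close> and \<open>x\<close>. It is only used inside integrals over the torus at fixed
  \<open>t\<close>, whose values do not depend on the representative.\<close>

definition weak_partial ::
  "3 \<Rightarrow> (real^3 \<Rightarrow> 'b::{banach, second_countable_topology}) \<Rightarrow> real^3 \<Rightarrow> 'b" where
  "weak_partial i f = (SOME g. has_weak_partial i f g)"

definition H1_norm :: "real \<Rightarrow> (real^3 \<Rightarrow> 'b::{banach, second_countable_topology}) \<Rightarrow> ennreal" where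
  "H1_norm \<alpha> f =
    (if \<forall>i. \<exists>g. has_weak_partial i f g
     then ennpowr ((Lp_norm 2 f)\<^sup>2 + ennreal (\<alpha>\<^sup>2) * (\<Sum>i\<in>UNIV. (Lp_norm 2 (weak_partial i f))\<^sup>2)) (1 / 2)
     else \<infinity>)"

section \<open>Besov spaces with third index \<open>\<infinity>\<close>\<close>

definition character :: "int^3 \<Rightarrow> real^3 \<Rightarrow> complex" where
  "character k x = cis (2 * pi * (\<Sum>i\<in>UNIV. of_int (k $ i) * x $ i))"

definition fourier_coeff :: "(real^3 \<Rightarrow> real^3) \<Rightarrow> int^3 \<Rightarrow> complex^3" where
  "fourier_coeff f k = (\<chi> j. LINT x|torus. complex_of_real (f x $ j) * cnj (character k x))"

text \<open>A cutoff \<open>\<theta>\<close> generates the inhomogeneous dyadic partition of unity \<open>\<theta>\<close>,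
  \<open>\<theta>(2\<^sup>-\<^sup>j \<xi>) - \<theta>(2\<^sup>1\<^sup>-\<^sup>j \<xi>)\<close> (\<open>j \<ge> 1\<close>).\<close>

definition dyadic_cutoff :: "(real^3 \<Rightarrow> real) \<Rightarrow> bool" where
  "dyadic_cutoff \<theta> \<longleftrightarrow>
    smooth \<theta> \<and> (\<forall>\<xi>. norm \<xi> \<le> 1 \<longrightarrow> \<theta> \<xi> = 1) \<and> (\<forall>\<xi>. 2 \<le> norm \<xi> \<longrightarrow> \<theta> \<xi> = 0)"

definition dyadic_symbol :: "(real^3 \<Rightarrow> real) \<Rightarrow> nat \<Rightarrow> real^3 \<Rightarrow> real" where
  "dyadic_symbol \<theta> j \<xi> =
    (if j = 0 then \<theta> \<xi> else \<theta> (\<xi> /\<^sub>R 2 ^ j) - \<theta> (\<xi> /\<^sub>R 2 ^ (j - 1)))"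

text \<open>Only finitely many terms of the sum are nonzero when \<open>\<theta>\<close> is a dyadic cutoff.\<close>

definition dyadic_block ::
  "(real^3 \<Rightarrow> real) \<Rightarrow> nat \<Rightarrow> (real^3 \<Rightarrow> real^3) \<Rightarrow> real^3 \<Rightarrow> complex^3" where
  "dyadic_block \<theta> j f x =
    infsum (\<lambda>k. (complex_of_real (dyadic_symbol \<theta> j (\<chi> i. of_int (k $ i))) * character k x)
                 *s fourier_coeff f k) UNIV"

text \<open>This is the norm of \<open>B\<^sup>s\<^sub>p\<^sub>,\<^sub>\<infinity>\<close>. Only integrable functions are considered, not general
  distributions; for \<open>s > 0\<close> and \<open>p \<ge> 1\<close> the space consists of \<open>L\<^sup>p\<close> functions anyway.\<close>

definition besov_infinity_norm ::
  "(real^3 \<Rightarrow> real) \<Rightarrow> real \<Rightarrow> real \<Rightarrow> (real^3 \<Rightarrow> real^3) \<Rightarrow> ennreal" where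
  "besov_infinity_norm \<theta> s p f =
    (if torus_integrable f
     then SUP j. ennreal (2 powr (real j * s)) * Lp_norm p (dyadic_block \<theta> j f) else \<infinity>)"

section \<open>Bochner spaces\<close>

text \<open>A Banach space of functions on the torus is given by its norm \<open>N\<close>, its elements being the \<open>f\<close>
  with \<open>N f < \<infinity>\<close>, up to equality almost everywhere. Measurability is strong measurability: the
  function is an almost everywhere limit, in the norm, of simple functions with values in the
  space.\<close>

definition strongly_measurable ::
  "((real^3 \<Rightarrow> 'b::real_normed_vector) \<Rightarrow> ennreal) \<Rightarrow> real \<Rightarrow> (real \<Rightarrow> real^3 \<Rightarrow> 'b) \<Rightarrow> bool" where
  "strongly_measurable N T u \<longleftrightarrow>
    (\<exists>\<sigma> :: nat \<Rightarrow> real \<Rightarrow> real^3 \<Rightarrow> 'b.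
      (\<forall>n. simple_function (lebesgue_on {0<..<T}) (\<sigma> n)) \<and>
      (\<forall>n. \<forall>t\<in>{0<..<T}. N (\<sigma> n t) < \<infinity>) \<and>
      (AE t in lebesgue_on {0<..<T}. (\<lambda>n. N (\<lambda>x. u t x - \<sigma> n t x)) \<longlonglongrightarrow> 0))"

definition in_Bochner_Lq ::
  "((real^3 \<Rightarrow> 'b::real_normed_vector) \<Rightarrow> ennreal) \<Rightarrow> real \<Rightarrow> real \<Rightarrow> (real \<Rightarrow> real^3 \<Rightarrow> 'b) \<Rightarrow> bool" where
  "in_Bochner_Lq N T q u \<longleftrightarrow>
    strongly_measurable N T u \<and> (\<integral>\<^sup>+ t. ennpowr (N (u t)) q \<partial>lebesgue_on {0<..<T}) < \<infinity>"

definition in_Bochner_Linfinity ::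
  "((real^3 \<Rightarrow> 'b::real_normed_vector) \<Rightarrow> ennreal) \<Rightarrow> real \<Rightarrow> (real \<Rightarrow> real^3 \<Rightarrow> 'b) \<Rightarrow> bool" where
  "in_Bochner_Linfinity N T u \<longleftrightarrow>
    strongly_measurable N T u \<and> (\<exists>C::real. AE t in lebesgue_on {0<..<T}. N (u t) \<le> ennreal C)"

section \<open>Weak solutions of the inviscid Clark-\<open>\<alpha>\<close> model\<close>

definition clark_integrand ::
  "real \<Rightarrow> (real \<Rightarrow> real^3 \<Rightarrow> real^3) \<Rightarrow> (real \<Rightarrow> real^3 \<Rightarrow> real) \<Rightarrow> (real \<Rightarrow> real^3 \<Rightarrow> real^3)
    \<Rightarrow> real \<Rightarrow> real^3 \<Rightarrow> real" where
  "clark_integrand \<alpha> u p \<psi> t x =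
    (let U = (\<lambda>i. u t x $ i);
         D = (\<lambda>k i. weak_partial k (u t) x $ i);
         P = (\<lambda>i j. partial i (\<psi> t) x $ j);
         P2 = (\<lambda>i k j. partial i (partial k (\<psi> t)) x $ j)
     in (\<Sum>j\<in>UNIV. U j * time_deriv \<psi> t x $ j)
      + \<alpha>\<^sup>2 * (\<Sum>k\<in>UNIV. \<Sum>j\<in>UNIV. D k j * partial k (time_deriv \<psi> t) x $ j)
      + (\<Sum>i\<in>UNIV. \<Sum>j\<in>UNIV. U i * U j * P i j)
      + 2 * \<alpha>\<^sup>2 * (\<Sum>i\<in>UNIV. \<Sum>j\<in>UNIV. \<Sum>k\<in>UNIV. D k i * D k j * P i j)
      + \<alpha>\<^sup>2 * (\<Sum>i\<in>UNIV. \<Sum>j\<in>UNIV. \<Sum>k\<in>UNIV. U i * D k j * P2 i k j)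
      + \<alpha>\<^sup>2 * (\<Sum>i\<in>UNIV. \<Sum>j\<in>UNIV. \<Sum>k\<in>UNIV. D k i * U j * P2 i k j)
      - \<alpha>\<^sup>2 * (\<Sum>i\<in>UNIV. \<Sum>j\<in>UNIV. \<Sum>k\<in>UNIV. D k i * D k j * P i j)
      + p t x * (\<Sum>i\<in>UNIV. P i i))"

definition clark_weak_solution ::
  "real \<Rightarrow> real \<Rightarrow> (real \<Rightarrow> real^3 \<Rightarrow> real^3) \<Rightarrow> (real \<Rightarrow> real^3 \<Rightarrow> real) \<Rightarrow> bool" where
  "clark_weak_solution \<alpha> T u p \<longleftrightarrow>
    in_Bochner_Linfinity (H1_norm \<alpha>) T u \<and>
    in_Bochner_Linfinity (Lp_norm 1) T p \<and>
    (\<forall>\<psi>. test_function T \<psi> \<longrightarrow>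
      (LINT t|lebesgue_on {0<..<T}. LINT x|torus. clark_integrand \<alpha> u p \<psi> t x) = 0) \<and>
    (\<forall>\<eta> :: real \<Rightarrow> real^3 \<Rightarrow> real. test_function T \<eta> \<longrightarrow>
      (LINT t|lebesgue_on {0<..<T}. LINT x|torus. (\<Sum>i\<in>UNIV. u t x $ i * partial i (\<eta> t) x)) = 0) \<and>
    (AE t in lebesgue_on {0<..<T}. (LINT x|torus. p t x) = 0)"

end

theory Submission
  imports Defs
begin

text \<open>Formally the velocity is an admissible test field, and the spatial terms then cancel: the transport
  of \<open>u\<close> and of \<open>\<nabla>u\<close> by the divergence-free field \<open>u\<close> contributes nothing, the pressure is orthogonal
  to divergence-free fields, and the two remaining cubic expressions in \<open>\<nabla>u\<close> are equal with opposite
  signs. All these expressions are trilinear, so they make sense if \<open>\<nabla>u\<close> is cube-integrable. This is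
  what Besov regularity of order \<open>s > 1\<close> gives: by Bernstein's inequality the gradients of the
  dyadic blocks form a geometric series (\<open>bernstein_N3\<close>, \<open>besov_W13\<close>).

  To justify the computation the velocity is mollified by a positive trigonometric kernel, a product of
  the functions \<open>cos\<^sup>2\<^sup>N (\<pi> z\<^sub>i)\<close>. Only finitely many Fourier modes are then involved
  (\<open>kern_expansion\<close>). By the weak formulation each of them is, for almost every time, a constant plus the
  primitive of a bounded function (\<open>weak_time_derivative\<close>, \<open>moment_evolution\<close>). The mollified energy
  is a finite sum of squares of such modes, since waves are eigenfunctions of \<open>1 - \<alpha>\<^sup>2 \<Delta>\<close>
  (\<open>moment_wave\<close>), and the product rule for primitives gives its evolution: a constant plus the
  primitive of twice the flux, which is the spatial part of the equation tested with the mollified velocity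
  (\<open>mol_energy_evolution\<close>).

  It remains to show that the flux disappears with the mollification. The only term that is not
  directly controlled by \<open>\<nabla>u\<close> in \<open>L\<^sup>3\<close> is the transport of \<open>\<nabla>u\<close>, where a derivative falls on the
  mollified gradient. Symmetrizing in the two gradients and using that the derivative of the kernel is odd
  produces a difference of the transporting velocity, of size \<open>|y| \<nabla>u\<close>, against a kernel for which
  \<open>|y| |\<nabla>K(y)|\<close> has bounded integral (\<open>partial_kern_weighted\<close>, \<open>transport_form_bound\<close>). With this
  commutator estimate, uniform in \<open>N\<close>, convergence follows by approximation with smooth functions
  (\<open>transport_limit\<close>, \<open>total_flux_tendsto\<close>), and the flux is dominated by the cube of the Besov
  norm (\<open>flux_dominated\<close>). Dominated convergence in time then makes the energy constant
  (\<open>energy_constant\<close>).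

  Two points of measure theory need care. The values of the solution are given through strongly measurable maps,
  so every functional of the solution is measurable only after passing through simple functions
  (\<open>strongly_measurable_functional\<close>); and an exceptional null set of times may be discarded for
  countably many waves only, which suffices because Fourier coefficients determine an integrable function
  (\<open>fourier_unique\<close>).\<close>

section \<open>Smooth functions\<close>

lemma Ck_continuous: "Ck n f \<Longrightarrow> continuous_on UNIV f"
  by (cases n) (auto intro!: differentiable_imp_continuous_on simp: differentiable_on_def)

lemma Ck_SucI:
  assumes "\<And>x. (f has_derivative f' x) (at x)" and "\<And>v. Ck n (\<lambda>x. f' x v)"
  shows "Ck (Suc n) f"
proof -
  have "frechet_derivative f (at x) = f' x" for x
    using frechet_derivative_at[OF assms(1)] by simp
  then show ?thesis
    using assms by (auto simp: differentiable_def)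
qed

lemma Ck_has_derivative:
  "Ck (Suc n) f \<Longrightarrow> (f has_derivative frechet_derivative f (at x)) (at x)"
  by (simp add: frechet_derivative_works)

lemma Ck_Suc_derivative: "Ck (Suc n) f \<Longrightarrow> Ck n (\<lambda>x. frechet_derivative f (at x) v)"
  by simp

lemma Ck_SucD: "Ck (Suc n) f \<Longrightarrow> Ck n f"
proof (induction n arbitrary: f)
  case 0 then show ?case using Ck_continuous[OF 0] by simp
next
  case (Suc n)
  show ?case unfolding Ck.simps(2)[of n]
    using Suc.prems Suc.IH by auto
qed

lemma Ck_const: "Ck n (\<lambda>x. c)"
proof (induction n arbitrary: c)
  case (Suc n)
  show ?case by (rule Ck_SucI[where f' = "\<lambda>x h. 0"]) (auto intro: Suc)
qed simp

lemma Ck_linear_comp: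
  assumes "bounded_linear L" "Ck n f"
  shows "Ck n (\<lambda>x. L (f x))"
  using assms(2)
proof (induction n arbitrary: f)
  case 0 then show ?case
    using assms(1) linear_continuous_on_compose bounded_linear.continuous_on by auto
next
  case (Suc n)
  show ?case
  proof (rule Ck_SucI)
    show "((\<lambda>x. L (f x)) has_derivative (\<lambda>h. L (frechet_derivative f (at x) h))) (at x)" for x
      by (rule bounded_linear.has_derivative[OF assms(1) Ck_has_derivative[OF Suc.prems]])
    show "Ck n (\<lambda>x. L (frechet_derivative f (at x) v))" for v
      using Suc by auto
  qed
qed

lemma Ck_comp_affine:
  assumes "bounded_linear L" "Ck n f"
  shows "Ck n (\<lambda>x. f (L x + c))"
  using assms(2)
proof (induction n arbitrary: f)
  case 0 then show ?case
    by (auto intro!: continuous_intros linear_continuous_on[OF assms(1)]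
        continuous_on_compose2[of UNIV f UNIV "\<lambda>x. L x + c"])
next
  case (Suc n)
  show ?case
  proof (rule Ck_SucI)
    fix x
    have "((\<lambda>x. L x + c) has_derivative L) (at x)"
      using bounded_linear_imp_has_derivative[OF assms(1)] by (auto intro!: derivative_eq_intros)
    from has_derivative_compose[OF this Ck_has_derivative[OF Suc.prems]]
    show "((\<lambda>x. f (L x + c)) has_derivative (\<lambda>h. frechet_derivative f (at (L x + c)) (L h))) (at x)" .
    show "Ck n (\<lambda>x. frechet_derivative f (at (L x + c)) (L v))" for v
      using Suc.IH[of "\<lambda>y. frechet_derivative f (at y) (L v)"] Suc.prems by auto
  qed
qed

lemma Ck_add: "Ck n f \<Longrightarrow> Ck n g \<Longrightarrow> Ck n (\<lambda>x. f x + g x)"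
proof (induction n arbitrary: f g)
  case 0 then show ?case by (simp add: continuous_on_add)
next
  case (Suc n)
  then show ?case
    by (intro Ck_SucI[where f' = "\<lambda>x h. frechet_derivative f (at x) h + frechet_derivative g (at x) h"]
          has_derivative_add Ck_has_derivative[OF Suc.prems(1)] Ck_has_derivative[OF Suc.prems(2)]
          Suc.IH[OF Ck_Suc_derivative[OF Suc.prems(1)] Ck_Suc_derivative[OF Suc.prems(2)]])
qed

lemma Ck_scaleR:
  fixes f :: "'a::real_normed_vector \<Rightarrow> real"
  shows "Ck n f \<Longrightarrow> Ck n g \<Longrightarrow> Ck n (\<lambda>x. f x *\<^sub>R g x)"
proof (induction n arbitrary: f g)
  case 0 then show ?case by (simp add: continuous_on_scaleR)
next
  case (Suc n)
  show ?case
  proof (rule Ck_SucI)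
    show "((\<lambda>x. f x *\<^sub>R g x) has_derivative
       (\<lambda>h. f x *\<^sub>R frechet_derivative g (at x) h + frechet_derivative f (at x) h *\<^sub>R g x)) (at x)" for x
      by (intro has_derivative_scaleR Ck_has_derivative[OF Suc.prems(1)] Ck_has_derivative[OF Suc.prems(2)])
    show "Ck n (\<lambda>x. f x *\<^sub>R frechet_derivative g (at x) v + frechet_derivative f (at x) v *\<^sub>R g x)" for v
      by (rule Ck_add[OF Suc.IH[OF Ck_SucD[OF Suc.prems(1)] Ck_Suc_derivative[OF Suc.prems(2)]]
            Suc.IH[OF Ck_Suc_derivative[OF Suc.prems(1)] Ck_SucD[OF Suc.prems(2)]]])
  qed
qed

lemma Ck_cos_affine:
  fixes L :: "'a::real_normed_vector \<Rightarrow> real"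
  assumes "bounded_linear L"
  shows "Ck n (\<lambda>x. c * cos (L x + \<tau>))"
proof (induction n arbitrary: c \<tau>)
  case 0 show ?case
    unfolding Ck.simps
    by (intro continuous_on_mult continuous_on_const continuous_on_cos continuous_on_add linear_continuous_on[OF assms])
next
  case (Suc n)
  show ?case
  proof (rule Ck_SucI)
    fix x
    have "((\<lambda>x. L x + \<tau>) has_derivative L) (at x)"
      using bounded_linear_imp_has_derivative[OF assms(1)] by (auto intro!: derivative_eq_intros)
    from has_derivative_mult_right[OF has_derivative_cos[OF this], of c]
    have "((\<lambda>x. c * cos (L x + \<tau>)) has_derivative (\<lambda>h. c * (L h * - sin (L x + \<tau>)))) (at x)" by simp
    moreover have "cos (L x + (\<tau> + pi / 2)) = - sin (L x + \<tau>)"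
      using cos_add[of "L x + \<tau>" "pi / 2"] by (simp add: add_ac)
    ultimately show "((\<lambda>x. c * cos (L x + \<tau>)) has_derivative
        (\<lambda>h. (c * L h) * cos (L x + (\<tau> + pi / 2)))) (at x)"
      by (simp add: mult_ac)
    show "Ck n (\<lambda>x. (c * L v) * cos (L x + (\<tau> + pi / 2)))" for v by (rule Suc)
  qed
qed

lemma smooth_const: "smooth (\<lambda>x. c)"
  by (simp add: smooth_def Ck_const)

lemma smooth_linear_comp: "bounded_linear L \<Longrightarrow> smooth f \<Longrightarrow> smooth (\<lambda>x. L (f x))"
  by (simp add: smooth_def Ck_linear_comp)

lemma smooth_comp_affine: "bounded_linear L \<Longrightarrow> smooth f \<Longrightarrow> smooth (\<lambda>x. f (L x + c))"
  by (simp add: smooth_def Ck_comp_affine)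

lemma smooth_add: "smooth f \<Longrightarrow> smooth g \<Longrightarrow> smooth (\<lambda>x. f x + g x)"
  by (simp add: smooth_def Ck_add)

lemma smooth_scaleR:
  fixes a :: "'a::real_normed_vector \<Rightarrow> real"
  shows "smooth a \<Longrightarrow> smooth f \<Longrightarrow> smooth (\<lambda>x. a x *\<^sub>R f x)"
  by (simp add: smooth_def Ck_scaleR)

lemma smooth_mult:
  fixes f g :: "'a::real_normed_vector \<Rightarrow> real"
  shows "smooth f \<Longrightarrow> smooth g \<Longrightarrow> smooth (\<lambda>x. f x * g x)"
  using smooth_scaleR[of f g] by simp

lemma smooth_uminus:
  fixes f :: "'a::real_normed_vector \<Rightarrow> 'b::real_normed_vector"
  shows "smooth f \<Longrightarrow> smooth (\<lambda>x. - f x)"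
  by (rule smooth_linear_comp) (auto intro: bounded_linear_minus bounded_linear_ident)

lemma smooth_diff:
  fixes f :: "'a::real_normed_vector \<Rightarrow> 'b::real_normed_vector"
  shows "smooth f \<Longrightarrow> smooth g \<Longrightarrow> smooth (\<lambda>x. f x - g x)"
  using smooth_add[of f "\<lambda>x. - g x"] smooth_uminus by auto

lemma smooth_cmult:
  fixes f :: "'a::real_normed_vector \<Rightarrow> real"
  shows "smooth f \<Longrightarrow> smooth (\<lambda>x. c * f x)"
  by (intro smooth_mult smooth_const)

lemma smooth_sum: "(\<And>i. i \<in> A \<Longrightarrow> smooth (f i)) \<Longrightarrow> smooth (\<lambda>x. \<Sum>i\<in>A. f i x)"
  by (induction A rule: infinite_finite_induct) (auto intro: smooth_const smooth_add)

lemma smooth_continuous: "smooth f \<Longrightarrow> continuous_on S f"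
  using Ck_continuous[of 0] continuous_on_subset unfolding smooth_def by (metis top_greatest)

lemma smooth_has_derivative: "smooth f \<Longrightarrow> (f has_derivative frechet_derivative f (at x)) (at x)"
  using Ck_has_derivative[of 0] unfolding smooth_def by blast

lemma smooth_differentiable: "smooth f \<Longrightarrow> f differentiable (at x)"
  using smooth_has_derivative differentiable_def by blast

lemma smooth_frechet_derivative: "smooth f \<Longrightarrow> smooth (\<lambda>x. frechet_derivative f (at x) v)"
  using Ck_Suc_derivative unfolding smooth_def by blast

lemma smooth_partial: "smooth f \<Longrightarrow> smooth (partial i f)"
  unfolding partial_def[abs_def] by (rule smooth_frechet_derivative)

lemma partial_eqI: "(f has_derivative f') (at x) \<Longrightarrow> partial i f x = f' (axis i 1)"
  unfolding partial_def using frechet_derivative_at by metis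

lemma partial_linear_comp:
  "bounded_linear L \<Longrightarrow> smooth f \<Longrightarrow> partial i (\<lambda>x. L (f x)) x = L (partial i f x)"
  using partial_eqI[OF bounded_linear.has_derivative[OF _ smooth_has_derivative]]
  by (simp add: partial_def)

lemma partial_add:
  "smooth f \<Longrightarrow> smooth g \<Longrightarrow> partial i (\<lambda>x. f x + g x) x = partial i f x + partial i g x"
  using partial_eqI[OF has_derivative_add[OF smooth_has_derivative smooth_has_derivative]]
  by (simp add: partial_def)

lemma partial_diff:
  "smooth f \<Longrightarrow> smooth g \<Longrightarrow> partial i (\<lambda>x. f x - g x) x = partial i f x - partial i g x"
  using partial_eqI[OF has_derivative_diff[OF smooth_has_derivative smooth_has_derivative]]
  by (simp add: partial_def)

lemma partial_mult:
  fixes f g :: "real^3 \<Rightarrow> real"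
  shows "smooth f \<Longrightarrow> smooth g \<Longrightarrow> partial i (\<lambda>x. f x * g x) x = f x * partial i g x + partial i f x * g x"
  using partial_eqI[OF has_derivative_mult[OF smooth_has_derivative smooth_has_derivative]]
  by (simp add: partial_def)

lemma partial_cmult:
  fixes f :: "real^3 \<Rightarrow> real"
  shows "smooth f \<Longrightarrow> partial i (\<lambda>x. c * f x) x = c * partial i f x"
  using partial_linear_comp[of "\<lambda>y. c * y" f] bounded_linear_mult_right by blast

lemma partial_const [simp]: "partial i (\<lambda>x. c) x = 0"
  by (rule partial_eqI[of _ "\<lambda>h. 0"]) auto

lemma partial_sum:
  "(\<And>m. m \<in> A \<Longrightarrow> smooth (f m)) \<Longrightarrow>
   partial i (\<lambda>x. \<Sum>m\<in>A. f m x) x = (\<Sum>m\<in>A. partial i (f m) x)"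
proof (induction A rule: infinite_finite_induct)
  case (insert m A)
  then show ?case using partial_add[of "f m" "\<lambda>x. \<Sum>m\<in>A. f m x"] by (simp add: smooth_sum)
qed auto

lemma partial_scaleR_const:
  fixes f :: "real^3 \<Rightarrow> real"
  shows "smooth f \<Longrightarrow> partial i (\<lambda>x. f x *\<^sub>R c) x = partial i f x *\<^sub>R c"
  using partial_linear_comp[of "\<lambda>y. y *\<^sub>R c" f] bounded_linear_scaleR_left by blast

lemma partial_shift:
  assumes "smooth f" shows "partial i (\<lambda>x. f (x + z)) x = partial i f (x + z)"
proof -
  have "((\<lambda>x. x + z) has_derivative (\<lambda>h. h)) (at x)" by (auto intro!: derivative_eq_intros)
  from has_derivative_compose[OF this smooth_has_derivative[OF assms]]
  show ?thesis using partial_eqI by (fastforce simp: partial_def)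
qed

lemma smooth_shift: "smooth f \<Longrightarrow> smooth (\<lambda>x. f (x + z))"
  by (rule smooth_comp_affine[OF bounded_linear_ident])

lemma has_real_derivative_line:
  fixes f :: "real^3 \<Rightarrow> real"
  assumes "smooth f"
  shows "((\<lambda>h. f (x + h *\<^sub>R axis i 1)) has_real_derivative partial i f (x + h *\<^sub>R axis i 1)) (at h within S)"
proof -
  have "((\<lambda>h. x + h *\<^sub>R axis i (1::real)) has_derivative (\<lambda>k. k *\<^sub>R axis i 1)) (at h within S)"
    by (auto intro!: derivative_eq_intros)
  from has_derivative_compose[OF this smooth_has_derivative[OF assms]]
  have "((\<lambda>h. f (x + h *\<^sub>R axis i 1)) has_derivative
     (\<lambda>k. frechet_derivative f (at (x + h *\<^sub>R axis i 1)) (k *\<^sub>R axis i 1))) (at h within S)" .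
  moreover have "(\<lambda>k. frechet_derivative f (at (x + h *\<^sub>R axis i 1)) (k *\<^sub>R axis i 1)) =
     (*) (partial i f (x + h *\<^sub>R axis i 1))"
    using linear_cmul[OF linear_frechet_derivative[OF smooth_differentiable[OF assms]]]
    by (auto simp: partial_def fun_eq_iff mult.commute)
  ultimately show ?thesis by (simp add: has_field_derivative_def)
qed

definition freq :: "int^3 \<Rightarrow> real^3" where "freq k = (\<chi> i. of_int (k $ i))"

text \<open>The phase makes this one family contain the cosines and the sines, and differentiation only shifts it.\<close>

definition wave :: "int^3 \<Rightarrow> real \<Rightarrow> real^3 \<Rightarrow> real" where
  "wave k \<tau> x = cos (2 * pi * (freq k \<bullet> x) + \<tau>)"

lemma smooth_wave: "smooth (wave k \<tau>)"
proof -
  have "bounded_linear (\<lambda>x. 2 * pi * (freq k \<bullet> x))"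
    by (intro bounded_linear_intros)
  from Ck_cos_affine[OF this, of _ 1] show ?thesis
    by (simp add: smooth_def wave_def[abs_def])
qed

lemma partial_wave: "partial i (wave k \<tau>) x = 2 * pi * of_int (k $ i) * wave k (\<tau> + pi / 2) x"
proof -
  have "((\<lambda>x. 2 * pi * (freq k \<bullet> x) + \<tau>) has_derivative (\<lambda>h. 2 * pi * (freq k \<bullet> h))) (at x)"
    by (auto intro!: derivative_eq_intros)
  from has_derivative_cos[OF this]
  have "((\<lambda>x. wave k \<tau> x) has_derivative
      (\<lambda>h. 2 * pi * (freq k \<bullet> h) * - sin (2 * pi * (freq k \<bullet> x) + \<tau>))) (at x)"
    unfolding wave_def by simp
  moreover have "wave k (\<tau> + pi / 2) x = - sin (2 * pi * (freq k \<bullet> x) + \<tau>)"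
    using cos_add[of "2 * pi * (freq k \<bullet> x) + \<tau>" "pi / 2"] by (simp add: add_ac wave_def)
  ultimately have "(wave k \<tau> has_derivative (\<lambda>h. (2 * pi * (freq k \<bullet> h)) * wave k (\<tau> + pi / 2) x)) (at x)"
    by simp
  from partial_eqI[OF this, of i] show ?thesis
    by (simp add: freq_def inner_axis)
qed

lemma periodic_wave: "periodic (wave k \<tau>)"
  unfolding periodic_def wave_def
proof (intro allI)
  fix x :: "real^3" and i
  have "2 * pi * (freq k \<bullet> (x + axis i 1)) + \<tau> = (2 * pi * (freq k \<bullet> x) + \<tau>) + 2 * pi * of_int (k $ i)"
    by (simp add: inner_add_right freq_def inner_axis algebra_simps)
  then show "cos (2 * pi * (freq k \<bullet> (x + axis i 1)) + \<tau>) = cos (2 * pi * (freq k \<bullet> x) + \<tau>)"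
    using cos_add[of "2 * pi * (freq k \<bullet> x) + \<tau>" "2 * pi * of_int (k $ i)"]
    by (simp add: add_ac)
qed

lemma periodic_const: "periodic (\<lambda>x. c)" by (simp add: periodic_def)
lemma periodic_add: "periodic f \<Longrightarrow> periodic g \<Longrightarrow> periodic (\<lambda>x. f x + g x)"
  by (simp add: periodic_def)
lemma periodic_diff: "periodic f \<Longrightarrow> periodic g \<Longrightarrow> periodic (\<lambda>x. f x - g x)"
  by (simp add: periodic_def)
lemma periodic_mult: "periodic f \<Longrightarrow> periodic g \<Longrightarrow> periodic (\<lambda>x. f x * g x)"
  by (simp add: periodic_def)
lemma periodic_shift: "periodic f \<Longrightarrow> periodic (\<lambda>x. f (x + z))"
  unfolding periodic_def by (metis add.assoc add.commute)
lemma periodic_sum: "(\<And>m. m \<in> A \<Longrightarrow> periodic (f m)) \<Longrightarrow> periodic (\<lambda>x. \<Sum>m\<in>A. f m x)"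
  by (simp add: periodic_def)

lemma periodic_partial:
  assumes "smooth f" "periodic f" shows "periodic (partial i f)"
  unfolding periodic_def
proof (intro allI)
  fix x j
  have eq: "(\<lambda>x. f (x + axis j 1)) = f" using assms(2) by (auto simp: periodic_def)
  show "partial i f (x + axis j 1) = partial i f x"
    using partial_shift[OF assms(1), of i "axis j 1" x] unfolding eq by simp
qed

definition cper :: "(real^3 \<Rightarrow> real) \<Rightarrow> bool" where
  "cper f \<longleftrightarrow> continuous_on UNIV f \<and> periodic f"

definition sper :: "(real^3 \<Rightarrow> real) \<Rightarrow> bool" where
  "sper f \<longleftrightarrow> smooth f \<and> periodic f"

lemma sper_cper: "sper f \<Longrightarrow> cper f"
  by (simp add: sper_def cper_def smooth_continuous)

lemma sper_partial: "sper f \<Longrightarrow> sper (partial i f)"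
  by (simp add: sper_def smooth_partial periodic_partial)

lemma sper_intros:
  "sper (\<lambda>x. c)" "sper (wave k \<tau>)"
  "sper f \<Longrightarrow> sper g \<Longrightarrow> sper (\<lambda>x. f x + g x)"
  "sper f \<Longrightarrow> sper g \<Longrightarrow> sper (\<lambda>x. f x - g x)"
  "sper f \<Longrightarrow> sper g \<Longrightarrow> sper (\<lambda>x. f x * g x)"
  "sper f \<Longrightarrow> sper (\<lambda>x. f (x + z))"
  "(\<And>m. m \<in> A \<Longrightarrow> sper (F m)) \<Longrightarrow> sper (\<lambda>x. \<Sum>m\<in>A. F m x)"
  by (simp_all add: sper_def smooth_const smooth_wave periodic_wave periodic_const smooth_add smooth_diff
      smooth_mult smooth_shift periodic_shift smooth_sum periodic_sum periodic_add periodic_diff periodic_mult)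

lemma continuous_on_shift:
  fixes f :: "'a::real_normed_vector \<Rightarrow> 'b::topological_space"
  assumes "continuous_on UNIV f" shows "continuous_on UNIV (\<lambda>x. f (x + z))"
  by (rule continuous_on_compose2[OF assms]) (auto intro: continuous_intros)

lemma cper_intros:
  "cper (\<lambda>x. c)"
  "cper f \<Longrightarrow> cper g \<Longrightarrow> cper (\<lambda>x. f x + g x)"
  "cper f \<Longrightarrow> cper g \<Longrightarrow> cper (\<lambda>x. f x - g x)"
  "cper f \<Longrightarrow> cper g \<Longrightarrow> cper (\<lambda>x. f x * g x)"
  "cper f \<Longrightarrow> cper (\<lambda>x. \<bar>f x\<bar>)"
  "cper f \<Longrightarrow> cper (\<lambda>x. f x ^ n)"
  "cper f \<Longrightarrow> cper (\<lambda>x. f (x + z))"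
  unfolding cper_def
  by (simp_all add: periodic_const periodic_add periodic_diff periodic_mult periodic_shift
      continuous_on_add continuous_on_diff continuous_on_mult continuous_on_rabs continuous_on_power
      continuous_on_shift) (simp_all add: periodic_def)

section \<open>Integration of periodic functions\<close>

lemma vec3_decomp: "(z::real^3) = z$1 *\<^sub>R axis 1 1 + z$2 *\<^sub>R axis 2 1 + z$3 *\<^sub>R axis 3 1"
  by (simp add: vec_eq_iff forall_3 axis_def)

lemma periodic_axis_int:
  assumes "periodic f" shows "f (x + of_int k *\<^sub>R axis i 1) = f x"
proof -
  have nat: "f (x + of_nat n *\<^sub>R axis i 1) = f x" for n x
  proof (induction n)
    case (Suc n)
    have "x + of_nat (Suc n) *\<^sub>R axis i 1 = (x + of_nat n *\<^sub>R axis i 1) + axis i (1::real)"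
      by (simp add: scaleR_left_distrib add_ac)
    then show ?case using assms Suc unfolding periodic_def by metis
  qed simp
  show ?thesis
  proof (cases "k \<ge> 0")
    case True
    then show ?thesis using nat[where n = "nat k"] by simp
  next
    case False
    then show ?thesis using nat[where n = "nat (- k)" and x = "x + of_int k *\<^sub>R axis i 1"] by simp
  qed
qed

lemma periodic_freq:
  assumes "periodic f" shows "f (x + freq k) = f x"
proof -
  have "x + freq k = ((x + of_int (k$1) *\<^sub>R axis 1 1) + of_int (k$2) *\<^sub>R axis 2 1) + of_int (k$3) *\<^sub>R axis 3 1"
    using vec3_decomp[of "freq k"] by (simp add: freq_def add_ac)
  then show ?thesis by (simp only: periodic_axis_int[OF assms])
qed

lemma periodic_reduce:
  assumes "periodic f" obtains y where "y \<in> cbox 0 1" "f y = f x"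
proof
  let ?k = "\<chi> i. - \<lfloor>x $ i\<rfloor> :: int^3"
  show "x + freq ?k \<in> cbox 0 1"
    by (auto simp: mem_box_cart freq_def) (linarith+)
  show "f (x + freq ?k) = f x" by (rule periodic_freq[OF assms])
qed

lemma cper_bounded:
  assumes "cper f" obtains B where "B > 0" "\<And>x. \<bar>f x\<bar> \<le> B"
proof -
  have "continuous_on (cbox 0 1) f"
    using assms unfolding cper_def by (meson continuous_on_subset subset_UNIV)
  then have "bounded (f ` cbox 0 1)"
    by (rule compact_imp_bounded[OF compact_continuous_image[OF _ compact_cbox]])
  then obtain B where B: "B > 0" "\<forall>y\<in>f ` cbox 0 1. norm y \<le> B"
    unfolding bounded_pos by auto
  have "\<bar>f x\<bar> \<le> B" for x
  proof -
    have "periodic f" using assms by (simp add: cper_def)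
    then obtain y where "y \<in> cbox 0 1" "f y = f x" by (rule periodic_reduce)
    then show ?thesis using B(2) by (metis imageI real_norm_def)
  qed
  then show thesis using that B(1) by metis
qed

interpretation torus: finite_measure torus
  by (rule finite_measure_lebesgue_on) simp

lemma measure_torus: "measure torus (space torus) = 1"
  by (simp add: measure_restrict_space content_cbox_if_cart interval_eq_empty_cart)

lemma integrable_torus_continuous:
  fixes f :: "real^3 \<Rightarrow> 'b::euclidean_space"
  assumes "continuous_on UNIV f" shows "integrable torus f"
  by (rule continuous_imp_integrable) (rule continuous_on_subset[OF assms], simp)

lemma LINT_torus_eq_integral:
  fixes f :: "real^3 \<Rightarrow> 'b::euclidean_space"
  assumes "integrable torus f" shows "(LINT x|torus. f x) = integral (cbox 0 1) f"
  by (rule lebesgue_integral_eq_integral[OF assms]) simp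

lemma cper_integrable: "cper f \<Longrightarrow> integrable torus f"
  by (simp add: cper_def integrable_torus_continuous)

lemma cper_LINT: "cper f \<Longrightarrow> (LINT x|torus. f x) = integral (cbox 0 1) f"
  by (simp add: cper_integrable LINT_torus_eq_integral)

lemma integral_shift_axis_unit:
  assumes f: "cper f" and h: "0 \<le> h" "h \<le> 1"
  shows "integral (cbox 0 1) (\<lambda>x. f (x + h *\<^sub>R axis i 1)) = integral (cbox 0 1) f"
proof -
  let ?e = "axis i 1 :: real^3" and ?B = "cbox 0 (1 + h *\<^sub>R axis i 1) :: (real^3) set"
  have intf: "f integrable_on cbox a b" for a b
    using f by (auto intro!: integrable_continuous continuous_on_subset[of UNIV] simp: cper_def)
  have e: "?e \<in> Basis" by simp
  have [simp]: "x \<bullet> ?e = x $ i" for x :: "real^3" by (simp add: inner_axis)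
  have 1: "?B \<inter> {x. x \<bullet> ?e \<le> 1} = cbox 0 1"
    using h unfolding interval_cbox_cart[symmetric] interval_split_cart \<open>\<And>x. x \<bullet> ?e = x $ i\<close>
    by (intro arg_cong2[where f = atLeastAtMost]) (auto simp: vec_eq_iff axis_def)
  have 2: "?B \<inter> {x. 1 \<le> x \<bullet> ?e} = cbox (0 + ?e) ((1 + (h-1) *\<^sub>R ?e) + ?e)"
    using h unfolding \<open>\<And>x. x \<bullet> ?e = x $ i\<close> interval_split_cart
    unfolding interval_cbox_cart[symmetric]
    by (intro arg_cong2[where f = atLeastAtMost]) (auto simp: vec_eq_iff axis_def)
  have 3: "?B \<inter> {x. x \<bullet> ?e \<le> h} = cbox 0 (1 + (h-1) *\<^sub>R ?e)"
    using h unfolding interval_cbox_cart[symmetric] interval_split_cart \<open>\<And>x. x \<bullet> ?e = x $ i\<close>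
    by (intro arg_cong2[where f = atLeastAtMost]) (auto simp: vec_eq_iff axis_def)
  have 4: "?B \<inter> {x. h \<le> x \<bullet> ?e} = cbox (0 + h *\<^sub>R ?e) (1 + h *\<^sub>R ?e)"
    using h unfolding \<open>\<And>x. x \<bullet> ?e = x $ i\<close> interval_split_cart
    unfolding interval_cbox_cart[symmetric]
    by (intro arg_cong2[where f = atLeastAtMost]) (auto simp: vec_eq_iff axis_def)
  have "integral (cbox 0 1) f + integral (cbox (0 + ?e) ((1 + (h-1) *\<^sub>R ?e) + ?e)) f
      = integral (cbox 0 (1 + (h-1) *\<^sub>R ?e)) f + integral (cbox (0 + h *\<^sub>R ?e) (1 + h *\<^sub>R ?e)) f"
    using integral_split[OF intf e, of 0 "1 + h *\<^sub>R ?e" 1] integral_split[OF intf e, of 0 "1 + h *\<^sub>R ?e" h]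
    unfolding 1 2 3 4 by simp
  moreover have "integral (cbox (0 + ?e) ((1 + (h-1) *\<^sub>R ?e) + ?e)) f = integral (cbox 0 (1 + (h-1) *\<^sub>R ?e)) f"
  proof -
    have "f \<circ> (+) ?e = f"
      using f by (auto simp: cper_def periodic_def add.commute)
    then show ?thesis using integral_shift_cbox_plus[of 0 "1 + (h-1) *\<^sub>R ?e" f ?e] by simp
  qed
  ultimately show ?thesis
    using integral_shift_cbox_plus[of 0 1 f "h *\<^sub>R ?e"] by (simp add: o_def add.commute)
qed

lemma integral_shift_axis:
  assumes f: "cper f"
  shows "integral (cbox 0 1) (\<lambda>x. f (x + h *\<^sub>R axis i 1)) = integral (cbox 0 1) f"
proof -
  have "f (x + h *\<^sub>R axis i 1) = f (x + frac h *\<^sub>R axis i 1)" for x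
  proof -
    have "x + h *\<^sub>R axis i 1 = (x + frac h *\<^sub>R axis i 1) + of_int \<lfloor>h\<rfloor> *\<^sub>R axis i (1::real)"
      by (simp add: frac_def scaleR_left_diff_distrib)
    then show ?thesis using f periodic_axis_int unfolding cper_def by metis
  qed
  then show ?thesis
    using integral_shift_axis_unit[OF f, of "frac h" i] frac_ge_0[of h] frac_lt_1[of h] by simp
qed

theorem torus_translation:
  assumes f: "cper f"
  shows "(LINT x|torus. f (x + z)) = (LINT x|torus. f x)"
proof -
  have "integral (cbox 0 1) (\<lambda>x. f (x + z))
      = integral (cbox 0 1) (\<lambda>x. f (((x + z$3 *\<^sub>R axis 3 1) + z$2 *\<^sub>R axis 2 1) + z$1 *\<^sub>R axis 1 1))"
    by (subst vec3_decomp[of z]) (simp add: add_ac)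
  also have "\<dots> = integral (cbox 0 1) (\<lambda>x. f ((x + z$2 *\<^sub>R axis 2 1) + z$1 *\<^sub>R axis 1 1))"
    by (rule integral_shift_axis[of "\<lambda>x. f ((x + z$2 *\<^sub>R axis 2 1) + z$1 *\<^sub>R axis 1 1)"])
      (intro cper_intros(7)[of "\<lambda>x. f (x + z$1 *\<^sub>R axis 1 1)"] cper_intros(7) f)
  also have "\<dots> = integral (cbox 0 1) (\<lambda>x. f (x + z$1 *\<^sub>R axis 1 1))"
    by (rule integral_shift_axis[of "\<lambda>x. f (x + z$1 *\<^sub>R axis 1 1)"]) (intro cper_intros f)
  also have "\<dots> = integral (cbox 0 1) f" by (rule integral_shift_axis[OF f])
  finally show ?thesis using f by (simp add: cper_LINT cper_intros(7))
qed

lemma torus_Fubini_continuous: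
  fixes F :: "real^3 \<Rightarrow> real^3 \<Rightarrow> real"
  assumes F: "continuous_on UNIV (\<lambda>(x, y). F x y)"
  shows "continuous_on UNIV (\<lambda>x. LINT y|torus. F x y)"
    and "(LINT x|torus. LINT y|torus. F x y) = (LINT y|torus. LINT x|torus. F x y)"
proof -
  have c1: "continuous_on UNIV (F x)" for x
    using continuous_on_compose2[OF F, of UNIV "\<lambda>y. (x, y)"] by (simp add: continuous_on_Pair)
  have c2: "continuous_on UNIV (\<lambda>x. F x y)" for y
    using continuous_on_compose2[OF F, of UNIV "\<lambda>x. (x, y)"] by (simp add: continuous_on_Pair)
  have F': "continuous_on UNIV (\<lambda>(y, x). F x y)"
    using continuous_on_compose2[OF F, of UNIV "\<lambda>p. (snd p, fst p)"]
    by (simp add: case_prod_unfold continuous_on_Pair continuous_on_fst continuous_on_snd continuous_on_id)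
  have i1: "(LINT y|torus. F x y) = integral (cbox 0 1) (F x)" for x
    by (rule LINT_torus_eq_integral[OF integrable_torus_continuous[OF c1]])
  have i2: "(LINT x|torus. F x y) = integral (cbox 0 1) (\<lambda>x. F x y)" for y
    by (rule LINT_torus_eq_integral[OF integrable_torus_continuous[OF c2]])
  have p1: "continuous_on UNIV (\<lambda>x. integral (cbox 0 1) (F x))"
    by (rule integral_continuous_on_param) (rule continuous_on_subset[OF F], simp)
  have p2: "continuous_on UNIV (\<lambda>y. integral (cbox 0 1) (\<lambda>x. F x y))"
    by (rule integral_continuous_on_param) (rule continuous_on_subset[OF F'], simp)
  show "continuous_on UNIV (\<lambda>x. LINT y|torus. F x y)" unfolding i1 by (rule p1)
  show "(LINT x|torus. LINT y|torus. F x y) = (LINT y|torus. LINT x|torus. F x y)"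
    unfolding i1 i2 LINT_torus_eq_integral[OF integrable_torus_continuous[OF p1]]
      LINT_torus_eq_integral[OF integrable_torus_continuous[OF p2]]
    by (rule integral_swap_continuous) (rule continuous_on_subset[OF F], simp)
qed

lemma sper_Taylor:
  assumes f: "sper f"
  obtains C where "C \<ge> 0" "\<And>x h. \<bar>f (x + h *\<^sub>R axis i 1) - f x - h * partial i f x\<bar> \<le> C * h\<^sup>2"
proof -
  have sf: "smooth f" "smooth (partial i f)" using f sper_partial sper_def by blast+
  obtain C where C: "C > 0" "\<And>x. \<bar>partial i (partial i f) x\<bar> \<le> C"
    using cper_bounded[OF sper_cper[OF sper_partial[OF sper_partial[OF f]]]] by blast
  have lip: "\<bar>partial i f (x + t *\<^sub>R axis i 1) - partial i f x\<bar> \<le> C * \<bar>t\<bar>" for x t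
    using field_differentiable_bound[OF convex_UNIV has_real_derivative_line[OF sf(2), of x i], of C t 0] C(2)
    by (simp)
  have "\<bar>f (x + h *\<^sub>R axis i 1) - f x - h * partial i f x\<bar> \<le> C * h\<^sup>2" for x h
  proof -
    let ?g = "\<lambda>t. f (x + t *\<^sub>R axis i 1) - t * partial i f x"
    have "norm (?g h - ?g 0) \<le> (C * \<bar>h\<bar>) * norm (h - 0)"
    proof (rule field_differentiable_bound[where S = "{-\<bar>h\<bar>..\<bar>h\<bar>}" and f = ?g])
      fix t assume t: "t \<in> {-\<bar>h\<bar>..\<bar>h\<bar>}"
      show "(?g has_field_derivative (partial i f (x + t *\<^sub>R axis i 1) - partial i f x)) (at t within {-\<bar>h\<bar>..\<bar>h\<bar>})"
        by (auto intro!: derivative_eq_intros has_real_derivative_line sf)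
      have "C * \<bar>t\<bar> \<le> C * \<bar>h\<bar>" using t C(1) by (intro mult_left_mono) auto
      then show "norm (partial i f (x + t *\<^sub>R axis i 1) - partial i f x) \<le> C * \<bar>h\<bar>"
        using lip[of x t] by simp
    qed auto
    then show ?thesis by (simp add: power2_eq_square abs_mult_self_eq mult.assoc algebra_simps)
  qed
  then show thesis using that[of C] C(1) by simp
qed

lemma torus_partial_zero:
  assumes f: "sper f" shows "(LINT x|torus. partial i f x) = 0"
proof -
  obtain C where C: "C \<ge> 0" "\<And>x h. \<bar>f (x + h *\<^sub>R axis i 1) - f x - h * partial i f x\<bar> \<le> C * h\<^sup>2"
    using sper_Taylor[OF f] by metis
  have cf: "cper f" "cper (\<lambda>x. f (x + h *\<^sub>R axis i 1))" "cper (partial i f)" for h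
    using f by (auto intro: sper_cper sper_intros sper_partial)
  let ?I = "LINT x|torus. partial i f x"
  have le: "\<bar>?I\<bar> \<le> C * h" if "h > 0" for h
  proof -
    have "(LINT x|torus. f (x + h *\<^sub>R axis i 1) - f x - h * partial i f x) = - h * ?I"
      by (simp add: cper_integrable cf torus_translation)
    moreover have "\<bar>LINT x|torus. f (x + h *\<^sub>R axis i 1) - f x - h * partial i f x\<bar> \<le> (LINT x|torus. C * h\<^sup>2)"
      by (rule integral_abs_bound[THEN order_trans], rule integral_mono)
        (use C(2) cf in \<open>auto intro!: integrable_abs cper_integrable cper_intros\<close>)
    ultimately have "h * \<bar>?I\<bar> \<le> h * (C * h)"
      using that measure_torus by (simp add: abs_mult power2_eq_square mult_ac)
    then show ?thesis using that mult_le_cancel_left_pos by blast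
  qed
  show ?thesis
  proof (rule ccontr)
    assume "?I \<noteq> 0"
    then show False using le[of "\<bar>?I\<bar> / (2 * (C + 1))"] C(1)
      by (simp add: field_simps) (smt (verit) mult_nonneg_nonneg)
  qed
qed

lemma torus_ibp:
  assumes "sper f" "sper g"
  shows "(LINT x|torus. f x * partial i g x) = - (LINT x|torus. partial i f x * g x)"
proof -
  have "(LINT x|torus. f x * partial i g x) + (LINT x|torus. partial i f x * g x)
     = (LINT x|torus. partial i (\<lambda>x. f x * g x) x)"
  proof (subst Bochner_Integration.integral_add[symmetric])
    show "integrable torus (\<lambda>x. f x * partial i g x)" "integrable torus (\<lambda>x. partial i f x * g x)"
      using assms by (auto intro!: cper_integrable sper_cper sper_intros sper_partial)
    show "(LINT x|torus. f x * partial i g x + partial i f x * g x)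
        = (LINT x|torus. partial i (\<lambda>x. f x * g x) x)"
      using assms by (intro Bochner_Integration.integral_cong refl) (simp add: partial_mult sper_def)
  qed
  also have "\<dots> = 0" by (rule torus_partial_zero) (intro sper_intros assms)
  finally show ?thesis by simp
qed

section \<open>The space of cube-integrable functions\<close>

definition L3 :: "(real^3 \<Rightarrow> real) \<Rightarrow> bool" where
  "L3 f \<longleftrightarrow> f \<in> borel_measurable torus \<and> integrable torus (\<lambda>x. \<bar>f x\<bar> ^ 3)"

definition N3 :: "(real^3 \<Rightarrow> real) \<Rightarrow> real" where
  "N3 f = root 3 (LINT x|torus. \<bar>f x\<bar> ^ 3)"

lemma L3_measurable [measurable_dest]: "L3 f \<Longrightarrow> f \<in> borel_measurable torus"
  by (simp add: L3_def)

lemma N3_nonneg: "N3 f \<ge> 0"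
  by (simp add: N3_def)

lemma N3_cube: "N3 f ^ 3 = (LINT x|torus. \<bar>f x\<bar> ^ 3)"
  by (simp add: N3_def)

lemma L3_cper: "cper f \<Longrightarrow> L3 f"
  unfolding L3_def using cper_integrable[of f] cper_integrable[OF cper_intros(6)[OF cper_intros(5)], of f 3]
  by (simp add: borel_measurable_integrable)

lemma young3:
  fixes x y z :: real
  assumes "x \<ge> 0" "y \<ge> 0" "z \<ge> 0" shows "x * y * z \<le> (x ^ 3 + y ^ 3 + z ^ 3) / 3"
proof -
  have "x ^ 3 + y ^ 3 + z ^ 3 - 3 * (x * y * z) = (x + y + z) * ((x - y)\<^sup>2 + (y - z)\<^sup>2 + (z - x)\<^sup>2) / 2"
    by (simp add: power2_eq_square power3_eq_cube field_simps)
  also have "\<dots> \<ge> 0" using assms by simp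
  finally show ?thesis by simp
qed

lemma L3_mult3_integrable:
  assumes "L3 a" "L3 b" "L3 c" shows "integrable torus (\<lambda>x. a x * b x * c x)"
proof (rule Bochner_Integration.integrable_bound)
  show "integrable torus (\<lambda>x. (\<bar>a x\<bar> ^ 3 + \<bar>b x\<bar> ^ 3 + \<bar>c x\<bar> ^ 3) / 3)"
    using assms unfolding L3_def by auto
  show "(\<lambda>x. a x * b x * c x) \<in> borel_measurable torus" using assms by measurable
  show "AE x in torus. norm (a x * b x * c x) \<le> norm ((\<bar>a x\<bar> ^ 3 + \<bar>b x\<bar> ^ 3 + \<bar>c x\<bar> ^ 3) / 3)"
    using young3[of "\<bar>a x\<bar>" "\<bar>b x\<bar>" "\<bar>c x\<bar>" for x] by (auto simp: abs_mult)
qed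

lemma L3_abs: "L3 f \<Longrightarrow> L3 (\<lambda>x. \<bar>f x\<bar>)"
  and N3_abs: "N3 (\<lambda>x. \<bar>f x\<bar>) = N3 f"
  by (auto simp: L3_def N3_def)

lemma L3_cmult: "L3 f \<Longrightarrow> L3 (\<lambda>x. c * f x)"
  and N3_cmult: "N3 (\<lambda>x. c * f x) = \<bar>c\<bar> * N3 f"
  by (auto simp: L3_def N3_def abs_mult power_mult_distrib real_root_mult real_root_power_cancel)

lemma L3_add: assumes "L3 f" "L3 g" shows "L3 (\<lambda>x. f x + g x)"
  unfolding L3_def
proof
  show "(\<lambda>x. f x + g x) \<in> borel_measurable torus" using assms by measurable
  show "integrable torus (\<lambda>x. \<bar>f x + g x\<bar> ^ 3)"
  proof (rule Bochner_Integration.integrable_bound)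
    show "integrable torus (\<lambda>x. 8 * (\<bar>f x\<bar> ^ 3 + \<bar>g x\<bar> ^ 3))" using assms unfolding L3_def by auto
    show "(\<lambda>x. \<bar>f x + g x\<bar> ^ 3) \<in> borel_measurable torus" using assms by measurable
    have "\<bar>f x + g x\<bar> ^ 3 \<le> 8 * (\<bar>f x\<bar> ^ 3 + \<bar>g x\<bar> ^ 3)" for x
    proof -
      have "\<bar>f x + g x\<bar> ^ 3 \<le> (2 * max \<bar>f x\<bar> \<bar>g x\<bar>) ^ 3" by (rule power_mono) auto
      also have "\<dots> \<le> 8 * (\<bar>f x\<bar> ^ 3 + \<bar>g x\<bar> ^ 3)" by (auto simp: max_def power_mult_distrib)
      finally show ?thesis .
    qed
    then show "AE x in torus. norm (\<bar>f x + g x\<bar> ^ 3) \<le> norm (8 * (\<bar>f x\<bar> ^ 3 + \<bar>g x\<bar> ^ 3))" by auto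
  qed
qed

lemma L3_uminus: "L3 f \<Longrightarrow> L3 (\<lambda>x. - f x)"
  using L3_cmult[of f "-1"] by simp
lemma L3_diff: "L3 f \<Longrightarrow> L3 g \<Longrightarrow> L3 (\<lambda>x. f x - g x)"
  using L3_add[of f "\<lambda>x. - g x"] L3_uminus by simp
lemma L3_const: "L3 (\<lambda>x. c)" by (rule L3_cper) (rule cper_intros)
lemma N3_const: "N3 (\<lambda>x. c) = \<bar>c\<bar>"
  using measure_torus by (simp add: N3_def real_root_power_cancel)
lemma L3_sum: "(\<And>i. i \<in> A \<Longrightarrow> L3 (f i)) \<Longrightarrow> L3 (\<lambda>x. \<Sum>i\<in>A. f i x)"
  by (induction A rule: infinite_finite_induct) (auto intro: L3_const L3_add)
lemma N3_diff_commute: "N3 (\<lambda>x. f x - g x) = N3 (\<lambda>x. g x - f x)"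
  by (simp add: N3_def abs_minus_commute)

lemma L3_integrable: "L3 f \<Longrightarrow> integrable torus f"
  using L3_mult3_integrable[OF _ L3_const[of 1] L3_const[of 1]] by simp
lemma L3_mult_integrable: "L3 f \<Longrightarrow> L3 g \<Longrightarrow> integrable torus (\<lambda>x. f x * g x)"
  using L3_mult3_integrable[OF _ _ L3_const[of 1]] by simp

lemma L3_cong_AE:
  assumes "L3 f" "g \<in> borel_measurable torus" "AE x in torus. f x = g x" shows "L3 g" "N3 g = N3 f"
proof -
  have ae: "AE x in torus. \<bar>f x\<bar> ^ 3 = \<bar>g x\<bar> ^ 3" using assms(3) by auto
  have m: "(\<lambda>x. \<bar>f x\<bar> ^ 3) \<in> borel_measurable torus" "(\<lambda>x. \<bar>g x\<bar> ^ 3) \<in> borel_measurable torus"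
    using assms by measurable
  show "L3 g" using assms integrable_cong_AE[OF m ae] unfolding L3_def by simp
  show "N3 g = N3 f" using integral_cong_AE[OF m ae] unfolding N3_def by simp
qed

theorem holder3:
  assumes L: "L3 a" "L3 b" "L3 c"
  shows "(LINT x|torus. \<bar>a x * b x * c x\<bar>) \<le> N3 a * N3 b * N3 c"
proof -
  have *: "(LINT x|torus. \<bar>a x * b x * c x\<bar>) \<le> (N3 a + \<epsilon>) * (N3 b + \<epsilon>) * (N3 c + \<epsilon>)" if "\<epsilon> > 0" for \<epsilon>
  proof -
    let ?A = "N3 a + \<epsilon>" and ?B = "N3 b + \<epsilon>" and ?C = "N3 c + \<epsilon>"
    have pos: "?A > 0" "?B > 0" "?C > 0" using that N3_nonneg by (simp_all add: add_nonneg_pos)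
    have int: "integrable torus (\<lambda>x. \<bar>a x\<bar> ^ 3)" "integrable torus (\<lambda>x. \<bar>b x\<bar> ^ 3)" "integrable torus (\<lambda>x. \<bar>c x\<bar> ^ 3)"
      using L unfolding L3_def by auto
    have ptw: "\<bar>a x * b x * c x\<bar> \<le> ?A * ?B * ?C / 3 * (\<bar>a x\<bar> ^ 3 / ?A ^ 3 + \<bar>b x\<bar> ^ 3 / ?B ^ 3 + \<bar>c x\<bar> ^ 3 / ?C ^ 3)" for x
    proof -
      have "\<bar>a x * b x * c x\<bar> = ?A * ?B * ?C * ((\<bar>a x\<bar> / ?A) * (\<bar>b x\<bar> / ?B) * (\<bar>c x\<bar> / ?C))"
        using pos by (simp add: abs_mult)
      also have "\<dots> \<le> ?A * ?B * ?C * (((\<bar>a x\<bar> / ?A) ^ 3 + (\<bar>b x\<bar> / ?B) ^ 3 + (\<bar>c x\<bar> / ?C) ^ 3) / 3)"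
        using pos by (intro mult_left_mono young3) auto
      finally show ?thesis by (simp add: power_divide)
    qed
    have "(LINT x|torus. \<bar>a x * b x * c x\<bar>)
       \<le> (LINT x|torus. ?A * ?B * ?C / 3 * (\<bar>a x\<bar> ^ 3 / ?A ^ 3 + \<bar>b x\<bar> ^ 3 / ?B ^ 3 + \<bar>c x\<bar> ^ 3 / ?C ^ 3))"
      using ptw int L3_mult3_integrable[OF L] by (intro integral_mono) auto
    also have "\<dots> = ?A * ?B * ?C / 3 * (N3 a ^ 3 / ?A ^ 3 + N3 b ^ 3 / ?B ^ 3 + N3 c ^ 3 / ?C ^ 3)"
      using int by (simp add: N3_cube)
    also have "\<dots> \<le> ?A * ?B * ?C / 3 * (1 + 1 + 1)"
      using pos that by (intro mult_left_mono add_mono) (auto simp: divide_le_eq_1 power_mono N3_nonneg)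
    finally show ?thesis by simp
  qed
  have "((\<lambda>\<epsilon>. (N3 a + \<epsilon>) * (N3 b + \<epsilon>) * (N3 c + \<epsilon>)) \<longlongrightarrow> (N3 a + 0) * (N3 b + 0) * (N3 c + 0)) (at_right 0)"
    by (intro tendsto_intros)
  moreover have "\<forall>\<^sub>F \<epsilon> in at_right 0. (LINT x|torus. \<bar>a x * b x * c x\<bar>) \<le> (N3 a + \<epsilon>) * (N3 b + \<epsilon>) * (N3 c + \<epsilon>)"
    using * by (auto simp: eventually_at_right_less eventually_at_filter)
  ultimately show ?thesis
    using tendsto_lowerbound by fastforce
qed

lemma holder3': 
  assumes L: "L3 a" "L3 b" "L3 c"
  shows "\<bar>LINT x|torus. a x * b x * c x\<bar> \<le> N3 a * N3 b * N3 c"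
  by (rule order_trans[OF integral_abs_bound holder3[OF L]])

lemma holder2': "L3 a \<Longrightarrow> L3 b \<Longrightarrow> \<bar>LINT x|torus. a x * b x\<bar> \<le> N3 a * N3 b"
  using holder3'[OF _ _ L3_const[of 1]] N3_const[of 1] by simp

text \<open>Hoelder's inequality applied to \<open>|f + g|\<^sup>3 \<le> |f| |f + g|\<^sup>2 + |g| |f + g|\<^sup>2\<close>.\<close>

theorem minkowski3:
  assumes L: "L3 f" "L3 g" shows "N3 (\<lambda>x. f x + g x) \<le> N3 f + N3 g"
proof -
  let ?s = "\<lambda>x. f x + g x"
  have Ls: "L3 ?s" by (rule L3_add[OF L])
  have "N3 ?s ^ 3 \<le> (LINT x|torus. \<bar>f x * ?s x * ?s x\<bar> + \<bar>g x * ?s x * ?s x\<bar>)"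
    unfolding N3_cube
  proof (rule integral_mono)
    show "integrable torus (\<lambda>x. \<bar>?s x\<bar> ^ 3)" using Ls L3_def by auto
    show "integrable torus (\<lambda>x. \<bar>f x * ?s x * ?s x\<bar> + \<bar>g x * ?s x * ?s x\<bar>)"
      using L3_mult3_integrable[OF L(1) Ls Ls] L3_mult3_integrable[OF L(2) Ls Ls] by auto
    show "\<bar>?s x\<bar> ^ 3 \<le> \<bar>f x * ?s x * ?s x\<bar> + \<bar>g x * ?s x * ?s x\<bar>" for x
    proof -
      have "\<bar>?s x\<bar> ^ 3 = \<bar>f x * ?s x * ?s x + g x * ?s x * ?s x\<bar>"
        by (simp add: power3_eq_cube abs_mult flip: distrib_right)
      then show ?thesis by linarith
    qed
  qed
  also have "\<dots> = (LINT x|torus. \<bar>f x * ?s x * ?s x\<bar>) + (LINT x|torus. \<bar>g x * ?s x * ?s x\<bar>)"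
    using L3_mult3_integrable[OF L(1) Ls Ls] L3_mult3_integrable[OF L(2) Ls Ls] by simp
  also have "\<dots> \<le> N3 f * N3 ?s * N3 ?s + N3 g * N3 ?s * N3 ?s"
    by (intro add_mono holder3 L Ls)
  finally have "N3 ?s * (N3 ?s)\<^sup>2 \<le> (N3 f + N3 g) * (N3 ?s)\<^sup>2"
    by (simp add: power3_eq_cube power2_eq_square algebra_simps)
  then show ?thesis
    using N3_nonneg[of ?s] N3_nonneg[of f] N3_nonneg[of g]
    by (cases "N3 ?s = 0") auto
qed

lemma N3_triangle_le: "L3 f \<Longrightarrow> L3 g \<Longrightarrow> N3 f \<le> N3 g + N3 (\<lambda>x. f x - g x)"
  using minkowski3[of g "\<lambda>x. f x - g x"] L3_diff[of f g] by simp

lemma minkowski3_sum: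
  "(\<And>i. i \<in> A \<Longrightarrow> L3 (f i)) \<Longrightarrow> N3 (\<lambda>x. \<Sum>i\<in>A. f i x) \<le> (\<Sum>i\<in>A. N3 (f i))"
proof (induction A rule: infinite_finite_induct)
  case (insert i A)
  then have "N3 (\<lambda>x. f i x + (\<Sum>i\<in>A. f i x)) \<le> N3 (f i) + N3 (\<lambda>x. \<Sum>i\<in>A. f i x)"
    by (intro minkowski3 L3_sum) auto
  then show ?case using insert by simp
qed (auto simp: N3_const)

lemma N3_mono: "L3 f \<Longrightarrow> L3 g \<Longrightarrow> (\<And>x. \<bar>f x\<bar> \<le> \<bar>g x\<bar>) \<Longrightarrow> N3 f \<le> N3 g"
  unfolding N3_def L3_def
  by (intro real_root_le_mono integral_mono) (auto intro: power_mono)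

lemma N3_translation: "cper f \<Longrightarrow> N3 (\<lambda>x. f (x + z)) = N3 f"
  using torus_translation[of "\<lambda>x. \<bar>f x\<bar> ^ 3" z] by (simp add: N3_def cper_intros)

lemma N3_lim:
  assumes "\<And>m. L3 (F m)" "L3 f" "(\<lambda>m. N3 (\<lambda>x. F m x - f x)) \<longlonglongrightarrow> 0"
  shows "(\<lambda>m. N3 (F m)) \<longlonglongrightarrow> N3 f"
proof (rule LIM_zero_cancel, rule Lim_null_comparison[OF _ assms(3)], rule always_eventually, rule allI)
  fix m show "norm (N3 (F m) - N3 f) \<le> N3 (\<lambda>x. F m x - f x)"
    using N3_triangle_le[OF assms(1)[of m] assms(2)] N3_triangle_le[OF assms(2) assms(1)[of m]]
      N3_diff_commute[of "F m" f] by simp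
qed

lemma LINT_mult3_lim:
  assumes L: "\<And>m. L3 (A m)" "\<And>m. L3 (B m)" "\<And>m. L3 (C m)" "L3 a" "L3 b" "L3 c"
    and lim: "(\<lambda>m. N3 (\<lambda>x. A m x - a x)) \<longlonglongrightarrow> 0" "(\<lambda>m. N3 (\<lambda>x. B m x - b x)) \<longlonglongrightarrow> 0"
      "(\<lambda>m. N3 (\<lambda>x. C m x - c x)) \<longlonglongrightarrow> 0"
  shows "(\<lambda>m. LINT x|torus. A m x * B m x * C m x) \<longlonglongrightarrow> (LINT x|torus. a x * b x * c x)"
proof (rule LIM_zero_cancel, rule Lim_null_comparison)
  let ?bd = "\<lambda>m. N3 (\<lambda>x. A m x - a x) * N3 (B m) * N3 (C m) + N3 a * N3 (\<lambda>x. B m x - b x) * N3 (C m)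
       + N3 a * N3 b * N3 (\<lambda>x. C m x - c x)"
  have "?bd \<longlonglongrightarrow> 0 * N3 b * N3 c + N3 a * 0 * N3 c + N3 a * N3 b * 0"
    using L by (intro tendsto_intros lim N3_lim)
  then show "?bd \<longlonglongrightarrow> 0" by simp
  show "\<forall>\<^sub>F m in sequentially. norm ((LINT x|torus. A m x * B m x * C m x) - (LINT x|torus. a x * b x * c x)) \<le> ?bd m"
  proof (rule always_eventually, rule allI)
    fix m
    have i: "integrable torus (\<lambda>x. (A m x - a x) * B m x * C m x)"
      "integrable torus (\<lambda>x. a x * (B m x - b x) * C m x)" "integrable torus (\<lambda>x. a x * b x * (C m x - c x))"
      using L by (auto intro!: L3_mult3_integrable L3_diff)
    have "(LINT x|torus. A m x * B m x * C m x) - (LINT x|torus. a x * b x * c x)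
      = (LINT x|torus. (A m x - a x) * B m x * C m x + a x * (B m x - b x) * C m x + a x * b x * (C m x - c x))"
    proof -
      have "integrable torus (\<lambda>x. A m x * B m x * C m x)" "integrable torus (\<lambda>x. a x * b x * c x)"
        using L by (auto intro: L3_mult3_integrable)
      moreover have "(\<lambda>x. (A m x - a x) * B m x * C m x + a x * (B m x - b x) * C m x + a x * b x * (C m x - c x))
          = (\<lambda>x. A m x * B m x * C m x - a x * b x * c x)"
        by (simp add: fun_eq_iff algebra_simps)
      ultimately show ?thesis by simp
    qed
    also have "\<dots> = (LINT x|torus. (A m x - a x) * B m x * C m x) + (LINT x|torus. a x * (B m x - b x) * C m x)
        + (LINT x|torus. a x * b x * (C m x - c x))" using i by simp
    finally show "norm ((LINT x|torus. A m x * B m x * C m x) - (LINT x|torus. a x * b x * c x)) \<le> ?bd m"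
      using holder3'[OF L3_diff[OF L(1)[of m] L(4)] L(2)[of m] L(3)[of m]]
        holder3'[OF L(4) L3_diff[OF L(2)[of m] L(5)] L(3)[of m]]
        holder3'[OF L(4) L(5) L3_diff[OF L(3)[of m] L(6)]]
      unfolding real_norm_def by linarith
  qed
qed

section \<open>A trigonometric approximate identity\<close>

definition cosq :: "3 \<Rightarrow> real^3 \<Rightarrow> real" where
  "cosq i z = (1 + wave (axis i 1) 0 z) / 2"

abbreviation sinq :: "3 \<Rightarrow> real^3 \<Rightarrow> real" where
  "sinq i z \<equiv> 1 - cosq i z"

text \<open>The de la Vallee-Poussin kernel, that is the product of the \<open>cos\<^sup>2\<^sup>N (\<pi> z\<^sub>i)\<close>. It is a positive even
  trigonometric polynomial, and its second moments follow from a single integration by parts.\<close>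

definition kraw :: "nat \<Rightarrow> real^3 \<Rightarrow> real" where
  "kraw N z = (\<Prod>l\<in>UNIV. cosq l z ^ N)"

definition kern :: "nat \<Rightarrow> real^3 \<Rightarrow> real" where
  "kern N z = kraw N z / (LINT x|torus. kraw N x)"

abbreviation kother :: "3 \<Rightarrow> nat \<Rightarrow> real^3 \<Rightarrow> real" where
  "kother i N z \<equiv> (\<Prod>l\<in>UNIV-{i}. cosq l z ^ N)"

lemma wave_axis: "wave (axis i 1) \<tau> z = cos (2 * pi * z $ i + \<tau>)"
proof -
  have "freq (axis i 1) = axis i 1" by (simp add: freq_def axis_def vec_eq_iff)
  then show ?thesis by (simp add: wave_def inner_axis inner_commute)
qed

lemma cosq_eq: "cosq i z = (cos (pi * z $ i))\<^sup>2"
  using cos_double_cos[of "pi * z $ i"] by (simp add: cosq_def wave_axis mult.assoc)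

lemma sinq_eq: "sinq i z = (sin (pi * z $ i))\<^sup>2"
  unfolding cosq_eq by (simp add: cos_squared_eq)

lemma cosq_bounds: "0 \<le> cosq i z" "cosq i z \<le> 1" "0 \<le> sinq i z"
  by (simp_all add: cosq_eq abs_square_le_1)

lemma sper_prod: "(\<And>m. m \<in> A \<Longrightarrow> sper (F m)) \<Longrightarrow> sper (\<lambda>x. \<Prod>m\<in>A. F m x)"
  by (induction A rule: infinite_finite_induct) (auto intro: sper_intros)

lemma sper_power: "sper f \<Longrightarrow> sper (\<lambda>x. f x ^ n)"
  by (induction n) (auto intro: sper_intros)

lemma sper_cmult: "sper f \<Longrightarrow> sper (\<lambda>x. c * f x)"
  by (intro sper_intros)

lemma sper_cosq: "sper (cosq i)"
  using sper_cmult[of "\<lambda>z. 1 + wave (axis i 1) 0 z" "1 / 2"] by (simp add: sper_intros cosq_def[abs_def])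

lemma sper_kraw: "sper (kraw N)"
  unfolding kraw_def[abs_def] by (intro sper_prod sper_power sper_cosq)

lemma sper_kern: "sper (kern N)"
  using sper_cmult[OF sper_kraw, of "1 / (LINT x|torus. kraw N x)" N] by (simp add: kern_def[abs_def])

lemma partial_power:
  fixes f :: "real^3 \<Rightarrow> real"
  assumes "smooth f"
  shows "smooth (\<lambda>x. f x ^ n)" "partial i (\<lambda>x. f x ^ n) x = of_nat n * f x ^ (n - 1) * partial i f x"
proof -
  show s: "smooth (\<lambda>x. f x ^ n)" for n by (induction n) (auto intro: smooth_const smooth_mult assms)
  show "partial i (\<lambda>x. f x ^ n) x = of_nat n * f x ^ (n - 1) * partial i f x"
  proof (induction n)
    case (Suc n)
    have "partial i (\<lambda>x. f x ^ Suc n) x = f x * partial i (\<lambda>x. f x ^ n) x + partial i f x * f x ^ n"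
      using partial_mult[OF assms s[of n], of i x] by simp
    then show ?case using Suc by (cases n) (simp_all add: algebra_simps)
  qed simp
qed

lemma partial_prod_zero:
  fixes F :: "'i \<Rightarrow> real^3 \<Rightarrow> real"
  shows "(\<And>m. m \<in> A \<Longrightarrow> smooth (F m) \<and> partial i (F m) x = 0) \<Longrightarrow>
    smooth (\<lambda>x. \<Prod>m\<in>A. F m x) \<and> partial i (\<lambda>x. \<Prod>m\<in>A. F m x) x = 0"
proof (induction A rule: infinite_finite_induct)
  case (insert m A)
  then show ?case using smooth_mult[of "F m" "\<lambda>x. \<Prod>m\<in>A. F m x"]
      partial_mult[of "F m" "\<lambda>x. \<Prod>m\<in>A. F m x" i x] by simp
qed (auto intro: smooth_const)

lemma partial_cosq: "partial i (cosq l) z = (if l = i then - pi * sin (2 * pi * z $ i) else 0)"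
proof -
  have "cosq l = (\<lambda>z. 1/2 + 1/2 * wave (axis l 1) 0 z)" by (simp add: fun_eq_iff add_divide_distrib cosq_def)
  then have "partial i (cosq l) z = partial i (\<lambda>z. 1/2 + 1/2 * wave (axis l 1) 0 z) z" by (simp only:)
  also have "\<dots> = 1/2 * partial i (wave (axis l 1) 0) z"
    by (simp only: partial_add[OF smooth_const smooth_cmult[OF smooth_wave]] partial_cmult[OF smooth_wave] partial_const
        add_0_left)
  finally have "partial i (cosq l) z = 1/2 * partial i (wave (axis l 1) 0) z" .
  then show ?thesis
    by (auto simp: partial_wave wave_axis cos_add) (auto simp: axis_def)
qed

lemma kother_smooth: "smooth (kother i N)" "partial i (kother i N) z = 0"
proof -
  have "smooth (\<lambda>z. cosq m z ^ N) \<and> partial i (\<lambda>z. cosq m z ^ N) z = 0" if "m \<in> UNIV - {i}" for m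
    using partial_power(1)[of "cosq m" N] partial_power(2)[of "cosq m" i N z] sper_cosq[of m] that by (simp add: sper_def partial_cosq)
  from partial_prod_zero[where A = "UNIV - {i}" and F = "\<lambda>m z. cosq m z ^ N", OF this]
  show "smooth (kother i N)" "partial i (kother i N) z = 0" by auto
qed

lemma sper_kother: "sper (kother i N)"
  by (intro sper_prod sper_power sper_cosq)

lemma kraw_split: "kraw N z = cosq i z ^ N * kother i N z"
  unfolding kraw_def by (rule prod.remove) auto

text \<open>The integral of the derivative of \<open>sin (2\<pi> z\<^sub>i) cos\<^sup>2\<^sup>M (\<pi> z\<^sub>i)\<close> vanishes.\<close>

lemma kraw_moment:
  "(2 * real M + 1) * (LINT z|torus. sinq i z * cosq i z ^ M * kother i N z)
   = (LINT z|torus. cosq i z ^ Suc M * kother i N z)"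
proof -
  let ?s = "wave (axis i 1) (- pi / 2)"
  define f where "f = (\<lambda>z. (?s z * cosq i z ^ M) * kother i N z)"
  have sf: "sper f" unfolding f_def by (intro sper_intros sper_power sper_cosq sper_kother)
  have pd: "partial i f z = 2 * pi * (cosq i z ^ Suc M * kother i N z)
      - 2 * pi * (2 * real M + 1) * (sinq i z * cosq i z ^ M * kother i N z)" for z
  proof -
    have ss: "smooth ?s" "smooth (\<lambda>z. cosq i z ^ M)" "smooth (\<lambda>z. ?s z * cosq i z ^ M)"
      using sper_cosq[of i] by (auto intro: smooth_wave partial_power smooth_mult simp: sper_def)
    have s: "?s z = sin (2 * pi * z $ i)" unfolding wave_axis by (simp add: cos_diff)
    have c: "partial i ?s z = 2 * pi * (cosq i z - sinq i z)"
      by (simp add: partial_wave wave_axis axis_def cosq_def field_simps)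
    have sc: "(sin (2 * pi * z $ i))\<^sup>2 = 4 * sinq i z * cosq i z"
    proof -
      have "sin (2 * pi * z $ i) = 2 * sin (pi * z $ i) * cos (pi * z $ i)"
        using sin_double[of "pi * z $ i"] by (simp add: mult.assoc)
      then show ?thesis unfolding sinq_eq unfolding cosq_eq by (simp add: power_mult_distrib)
    qed
    have "partial i f z = partial i (\<lambda>z. ?s z * cosq i z ^ M) z * kother i N z"
      unfolding f_def using partial_mult[OF ss(3) kother_smooth(1)] kother_smooth(2)[of i N z] by simp
    also have "partial i (\<lambda>z. ?s z * cosq i z ^ M) z
       = sin (2 * pi * z $ i) * (real M * cosq i z ^ (M - 1) * (- pi * sin (2 * pi * z $ i)))
         + 2 * pi * (cosq i z - sinq i z) * cosq i z ^ M"
      using partial_mult[OF ss(1,2), of i z] partial_power(2)[of "cosq i" i M z] sper_cosq[of i]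
      unfolding s c partial_cosq by (simp add: sper_def)
    also have "sin (2 * pi * z $ i) * (real M * cosq i z ^ (M - 1) * (- pi * sin (2 * pi * z $ i)))
       = - pi * real M * cosq i z ^ (M - 1) * (sin (2 * pi * z $ i))\<^sup>2" by (simp add: power2_eq_square)
    also have "\<dots> = - 4 * pi * real M * (sinq i z * cosq i z ^ M)"
      unfolding sc by (cases M) simp_all
    finally show ?thesis by (simp add: algebra_simps)
  qed
  have i: "integrable torus (\<lambda>z. cosq i z ^ Suc M * kother i N z)"
    "integrable torus (\<lambda>z. sinq i z * cosq i z ^ M * kother i N z)"
    by (intro cper_integrable sper_cper sper_intros sper_power sper_cosq sper_kother)+
  have "0 = (LINT z|torus. partial i f z)" using torus_partial_zero[OF sf] by simp
  also have "\<dots> = 2 * pi * ((LINT z|torus. cosq i z ^ Suc M * kother i N z)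
       - (2 * real M + 1) * (LINT z|torus. sinq i z * cosq i z ^ M * kother i N z))"
    unfolding pd using i by (simp only: Bochner_Integration.integral_diff integrable_mult_right
        Bochner_Integration.integral_mult_right_zero) (simp only: mult.assoc right_diff_distrib)
  finally show ?thesis by simp
qed

lemma kraw_nonneg: "0 \<le> kraw N z"
  unfolding kraw_def using cosq_bounds(1) by (intro prod_nonneg ballI zero_le_power) auto

lemma kother_nonneg: "0 \<le> kother i N z"
  using cosq_bounds(1) by (intro prod_nonneg ballI zero_le_power) auto

lemma kraw_mass: "0 < (LINT z|torus. kraw N z)"
proof -
  have "(LINT z|torus. kraw N z) \<noteq> 0"
  proof
    assume "(LINT z|torus. kraw N z) = 0"
    then have "integral (cbox 0 1) (kraw N) = 0"
      using cper_LINT[OF sper_cper[OF sper_kraw]] by simp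
    then have "\<forall>x\<in>cbox 0 1. kraw N x = 0"
      using sper_cper[OF sper_kraw, of N]
      by (subst (asm) integral_cbox_eq_0_iff)
        (auto simp: kraw_nonneg cper_def interval_ne_empty_cart intro: continuous_on_subset)
    then have "kraw N 0 = 0" by (simp add: mem_box_cart)
    moreover have "kraw N 0 = 1" by (simp add: kraw_def cosq_eq)
    ultimately show False by simp
  qed
  moreover have "(LINT z|torus. kraw N z) \<ge> 0" by (rule integral_nonneg_AE) (simp add: kraw_nonneg)
  ultimately show ?thesis by simp
qed

lemma kern_nonneg: "0 \<le> kern N z"
  unfolding kern_def using kraw_nonneg kraw_mass[of N] by simp

lemma kern_mass: "(LINT z|torus. kern N z) = 1"
  unfolding kern_def using kraw_mass[of N] by simp

lemma kern_even: "kern N (x - y) = kern N (y - x)"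
proof -
  have "wave (axis l 1) 0 (x - y) = wave (axis l 1) 0 (y - x)" for l
    using cos_minus[of "2 * pi * (x - y) $ l"] by (simp add: wave_axis algebra_simps)
  then show ?thesis by (simp add: kern_def kraw_def cosq_def)
qed

lemma kern_sinq: "(LINT z|torus. sinq l z * kern N z) \<le> 1 / (2 * real N + 1)"
proof -
  let ?W = "LINT z|torus. kraw N z"
  have "(2 * real N + 1) * (LINT z|torus. sinq l z * cosq l z ^ N * kother l N z)
     = (LINT z|torus. cosq l z ^ Suc N * kother l N z)" by (rule kraw_moment)
  also have "\<dots> \<le> (LINT z|torus. kraw N z)"
  proof (rule integral_mono)
    show "integrable torus (\<lambda>z. cosq l z ^ Suc N * kother l N z)" "integrable torus (kraw N)"
      by (intro cper_integrable sper_cper sper_intros sper_power sper_cosq sper_kother sper_kraw)+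
    show "cosq l z ^ Suc N * kother l N z \<le> kraw N z" for z
    proof -
      have "cosq l z * (cosq l z ^ N * kother l N z) \<le> 1 * (cosq l z ^ N * kother l N z)"
        using cosq_bounds[of l z] kother_nonneg[where i = l and z = z and N = N] by (intro mult_right_mono mult_nonneg_nonneg) auto
      then show ?thesis unfolding kraw_split[of N z l] by (simp only: power_Suc mult.assoc mult_1)
    qed
  qed
  finally have A: "(2 * real N + 1) * (LINT z|torus. sinq l z * kraw N z) \<le> ?W"
    unfolding kraw_split[of N _ l] by (simp only: mult.assoc)
  have B: "(LINT z|torus. sinq l z * kern N z) = (LINT z|torus. sinq l z * kraw N z) / ?W"
    unfolding kern_def by (simp only: times_divide_eq_right Bochner_Integration.integral_divide_zero)
  have div: "A / W \<le> 1 / m" if "W > 0" "m > 0" "m * A \<le> W" for A W m :: real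
    using that by (simp add: field_simps)
  show ?thesis unfolding B by (rule div[OF kraw_mass _ A]) simp
qed

text \<open>The integrand is \<open>tan\<^sup>2 (\<pi> z\<^sub>i)\<close> times the kernel, written without the singular factor.\<close>

lemma kern_tanq:
  assumes "N \<ge> 1"
  shows "(LINT z|torus. sinq i z * cosq i z ^ (N - 1) * kother i N z / (LINT z|torus. kraw N z))
    = 1 / (2 * real N - 1)"
proof -
  have "(2 * real (N - 1) + 1) * (LINT z|torus. sinq i z * cosq i z ^ (N - 1) * kother i N z)
     = (LINT z|torus. kraw N z)"
    using kraw_moment[of "N - 1" i N] assms unfolding kraw_split[of N _ i] by simp
  moreover have "2 * real (N - 1) + 1 = 2 * real N - 1" "2 * real N - 1 > 0" using assms by auto
  ultimately show ?thesis using kraw_mass[of N]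
    by (simp only: Bochner_Integration.integral_divide_zero) (simp add: field_simps)
qed

lemma partial_kern:
  "partial i (kern N) z = real N * cosq i z ^ (N - 1) * (- pi * sin (2 * pi * z $ i)) * kother i N z
     / (LINT z|torus. kraw N z)"
proof -
  let ?W = "LINT z|torus. kraw N z"
  have k: "kern N = (\<lambda>z. (1 / ?W) * (cosq i z ^ N * kother i N z))"
    by (simp only: fun_eq_iff kern_def kraw_split[of N _ i]) simp
  have s: "smooth (cosq i)" using sper_cosq sper_def by blast
  have "partial i (kern N) z = (1 / ?W) * partial i (\<lambda>z. cosq i z ^ N * kother i N z) z"
    unfolding k by (rule partial_cmult) (intro smooth_mult partial_power s kother_smooth)
  also have "partial i (\<lambda>z. cosq i z ^ N * kother i N z) z
      = real N * cosq i z ^ (N - 1) * (- pi * sin (2 * pi * z $ i)) * kother i N z"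
    using partial_mult[OF partial_power(1)[OF s] kother_smooth(1)] kother_smooth(2)[of i N z]
    by (simp add: partial_power(2)[OF s] partial_cosq)
  finally show ?thesis by simp
qed

text \<open>The gradient of the kernel has size about \<open>\<surd>N\<close> in \<open>L\<^sup>1\<close>, but it lives at distance \<open>1/\<surd>N\<close>
  from the lattice, so weighted by the distance it stays bounded. This is what makes the commutator
  estimate work.\<close>

lemma partial_kern_weighted:
  "(LINT z|torus. \<bar>partial i (kern N) z\<bar> * sqrt (sinq l z)) \<le> 2 * pi"
proof (cases "N \<ge> 1")
  case False
  then have "partial i (kern N) z = 0" for z by (simp only: partial_kern) simp
  then show ?thesis by simp
next
  case N: True
  let ?W = "LINT z|torus. kraw N z"
  have W: "?W > 0" by (rule kraw_mass)
  have c: "cper (\<lambda>z. sinq l z * kern N z)" "cper (\<lambda>z. sinq i z * cosq i z ^ (N - 1) * kother i N z / ?W)"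
  proof -
    show "cper (\<lambda>z. sinq l z * kern N z)" by (intro sper_cper sper_intros sper_cosq sper_kern)
    have "sper (\<lambda>z. (1 / ?W) * (sinq i z * cosq i z ^ (N - 1) * kother i N z))"
      by (intro sper_cmult sper_intros sper_power sper_cosq sper_kother)
    then show "cper (\<lambda>z. sinq i z * cosq i z ^ (N - 1) * kother i N z / ?W)" using sper_cper by simp
  qed
  have ptw: "\<bar>partial i (kern N) z\<bar> * sqrt (sinq l z)
      \<le> pi * real N * (sinq l z * kern N z + sinq i z * cosq i z ^ (N - 1) * kother i N z / ?W)" for z
  proof -
    \<comment> \<open>Up to the remaining factors the integrand is \<open>2ab\<close>, and \<open>a\<^sup>2\<close> and \<open>b\<^sup>2\<close> have integrals of order \<open>1/N\<close>.\<close>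
    define a where "a = \<bar>sin (pi * z $ l)\<bar> * \<bar>cos (pi * z $ i)\<bar> ^ N"
    define b where "b = \<bar>sin (pi * z $ i)\<bar> * \<bar>cos (pi * z $ i)\<bar> ^ (N - 1)"
    have a2: "a\<^sup>2 = sinq l z * cosq i z ^ N" and b2: "b\<^sup>2 = sinq i z * cosq i z ^ (N - 1)"
      unfolding a_def b_def sinq_eq unfolding cosq_eq
      by (simp_all add: power_mult_distrib) (simp_all add: power_even_abs mult.commute flip: power_mult)
    have cN: "cosq i z ^ (N - 1) * \<bar>cos (pi * z $ i)\<bar> = \<bar>cos (pi * z $ i)\<bar> ^ (N - 1) * \<bar>cos (pi * z $ i)\<bar> ^ N"
      using N unfolding cosq_eq
      by (cases N) (simp_all add: power2_eq_square power_mult_distrib mult_ac flip: abs_mult power_mult_distrib)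
    have "\<bar>partial i (kern N) z\<bar> * sqrt (sinq l z)
       = real N * cosq i z ^ (N - 1) * (pi * \<bar>sin (2 * pi * z $ i)\<bar>) * kother i N z / ?W * \<bar>sin (pi * z $ l)\<bar>"
      unfolding partial_kern sinq_eq real_sqrt_abs
      using W kother_nonneg[where i = i and z = z and N = N] cosq_bounds(1)[of i z] by (simp add: abs_mult)
    also have "\<bar>sin (2 * pi * z $ i)\<bar> = 2 * \<bar>sin (pi * z $ i)\<bar> * \<bar>cos (pi * z $ i)\<bar>"
      using sin_double[of "pi * z $ i"] by (simp add: abs_mult mult.assoc)
    also have "real N * cosq i z ^ (N - 1) * (pi * (2 * \<bar>sin (pi * z $ i)\<bar> * \<bar>cos (pi * z $ i)\<bar>)) * kother i N z / ?W * \<bar>sin (pi * z $ l)\<bar>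
       = (pi * real N * kother i N z / ?W) * (2 * (cosq i z ^ (N - 1) * \<bar>cos (pi * z $ i)\<bar>) * \<bar>sin (pi * z $ i)\<bar> * \<bar>sin (pi * z $ l)\<bar>)"
      by (simp only: mult_ac times_divide_eq_right times_divide_eq_left)
    also have "\<dots> = (pi * real N * kother i N z / ?W) * (2 * a * b)"
      unfolding cN a_def b_def by (simp only: mult_ac)
    also have "\<dots> \<le> (pi * real N * kother i N z / ?W) * (a\<^sup>2 + b\<^sup>2)"
      using W kother_nonneg[where i = i and z = z and N = N] sum_squares_bound[of a b] by (intro mult_left_mono) auto
    also have "\<dots> = pi * real N * (sinq l z * kern N z + sinq i z * cosq i z ^ (N - 1) * kother i N z / ?W)"
      unfolding a2 b2 kern_def kraw_split[of N z i] by (simp only: distrib_left distrib_right mult_ac times_divide_eq_right times_divide_eq_left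
          add_divide_distrib)
    finally show ?thesis .
  qed
  have "continuous_on UNIV (\<lambda>z. sqrt (sinq l z))" "continuous_on UNIV (\<lambda>z. \<bar>partial i (kern N) z\<bar>)"
    using sper_cper[OF sper_partial[OF sper_kern[of N]], of i] sper_cper[OF sper_cosq[of l]]
    by (auto simp: cper_def intro!: continuous_intros)
  then have "integrable torus (\<lambda>z. \<bar>partial i (kern N) z\<bar> * sqrt (sinq l z))"
    by (intro integrable_torus_continuous continuous_on_mult)
  then have "(LINT z|torus. \<bar>partial i (kern N) z\<bar> * sqrt (sinq l z))
     \<le> (LINT z|torus. pi * real N * (sinq l z * kern N z + sinq i z * cosq i z ^ (N - 1) * kother i N z / ?W))"
    using cper_integrable[OF c(1)] cper_integrable[OF c(2)]
    by (intro integral_mono ptw integrable_mult_right Bochner_Integration.integrable_add)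
  also have "\<dots> = pi * real N * ((LINT z|torus. sinq l z * kern N z) + 1 / (2 * real N - 1))"
    unfolding kern_tanq[OF N, of i, symmetric]
    using cper_integrable[OF c(1)] cper_integrable[OF c(2)]
    by (simp only: Bochner_Integration.integral_add Bochner_Integration.integral_mult_right_zero)
  also have "\<dots> \<le> pi * real N * (1 / (2 * real N + 1) + 1 / (2 * real N - 1))"
    by (intro mult_left_mono add_right_mono kern_sinq) auto
  also have "\<dots> \<le> pi * real N * (1 / real N + 1 / real N)"
    using N by (intro mult_left_mono add_mono divide_left_mono) auto
  also have "\<dots> = 2 * pi" using N by simp
  finally show ?thesis .
qed

text \<open>The first moment of the kernel is estimated by its mass and its second moment.\<close>

lemma kern_sqrt_sinq:
  assumes "N \<ge> 1" shows "(LINT z|torus. kern N z * sqrt (sinq l z)) \<le> 1 / sqrt (real N)"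
proof -
  \<comment> \<open>The length scale of the kernel.\<close>
  define d where "d = 1 / sqrt (real N)"
  have d: "d > 0" "1 / d\<^sup>2 = real N" using assms by (auto simp: d_def power_divide)
  have ptw: "kern N z * sqrt (sinq l z) \<le> d / 2 * kern N z + 1 / (2 * d) * (sinq l z * kern N z)" for z
  proof -
    have "2 * (sqrt (sinq l z) * d) \<le> (sqrt (sinq l z))\<^sup>2 + d\<^sup>2"
      using sum_squares_bound[of "sqrt (sinq l z)" d] by (simp only: mult.assoc)
    then have "sqrt (sinq l z) \<le> d / 2 + 1 / (2 * d) * sinq l z"
      using d(1) cosq_bounds(3)[of l z] by (simp add: field_simps power2_eq_square)
    from mult_left_mono[OF this kern_nonneg[of N z]] show ?thesis
      by (simp only: distrib_left mult_ac)
  qed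
  have c: "cper (kern N)" "cper (\<lambda>z. sinq l z * kern N z)"
    by (auto intro!: sper_cper sper_intros sper_cosq sper_kern)
  have i: "integrable torus (\<lambda>z. kern N z * sqrt (sinq l z))"
    using c(1) sper_cper[OF sper_cosq[of l]]
    by (intro integrable_torus_continuous) (auto simp: cper_def intro!: continuous_intros)
  have "(LINT z|torus. kern N z * sqrt (sinq l z))
      \<le> (LINT z|torus. d / 2 * kern N z + 1 / (2 * d) * (sinq l z * kern N z))"
    using cper_integrable[OF c(1)] cper_integrable[OF c(2)]
    by (intro integral_mono ptw i integrable_mult_right Bochner_Integration.integrable_add)
  also have "\<dots> = d / 2 + 1 / (2 * d) * (LINT z|torus. sinq l z * kern N z)"
    using cper_integrable[OF c(1)] cper_integrable[OF c(2)]
    by (simp only: Bochner_Integration.integral_add integrable_mult_right Bochner_Integration.integral_mult_right_zero kern_mass mult_1_right)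
  also have "\<dots> \<le> d / 2 + 1 / (2 * d) * (1 / (2 * real N + 1))"
    using d by (intro add_left_mono mult_left_mono kern_sinq) auto
  also have "\<dots> \<le> d / 2 + 1 / (2 * d) * (1 / real N)"
    using d assms by (intro add_left_mono mult_left_mono divide_left_mono) auto
  also have "\<dots> = d"
  proof -
    have "1 / real N = d\<^sup>2" using d by (metis divide_divide_eq_right mult_1 div_by_1)
    then show ?thesis using d(1) by (simp add: power2_eq_square)
  qed
  finally show ?thesis by (simp add: d_def)
qed

lemma sin_ge_half:
  assumes "0 \<le> t" "t \<le> 1 / 2" shows "t \<le> sin (pi * t)"
proof (cases "pi * t \<le> pi / 3")
  case True
  have "\<exists>\<xi>. 0 \<le> \<xi> \<and> \<xi> \<le> pi * t \<and> sin (pi * t) = pi * t * cos \<xi>"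
  proof (cases "t = 0")
    case False
    then have "0 < pi * t" using assms by simp
    then obtain z where "0 < z" "z < pi * t" "sin (pi * t) - sin 0 = (pi * t - 0) * cos z"
      using MVT2[of 0 "pi * t" sin cos] by (auto intro: DERIV_sin)
    then show ?thesis by (intro exI[of _ z]) auto
  qed (auto intro!: exI[of _ 0])
  then obtain \<xi> where x: "0 \<le> \<xi>" "\<xi> \<le> pi * t" "sin (pi * t) = pi * t * cos \<xi>" by blast
  have "cos (pi / 3) \<le> cos \<xi>"
  proof (rule cos_monotone_0_pi_le)
    show "\<xi> \<le> pi / 3" using x(2) True by linarith
  qed (use x pi_gt_zero in auto)
  then have "pi * t * (1 / 2) \<le> sin (pi * t)"
    unfolding x(3) using assms by (intro mult_left_mono) (auto simp: cos_60)
  moreover have "t \<le> pi * t * (1 / 2)" using assms pi_ge_two mult_right_mono[of 2 pi t] by simp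
  ultimately show ?thesis by linarith
next
  case False
  have "sin (pi / 6) \<le> sin (pi * t)"
    using False assms mult_left_mono[of t "1/2" pi] pi_gt_zero by (intro sin_monotone_2pi_le) (auto)
  then show ?thesis using assms by (simp add: sin_30)
qed

text \<open>Every coordinate is rounded to the nearest integer. Since \<open>t \<le> sin (\<pi> t)\<close> on \<open>[0, 1/2]\<close>, the function
  \<open>sqrt (sinq l y)\<close> dominates the distance of the coordinate from the integers; it serves as a
  periodic substitute for that distance throughout.\<close>

lemma periodic_short_shift:
  obtains y' where "\<And>f::real^3\<Rightarrow>real. \<And>x. periodic f \<Longrightarrow> f (x + y) = f (x + y')"
    and "\<And>l. \<bar>y' $ l\<bar> \<le> sqrt (sinq l y)"
proof
  define k :: "int^3" where "k = (\<chi> l. - round (y $ l))"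
  show "f (x + y) = f (x + (y + freq k))" if "periodic f" for f :: "real^3 \<Rightarrow> real" and x
    using periodic_freq[OF that, of "x + y" k] by (simp add: add.assoc)
  show "\<bar>(y + freq k) $ l\<bar> \<le> sqrt (sinq l y)" for l
  proof -
    define w where "w = (y + freq k) $ l"
    have w: "w = y $ l - of_int (round (y $ l))" by (simp add: w_def freq_def k_def)
    have "\<bar>w\<bar> \<le> 1/2" using of_int_round_abs_le[of "y $ l"] by (simp add: w abs_minus_commute)
    then have "\<bar>w\<bar> \<le> sin (pi * \<bar>w\<bar>)" by (intro sin_ge_half) auto
    also have "\<dots> \<le> \<bar>sin (pi * w)\<bar>" by (cases "w \<ge> 0") (auto simp: abs_if)
    also have "sinq l (y + freq k) = sinq l y"
      using periodic_freq[OF periodic_wave] by (simp add: cosq_def)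
    then have "\<bar>sin (pi * w)\<bar> = sqrt (sinq l y)" unfolding sinq_eq w_def by (metis real_sqrt_abs)
    finally show ?thesis by (simp add: w_def)
  qed
qed

section \<open>Mollification\<close>

lemma integrable_cper_mult:
  assumes "cper \<phi>" "integrable torus f" shows "integrable torus (\<lambda>x. \<phi> x * f x)"
proof -
  obtain B where B: "B > 0" "\<And>x. \<bar>\<phi> x\<bar> \<le> B" using cper_bounded[OF assms(1)] by metis
  show ?thesis
  proof (rule Bochner_Integration.integrable_bound)
    show "integrable torus (\<lambda>x. B * f x)" using assms(2) by simp
    show "(\<lambda>x. \<phi> x * f x) \<in> borel_measurable torus"
      using cper_integrable[OF assms(1)] assms(2) by (intro borel_measurable_times borel_measurable_integrable)
    show "AE x in torus. norm (\<phi> x * f x) \<le> norm (B * f x)"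
      using B by (auto simp: abs_mult intro!: mult_right_mono)
  qed
qed

definition mol :: "nat \<Rightarrow> (real^3 \<Rightarrow> real) \<Rightarrow> real^3 \<Rightarrow> real" where
  "mol N f x = (LINT y|torus. kern N (x - y) * f y)"

text \<open>Lists allow repeated frequencies, so that products of cosine sums need no collection of terms.\<close>

definition cosine_sum :: "(real^3 \<Rightarrow> real) \<Rightarrow> bool" where
  "cosine_sum f \<longleftrightarrow> (\<exists>L :: (real \<times> (int^3)) list. \<forall>z. f z = (\<Sum>(c, k)\<leftarrow>L. c * wave k 0 z))"

lemma cosine_sum_add: "cosine_sum f \<Longrightarrow> cosine_sum g \<Longrightarrow> cosine_sum (\<lambda>z. f z + g z)"
  unfolding cosine_sum_def
proof (elim exE)
  fix L M assume "\<forall>z. f z = (\<Sum>(c, k)\<leftarrow>L. c * wave k 0 z)" "\<forall>z. g z = (\<Sum>(c, k)\<leftarrow>M. c * wave k 0 z)"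
  then show "\<exists>L. \<forall>z. f z + g z = (\<Sum>(c, k)\<leftarrow>L. c * wave k 0 z)"
    by (intro exI[of _ "L @ M"]) simp
qed

lemma cosine_sum_wave: "cosine_sum (\<lambda>z. c * wave k 0 z)"
  unfolding cosine_sum_def by (rule exI[of _ "[(c, k)]"]) simp

lemma cosine_sum_mult:
  assumes "cosine_sum f" "cosine_sum g" shows "cosine_sum (\<lambda>z. f z * g z)"
proof -
  have freq_add: "freq (k + k') = freq k + freq k'" "freq (k - k') = freq k - freq k'" for k k'
    by (auto simp: freq_def vec_eq_iff)
  have ww: "c * wave k 0 z * (d * wave k' 0 z)
      = (c * d / 2) * wave (k + k') 0 z + (c * d / 2) * wave (k - k') 0 z" for c d k k' z
    unfolding wave_def freq_add inner_add_left inner_diff_left distrib_left right_diff_distrib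
    by (simp add: cos_add cos_diff algebra_simps)
  have zero: "cosine_sum (\<lambda>z. 0)" unfolding cosine_sum_def by (rule exI[of _ "[]"]) simp
  have 1: "cosine_sum (\<lambda>z. c * wave k 0 z * g z)" for c k
  proof -
    obtain M where M: "\<And>z. g z = (\<Sum>(c, k)\<leftarrow>M. c * wave k 0 z)" using assms(2) cosine_sum_def by metis
    have "cosine_sum (\<lambda>z. c * wave k 0 z * (\<Sum>(c, k)\<leftarrow>M. c * wave k 0 z))"
    proof (induction M)
      case (Cons a M)
      obtain d k' where a: "a = (d, k')" by force
      show ?case unfolding a list.map sum_list.Cons prod.case distrib_left ww
        by (intro cosine_sum_add cosine_sum_wave Cons)
    qed (simp add: zero)
    then show ?thesis by (simp only: M)
  qed
  obtain L where L: "\<And>z. f z = (\<Sum>(c, k)\<leftarrow>L. c * wave k 0 z)" using assms(1) cosine_sum_def by metis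
  have "cosine_sum (\<lambda>z. (\<Sum>(c, k)\<leftarrow>L. c * wave k 0 z) * g z)"
  proof (induction L)
    case (Cons a L)
    obtain d k' where a: "a = (d, k')" by force
    show ?case unfolding a list.map sum_list.Cons prod.case distrib_right
      by (intro cosine_sum_add 1 Cons)
  qed (simp add: zero)
  then show ?thesis by (simp only: L)
qed

lemma cosine_sum_kern: "cosine_sum (kern N)"
proof -
  have one: "cosine_sum (\<lambda>z. c)" for c
  proof -
    have "wave 0 0 z = 1" for z by (simp add: wave_def freq_def inner_vec_def)
    then show ?thesis using cosine_sum_wave[of c 0] by simp
  qed
  have "cosine_sum (cosq l)" for l
    using cosine_sum_add[OF one[of "1/2"] cosine_sum_wave[of "1/2" "axis l 1"]]
    by (simp add: add_divide_distrib cosq_def[abs_def])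
  then have "cosine_sum (\<lambda>z. cosq l z ^ N)" for l
    by (induction N) (auto intro: one cosine_sum_mult)
  then have "cosine_sum (\<lambda>z. \<Prod>l\<in>A. cosq l z ^ N)" for A
    by (induction A rule: infinite_finite_induct) (auto intro: one cosine_sum_mult)
  then have "cosine_sum (kraw N)" unfolding kraw_def[abs_def] .
  from cosine_sum_mult[OF one[of "1 / (LINT x|torus. kraw N x)"] this] show ?thesis
    by (simp add: kern_def[abs_def])
qed

text \<open>The addition theorem separates the variables, so mollification has finite rank: it depends only on
  finitely many Fourier coefficients.\<close>

lemma kern_expansion:
  obtains c k \<tau> and M :: nat where
    "\<And>x y. kern N (x - y) = (\<Sum>m<M. c m * (wave (k m) (\<tau> m) x * wave (k m) (\<tau> m) y))"
proof -
  obtain L :: "(real \<times> (int^3)) list" where L: "\<And>z. kern N z = (\<Sum>(c, k)\<leftarrow>L. c * wave k 0 z)"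
    using cosine_sum_kern[of N] unfolding cosine_sum_def by blast
  have sp: "c * wave k 0 (x - y) = c * (wave k 0 x * wave k 0 y) + c * (wave k (- pi / 2) x * wave k (- pi / 2) y)"
    for c k x y
  proof -
    have "wave k (- pi / 2) x = sin (2 * pi * (freq k \<bullet> x))" for x
      using cos_diff[of "2 * pi * (freq k \<bullet> x)" "pi / 2"] by (simp add: wave_def)
    then show ?thesis by (simp add: wave_def inner_diff_right right_diff_distrib cos_diff distrib_left)
  qed
  define M where "M = concat (map (\<lambda>(c, k). [(c, k, 0), (c, k, - pi / 2)]) L)"
  have "kern N (x - y) = (\<Sum>m<length M. fst (M ! m) * (wave (fst (snd (M ! m))) (snd (snd (M ! m))) x
      * wave (fst (snd (M ! m))) (snd (snd (M ! m))) y))" for x y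
  proof -
    have "kern N (x - y) = (\<Sum>(c, k, \<tau>)\<leftarrow>M. c * (wave k \<tau> x * wave k \<tau> y))"
      unfolding L M_def by (induction L) (auto simp: sp)
    then show ?thesis by (simp add: sum_list_sum_nth atLeast0LessThan case_prod_unfold)
  qed
  then show thesis
    by (rule that[where M = "length M" and c = "\<lambda>m. fst (M ! m)" and k = "\<lambda>m. fst (snd (M ! m))"
          and \<tau> = "\<lambda>m. snd (snd (M ! m))"])
qed

lemma mol_expansion:
  obtains c k \<tau> and M :: nat where
    "\<And>x y. kern N (x - y) = (\<Sum>m<M. c m * (wave (k m) (\<tau> m) x * wave (k m) (\<tau> m) y))"
    "\<And>f x. integrable torus f \<Longrightarrow>
      mol N f x = (\<Sum>m<M. c m * (LINT y|torus. wave (k m) (\<tau> m) y * f y) * wave (k m) (\<tau> m) x)"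
proof -
  obtain c k \<tau> and M :: nat where
    E: "\<And>x y. kern N (x - y) = (\<Sum>m<M. c m * (wave (k m) (\<tau> m) x * wave (k m) (\<tau> m) y))"
    by (rule kern_expansion[of N]; rule that; assumption)
  have "mol N f x = (\<Sum>m<M. c m * (LINT y|torus. wave (k m) (\<tau> m) y * f y) * wave (k m) (\<tau> m) x)"
    if f: "integrable torus f" for f x
  proof -
    have "integrable torus (\<lambda>y. wave (k m) (\<tau> m) y * f y)" for m
      by (intro integrable_cper_mult f sper_cper sper_intros)
    moreover have "mol N f x = (LINT y|torus. (\<Sum>m<M. (c m * wave (k m) (\<tau> m) x) * (wave (k m) (\<tau> m) y * f y)))"
      unfolding mol_def E by (simp only: sum_distrib_right) (simp only: mult_ac)
    ultimately have "mol N f x = (\<Sum>m<M. (c m * wave (k m) (\<tau> m) x) * (LINT y|torus. wave (k m) (\<tau> m) y * f y))"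
      by (simp only: Bochner_Integration.integral_sum integrable_mult_right Bochner_Integration.integral_mult_right_zero)
    then show ?thesis by (simp only: mult_ac)
  qed
  then show thesis by (rule that[OF E])
qed

lemma sper_mol: assumes "integrable torus f" shows "sper (mol N f)"
proof -
  obtain c k \<tau> and M :: nat where
    "\<And>x y. kern N (x - y) = (\<Sum>m<M. c m * (wave (k m) (\<tau> m) x * wave (k m) (\<tau> m) y))"
    "\<And>f x. integrable torus f \<Longrightarrow>
      mol N f x = (\<Sum>m<M. c m * (LINT y|torus. wave (k m) (\<tau> m) y * f y) * wave (k m) (\<tau> m) x)"
    by (rule mol_expansion[of N]; rule that; assumption)
  with assms have "mol N f = (\<lambda>x. \<Sum>m<M. c m * (LINT y|torus. wave (k m) (\<tau> m) y * f y) * wave (k m) (\<tau> m) x)"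
    by auto
  then show ?thesis by (auto intro!: sper_intros)
qed

lemma partial_mol:
  assumes f: "integrable torus f"
  shows "partial i (mol N f) x = (LINT y|torus. partial i (kern N) (x - y) * f y)"
proof -
  obtain c k \<tau> and M :: nat where
    E: "\<And>x y. kern N (x - y) = (\<Sum>m<M. c m * (wave (k m) (\<tau> m) x * wave (k m) (\<tau> m) y))"
    and m: "\<And>f x. integrable torus f \<Longrightarrow>
      mol N f x = (\<Sum>m<M. c m * (LINT y|torus. wave (k m) (\<tau> m) y * f y) * wave (k m) (\<tau> m) x)"
    by (rule mol_expansion[of N]; rule that; assumption)
  have pk: "partial i (kern N) (x - y) = (\<Sum>m<M. c m * wave (k m) (\<tau> m) y * partial i (wave (k m) (\<tau> m)) x)" for y
  proof -
    have "partial i (kern N) (x + - y) = partial i (\<lambda>x. kern N (x + - y)) x"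
      using partial_shift[of "kern N"] sper_kern sper_def by metis
    also have "\<dots> = partial i (\<lambda>x. \<Sum>m<M. c m * wave (k m) (\<tau> m) y * wave (k m) (\<tau> m) x) x"
      by (simp add: E mult_ac)
    also have "\<dots> = (\<Sum>m<M. c m * wave (k m) (\<tau> m) y * partial i (wave (k m) (\<tau> m)) x)"
      by (subst partial_sum) (auto intro!: smooth_cmult smooth_wave simp: partial_cmult smooth_wave)
    finally show ?thesis by simp
  qed
  have "mol N f = (\<lambda>x. \<Sum>m<M. c m * (LINT y|torus. wave (k m) (\<tau> m) y * f y) * wave (k m) (\<tau> m) x)"
    using m[OF f] by auto
  then have "partial i (mol N f) x = (\<Sum>m<M. c m * (LINT y|torus. wave (k m) (\<tau> m) y * f y) * partial i (wave (k m) (\<tau> m)) x)"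
    by (simp only:) (subst partial_sum, auto intro!: smooth_cmult smooth_wave simp: partial_cmult smooth_wave)
  also have "\<dots> = (LINT y|torus. (\<Sum>m<M. (c m * partial i (wave (k m) (\<tau> m)) x) * (wave (k m) (\<tau> m) y * f y)))"
    using integrable_cper_mult[OF sper_cper[OF sper_intros(2)] f]
    by (simp only: Bochner_Integration.integral_sum integrable_mult_right
        Bochner_Integration.integral_mult_right_zero) (simp only: mult_ac)
  also have "\<dots> = (LINT y|torus. partial i (kern N) (x - y) * f y)"
    unfolding pk by (simp only: sum_distrib_right) (simp only: mult_ac)
  finally show ?thesis .
qed

lemma cper_kern_reflect: "cper (\<lambda>y. kern N (x - y))"
  using sper_cper[OF sper_intros(6)[OF sper_kern, of N "- x"]] kern_even[of N x] by simp

lemma sper_kern_reflect: "sper (\<lambda>y. kern N (x - y))"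
  using sper_intros(6)[OF sper_kern, of N "- x"] kern_even[of N x] by simp

lemma mol_diff:
  assumes "integrable torus f" "integrable torus g"
  shows "mol N (\<lambda>x. f x - g x) x = mol N f x - mol N g x"
  unfolding mol_def
  by (subst Bochner_Integration.integral_diff[symmetric])
    (auto intro!: integrable_cper_mult cper_kern_reflect assms simp: right_diff_distrib)

lemma cper_reflect: assumes "cper f" shows "cper (\<lambda>y. f (x - y))"
proof -
  have "continuous_on UNIV (\<lambda>y. f (x - y))"
    using continuous_on_compose2[of UNIV f UNIV "\<lambda>y. x - y"] assms
    by (simp add: cper_def continuous_on_diff)
  moreover have "f (x - (y + axis i 1)) = f (x - y)" for y i
  proof -
    have "f (x - (y + axis i 1) + axis i 1) = f (x - (y + axis i 1))"
      using assms unfolding cper_def periodic_def by metis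
    then show ?thesis by simp
  qed
  ultimately show ?thesis by (simp add: cper_def periodic_def)
qed

lemma conv_translate:
  assumes "cper K" "cper g"
  shows "(LINT y|torus. K (x - y) * g y) = (LINT y|torus. K (- y) * g (x + y))"
  using torus_translation[OF cper_intros(4)[OF cper_reflect[OF assms(1), of x] assms(2)], of x]
  by (simp add: add.commute)

lemma mol_translate:
  assumes "cper g" shows "mol N g x = (LINT y|torus. kern N y * g (x + y))"
  unfolding mol_def conv_translate[OF sper_cper[OF sper_kern] assms]
  using kern_even[of N 0] by simp

text \<open>Lipschitz continuity of \<open>g\<close> against the first moment of the kernel.\<close>

lemma mol_uniform:
  assumes g: "sper g"
  obtains C where "C \<ge> 0" "\<And>N x. N \<ge> 1 \<Longrightarrow> \<bar>mol N g x - g x\<bar> \<le> C / sqrt (real N)"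
proof -
  have "\<forall>l. \<exists>B>0. \<forall>x. \<bar>partial l g x\<bar> \<le> B"
    using cper_bounded[OF sper_cper[OF sper_partial[OF g]]] by metis
  then obtain B where B: "\<And>l. B l > 0" "\<And>l x. \<bar>partial l g x\<bar> \<le> B l" by metis
  have sg: "smooth g" using g sper_def by blast
  have lip1: "\<bar>g (x + t *\<^sub>R axis l 1) - g x\<bar> \<le> B l * \<bar>t\<bar>" for x t l
    using field_differentiable_bound[OF convex_UNIV has_real_derivative_line[OF sg, of x l], of "B l" t 0] B(2)
    by simp
  have lip: "\<bar>g (x + y) - g x\<bar> \<le> (\<Sum>l\<in>UNIV. B l * sqrt (sinq l y))" for x y
  proof -
    obtain y' where y': "\<And>f::real^3\<Rightarrow>real. \<And>x. periodic f \<Longrightarrow> f (x + y) = f (x + y')"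
      "\<And>l. \<bar>y' $ l\<bar> \<le> sqrt (sinq l y)" using periodic_short_shift[of y] by metis
    have eq: "x + y' = ((x + y'$1 *\<^sub>R axis 1 1) + y'$2 *\<^sub>R axis 2 1) + y'$3 *\<^sub>R axis 3 1"
      by (subst vec3_decomp[of y']) (simp only: add_ac)
    have "\<bar>g (x + y') - g x\<bar> \<le> (\<Sum>l\<in>UNIV. B l * \<bar>y' $ l\<bar>)"
      unfolding sum_3 eq using lip1[of x "y'$1" 1] lip1[of "x + y'$1 *\<^sub>R axis 1 1" "y'$2" 2]
        lip1[of "(x + y'$1 *\<^sub>R axis 1 1) + y'$2 *\<^sub>R axis 2 1" "y'$3" 3] by linarith
    also have "\<dots> \<le> (\<Sum>l\<in>UNIV. B l * sqrt (sinq l y))"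
      using B(1) y'(2) by (intro sum_mono mult_left_mono) (auto intro: less_imp_le)
    finally show ?thesis using y'(1)[of g x] g by (simp add: sper_def)
  qed
  have "\<bar>mol N g x - g x\<bar> \<le> (\<Sum>l\<in>UNIV. B l) / sqrt (real N)" if N: "N \<ge> 1" for N x
  proof -
    have cg: "cper (\<lambda>y. kern N y * (g (x + y) - g x))"
      using sper_cper[OF sper_intros(6)[OF g, of x]]
      by (intro cper_intros sper_cper[OF sper_kern]) (simp add: add.commute)
    have cg': "cper (\<lambda>y. kern N y * g (x + y))"
      using sper_cper[OF sper_intros(6)[OF g, of x]]
      by (intro cper_intros sper_cper[OF sper_kern]) (simp add: add.commute)
    have ck: "integrable torus (\<lambda>y. kern N y * sqrt (sinq l y))" for l
      using sper_cper[OF sper_cosq[of l]] sper_cper[OF sper_kern[of N]]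
      by (intro integrable_torus_continuous continuous_intros) (auto simp: cper_def intro!: continuous_intros)
    have "mol N g x - g x = (LINT y|torus. kern N y * g (x + y)) - (LINT y|torus. kern N y * g x)"
      using sper_cper[OF g] by (simp add: mol_translate kern_mass)
    also have "\<dots> = (LINT y|torus. kern N y * (g (x + y) - g x))"
      by (subst Bochner_Integration.integral_diff[symmetric])
        (auto intro!: cper_integrable cg' sper_cper sper_intros sper_kern simp: right_diff_distrib)
    finally have "\<bar>mol N g x - g x\<bar> \<le> (LINT y|torus. \<bar>kern N y * (g (x + y) - g x)\<bar>)"
      using integral_abs_bound by simp
    also have "\<dots> \<le> (LINT y|torus. (\<Sum>l\<in>UNIV. B l * (kern N y * sqrt (sinq l y))))"
    proof (rule integral_mono)
      show "integrable torus (\<lambda>y. \<bar>kern N y * (g (x + y) - g x)\<bar>)"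
        by (intro cper_integrable cper_intros(5) cg)
      show "integrable torus (\<lambda>y. \<Sum>l\<in>UNIV. B l * (kern N y * sqrt (sinq l y)))"
        by (intro Bochner_Integration.integrable_sum integrable_mult_right ck)
      show "\<bar>kern N y * (g (x + y) - g x)\<bar> \<le> (\<Sum>l\<in>UNIV. B l * (kern N y * sqrt (sinq l y)))" for y
        using mult_left_mono[OF lip[of x y] kern_nonneg[of N y]] kern_nonneg[of N y]
        by (simp only: abs_mult abs_of_nonneg sum_distrib_left) (simp only: mult_ac)
    qed
    also have "\<dots> = (\<Sum>l\<in>UNIV. B l * (LINT y|torus. kern N y * sqrt (sinq l y)))"
      using ck by (simp only: Bochner_Integration.integral_sum integrable_mult_right Bochner_Integration.integral_mult_right_zero)
    also have "\<dots> \<le> (\<Sum>l\<in>UNIV. B l * (1 / sqrt (real N)))"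
      using B(1) by (intro sum_mono mult_left_mono kern_sqrt_sinq N) (auto intro: less_imp_le)
    finally show ?thesis by (simp add: sum_divide_distrib)
  qed
  moreover have "(\<Sum>l\<in>UNIV. B l) \<ge> 0" using B(1) by (intro sum_nonneg) (auto intro: less_imp_le)
  ultimately show thesis using that by blast
qed

section \<open>Uniqueness of Fourier coefficients and of weak derivatives\<close>

text \<open>Boxes form an intersection-stable generator of the Borel sets.\<close>

lemma AE_zero_if_box_integrals_zero:
  fixes g :: "'a::euclidean_space \<Rightarrow> real"
  assumes g: "integrable lebesgue g"
    and zero: "\<And>c d. (LINT x|lebesgue. indicator (box c d) x * g x) = 0"
  shows "AE x in lebesgue. g x = 0"
proof -
  obtain g' where [measurable]: "g' \<in> borel_measurable lborel" and ae: "AE x in lborel. g x = g' x"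
    using completion_ex_borel_measurable_real[OF borel_measurable_integrable[OF g]] by blast
  have aeL: "AE x in lebesgue. g x = g' x" using ae by (rule AE_completion)
  have mL: "g' \<in> borel_measurable lebesgue" by (rule measurable_completion) simp
  have "integrable lebesgue g'"
    using g integrable_cong_AE[OF borel_measurable_integrable[OF g] mL aeL] by simp
  then have g': "integrable lborel g'" by (simp add: integrable_completion)
  have eq: "(LINT x:A|lborel. g' x) = (LINT x|lebesgue. indicator A x * g x)" if [measurable]: "A \<in> sets borel" for A
  proof -
    have A': "A \<in> sets lebesgue" by simp
    have "(LINT x:A|lborel. g' x) = (LINT x|lebesgue. indicator A x * g' x)"
      unfolding set_lebesgue_integral_def by (subst integral_completion) auto
    also have "\<dots> = (LINT x|lebesgue. indicator A x * g x)"
      using aeL by (intro integral_cong_AE borel_measurable_times borel_measurable_indicator[OF A'] mL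
          borel_measurable_integrable[OF g]) auto
    finally show ?thesis .
  qed
  have si: "set_integrable lborel A g'" if "A \<in> sets borel" for A
    using g' that unfolding set_integrable_def by (intro integrable_mult_indicator) auto
  have box0: "(LINT x:box c d|lborel. g' x) = 0" for c d by (subst eq) (auto simp: zero)
  have univ0: "(LINT x|lborel. g' x) = 0"
  proof -
    let ?B = "\<lambda>n::nat. box (- (real n *\<^sub>R One)) (real n *\<^sub>R One) :: 'a set"
    have "(\<lambda>n. LINT x:?B n|lborel. g' x) \<longlonglongrightarrow> (LINT x|lborel. g' x)"
      unfolding set_lebesgue_integral_def
    proof (rule integral_dominated_convergence[where w = "\<lambda>x. \<bar>g' x\<bar>"])
      show "AE x in lborel. (\<lambda>n. indicat_real (?B n) x *\<^sub>R g' x) \<longlonglongrightarrow> g' x"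
      proof (rule AE_I2)
        fix x
        obtain m :: nat where m: "x \<in> ?B m" using UN_box_eq_UNIV by blast
        have "x \<in> ?B n" if "n \<ge> m" for n
        proof -
          have "real m \<le> real n" using that by simp
          then show ?thesis using m unfolding mem_box by (force simp: inner_Basis)
        qed
        then have "eventually (\<lambda>n. indicat_real (?B n) x *\<^sub>R g' x = g' x) sequentially"
          using eventually_sequentiallyI[of m] by simp
        then show "(\<lambda>n. indicat_real (?B n) x *\<^sub>R g' x) \<longlonglongrightarrow> g' x"
          by (rule tendsto_eventually)
      qed
      show "integrable lborel (\<lambda>x. \<bar>g' x\<bar>)" using g' by simp
      show "AE x in lborel. norm (indicat_real (?B n) x *\<^sub>R g' x) \<le> \<bar>g' x\<bar>" for n
        by (rule AE_I2) (simp add: indicator_def)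
    qed simp_all
    from LIMSEQ_unique[OF this[unfolded box0] tendsto_const] show ?thesis by simp
  qed
  have borel0: "(LINT x:A|lborel. g' x) = 0" if A: "A \<in> sets lborel" for A
  proof -
    let ?E = "range (\<lambda>(a, b). box a b::'a set)"
    have st: "Int_stable ?E" by (auto simp: Int_stable_def box_Int_box)
    have PE: "?E \<subseteq> Pow UNIV" by simp
    have A': "A \<in> sigma_sets UNIV ?E" using A by (simp add: borel_eq_box)
    from st PE A' have "A \<in> sets borel \<and> (LINT x:A|lborel. g' x) = 0"
    proof (induction A rule: sigma_sets_induct_disjoint)
      case (basic A)
      then obtain c d where "A = box c d" by auto
      then show ?case using box0 by simp
    next
      case empty
      then show ?case by (simp add: set_lebesgue_integral_def)
    next
      case (compl A)
      then have A: "A \<in> sets borel" "UNIV - A \<in> sets borel" and "(LINT x:A|lborel. g' x) = 0"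
        by (simp_all add: Compl_eq_Diff_UNIV[symmetric] borel_comp)
      have "(LINT x:A \<union> (UNIV - A)|lborel. g' x) = (LINT x:A|lborel. g' x) + (LINT x:UNIV - A|lborel. g' x)"
        by (rule set_integral_Un[OF _ si[OF A(1)] si[OF A(2)]]) simp
      moreover have "(LINT x:A \<union> (UNIV - A)|lborel. g' x) = 0"
        using univ0 by (simp add: set_lebesgue_integral_def)
      ultimately show ?case using \<open>(LINT x:A|lborel. g' x) = 0\<close> A by simp
    next
      case (union A)
      have A: "A i \<in> sets borel" and z: "(LINT x:A i|lborel. g' x) = 0" for i using union.IH by auto
      have U: "(\<Union>i. A i) \<in> sets borel" using A by blast
      have "(LINT x:(\<Union>i. A i)|lborel. g' x) = (\<Sum>i. LINT x:A i|lborel. g' x)"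
      proof (rule lebesgue_integral_countable_add)
        show "A i \<in> sets lborel" for i using A by simp
        show "A i \<inter> A j = {}" if "i \<noteq> j" for i j
          using union.hyps that by (auto simp: disjoint_family_on_def)
        show "set_integrable lborel (\<Union>i. A i) g'" by (rule si[OF U])
      qed
      then show ?case using U z by simp
    qed
    then show ?thesis by simp
  qed
  have "AE x in lborel. g' x = 0"
    using density_unique_real[OF g', of "\<lambda>_. 0"] borel0 by (simp add: set_lebesgue_integral_def)
  then have "AE x in lborel. g x = 0" using ae by auto
  then show ?thesis by (rule AE_completion)
qed

lemma kern_sinq_conv: "(LINT y|torus. kern N (x - y) * sinq l (x - y)) \<le> 1 / (2 * real N + 1)"
proof -
  have c: "cper (\<lambda>z. kern N z * sinq l z)" by (intro sper_cper sper_intros sper_kern sper_cosq)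
  have "(LINT y|torus. kern N (x - y) * sinq l (x - y)) = (LINT y|torus. kern N (- y) * sinq l (- y))"
    using conv_translate[OF c cper_intros(1)[of 1], of x] by simp
  also have "\<dots> = (LINT y|torus. sinq l y * kern N y)"
    using kern_even[of N 0] by (simp add: cosq_eq mult.commute)
  finally show ?thesis using kern_sinq[of l N] by simp
qed

lemma abs_sin_ge:
  assumes "0 \<le> \<delta>" "\<delta> \<le> \<bar>t\<bar>" "\<bar>t\<bar> \<le> 1 - \<delta>" shows "\<delta>\<^sup>2 \<le> (sin (pi * t))\<^sup>2"
proof -
  have "\<delta> \<le> \<bar>sin (pi * t)\<bar>"
  proof -
    have *: "\<delta> \<le> sin (pi * \<bar>t\<bar>)"
    proof (cases "\<bar>t\<bar> \<le> 1/2")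
      case True then show ?thesis using sin_ge_half[of "\<bar>t\<bar>"] assms by simp
    next
      case False
      have "sin (pi * (1 - \<bar>t\<bar>)) = sin (pi * \<bar>t\<bar>)" by (simp add: right_diff_distrib)
      then show ?thesis using sin_ge_half[of "1 - \<bar>t\<bar>"] assms False by simp
    qed
    then show ?thesis by (cases "t \<ge> 0") (auto simp: abs_if)
  qed
  then show ?thesis using assms(1) abs_le_square_iff by force
qed

lemma integrable_torus_box: "integrable torus (indicat_real (box c d))"
proof (rule torus.integrable_const_bound[where B = 1])
  have "indicat_real (box c d) \<in> borel_measurable lebesgue"
    by (intro borel_measurable_indicator) simp
  then show "indicat_real (box c d) \<in> borel_measurable torus" by (rule measurable_restrict_space1)
qed (simp add: indicator_def)

text \<open>Away from the boundary of the box, the indicator at \<open>y\<close> differs from its value at \<open>x\<close> only if some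
  coordinate of \<open>x - y\<close> stays away from \<open>0\<close>, and from \<open>\<plusminus>1\<close> because \<open>x\<close> is interior to the cube. There
  the function \<open>sinq\<close>, whose average against the kernel tends to zero, is bounded below.\<close>

lemma mol_box_tendsto:
  fixes c d x :: "real^3"
  assumes x: "x \<in> box 0 1" "x \<in> box c d \<or> x \<notin> cbox c d"
  shows "(\<lambda>N. mol N (indicator (box c d)) x) \<longlonglongrightarrow> indicator (box c d) x"
proof -
  let ?\<chi> = "indicat_real (box c d)"
  have "\<exists>e>0. ball x e \<subseteq> box c d \<or> ball x e \<subseteq> - cbox c d"
    using x(2)
  proof
    assume "x \<in> box c d"
    then show ?thesis using open_contains_ball[of "box c d"] open_box by blast
  next
    assume "x \<notin> cbox c d"
    then have "x \<in> - cbox c d" "open (- cbox c d)" by auto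
    then show ?thesis unfolding open_contains_ball by blast
  qed
  then obtain e where e: "e > 0" "ball x e \<subseteq> box c d \<or> ball x e \<subseteq> - cbox c d" by blast
  define m where "m = Min ((\<lambda>l. min (x $ l) (1 - x $ l)) ` UNIV)"
  have m: "m > 0" "\<And>l. m \<le> x $ l" "\<And>l. x $ l \<le> 1 - m"
  proof -
    show "m > 0" unfolding m_def using x(1) by (subst Min_gr_iff) (auto simp: mem_box_cart)
    have "m \<le> min (x $ l) (1 - x $ l)" for l unfolding m_def by (rule Min_le) auto
    then show "\<And>l. m \<le> x $ l" "\<And>l. x $ l \<le> 1 - m" by (simp_all add: algebra_simps)
  qed
  define \<delta> where "\<delta> = min m (e / 4)"
  have \<delta>: "\<delta> > 0" "\<delta> \<le> m" "\<delta> < e / 3" using m(1) e(1) by (auto simp: \<delta>_def)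
  have key: "\<bar>?\<chi> y - ?\<chi> x\<bar> \<le> (1 / \<delta>\<^sup>2) * (\<Sum>l\<in>UNIV. sinq l (x - y))" if y: "y \<in> cbox 0 1" for y
  proof (cases "?\<chi> y = ?\<chi> x")
    case True
    have "(\<Sum>l\<in>UNIV. sinq l (x - y)) \<ge> 0" by (intro sum_nonneg cosq_bounds(3))
    then show ?thesis using True by simp
  next
    case False
    have "box c d \<subseteq> cbox c d" by (rule box_subset_cbox)
    then have "y \<in> box c d \<longleftrightarrow> x \<in> box c d" if "y \<in> ball x e"
      using e(2) centre_in_ball[of x e] e(1) that by blast
    then have "y \<notin> ball x e" using False by (auto simp: indicator_def)
    then have "e \<le> norm (x - y)" by (simp add: dist_norm)
    also have "\<dots> \<le> (\<Sum>l\<in>UNIV. \<bar>(x - y) $ l\<bar>)" by (rule norm_le_l1_cart)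
    finally have sum: "e \<le> \<bar>(x - y) $ 1\<bar> + \<bar>(x - y) $ 2\<bar> + \<bar>(x - y) $ 3\<bar>" unfolding sum_3 .
    have "\<exists>l. \<delta> \<le> \<bar>(x - y) $ l\<bar>"
    proof (rule ccontr)
      assume "\<nexists>l. \<delta> \<le> \<bar>(x - y) $ l\<bar>"
      then have "\<bar>(x - y) $ l\<bar> < \<delta>" for l by (simp add: not_le)
      from this[of 1] this[of 2] this[of 3] sum \<delta>(3) show False by linarith
    qed
    then obtain l where l: "\<delta> \<le> \<bar>(x - y) $ l\<bar>" by blast
    have "\<bar>(x - y) $ l\<bar> \<le> 1 - \<delta>"
    proof -
      have "0 \<le> y $ l" "y $ l \<le> 1" using y by (auto simp: mem_box_cart)
      then show ?thesis using m(2)[of l] m(3)[of l] \<delta>(2) by (simp add: abs_le_iff)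
    qed
    then have "\<delta>\<^sup>2 \<le> sinq l (x - y)" unfolding sinq_eq using l \<delta>(1) by (intro abs_sin_ge) auto
    also have "\<dots> \<le> (\<Sum>l\<in>UNIV. sinq l (x - y))" by (rule member_le_sum) (auto simp: cosq_bounds)
    finally have "1 \<le> (1 / \<delta>\<^sup>2) * (\<Sum>l\<in>UNIV. sinq l (x - y))" using \<delta>(1) by (simp add: field_simps)
    moreover have "\<bar>?\<chi> y - ?\<chi> x\<bar> \<le> 1" by (auto simp: indicator_def)
    ultimately show ?thesis by linarith
  qed
  have im: "integrable torus ?\<chi>"
    by (rule integrable_torus_box)
  have bd: "\<bar>mol N ?\<chi> x - ?\<chi> x\<bar> \<le> (1 / \<delta>\<^sup>2) * (3 / (2 * real N + 1))" for N
  proof -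
    have i1: "integrable torus (\<lambda>y. kern N (x - y) * ?\<chi> y)" by (rule integrable_cper_mult[OF cper_kern_reflect im])
    have i2: "integrable torus (\<lambda>y. kern N (x - y) * sinq l (x - y))" for l
      by (intro cper_integrable cper_intros cper_kern_reflect cper_reflect[of "cosq l"] sper_cper[OF sper_cosq])
    have mass: "(LINT y|torus. kern N (x - y)) = 1"
      using conv_translate[OF sper_cper[OF sper_kern] cper_intros(1)[of 1], of N x] kern_even[of N 0] by (simp add: kern_mass)
    have "mol N ?\<chi> x - ?\<chi> x = (LINT y|torus. kern N (x - y) * ?\<chi> y) - (LINT y|torus. kern N (x - y) * ?\<chi> x)"
      using mass by (simp add: mol_def)
    also have "\<dots> = (LINT y|torus. kern N (x - y) * (?\<chi> y - ?\<chi> x))"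
      using i1 cper_integrable[OF cper_kern_reflect, of N x] by (simp add: right_diff_distrib)
    finally have "\<bar>mol N ?\<chi> x - ?\<chi> x\<bar> \<le> (LINT y|torus. \<bar>kern N (x - y) * (?\<chi> y - ?\<chi> x)\<bar>)"
      using integral_abs_bound by simp
    also have "\<dots> \<le> (LINT y|torus. (1 / \<delta>\<^sup>2) * (\<Sum>l\<in>UNIV. kern N (x - y) * sinq l (x - y)))"
    proof (rule integral_mono)
      show "integrable torus (\<lambda>y. \<bar>kern N (x - y) * (?\<chi> y - ?\<chi> x)\<bar>)"
        using i1 cper_integrable[OF cper_kern_reflect, of N x]
        by (intro integrable_abs) (simp add: right_diff_distrib)
      show "integrable torus (\<lambda>y. (1 / \<delta>\<^sup>2) * (\<Sum>l\<in>UNIV. kern N (x - y) * sinq l (x - y)))"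
        by (intro integrable_mult_right Bochner_Integration.integrable_sum i2)
      fix y assume "y \<in> space torus"
      then have y: "y \<in> cbox 0 1" by simp
      show "\<bar>kern N (x - y) * (?\<chi> y - ?\<chi> x)\<bar> \<le> (1 / \<delta>\<^sup>2) * (\<Sum>l\<in>UNIV. kern N (x - y) * sinq l (x - y))"
        using mult_left_mono[OF key[OF y] kern_nonneg[of N "x - y"]] kern_nonneg[of N "x - y"]
        unfolding abs_mult sum_distrib_left[symmetric] by (simp only: abs_of_nonneg mult_ac)
    qed
    also have "\<dots> = (1 / \<delta>\<^sup>2) * (\<Sum>l\<in>UNIV. (LINT y|torus. kern N (x - y) * sinq l (x - y)))"
      using i2 by (simp only: Bochner_Integration.integral_mult_right_zero Bochner_Integration.integral_sum)
    also have "\<dots> \<le> (1 / \<delta>\<^sup>2) * (\<Sum>l\<in>(UNIV::3 set). 1 / (2 * real N + 1))"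
      by (intro mult_left_mono sum_mono kern_sinq_conv) auto
    finally show ?thesis by simp
  qed
  have "(1 / \<delta>\<^sup>2) * (3 / (2 * real N + 1)) \<le> (3 / \<delta>\<^sup>2) * inverse (real (Suc N))" for N
    using \<delta>(1) by (simp add: divide_simps)
  from order_trans[OF bd this]
  have bd: "\<bar>mol N ?\<chi> x - ?\<chi> x\<bar> \<le> (3 / \<delta>\<^sup>2) * inverse (real (Suc N))" for N .
  have "(\<lambda>N. (3 / \<delta>\<^sup>2) * inverse (real (Suc N))) \<longlonglongrightarrow> 0"
    by (rule tendsto_mult_right_zero[OF LIMSEQ_inverse_real_of_nat])
  then have "(\<lambda>N. mol N ?\<chi> x - ?\<chi> x) \<longlonglongrightarrow> 0"
    by (rule Lim_null_comparison[rotated]) (rule always_eventually, simp only: real_norm_def bd simp_thms)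
  then show ?thesis by (rule LIM_zero_cancel)
qed

lemma null_sets_frontier_box: "cbox c d - box c d \<in> null_sets (lebesgue :: (real^3) measure)"
  using negligible_frontier_interval[of c d] by (simp add: negligible_iff_null_sets)

text \<open>The mollified indicator of a box is a trigonometric polynomial with values in \<open>[0, 1]\<close>, hence orthogonal
  to \<open>f\<close>; dominated convergence yields orthogonality to the indicator itself.\<close>

theorem fourier_unique:
  assumes f: "integrable torus f" and zero: "\<And>k \<tau>. (LINT x|torus. wave k \<tau> x * f x) = 0"
  shows "AE x in torus. f x = 0"
proof -
  let ?g = "\<lambda>x. indicat_real (cbox 0 1) x *\<^sub>R f x"
  have g: "integrable lebesgue ?g"
    using f by (simp add: integrable_restrict_space)
  have box0: "(LINT x|torus. indicat_real (box c d) x * f x) = 0" for c d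
  proof -
    let ?\<chi> = "indicat_real (box c d)"
    have im: "integrable torus ?\<chi>"
      by (rule integrable_torus_box)
    have z: "(LINT x|torus. mol N ?\<chi> x * f x) = 0" for N
    proof -
      obtain C k \<tau> and M :: nat where
        "\<And>x y. kern N (x - y) = (\<Sum>m<M. C m * (wave (k m) (\<tau> m) x * wave (k m) (\<tau> m) y))"
        and m: "\<And>f x. integrable torus f \<Longrightarrow>
          mol N f x = (\<Sum>m<M. C m * (LINT y|torus. wave (k m) (\<tau> m) y * f y) * wave (k m) (\<tau> m) x)"
        by (rule mol_expansion[of N]; rule that; assumption)
      have "(LINT x|torus. mol N ?\<chi> x * f x)
         = (LINT x|torus. (\<Sum>m<M. (C m * (LINT y|torus. wave (k m) (\<tau> m) y * ?\<chi> y)) * (wave (k m) (\<tau> m) x * f x)))"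
        unfolding m[OF im] by (simp only: sum_distrib_right mult.assoc)
      also have "\<dots> = 0"
        using integrable_cper_mult[OF sper_cper[OF sper_intros(2)] f]
        by (simp only: Bochner_Integration.integral_sum integrable_mult_right
            Bochner_Integration.integral_mult_right_zero zero mult_zero_right sum.neutral_const)
      finally show ?thesis .
    qed
    have "(\<lambda>N. LINT x|torus. mol N ?\<chi> x * f x) \<longlonglongrightarrow> (LINT x|torus. ?\<chi> x * f x)"
    proof (rule integral_dominated_convergence[where w = "\<lambda>x. \<bar>f x\<bar>"])
      show "(\<lambda>x. ?\<chi> x * f x) \<in> borel_measurable torus"
        using f im by (intro borel_measurable_times borel_measurable_integrable)
      show "(\<lambda>x. mol N ?\<chi> x * f x) \<in> borel_measurable torus" for N
        using f cper_integrable[OF sper_cper[OF sper_mol[OF im]]] by (intro borel_measurable_times borel_measurable_integrable)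
      show "integrable torus (\<lambda>x. \<bar>f x\<bar>)" using f by simp
      have n: "cbox c d - box c d \<in> null_sets lebesgue" "cbox 0 1 - box 0 (1::real^3) \<in> null_sets lebesgue"
        by (rule null_sets_frontier_box)+
      have "AE x in lebesgue. x \<in> cbox 0 1 \<longrightarrow> (\<lambda>N. mol N ?\<chi> x * f x) \<longlonglongrightarrow> ?\<chi> x * f x"
        using AE_not_in[OF n(1)] AE_not_in[OF n(2)]
        by eventually_elim (auto intro!: tendsto_mult mol_box_tendsto)
      then show "AE x in torus. (\<lambda>N. mol N ?\<chi> x * f x) \<longlonglongrightarrow> ?\<chi> x * f x"
        by (simp add: AE_restrict_space_iff)
      show "AE x in torus. norm (mol N ?\<chi> x * f x) \<le> \<bar>f x\<bar>" for N
      proof (rule AE_I2)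
        fix x
        have i1: "integrable torus (\<lambda>y. kern N (x - y) * ?\<chi> y)" by (rule integrable_cper_mult[OF cper_kern_reflect im])
        have mass: "(LINT y|torus. kern N (x - y)) = 1"
          using conv_translate[OF sper_cper[OF sper_kern] cper_intros(1)[of 1], of N x] kern_even[of N 0] by (simp add: kern_mass)
        have "0 \<le> mol N ?\<chi> x" unfolding mol_def
          by (rule integral_nonneg_AE) (auto simp: kern_nonneg)
        moreover have "mol N ?\<chi> x \<le> (LINT y|torus. kern N (x - y))" unfolding mol_def
          by (rule integral_mono[OF i1 cper_integrable[OF cper_kern_reflect]]) (auto simp: kern_nonneg indicator_def)
        ultimately show "norm (mol N ?\<chi> x * f x) \<le> \<bar>f x\<bar>"
          using mass by (auto simp: abs_mult intro: mult_left_le_one_le)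
      qed
    qed
    from LIMSEQ_unique[OF this[unfolded z] tendsto_const] show ?thesis by simp
  qed
  have "AE x in lebesgue. ?g x = 0"
  proof (rule AE_zero_if_box_integrals_zero[OF g])
    fix c d :: "real^3"
    have "(LINT x|lebesgue. indicator (box c d) x * ?g x) = (LINT x|lebesgue. indicator (cbox 0 1) x *\<^sub>R (indicat_real (box c d) x * f x))"
      by (simp add: mult_ac)
    also have "\<dots> = 0" using box0[of c d] by (simp add: integral_restrict_space)
    finally show "(LINT x|lebesgue. indicator (box c d) x * ?g x) = 0" .
  qed
  then have "AE x in lebesgue. x \<in> cbox 0 1 \<longrightarrow> f x = 0"
    by eventually_elim (auto simp: indicator_def)
  then show ?thesis by (simp add: AE_restrict_space_iff)
qed

text \<open>Only the values on the unit cube enter, so neither function has to be periodic. This admits limits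
  in \<open>L\<^sup>3\<close>, which are obtained on the cube only.\<close>

definition wpart :: "3 \<Rightarrow> (real^3 \<Rightarrow> real) \<Rightarrow> (real^3 \<Rightarrow> real) \<Rightarrow> bool" where
  "wpart i f g \<longleftrightarrow> integrable torus f \<and> integrable torus g \<and>
    (\<forall>\<phi>. sper \<phi> \<longrightarrow> (LINT x|torus. partial i \<phi> x * f x) = - (LINT x|torus. \<phi> x * g x))"

lemma wpartD:
  assumes "wpart i f g"
  shows "integrable torus f" "integrable torus g"
    "sper \<phi> \<Longrightarrow> (LINT x|torus. partial i \<phi> x * f x) = - (LINT x|torus. \<phi> x * g x)"
  using assms by (auto simp: wpart_def)

lemma wpart_unique:
  assumes "wpart i f g" "wpart i f g'" shows "AE x in torus. g x = g' x"
proof -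
  have i: "integrable torus g" "integrable torus g'" using assms wpartD by blast+
  have "AE x in torus. g x - g' x = 0"
  proof (rule fourier_unique)
    show "integrable torus (\<lambda>x. g x - g' x)" using i by simp
    show "(LINT x|torus. wave k \<tau> x * (g x - g' x)) = 0" for k \<tau>
      using wpartD(3)[OF assms(1) sper_intros(2)] wpartD(3)[OF assms(2) sper_intros(2)]
        integrable_cper_mult[OF sper_cper[OF sper_intros(2)] i(1)] integrable_cper_mult[OF sper_cper[OF sper_intros(2)] i(2)]
      by (simp add: right_diff_distrib)
  qed
  then show ?thesis by auto
qed

lemma wpart_sper: "sper f \<Longrightarrow> wpart i f (partial i f)"
  unfolding wpart_def using torus_ibp by (auto intro!: cper_integrable sper_cper sper_partial)

lemma partial_mol_wpart:
  assumes w: "wpart i f g" shows "partial i (mol N f) x = mol N g x"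
proof -
  have pk: "partial i (\<lambda>y. kern N (x - y)) y = - partial i (kern N) (x - y)" for y
  proof -
    have "((\<lambda>y. x - y) has_derivative (\<lambda>h. - h)) (at y)" by (auto intro!: derivative_eq_intros)
    moreover have sk: "smooth (kern N)" using sper_kern sper_def by blast
    ultimately have "((\<lambda>y. kern N (x - y)) has_derivative (\<lambda>h. frechet_derivative (kern N) (at (x - y)) (- h))) (at y)"
      using has_derivative_compose smooth_has_derivative by blast
    from partial_eqI[OF this, of i] show ?thesis
      using linear_neg[OF linear_frechet_derivative[OF smooth_differentiable[OF sk]]] by (simp add: partial_def)
  qed
  have "partial i (mol N f) x = (LINT y|torus. partial i (kern N) (x - y) * f y)"
    by (rule partial_mol[OF wpartD(1)[OF w]])
  also have "\<dots> = - (LINT y|torus. partial i (\<lambda>y. kern N (x - y)) y * f y)"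
    unfolding pk by simp
  also have "\<dots> = mol N g x" using wpartD(3)[OF w sper_kern_reflect] by (simp add: mol_def)
  finally show ?thesis .
qed

text \<open>Both sides have the same Fourier coefficients. Equality almost everywhere is enough below, since the
  derivatives only occur under integrals.\<close>

lemma partial_commute:
  assumes f: "sper f" shows "AE x in torus. partial i (partial k f) x = partial k (partial i f) x"
proof -
  let ?d = "\<lambda>x. partial i (partial k f) x - partial k (partial i f) x"
  have sp: "sper (partial i (partial k f))" for i k by (intro sper_partial f)
  have pw: "partial i (wave q \<tau>) = (\<lambda>x. (2 * pi * of_int (q $ i)) * wave q (\<tau> + pi / 2) x)" for i q \<tau>
    using partial_wave by auto
  have w2: "partial k (partial i (wave q \<tau>)) x = partial i (partial k (wave q \<tau>)) x" for q \<tau> x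
    by (simp add: pw partial_cmult[OF smooth_wave] partial_wave)
  have ibp2: "(LINT x|torus. wave q \<tau> x * partial i (partial k f) x) = (LINT x|torus. partial k (partial i (wave q \<tau>)) x * f x)" for i k q \<tau>
    using torus_ibp[OF sper_intros(2) sper_partial[OF f], of q \<tau> i k] torus_ibp[OF sper_partial[OF sper_intros(2)] f, of i q \<tau> k]
    by simp
  have "AE x in torus. ?d x = 0"
  proof (rule fourier_unique)
    show "integrable torus ?d" by (intro cper_integrable cper_intros sper_cper sp)
    show "(LINT x|torus. wave q \<tau> x * ?d x) = 0" for q \<tau>
    proof -
      have "(LINT x|torus. wave q \<tau> x * ?d x) = (LINT x|torus. wave q \<tau> x * partial i (partial k f) x)
          - (LINT x|torus. wave q \<tau> x * partial k (partial i f) x)"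
        unfolding right_diff_distrib
        by (intro Bochner_Integration.integral_diff cper_integrable cper_intros sper_cper sp sper_intros(2))
      then show ?thesis unfolding ibp2 w2 by simp
    qed
  qed
  then show ?thesis by auto
qed

lemma has_weak_partial_component:
  fixes f g :: "real^3 \<Rightarrow> real^3"
  assumes "has_weak_partial i f g" shows "wpart i (\<lambda>x. f x $ j) (\<lambda>x. g x $ j)"
proof -
  have i: "integrable torus f" "integrable torus g"
    using assms by (auto simp: has_weak_partial_def torus_integrable_def)
  have component: "integrable torus (\<lambda>x. h x $ j)" "(LINT x|torus. \<phi> x * h x $ j) = (LINT x|torus. \<phi> x *\<^sub>R h x) $ j"
    if h: "integrable torus h" and \<phi>: "cper \<phi>" for h :: "real^3 \<Rightarrow> real^3" and \<phi>
  proof -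
    show "integrable torus (\<lambda>x. h x $ j)" by (rule integrable_bounded_linear[OF bounded_linear_vec_nth h])
    obtain B where B: "B > 0" "\<And>x. \<bar>\<phi> x\<bar> \<le> B" using cper_bounded[OF \<phi>] by metis
    have "integrable torus (\<lambda>x. \<phi> x *\<^sub>R h x)"
    proof (rule Bochner_Integration.integrable_bound)
      show "integrable torus (\<lambda>x. B *\<^sub>R h x)" using h by simp
      show "(\<lambda>x. \<phi> x *\<^sub>R h x) \<in> borel_measurable torus"
        using cper_integrable[OF \<phi>] h by (intro borel_measurable_scaleR borel_measurable_integrable)
      show "AE x in torus. norm (\<phi> x *\<^sub>R h x) \<le> norm (B *\<^sub>R h x)"
        using B by (auto intro!: mult_right_mono)
    qed
    from integral_bounded_linear[OF bounded_linear_vec_nth this, of j]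
    show "(LINT x|torus. \<phi> x * h x $ j) = (LINT x|torus. \<phi> x *\<^sub>R h x) $ j" by simp
  qed
  show ?thesis
    unfolding wpart_def
  proof (intro conjI allI impI)
    show "integrable torus (\<lambda>x. f x $ j)" "integrable torus (\<lambda>x. g x $ j)"
      using component(1)[OF _ cper_intros(1)] i by blast+
    fix \<phi> assume s: "sper \<phi>"
    then have "(LINT x|torus. partial i \<phi> x *\<^sub>R f x) = - (LINT x|torus. \<phi> x *\<^sub>R g x)"
      using assms by (auto simp: has_weak_partial_def sper_def)
    then show "(LINT x|torus. partial i \<phi> x * f x $ j) = - (LINT x|torus. \<phi> x * g x $ j)"
      using component(2)[OF i(1) sper_cper[OF sper_partial[OF s]]] component(2)[OF i(2) sper_cper[OF s]] by simp
  qed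
qed

section \<open>Functions with cube-integrable gradient\<close>

text \<open>The closure of the smooth periodic functions. Every estimate below is proved for smooth functions
  and passes to the limit, so approximability is the form in which regularity is used; it also
  dispenses with density theorems.\<close>

definition L3_approx :: "(real^3 \<Rightarrow> real) \<Rightarrow> bool" where
  "L3_approx a \<longleftrightarrow> L3 a \<and> (\<exists>F. (\<forall>m. sper (F m)) \<and> (\<lambda>m. N3 (\<lambda>x. F m x - a x)) \<longlonglongrightarrow> 0)"

definition W13 :: "(real^3 \<Rightarrow> real) \<Rightarrow> (3 \<Rightarrow> real^3 \<Rightarrow> real) \<Rightarrow> bool" where
  "W13 v D \<longleftrightarrow> L3 v \<and> (\<forall>i. L3 (D i)) \<and>
    (\<exists>F. (\<forall>m. sper (F m)) \<and> (\<lambda>m. N3 (\<lambda>x. F m x - v x)) \<longlonglongrightarrow> 0 \<and>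
      (\<forall>i. (\<lambda>m. N3 (\<lambda>x. partial i (F m) x - D i x)) \<longlonglongrightarrow> 0))"

lemma sper_L3: "sper f \<Longrightarrow> L3 f"
  by (rule L3_cper[OF sper_cper])

lemma L3_approxE:
  assumes "L3_approx a"
  obtains F where "L3 a" "\<And>m. sper (F m)" "(\<lambda>m. N3 (\<lambda>x. F m x - a x)) \<longlonglongrightarrow> 0"
  using assms unfolding L3_approx_def by blast

lemma W13E:
  assumes "W13 v D"
  obtains F where "L3 v" "\<And>i. L3 (D i)" "\<And>m. sper (F m)" "(\<lambda>m. N3 (\<lambda>x. F m x - v x)) \<longlonglongrightarrow> 0"
    "\<And>i. (\<lambda>m. N3 (\<lambda>x. partial i (F m) x - D i x)) \<longlonglongrightarrow> 0"
  using assms unfolding W13_def by blast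

lemma W13_L3: "W13 v D \<Longrightarrow> L3 v" "W13 v D \<Longrightarrow> L3 (D i)"
  by (auto simp: W13_def)

lemma L3_approx_L3: "L3_approx a \<Longrightarrow> L3 a"
  by (simp add: L3_approx_def)

lemma L3_approx_sper: "sper f \<Longrightarrow> L3_approx f"
  unfolding L3_approx_def using sper_L3 by (auto intro!: exI[of _ "\<lambda>_. f"] simp: N3_const)

lemma W13_approx:
  assumes "W13 v D" shows "L3_approx v" "L3_approx (D i)"
proof -
  obtain F where F: "L3 v" "\<And>i. L3 (D i)" "\<And>m. sper (F m)" "(\<lambda>m. N3 (\<lambda>x. F m x - v x)) \<longlonglongrightarrow> 0"
    "\<And>i. (\<lambda>m. N3 (\<lambda>x. partial i (F m) x - D i x)) \<longlonglongrightarrow> 0"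
    using W13E[OF assms] by blast
  show "L3_approx v" unfolding L3_approx_def using F(1,3,4) by blast
  have "\<forall>m. sper (partial i (F m))" using F(3) sper_partial by blast
  with F(5)[of i] F(2)[of i] show "L3_approx (D i)" unfolding L3_approx_def
    by (intro conjI exI[of _ "\<lambda>m. partial i (F m)"]) auto
qed

lemma N3_tendsto_add:
  assumes "\<And>m. L3 (F m)" "L3 f" "\<And>m. L3 (G m)" "L3 g"
    and "(\<lambda>m. N3 (\<lambda>x. F m x - f x)) \<longlonglongrightarrow> 0" "(\<lambda>m. N3 (\<lambda>x. G m x - g x)) \<longlonglongrightarrow> 0"
  shows "(\<lambda>m. N3 (\<lambda>x. (F m x + G m x) - (f x + g x))) \<longlonglongrightarrow> 0"
proof (rule Lim_null_comparison)
  show "(\<lambda>m. N3 (\<lambda>x. F m x - f x) + N3 (\<lambda>x. G m x - g x)) \<longlonglongrightarrow> 0"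
    using tendsto_add[OF assms(5,6)] by simp
  show "\<forall>\<^sub>F m in sequentially. norm (N3 (\<lambda>x. (F m x + G m x) - (f x + g x))) \<le> N3 (\<lambda>x. F m x - f x) + N3 (\<lambda>x. G m x - g x)"
  proof (rule always_eventually, rule allI)
    fix m
    have "(\<lambda>x. (F m x + G m x) - (f x + g x)) = (\<lambda>x. (F m x - f x) + (G m x - g x))" by auto
    then show "norm (N3 (\<lambda>x. (F m x + G m x) - (f x + g x))) \<le> N3 (\<lambda>x. F m x - f x) + N3 (\<lambda>x. G m x - g x)"
      using minkowski3[OF L3_diff[OF assms(1)[of m] assms(2)] L3_diff[OF assms(3)[of m] assms(4)]] N3_nonneg
      by simp
  qed
qed

lemma W13_add:
  assumes "W13 v D" "W13 w E" shows "W13 (\<lambda>x. v x + w x) (\<lambda>i x. D i x + E i x)"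
proof -
  obtain F where F: "L3 v" "\<And>i. L3 (D i)" "\<And>m. sper (F m)" "(\<lambda>m. N3 (\<lambda>x. F m x - v x)) \<longlonglongrightarrow> 0"
    "\<And>i. (\<lambda>m. N3 (\<lambda>x. partial i (F m) x - D i x)) \<longlonglongrightarrow> 0"
    using W13E[OF assms(1)] by blast
  obtain G where G: "L3 w" "\<And>i. L3 (E i)" "\<And>m. sper (G m)" "(\<lambda>m. N3 (\<lambda>x. G m x - w x)) \<longlonglongrightarrow> 0"
    "\<And>i. (\<lambda>m. N3 (\<lambda>x. partial i (G m) x - E i x)) \<longlonglongrightarrow> 0"
    using W13E[OF assms(2)] by blast
  have p: "partial i (\<lambda>x. F m x + G m x) x = partial i (F m) x + partial i (G m) x" for i m x
    using F(3) G(3) by (intro partial_add) (auto simp: sper_def)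
  show ?thesis unfolding W13_def
  proof (intro conjI allI exI[of _ "\<lambda>m x. F m x + G m x"])
    show "L3 (\<lambda>x. v x + w x)" by (rule L3_add[OF F(1) G(1)])
    show "L3 (\<lambda>x. D i x + E i x)" for i by (rule L3_add[OF F(2) G(2)])
    show "sper (\<lambda>x. F m x + G m x)" for m by (intro sper_intros F G)
    show "(\<lambda>m. N3 (\<lambda>x. F m x + G m x - (v x + w x))) \<longlonglongrightarrow> 0"
      by (rule N3_tendsto_add[OF sper_L3[OF F(3)] F(1) sper_L3[OF G(3)] G(1) F(4) G(4)])
    show "(\<lambda>m. N3 (\<lambda>x. partial i (\<lambda>x. F m x + G m x) x - (D i x + E i x))) \<longlonglongrightarrow> 0" for i
      unfolding p by (rule N3_tendsto_add[OF sper_L3[OF sper_partial[OF F(3)]] F(2)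
            sper_L3[OF sper_partial[OF G(3)]] G(2) F(5) G(5)])
  qed
qed

lemma N3_zero_lim: "(\<lambda>m. N3 (\<lambda>x. f x - f x)) \<longlonglongrightarrow> 0"
  by (simp add: N3_const)

lemma LINT_mult_lim:
  assumes "L3 a" "\<And>m. L3 (C m)" "L3 c" "(\<lambda>m. N3 (\<lambda>x. C m x - c x)) \<longlonglongrightarrow> 0"
  shows "(\<lambda>m. LINT x|torus. a x * C m x) \<longlonglongrightarrow> (LINT x|torus. a x * c x)"
  using LINT_mult3_lim[of "\<lambda>_ _. 1" "\<lambda>_. a" C "\<lambda>_. 1" a c] assms L3_const[of 1] N3_zero_lim[of "\<lambda>_. 1"] N3_zero_lim[of a]
  by simp

lemma W13_wpart:
  assumes "W13 v D" shows "wpart i v (D i)"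
proof -
  obtain F where F: "L3 v" "\<And>i. L3 (D i)" "\<And>m. sper (F m)" "(\<lambda>m. N3 (\<lambda>x. F m x - v x)) \<longlonglongrightarrow> 0"
    "\<And>i. (\<lambda>m. N3 (\<lambda>x. partial i (F m) x - D i x)) \<longlonglongrightarrow> 0"
    using W13E[OF assms] by blast
  show ?thesis unfolding wpart_def
  proof (intro conjI allI impI)
    show "integrable torus v" "integrable torus (D i)" using F L3_integrable by blast+
    fix \<phi> assume \<phi>: "sper \<phi>"
    have "(\<lambda>m. LINT x|torus. partial i \<phi> x * F m x) \<longlonglongrightarrow> (LINT x|torus. partial i \<phi> x * v x)"
      by (rule LINT_mult_lim[OF sper_L3[OF sper_partial[OF \<phi>]] sper_L3[OF F(3)] F(1,4)])
    moreover have "(\<lambda>m. LINT x|torus. \<phi> x * partial i (F m) x) \<longlonglongrightarrow> (LINT x|torus. \<phi> x * D i x)"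
      by (rule LINT_mult_lim[OF sper_L3[OF \<phi>] sper_L3[OF sper_partial[OF F(3)]] F(2,5)])
    then have "(\<lambda>m. LINT x|torus. partial i \<phi> x * F m x) \<longlonglongrightarrow> - (LINT x|torus. \<phi> x * D i x)"
      using torus_ibp[OF \<phi> F(3)] tendsto_minus[of "\<lambda>m. LINT x|torus. \<phi> x * partial i (F m) x"] by simp
    ultimately show "(LINT x|torus. partial i \<phi> x * v x) = - (LINT x|torus. \<phi> x * D i x)"
      by (rule LIMSEQ_unique)
  qed
qed

text \<open>A crude bound for a fixed kernel, used only to pass to the limit in smooth approximations.\<close>

lemma mol_bound:
  obtains B where "B \<ge> 0" "\<And>f x. L3 f \<Longrightarrow> \<bar>mol N f x\<bar> \<le> B * N3 f"
    "\<And>f x i. L3 f \<Longrightarrow> \<bar>partial i (mol N f) x\<bar> \<le> B * N3 f"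
proof -
  have bd: "\<exists>B\<ge>0. \<forall>f x. L3 f \<longrightarrow> \<bar>LINT y|torus. K (x - y) * f y\<bar> \<le> B * N3 f" if K: "cper K" for K
  proof -
    obtain B where B: "B > 0" "\<And>x. \<bar>K x\<bar> \<le> B" using cper_bounded[OF K] by metis
    have "\<bar>LINT y|torus. K (x - y) * f y\<bar> \<le> B * N3 f" if f: "L3 f" for f x
    proof -
      have "N3 (\<lambda>y. K (x - y)) \<le> N3 (\<lambda>_. B)"
        by (rule N3_mono[OF L3_cper[OF cper_reflect[OF K]] L3_const]) (use B in auto)
      then have "N3 (\<lambda>y. K (x - y)) \<le> B" using B(1) by (simp add: N3_const)
      then show ?thesis
        using holder2'[OF L3_cper[OF cper_reflect[OF K]] f, of x]
          mult_right_mono[OF \<open>N3 (\<lambda>y. K (x - y)) \<le> B\<close> N3_nonneg[of f]] by linarith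
    qed
    then show ?thesis using B(1) by (intro exI[of _ B]) auto
  qed
  have "\<forall>i. \<exists>B\<ge>0. \<forall>f x. L3 f \<longrightarrow> \<bar>LINT y|torus. partial i (kern N) (x - y) * f y\<bar> \<le> B * N3 f"
    by (intro allI bd sper_cper sper_partial sper_kern)
  from choice[OF this] obtain B where
    "\<forall>i. B i \<ge> 0 \<and> (\<forall>f x. L3 f \<longrightarrow> \<bar>LINT y|torus. partial i (kern N) (x - y) * f y\<bar> \<le> B i * N3 f)" ..
  then have B: "\<And>i. B i \<ge> 0" "\<And>i f x. L3 f \<Longrightarrow> \<bar>LINT y|torus. partial i (kern N) (x - y) * f y\<bar> \<le> B i * N3 f"
    by auto
  from bd[OF sper_cper[OF sper_kern]] obtain B0 where
    "B0 \<ge> 0 \<and> (\<forall>f x. L3 f \<longrightarrow> \<bar>LINT y|torus. kern N (x - y) * f y\<bar> \<le> B0 * N3 f)" ..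
  then have B0: "B0 \<ge> 0" "\<And>f x. L3 f \<Longrightarrow> \<bar>LINT y|torus. kern N (x - y) * f y\<bar> \<le> B0 * N3 f" by auto
  let ?B = "B0 + (\<Sum>i\<in>UNIV. B i)"
  have Bi: "B i \<le> ?B" for i
    using member_le_sum[of i UNIV B] B(1) B0(1) by simp
  have s: "0 \<le> (\<Sum>i\<in>UNIV. B i)" using B(1) by (intro sum_nonneg)
  show thesis
  proof (rule that[of ?B])
    show "?B \<ge> 0" using s B0(1) by simp
    show "\<bar>mol N f x\<bar> \<le> ?B * N3 f" if "L3 f" for f x
      unfolding mol_def using B0(2)[OF that, of x] mult_right_mono[OF _ N3_nonneg[of f], of B0 ?B] s by simp
    show "\<bar>partial i (mol N f) x\<bar> \<le> ?B * N3 f" if "L3 f" for f x i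
      unfolding partial_mol[OF L3_integrable[OF that]]
      using B(2)[OF that, of i x] mult_right_mono[OF Bi[of i] N3_nonneg[of f]] by linarith
  qed
qed

lemma mol_L3: "L3 f \<Longrightarrow> L3 (mol N f)" "L3 f \<Longrightarrow> L3 (partial i (mol N f))"
  by (auto intro!: sper_L3 sper_mol sper_partial L3_integrable)

lemma partial_mol_diff:
  assumes "integrable torus f" "integrable torus g"
  shows "partial i (mol N (\<lambda>x. f x - g x)) x = partial i (mol N f) x - partial i (mol N g) x"
proof -
  have "mol N (\<lambda>x. f x - g x) = (\<lambda>x. mol N f x - mol N g x)" using mol_diff[OF assms] by auto
  then show ?thesis
    using partial_diff[of "mol N f" "mol N g"] sper_mol[OF assms(1)] sper_mol[OF assms(2)] by (simp add: sper_def)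
qed

lemma mol_lim:
  assumes "\<And>m. L3 (C m)" "L3 c" "(\<lambda>m. N3 (\<lambda>x. C m x - c x)) \<longlonglongrightarrow> 0"
  shows "(\<lambda>m. N3 (\<lambda>x. mol N (C m) x - mol N c x)) \<longlonglongrightarrow> 0"
    "(\<lambda>m. N3 (\<lambda>x. partial i (mol N (C m)) x - partial i (mol N c) x)) \<longlonglongrightarrow> 0"
proof -
  obtain B where B: "B \<ge> 0" "\<And>f x. L3 f \<Longrightarrow> \<bar>mol N f x\<bar> \<le> B * N3 f"
    "\<And>f x i. L3 f \<Longrightarrow> \<bar>partial i (mol N f) x\<bar> \<le> B * N3 f" by (rule mol_bound[of N]; rule that; assumption)
  have d: "L3 (\<lambda>x. C m x - c x)" for m using assms L3_diff by blast
  have bd: "(\<lambda>m. B * N3 (\<lambda>x. C m x - c x)) \<longlonglongrightarrow> 0"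
    using tendsto_mult_left[OF assms(3), of B] by simp
  have *: "(\<lambda>m. N3 (G m)) \<longlonglongrightarrow> 0"
    if "\<And>m. L3 (G m)" "\<And>m x. \<bar>G m x\<bar> \<le> B * N3 (\<lambda>x. C m x - c x)" for G
  proof (rule Lim_null_comparison[OF _ bd], rule always_eventually, rule allI)
    fix m
    have "N3 (G m) \<le> N3 (\<lambda>_. B * N3 (\<lambda>x. C m x - c x))"
      using that by (intro N3_mono L3_const) (auto intro: order_trans[OF _ abs_ge_self])
    then show "norm (N3 (G m)) \<le> B * N3 (\<lambda>x. C m x - c x)"
      using N3_nonneg B(1) by (simp add: N3_const abs_mult)
  qed
  show "(\<lambda>m. N3 (\<lambda>x. mol N (C m) x - mol N c x)) \<longlonglongrightarrow> 0"
  proof (rule *)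
    show "L3 (\<lambda>x. mol N (C m) x - mol N c x)" for m by (intro L3_diff mol_L3 assms)
    show "\<bar>mol N (C m) x - mol N c x\<bar> \<le> B * N3 (\<lambda>x. C m x - c x)" for m x
      using B(2)[OF d, of m x] mol_diff[OF L3_integrable[OF assms(1)] L3_integrable[OF assms(2)], of N m x] by simp
  qed
  show "(\<lambda>m. N3 (\<lambda>x. partial i (mol N (C m)) x - partial i (mol N c) x)) \<longlonglongrightarrow> 0"
  proof (rule *)
    show "L3 (\<lambda>x. partial i (mol N (C m)) x - partial i (mol N c) x)" for m by (intro L3_diff mol_L3 assms)
    show "\<bar>partial i (mol N (C m)) x - partial i (mol N c) x\<bar> \<le> B * N3 (\<lambda>x. C m x - c x)" for m x
      using B(3)[OF d, of i m x]
        partial_mol_diff[OF L3_integrable[OF assms(1)[of m]] L3_integrable[OF assms(2)], of i N x] by simp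
  qed
qed

section \<open>Trilinear forms\<close>

lemma continuous_shift2: "continuous_on UNIV f \<Longrightarrow> continuous_on UNIV (\<lambda>p. f (fst p + snd p))"
  for f :: "real^3 \<Rightarrow> real"
  by (rule continuous_on_compose2[of UNIV f]) (auto intro!: continuous_on_add continuous_on_fst continuous_on_snd continuous_on_id)

lemma continuous_fst2: "continuous_on UNIV f \<Longrightarrow> continuous_on UNIV (\<lambda>p. f (fst p))"
  and continuous_snd2: "continuous_on UNIV f \<Longrightarrow> continuous_on UNIV (\<lambda>p. f (snd p))"
  for f :: "real^3 \<Rightarrow> real"
  by (rule continuous_on_compose2[of UNIV f]; auto intro!: continuous_on_fst continuous_on_snd continuous_on_id)+

text \<open>Mollification averages translates of \<open>c\<close>, and Hoelder's inequality holds for every translate.\<close>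

lemma trilinear_bound_sper:
  assumes s: "sper a" "sper b" "sper c"
  shows "\<bar>LINT x|torus. a x * b x * mol N c x\<bar> \<le> N3 a * N3 b * N3 c"
proof -
  note c = s[THEN sper_cper]
  have cc: "cper (\<lambda>y. c (x + y))" for x using cper_intros(7)[OF c(3), of x] by (simp add: add.commute)
  let ?F = "\<lambda>x y. kern N y * (a x * b x * c (x + y))"
  have cont: "continuous_on UNIV (\<lambda>(x, y). ?F x y)"
    unfolding case_prod_unfold using c sper_cper[OF sper_kern[of N]]
    by (intro continuous_on_mult continuous_shift2 continuous_fst2 continuous_snd2) (auto simp: cper_def)
  have "(LINT x|torus. a x * b x * mol N c x) = (LINT x|torus. LINT y|torus. ?F x y)"
    unfolding mol_translate[OF c(3)] by (simp add: mult_ac flip: Bochner_Integration.integral_mult_right_zero)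
  also have "\<dots> = (LINT y|torus. LINT x|torus. ?F x y)" by (rule torus_Fubini_continuous(2)[OF cont])
  also have "\<dots> = (LINT y|torus. kern N y * (LINT x|torus. a x * b x * c (x + y)))" by simp
  finally have eq: "(LINT x|torus. a x * b x * mol N c x) = (LINT y|torus. kern N y * (LINT x|torus. a x * b x * c (x + y)))" .
  have "continuous_on UNIV (\<lambda>y. LINT x|torus. a x * b x * c (x + y))"
    using c by (intro torus_Fubini_continuous(1)[of "\<lambda>y x. a x * b x * c (x + y)"])
      (simp add: case_prod_unfold add.commute cper_def continuous_on_mult continuous_shift2 continuous_snd2)
  then have i: "integrable torus (\<lambda>y. kern N y * (LINT x|torus. a x * b x * c (x + y)))"
    using sper_cper[OF sper_kern[of N]] by (intro integrable_torus_continuous continuous_on_mult) (auto simp: cper_def)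
  have "\<bar>LINT y|torus. kern N y * (LINT x|torus. a x * b x * c (x + y))\<bar>
     \<le> (LINT y|torus. kern N y * (N3 a * N3 b * N3 c))"
  proof (rule order_trans[OF integral_abs_bound], rule integral_mono)
    show "integrable torus (\<lambda>y. \<bar>kern N y * (LINT x|torus. a x * b x * c (x + y))\<bar>)" using i by simp
    show "integrable torus (\<lambda>y. kern N y * (N3 a * N3 b * N3 c))"
      using cper_integrable[OF sper_cper[OF sper_kern[of N]]] by simp
    fix y
    have "\<bar>LINT x|torus. a x * b x * c (x + y)\<bar> \<le> N3 a * N3 b * N3 (\<lambda>x. c (x + y))"
      using s by (intro holder3' sper_L3 sper_intros)
    then show "\<bar>kern N y * (LINT x|torus. a x * b x * c (x + y))\<bar> \<le> kern N y * (N3 a * N3 b * N3 c)"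
      using kern_nonneg[of N y] by (simp add: abs_mult N3_translation[OF c(3)] mult_left_mono)
  qed
  also have "\<dots> = N3 a * N3 b * N3 c" using kern_mass[of N] by simp
  finally show ?thesis unfolding eq .
qed

lemma trilinear_bound:
  assumes "L3_approx a" "L3_approx b" "L3_approx c"
  shows "\<bar>LINT x|torus. a x * b x * mol N c x\<bar> \<le> N3 a * N3 b * N3 c"
proof -
  obtain A where A: "L3 a" "\<And>m. sper (A m)" "(\<lambda>m. N3 (\<lambda>x. A m x - a x)) \<longlonglongrightarrow> 0"
    using L3_approxE[OF assms(1)] by blast
  obtain B where B: "L3 b" "\<And>m. sper (B m)" "(\<lambda>m. N3 (\<lambda>x. B m x - b x)) \<longlonglongrightarrow> 0"
    using L3_approxE[OF assms(2)] by blast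
  obtain C where C: "L3 c" "\<And>m. sper (C m)" "(\<lambda>m. N3 (\<lambda>x. C m x - c x)) \<longlonglongrightarrow> 0"
    using L3_approxE[OF assms(3)] by blast
  note L = sper_L3[OF A(2)] sper_L3[OF B(2)] sper_L3[OF C(2)]
  have 1: "(\<lambda>m. \<bar>LINT x|torus. A m x * B m x * mol N (C m) x\<bar>) \<longlonglongrightarrow> \<bar>LINT x|torus. a x * b x * mol N c x\<bar>"
    by (intro tendsto_rabs LINT_mult3_lim mol_lim(1)[OF L(3) C(1,3)] mol_L3 L A B C)
  have 2: "(\<lambda>m. N3 (A m) * N3 (B m) * N3 (C m)) \<longlonglongrightarrow> N3 a * N3 b * N3 c"
    by (intro tendsto_mult N3_lim L A B C)
  show ?thesis
    by (rule LIMSEQ_le[OF 1 2]) (auto intro: trilinear_bound_sper A B C)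
qed

lemma tendsto_if_approximable:
  fixes X :: "nat \<Rightarrow> real"
  assumes "\<And>e. e > 0 \<Longrightarrow> \<exists>Y y. (\<forall>n. \<bar>X n - Y n\<bar> \<le> e) \<and> Y \<longlonglongrightarrow> y \<and> \<bar>y - x\<bar> \<le> e"
  shows "X \<longlonglongrightarrow> x"
proof (rule LIMSEQ_I)
  fix r :: real assume "r > 0"
  then obtain Y y where Y: "\<And>n. \<bar>X n - Y n\<bar> \<le> r / 4" "Y \<longlonglongrightarrow> y" "\<bar>y - x\<bar> \<le> r / 4"
    using assms[of "r / 4"] by auto
  obtain n0 where n0: "\<And>n. n \<ge> n0 \<Longrightarrow> \<bar>Y n - y\<bar> < r / 4"
    using LIMSEQ_D[OF Y(2), of "r / 4"] \<open>r > 0\<close> by auto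
  have "norm (X n - x) < r" if "n \<ge> n0" for n
    using Y(1)[of n] Y(3) n0[OF that] \<open>r > 0\<close> unfolding real_norm_def by linarith
  then show "\<exists>no. \<forall>n\<ge>no. norm (X n - x) < r" by blast
qed

lemma mol_tendsto_sper:
  assumes "sper c" shows "(\<lambda>N. N3 (\<lambda>x. mol N c x - c x)) \<longlonglongrightarrow> 0"
proof -
  obtain C where C: "C \<ge> 0" "\<And>N x. N \<ge> 1 \<Longrightarrow> \<bar>mol N c x - c x\<bar> \<le> C / sqrt (real N)"
    using mol_uniform[OF assms] by metis
  have lim: "(\<lambda>N. C / sqrt (real N)) \<longlonglongrightarrow> 0"
    by (intro real_tendsto_divide_at_top[OF tendsto_const] filterlim_compose[OF sqrt_at_top] filterlim_real_sequentially)
  have L: "L3 (\<lambda>x. mol N c x - c x)" for N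
    by (intro L3_diff mol_L3 sper_L3 assms)
  show ?thesis
  proof (rule Lim_null_comparison[OF _ lim], rule eventually_sequentiallyI[of 1])
    fix N :: nat assume N: "1 \<le> N"
    have "N3 (\<lambda>x. mol N c x - c x) \<le> N3 (\<lambda>_. C / sqrt (real N))"
      using C(2)[OF N] C(1) by (intro N3_mono L L3_const) (auto intro: order_trans[OF _ abs_ge_self])
    then show "norm (N3 (\<lambda>x. mol N c x - c x)) \<le> C / sqrt (real N)"
      using C(1) N3_nonneg by (simp add: N3_const)
  qed
qed

text \<open>The uniform bound reduces the claim to smooth \<open>c\<close>, for which mollification converges uniformly.\<close>

theorem trilinear_limit:
  assumes ap: "L3_approx a" "L3_approx b" "L3_approx c"
  shows "(\<lambda>N. LINT x|torus. a x * b x * mol N c x) \<longlonglongrightarrow> (LINT x|torus. a x * b x * c x)"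
proof (rule tendsto_if_approximable)
  fix e :: real assume e: "e > 0"
  obtain C where C: "L3 c" "\<And>m. sper (C m)" "(\<lambda>m. N3 (\<lambda>x. C m x - c x)) \<longlonglongrightarrow> 0"
    using L3_approxE[OF ap(3)] by blast
  have La: "L3 a" and Lb: "L3 b" using ap L3_approx_L3 by blast+
  have "(\<lambda>m. N3 a * N3 b * N3 (\<lambda>x. C m x - c x)) \<longlonglongrightarrow> N3 a * N3 b * 0"
    by (intro tendsto_intros C)
  then obtain m where m: "N3 a * N3 b * N3 (\<lambda>x. C m x - c x) < e"
    using order_tendstoD(2)[of _ 0 sequentially e] e eventually_sequentially by fastforce
  have Cm: "L3 (C m)" "L3 (\<lambda>x. C m x - c x)" using sper_L3[OF C(2)] L3_diff[OF sper_L3[OF C(2)] C(1)] by auto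
  have apd: "L3_approx (\<lambda>x. C m x - c x)"
    unfolding L3_approx_def
  proof (intro conjI Cm exI[of _ "\<lambda>n x. C m x - C n x"] allI)
    show "sper (\<lambda>x. C m x - C n x)" for n by (intro sper_intros C)
    have "N3 (\<lambda>x. (C m x - C n x) - (C m x - c x)) = N3 (\<lambda>x. C n x - c x)" for n
      using N3_diff_commute[of c "C n"] by simp
    then show "(\<lambda>n. N3 (\<lambda>x. (C m x - C n x) - (C m x - c x))) \<longlonglongrightarrow> 0" using C(3) by simp
  qed
  show "\<exists>Y y. (\<forall>N. \<bar>(LINT x|torus. a x * b x * mol N c x) - Y N\<bar> \<le> e) \<and> Y \<longlonglongrightarrow> y \<and> \<bar>y - (LINT x|torus. a x * b x * c x)\<bar> \<le> e"
  proof (intro exI conjI allI)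
    show "(\<lambda>N. LINT x|torus. a x * b x * mol N (C m) x) \<longlonglongrightarrow> (LINT x|torus. a x * b x * C m x)"
      by (rule LINT_mult3_lim[OF La Lb mol_L3(1)[OF Cm(1)] La Lb Cm(1) N3_zero_lim N3_zero_lim mol_tendsto_sper[OF C(2)]])
    have "(LINT x|torus. a x * b x * mol N c x) - (LINT x|torus. a x * b x * mol N (C m) x)
        = - (LINT x|torus. a x * b x * mol N (\<lambda>x. C m x - c x) x)" for N
    proof -
      have "integrable torus (\<lambda>x. a x * b x * mol N c x)" "integrable torus (\<lambda>x. a x * b x * mol N (C m) x)"
        by (intro L3_mult3_integrable La Lb mol_L3 C Cm)+
      then show ?thesis by (simp add: mol_diff[OF L3_integrable[OF Cm(1)] L3_integrable[OF C(1)]] right_diff_distrib)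
    qed
    then show "\<bar>(LINT x|torus. a x * b x * mol N c x) - (LINT x|torus. a x * b x * mol N (C m) x)\<bar> \<le> e" for N
      using trilinear_bound[OF ap(1,2) apd, of N] m by simp
    have "(LINT x|torus. a x * b x * C m x) - (LINT x|torus. a x * b x * c x) = (LINT x|torus. a x * b x * (C m x - c x))"
      using L3_mult3_integrable[OF La Lb Cm(1)] L3_mult3_integrable[OF La Lb C(1)] by (simp add: right_diff_distrib)
    then show "\<bar>(LINT x|torus. a x * b x * C m x) - (LINT x|torus. a x * b x * c x)\<bar> \<le> e"
      using holder3'[OF La Lb Cm(2)] m by simp
  qed
qed

section \<open>The commutator estimate\<close>

text \<open>The shift is divided into \<open>n\<close> equal steps. The Taylor remainders add up to \<open>O(1/n)\<close>, and translations
  preserve the norm.\<close>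

lemma translation_axis_bound:
  assumes f: "sper f"
  shows "N3 (\<lambda>x. f (x + h *\<^sub>R axis i 1) - f x) \<le> \<bar>h\<bar> * N3 (partial i f)"
proof -
  obtain C where C: "C \<ge> 0" "\<And>x h. \<bar>f (x + h *\<^sub>R axis i 1) - f x - h * partial i f x\<bar> \<le> C * h\<^sup>2"
    using sper_Taylor[OF f] by metis
  have L: "L3 (\<lambda>x. f (x + z))" "L3 (partial i f)" "L3 f" for z
    using f by (auto intro!: sper_L3 sper_intros sper_partial)
  have small: "N3 (\<lambda>x. f (x + h *\<^sub>R axis i 1) - f x) \<le> \<bar>h\<bar> * N3 (partial i f) + C * h\<^sup>2" for h
  proof -
    have "N3 (\<lambda>x. f (x + h *\<^sub>R axis i 1) - f x)
        \<le> N3 (\<lambda>x. h * partial i f x) + N3 (\<lambda>x. (f (x + h *\<^sub>R axis i 1) - f x) - h * partial i f x)"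
      by (intro N3_triangle_le L3_diff L L3_cmult)
    also have "N3 (\<lambda>x. (f (x + h *\<^sub>R axis i 1) - f x) - h * partial i f x) \<le> N3 (\<lambda>_. C * h\<^sup>2)"
      using C by (intro N3_mono L3_diff L L3_cmult L3_const) (auto intro: order_trans[OF _ abs_ge_self])
    finally show ?thesis using C(1) by (simp add: N3_cmult N3_const)
  qed
  have multi: "N3 (\<lambda>x. f (x + (real n * h) *\<^sub>R axis i 1) - f x) \<le> real n * N3 (\<lambda>x. f (x + h *\<^sub>R axis i 1) - f x)" for n h
  proof (induction n)
    case (Suc n)
    have "N3 (\<lambda>x. f (x + (real (Suc n) * h) *\<^sub>R axis i 1) - f x)
      = N3 (\<lambda>x. (f ((x + (real n * h) *\<^sub>R axis i 1) + h *\<^sub>R axis i 1) - f (x + (real n * h) *\<^sub>R axis i 1))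
          + (f (x + (real n * h) *\<^sub>R axis i 1) - f x))"
      by (simp add: scaleR_left_distrib distrib_right add_ac)
    also have "\<dots> \<le> N3 (\<lambda>x. f ((x + (real n * h) *\<^sub>R axis i 1) + h *\<^sub>R axis i 1) - f (x + (real n * h) *\<^sub>R axis i 1))
          + N3 (\<lambda>x. f (x + (real n * h) *\<^sub>R axis i 1) - f x)"
      by (intro minkowski3 L3_diff L) (simp add: add.assoc L)
    also have "N3 (\<lambda>x. f ((x + (real n * h) *\<^sub>R axis i 1) + h *\<^sub>R axis i 1) - f (x + (real n * h) *\<^sub>R axis i 1))
        = N3 (\<lambda>x. f (x + h *\<^sub>R axis i 1) - f x)"
      using f by (intro N3_translation[of "\<lambda>x. f (x + h *\<^sub>R axis i 1) - f x"]) (intro sper_cper sper_intros)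
    finally show ?case using Suc by (simp add: distrib_right)
  qed (simp add: N3_const)
  have "N3 (\<lambda>x. f (x + h *\<^sub>R axis i 1) - f x) \<le> \<bar>h\<bar> * N3 (partial i f) + C * h\<^sup>2 * inverse (real (Suc n))" for n
  proof -
    have "N3 (\<lambda>x. f (x + h *\<^sub>R axis i 1) - f x) \<le> real (Suc n) * N3 (\<lambda>x. f (x + (h / real (Suc n)) *\<^sub>R axis i 1) - f x)"
      using multi[of "Suc n" "h / real (Suc n)"] by simp
    also have "\<dots> \<le> real (Suc n) * (\<bar>h / real (Suc n)\<bar> * N3 (partial i f) + C * (h / real (Suc n))\<^sup>2)"
      by (intro mult_left_mono small) simp
    also have "\<dots> = \<bar>h\<bar> * N3 (partial i f) + C * h\<^sup>2 * inverse (real (Suc n))"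
      by (simp add: abs_divide distrib_left power2_eq_square divide_simps del: of_nat_Suc)
        (simp add: mult_ac distrib_left del: of_nat_Suc)
    finally show ?thesis .
  qed
  moreover have "(\<lambda>n. \<bar>h\<bar> * N3 (partial i f) + C * h\<^sup>2 * inverse (real (Suc n))) \<longlonglongrightarrow> \<bar>h\<bar> * N3 (partial i f) + C * h\<^sup>2 * 0"
    by (intro tendsto_intros LIMSEQ_inverse_real_of_nat)
  ultimately show ?thesis using LIMSEQ_le_const[of _ "\<bar>h\<bar> * N3 (partial i f) + C * h\<^sup>2 * 0"] by auto
qed

lemma translation_bound:
  assumes f: "sper f"
  shows "N3 (\<lambda>x. f (x + y) - f x) \<le> (\<Sum>l\<in>UNIV. sqrt (sinq l y) * N3 (partial l f))"
proof -
  obtain y' where y': "\<And>f::real^3\<Rightarrow>real. \<And>x. periodic f \<Longrightarrow> f (x + y) = f (x + y')"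
    "\<And>l. \<bar>y' $ l\<bar> \<le> sqrt (sinq l y)" using periodic_short_shift[of y] by metis
  let ?e = "\<lambda>l. y' $ l *\<^sub>R axis l (1::real)"
  have L: "L3 (\<lambda>x. f (x + z))" "L3 (\<lambda>x. f (x + z + w))" "L3 f" for z w
    using f by (auto intro!: sper_L3 sper_intros simp: add.assoc)
  have eq: "x + y' = ((x + ?e 1) + ?e 2) + ?e 3" for x
    by (subst vec3_decomp[of y']) (simp only: add_ac)
  have "N3 (\<lambda>x. f (x + y) - f x)
    = N3 (\<lambda>x. (f ((x + ?e 1 + ?e 2) + ?e 3) - f (x + ?e 1 + ?e 2)) + ((f ((x + ?e 1) + ?e 2) - f (x + ?e 1)) + (f (x + ?e 1) - f x)))"
    using y'(1)[of f] f by (simp add: sper_def eq)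
  also have "\<dots> \<le> N3 (\<lambda>x. f ((x + ?e 1 + ?e 2) + ?e 3) - f (x + ?e 1 + ?e 2))
      + (N3 (\<lambda>x. f ((x + ?e 1) + ?e 2) - f (x + ?e 1)) + N3 (\<lambda>x. f (x + ?e 1) - f x))"
    by (rule order_trans[OF minkowski3 add_left_mono[OF minkowski3]])
      (use L(1)[of "?e 1 + ?e 2 + ?e 3"] in \<open>auto intro!: L3_diff L3_add L simp: add.assoc\<close>)
  also have "N3 (\<lambda>x. f ((x + ?e 1 + ?e 2) + ?e 3) - f (x + ?e 1 + ?e 2)) = N3 (\<lambda>x. f (x + ?e 3) - f x)"
    using N3_translation[of "\<lambda>x. f (x + ?e 3) - f x" "?e 1 + ?e 2"] sper_cper[OF sper_intros(4)[OF sper_intros(6)[OF f] f]]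
    by (simp add: add.assoc)
  also have "N3 (\<lambda>x. f ((x + ?e 1) + ?e 2) - f (x + ?e 1)) = N3 (\<lambda>x. f (x + ?e 2) - f x)"
    using N3_translation[of "\<lambda>x. f (x + ?e 2) - f x" "?e 1"] sper_cper[OF sper_intros(4)[OF sper_intros(6)[OF f] f]]
    by simp
  also have "N3 (\<lambda>x. f (x + ?e 3) - f x) + (N3 (\<lambda>x. f (x + ?e 2) - f x) + N3 (\<lambda>x. f (x + ?e 1) - f x))
     = (\<Sum>l\<in>UNIV. N3 (\<lambda>x. f (x + ?e l) - f x))" by (simp add: sum_3)
  also have "\<dots> \<le> (\<Sum>l\<in>UNIV. sqrt (sinq l y) * N3 (partial l f))"
  proof (rule sum_mono)
    fix l
    have "N3 (\<lambda>x. f (x + ?e l) - f x) \<le> \<bar>y' $ l\<bar> * N3 (partial l f)" by (rule translation_axis_bound[OF f])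
    also have "\<dots> \<le> sqrt (sinq l y) * N3 (partial l f)" by (intro mult_right_mono y' N3_nonneg)
    finally show "N3 (\<lambda>x. f (x + ?e l) - f x) \<le> sqrt (sinq l y) * N3 (partial l f)" .
  qed
  finally show ?thesis .
qed

text \<open>Symmetrization turns the derivative of the kernel, which is odd, against a difference of the
  transporting field, so that the singular factor of the kernel is compensated by one derivative
  of the field.\<close>

definition transport_form :: "nat \<Rightarrow> 3 \<Rightarrow> (real^3 \<Rightarrow> real) \<Rightarrow> (real^3 \<Rightarrow> real) \<Rightarrow> (real^3 \<Rightarrow> real) \<Rightarrow> real" where
  "transport_form N i v a b =
    (LINT x|torus. v x * a x * partial i (mol N b) x) + (LINT x|torus. v x * b x * partial i (mol N a) x)"

lemma partial_kern_odd: "partial i (kern N) (y - x) = - partial i (kern N) (x - y)"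
proof -
  let ?z = "y - x"
  have ev: "kern N (0 - z) = kern N z" for z using kern_even[of N 0 z] by simp
  have k: "(\<lambda>z. kern N (0 - z)) = kern N" by (rule ext) (rule ev)
  have sk: "smooth (kern N)" using sper_kern sper_def by blast
  have "((\<lambda>z. 0 - z) has_derivative (\<lambda>h. - h)) (at ?z)" by (auto intro!: derivative_eq_intros)
  from has_derivative_compose[OF this smooth_has_derivative[OF sk]]
  have "((\<lambda>z. kern N (0 - z)) has_derivative (\<lambda>h. frechet_derivative (kern N) (at (0 - ?z)) (- h))) (at ?z)" .
  from partial_eqI[OF this, of i]
  have "partial i (kern N) ?z = frechet_derivative (kern N) (at (0 - ?z)) (- axis i 1)"
    unfolding k .
  also have "\<dots> = - frechet_derivative (kern N) (at (0 - ?z)) (axis i 1)"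
    by (rule linear_neg[OF linear_frechet_derivative[OF smooth_differentiable[OF sk]]])
  finally show ?thesis by (simp add: partial_def)
qed

lemma mult_LINT:
  fixes c :: real
  shows "c * (LINT y|M. K y * f y) = (LINT y|M. K y * (c * f y))"
proof -
  have "c * (LINT y|M. K y * f y) = (LINT y|M. c * (K y * f y))" by simp
  then show ?thesis by (simp only: mult.left_commute[of c])
qed

lemma transport_form_bound_sper:
  assumes s: "sper v" "sper a" "sper b"
  shows "\<bar>transport_form N i v a b\<bar> \<le> 2 * pi * (\<Sum>l\<in>UNIV. N3 (partial l v)) * N3 a * N3 b"
proof -
  let ?k = "partial i (kern N)"
  note c = s[THEN sper_cper]
  have ck: "cper ?k" by (rule sper_cper[OF sper_partial[OF sper_kern]])
  have ckd: "continuous_on UNIV (\<lambda>p. ?k (fst p - snd p))"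
    using continuous_on_compose2[of UNIV ?k UNIV "\<lambda>p. fst p - snd p"] ck
    by (simp add: cper_def continuous_on_diff continuous_on_fst continuous_on_snd continuous_on_id)
  have swap: "(LINT x|torus. v x * b x * partial i (mol N a) x) = - (LINT x|torus. LINT y|torus. ?k (x - y) * (v y * a x * b y))"
  proof -
    have "(LINT x|torus. v x * b x * partial i (mol N a) x) = (LINT x|torus. LINT y|torus. ?k (x - y) * (v x * b x * a y))"
      unfolding partial_mol[OF cper_integrable[OF c(2)]] by (simp only: mult_LINT)
    also have "\<dots> = (LINT y|torus. LINT x|torus. ?k (x - y) * (v x * b x * a y))"
    proof (rule torus_Fubini_continuous(2))
      show "continuous_on UNIV (\<lambda>(x, y). ?k (x - y) * (v x * b x * a y))"
        unfolding case_prod_unfold using c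
        by (intro continuous_on_mult ckd continuous_fst2 continuous_snd2) (auto simp: cper_def)
    qed
    also have "\<dots> = (LINT y|torus. LINT x|torus. - (?k (y - x) * (v x * b x * a y)))"
    proof (intro Bochner_Integration.integral_cong refl)
      show "?k (x - y) * (v x * b x * a y) = - (?k (y - x) * (v x * b x * a y))" for x y
        using partial_kern_odd[of i N x y] by simp
    qed
    also have "\<dots> = - (LINT x|torus. LINT y|torus. ?k (x - y) * (v y * b y * a x))"
      by (simp only: Bochner_Integration.integral_minus)
    finally show ?thesis by (simp only: mult_ac)
  qed
  have i1: "integrable torus (\<lambda>x. LINT y|torus. ?k (x - y) * w (x, y))" "integrable torus (\<lambda>y. ?k (x - y) * w (x, y))"
    if w: "continuous_on UNIV w" for w :: "_ \<Rightarrow> real" and x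
  proof -
    have cw: "continuous_on UNIV (\<lambda>(x, y). ?k (x - y) * w (x, y))"
      unfolding case_prod_unfold using continuous_on_mult[OF ckd w] by simp
    show "integrable torus (\<lambda>x. LINT y|torus. ?k (x - y) * w (x, y))"
      by (rule integrable_torus_continuous[OF torus_Fubini_continuous(1)[OF cw]])
    show "integrable torus (\<lambda>y. ?k (x - y) * w (x, y))"
      using continuous_on_compose2[OF cw, of UNIV "\<lambda>y. (x, y)"]
      by (intro integrable_torus_continuous) (simp add: continuous_on_Pair)
  qed
  have w: "continuous_on UNIV (\<lambda>p. v (fst p) * a (fst p) * b (snd p))" "continuous_on UNIV (\<lambda>p. v (snd p) * a (fst p) * b (snd p))"
    using c by (intro continuous_on_mult continuous_fst2 continuous_snd2; simp add: cper_def)+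
  have "transport_form N i v a b = (LINT x|torus. LINT y|torus. ?k (x - y) * (v x * a x * b y))
      - (LINT x|torus. LINT y|torus. ?k (x - y) * (v y * a x * b y))"
    unfolding transport_form_def swap unfolding partial_mol[OF cper_integrable[OF c(3)]]
    by (simp only: mult_LINT add_uminus_conv_diff)
  also have "\<dots> = (LINT x|torus. LINT y|torus. ?k (x - y) * ((v x - v y) * a x * b y))"
  proof -
    note w1 = i1[OF w(1), unfolded fst_conv snd_conv] and w2 = i1[OF w(2), unfolded fst_conv snd_conv]
    have "(LINT y|torus. ?k (x - y) * ((v x - v y) * a x * b y))
       = (LINT y|torus. ?k (x - y) * (v x * a x * b y)) - (LINT y|torus. ?k (x - y) * (v y * a x * b y))" for x
      unfolding Bochner_Integration.integral_diff[OF w1(2) w2(2), symmetric]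
      by (simp only: left_diff_distrib right_diff_distrib)
    then show ?thesis
      unfolding Bochner_Integration.integral_diff[OF w1(1) w2(1), symmetric] by (simp only:)
  qed
  also have "\<dots> = (LINT x|torus. LINT y|torus. ?k (- y) * ((v x - v (x + y)) * a x * b (x + y)))"
  proof (rule Bochner_Integration.integral_cong[OF refl])
    fix x
    have "cper (\<lambda>y. (v x - v y) * a x * b y)" by (intro cper_intros c)
    from conv_translate[OF ck this, of x]
    show "(LINT y|torus. ?k (x - y) * ((v x - v y) * a x * b y)) = (LINT y|torus. ?k (- y) * ((v x - v (x + y)) * a x * b (x + y)))" .
  qed
  also have "\<dots> = (LINT y|torus. LINT x|torus. ?k (- y) * ((v x - v (x + y)) * a x * b (x + y)))"
  proof (rule torus_Fubini_continuous(2))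
    have "continuous_on UNIV (\<lambda>y. ?k (- y))"
      using ck cper_reflect[OF ck, of 0] by (simp add: cper_def)
    then show "continuous_on UNIV (\<lambda>(x, y). ?k (- y) * ((v x - v (x + y)) * a x * b (x + y)))"
      unfolding case_prod_unfold using c
      by (intro continuous_on_mult continuous_on_diff continuous_fst2 continuous_snd2[of "\<lambda>y. ?k (- y)"] continuous_shift2)
        (auto simp: cper_def)
  qed
  also have "\<dots> = (LINT y|torus. ?k y * (LINT x|torus. (v (x + y) - v x) * a x * b (x + y)))"
  proof (rule Bochner_Integration.integral_cong[OF refl])
    fix y
    have "?k (- y) = - ?k y" using partial_kern_odd[of i N 0 y] by simp
    moreover have "(LINT x|torus. (v x - v (x + y)) * a x * b (x + y)) = - (LINT x|torus. (v (x + y) - v x) * a x * b (x + y))"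
    proof -
      have "(\<lambda>x. (v x - v (x + y)) * a x * b (x + y)) = (\<lambda>x. - ((v (x + y) - v x) * a x * b (x + y)))"
        by (simp add: fun_eq_iff algebra_simps)
      then show ?thesis by simp
    qed
    ultimately show "(LINT x|torus. ?k (- y) * ((v x - v (x + y)) * a x * b (x + y))) = ?k y * (LINT x|torus. (v (x + y) - v x) * a x * b (x + y))"
      by simp
  qed
  finally have eq: "transport_form N i v a b = (LINT y|torus. ?k y * (LINT x|torus. (v (x + y) - v x) * a x * b (x + y)))" .
  let ?S = "\<lambda>y. \<Sum>l\<in>UNIV. sqrt (sinq l y) * N3 (partial l v)"
  have ik: "integrable torus (\<lambda>y. \<bar>?k y\<bar> * sqrt (sinq l y))" for l
    using ck sper_cper[OF sper_cosq[of l]]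
    by (intro integrable_torus_continuous continuous_on_mult) (auto simp: cper_def intro!: continuous_intros)
  have "\<bar>transport_form N i v a b\<bar> \<le> (LINT y|torus. (\<Sum>l\<in>UNIV. (N3 (partial l v) * N3 a * N3 b) * (\<bar>?k y\<bar> * sqrt (sinq l y))))"
    unfolding eq
  proof (rule order_trans[OF integral_abs_bound], rule integral_mono)
    have "continuous_on UNIV (\<lambda>y. LINT x|torus. (v (x + y) - v x) * a x * b (x + y))"
      using c by (intro torus_Fubini_continuous(1)[of "\<lambda>y x. (v (x + y) - v x) * a x * b (x + y)"])
        (simp add: case_prod_unfold add.commute[of "snd _"] cper_def continuous_on_mult continuous_on_diff continuous_shift2 continuous_snd2)
    then show "integrable torus (\<lambda>y. \<bar>?k y * (LINT x|torus. (v (x + y) - v x) * a x * b (x + y))\<bar>)"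
      using ck by (intro integrable_abs integrable_torus_continuous continuous_on_mult) (auto simp: cper_def)
    show "integrable torus (\<lambda>y. \<Sum>l\<in>UNIV. (N3 (partial l v) * N3 a * N3 b) * (\<bar>?k y\<bar> * sqrt (sinq l y)))"
      by (intro Bochner_Integration.integrable_sum integrable_mult_right ik)
    fix y
    have "\<bar>LINT x|torus. (v (x + y) - v x) * a x * b (x + y)\<bar> \<le> N3 (\<lambda>x. v (x + y) - v x) * N3 a * N3 (\<lambda>x. b (x + y))"
      using s by (intro holder3' sper_L3 sper_intros)
    also have "\<dots> \<le> ?S y * N3 a * N3 b"
      unfolding N3_translation[OF c(3)] using translation_bound[OF s(1)]
      by (intro mult_right_mono N3_nonneg)
    finally have "\<bar>?k y\<bar> * \<bar>LINT x|torus. (v (x + y) - v x) * a x * b (x + y)\<bar> \<le> \<bar>?k y\<bar> * (?S y * N3 a * N3 b)"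
      by (rule mult_left_mono) simp
    also have "\<dots> = (\<Sum>l\<in>UNIV. (N3 (partial l v) * N3 a * N3 b) * (\<bar>?k y\<bar> * sqrt (sinq l y)))"
      by (simp only: sum_distrib_left sum_distrib_right) (simp only: mult_ac)
    finally show "\<bar>?k y * (LINT x|torus. (v (x + y) - v x) * a x * b (x + y))\<bar>
        \<le> (\<Sum>l\<in>UNIV. (N3 (partial l v) * N3 a * N3 b) * (\<bar>?k y\<bar> * sqrt (sinq l y)))"
      by (simp only: abs_mult)
  qed
  also have "\<dots> = (\<Sum>l\<in>UNIV. (N3 (partial l v) * N3 a * N3 b) * (LINT y|torus. \<bar>?k y\<bar> * sqrt (sinq l y)))"
    using ik by (simp only: Bochner_Integration.integral_sum integrable_mult_right Bochner_Integration.integral_mult_right_zero)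
  also have "\<dots> \<le> (\<Sum>l\<in>UNIV. (N3 (partial l v) * N3 a * N3 b) * (2 * pi))"
    by (intro sum_mono mult_left_mono partial_kern_weighted mult_nonneg_nonneg N3_nonneg)
  also have "\<dots> = 2 * pi * (\<Sum>l\<in>UNIV. N3 (partial l v)) * N3 a * N3 b"
    by (simp only: sum_distrib_left sum_distrib_right) (simp only: mult_ac)
  finally show ?thesis .
qed

lemma transport_form_bound:
  assumes "W13 v D" "L3_approx a" "L3_approx b"
  shows "\<bar>transport_form N i v a b\<bar> \<le> 2 * pi * (\<Sum>l\<in>UNIV. N3 (D l)) * N3 a * N3 b"
proof -
  obtain V where V: "L3 v" "\<And>i. L3 (D i)" "\<And>m. sper (V m)" "(\<lambda>m. N3 (\<lambda>x. V m x - v x)) \<longlonglongrightarrow> 0"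
    "\<And>i. (\<lambda>m. N3 (\<lambda>x. partial i (V m) x - D i x)) \<longlonglongrightarrow> 0"
    using W13E[OF assms(1)] by blast
  obtain A where A: "L3 a" "\<And>m. sper (A m)" "(\<lambda>m. N3 (\<lambda>x. A m x - a x)) \<longlonglongrightarrow> 0"
    using L3_approxE[OF assms(2)] by blast
  obtain B where B: "L3 b" "\<And>m. sper (B m)" "(\<lambda>m. N3 (\<lambda>x. B m x - b x)) \<longlonglongrightarrow> 0"
    using L3_approxE[OF assms(3)] by blast
  note L = sper_L3[OF V(3)] sper_L3[OF A(2)] sper_L3[OF B(2)] sper_L3[OF sper_partial[OF V(3)]]
  have 1: "(\<lambda>m. \<bar>transport_form N i (V m) (A m) (B m)\<bar>) \<longlonglongrightarrow> \<bar>transport_form N i v a b\<bar>"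
    unfolding transport_form_def
    by (intro tendsto_rabs tendsto_add LINT_mult3_lim mol_lim(2)[OF L(3) B(1,3)] mol_lim(2)[OF L(2) A(1,3)] mol_L3 L V A B)
  have 2: "(\<lambda>m. 2 * pi * (\<Sum>l\<in>UNIV. N3 (partial l (V m))) * N3 (A m) * N3 (B m)) \<longlonglongrightarrow> 2 * pi * (\<Sum>l\<in>UNIV. N3 (D l)) * N3 a * N3 b"
    by (intro tendsto_mult tendsto_const tendsto_sum N3_lim L V A B)
  show ?thesis
    by (rule LIMSEQ_le[OF 1 2]) (auto intro: transport_form_bound_sper A B V)
qed

lemma transport_form_commute: "transport_form N i v a b = transport_form N i v b a"
  by (simp add: transport_form_def)

lemma transport_form_diff:
  assumes "L3 v" "L3 a" "L3 b" "L3 c"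
  shows "transport_form N i v (\<lambda>x. a x - b x) c = transport_form N i v a c - transport_form N i v b c"
proof -
  have i: "integrable torus (\<lambda>x. v x * a x * partial i (mol N c) x)" "integrable torus (\<lambda>x. v x * b x * partial i (mol N c) x)"
    "integrable torus (\<lambda>x. v x * c x * partial i (mol N a) x)" "integrable torus (\<lambda>x. v x * c x * partial i (mol N b) x)"
    by (intro L3_mult3_integrable mol_L3 assms)+
  have e: "(\<lambda>x. v x * (a x - b x) * partial i (mol N c) x)
      = (\<lambda>x. v x * a x * partial i (mol N c) x - v x * b x * partial i (mol N c) x)"
    "(\<lambda>x. v x * c x * partial i (mol N (\<lambda>x. a x - b x)) x)
      = (\<lambda>x. v x * c x * partial i (mol N a) x - v x * c x * partial i (mol N b) x)"
    by (simp_all add: fun_eq_iff right_diff_distrib left_diff_distrib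
        partial_mol_diff[OF L3_integrable[OF assms(2)] L3_integrable[OF assms(3)], of i N])
  show ?thesis unfolding transport_form_def e using i by simp
qed

lemma L3_approx_diff_sper:
  assumes "L3_approx w" "sper c" shows "L3_approx (\<lambda>x. w x - c x)"
proof -
  obtain F where F: "L3 w" "\<And>m. sper (F m)" "(\<lambda>m. N3 (\<lambda>x. F m x - w x)) \<longlonglongrightarrow> 0"
    using L3_approxE[OF assms(1)] by blast
  show ?thesis unfolding L3_approx_def
    by (intro conjI exI[of _ "\<lambda>m x. F m x - c x"] allI L3_diff F sper_L3 assms sper_intros) (use F(3) in simp)
qed

locale divergence_free_W13 =
  fixes U :: "3 \<Rightarrow> real^3 \<Rightarrow> real" and D :: "3 \<Rightarrow> 3 \<Rightarrow> real^3 \<Rightarrow> real"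
  assumes W13: "\<And>i. W13 (U i) (\<lambda>k. D k i)"
    and div: "AE x in torus. (\<Sum>i\<in>UNIV. D i i x) = 0"
begin

lemma U_L3: "L3 (U i)" and D_L3: "L3 (D k i)"
  using W13_L3(1)[OF W13] W13_L3(2)[OF W13, of k i] by auto

lemma U_approx: "L3_approx (U i)" and D_approx: "L3_approx (D k i)"
  using W13_approx(1)[OF W13] W13_approx(2)[OF W13, of k i] by auto

lemma U_wpart: "wpart k (U i) (D k i)"
  by (rule W13_wpart[OF W13])

lemma div_weak:
  assumes "sper \<eta>" shows "(\<Sum>i\<in>UNIV. LINT x|torus. U i x * partial i \<eta> x) = 0"
proof -
  have i: "integrable torus (\<lambda>x. \<eta> x * D i i x)" for i by (intro L3_mult_integrable sper_L3 assms D_L3)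
  have "(LINT x|torus. U i x * partial i \<eta> x) = - (LINT x|torus. \<eta> x * D i i x)" for i
    using wpartD(3)[OF U_wpart assms, of i i] by (simp add: mult.commute)
  then have "(\<Sum>i\<in>UNIV. LINT x|torus. U i x * partial i \<eta> x) = - (LINT x|torus. (\<Sum>i\<in>UNIV. \<eta> x * D i i x))"
    using i by (simp add: sum_negf)
  also have "(LINT x|torus. (\<Sum>i\<in>UNIV. \<eta> x * D i i x)) = (LINT x|torus. 0)"
  proof (rule integral_cong_AE)
    show "(\<lambda>x. \<Sum>i\<in>UNIV. \<eta> x * D i i x) \<in> borel_measurable torus"
      using i by (intro borel_measurable_integrable Bochner_Integration.integrable_sum)
    show "AE x in torus. (\<Sum>i\<in>UNIV. \<eta> x * D i i x) = 0"
      using div by (auto simp flip: sum_distrib_left)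
  qed simp
  finally show ?thesis by simp
qed

lemma div_weak_derivative:
  assumes "sper \<eta>" shows "(\<Sum>i\<in>UNIV. LINT x|torus. D k i x * partial i \<eta> x) = 0"
proof -
  have "(LINT x|torus. D k i x * partial i \<eta> x) = - (LINT x|torus. U i x * partial i (partial k \<eta>) x)" for i
  proof -
    have "(LINT x|torus. D k i x * partial i \<eta> x) = - (LINT x|torus. partial k (partial i \<eta>) x * U i x)"
      using wpartD(3)[OF U_wpart sper_partial[OF assms], of k i i] by (simp add: mult.commute)
    also have "(LINT x|torus. partial k (partial i \<eta>) x * U i x) = (LINT x|torus. U i x * partial i (partial k \<eta>) x)"
    proof (rule integral_cong_AE)
      show "(\<lambda>x. partial k (partial i \<eta>) x * U i x) \<in> borel_measurable torus"
        "(\<lambda>x. U i x * partial i (partial k \<eta>) x) \<in> borel_measurable torus"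
        by (intro borel_measurable_integrable L3_mult_integrable sper_L3 sper_partial assms U_L3)+
      show "AE x in torus. partial k (partial i \<eta>) x * U i x = U i x * partial i (partial k \<eta>) x"
        using partial_commute[OF assms, of k i] by (auto simp: mult.commute)
    qed
    finally show ?thesis .
  qed
  then show ?thesis using div_weak[OF sper_partial[OF assms], of k] by (simp add: sum_negf)
qed

text \<open>The commutator estimate is uniform in \<open>N\<close> and bilinear in the transported function, so a smooth
  function \<open>c\<close> may take the place of \<open>w\<close>. In that case the limit is the integral of the field
  against the gradient of \<open>c\<^sup>2 / 2\<close>, which vanishes.\<close>

lemma transport_limit:
  assumes w: "L3_approx w"
  shows "(\<lambda>N. \<Sum>i\<in>UNIV. LINT x|torus. U i x * w x * partial i (mol N w) x) \<longlonglongrightarrow> 0"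
proof (rule tendsto_if_approximable)
  fix e :: real assume e: "e > 0"
  obtain C where C: "L3 w" "\<And>m. sper (C m)" "(\<lambda>m. N3 (\<lambda>x. C m x - w x)) \<longlonglongrightarrow> 0"
    using L3_approxE[OF w] by blast
  define K where "K = (\<Sum>i\<in>UNIV. pi * (\<Sum>l\<in>UNIV. N3 (D l i)))"
  have K: "K \<ge> 0" unfolding K_def by (intro sum_nonneg mult_nonneg_nonneg N3_nonneg) auto
  have "(\<lambda>m. K * N3 (\<lambda>x. C m x - w x) * (N3 w + N3 (C m))) \<longlonglongrightarrow> K * 0 * (N3 w + N3 w)"
    by (intro tendsto_intros C N3_lim sper_L3)
  then have "eventually (\<lambda>m. K * N3 (\<lambda>x. C m x - w x) * (N3 w + N3 (C m)) < e) sequentially"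
    by (rule order_tendstoD(2)) (simp add: e)
  then obtain m where m: "K * N3 (\<lambda>x. C m x - w x) * (N3 w + N3 (C m)) < e"
    by (auto simp: eventually_sequentially)
  define c where "c = C m"
  have c: "sper c" using C by (simp add: c_def)
  have Lc: "L3 c" "L3 (\<lambda>x. w x - c x)" using sper_L3[OF c] L3_diff[OF C(1) sper_L3[OF c]] by auto
  note apr = L3_approx_diff_sper[OF w c]
  let ?X = "\<lambda>N. \<Sum>i\<in>UNIV. LINT x|torus. U i x * w x * partial i (mol N w) x"
  let ?Y = "\<lambda>N. \<Sum>i\<in>UNIV. LINT x|torus. U i x * c x * mol N (partial i c) x"
  show "\<exists>Y y. (\<forall>N. \<bar>?X N - Y N\<bar> \<le> e) \<and> Y \<longlonglongrightarrow> y \<and> \<bar>y - 0\<bar> \<le> e"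
  proof (intro exI conjI allI)
    show "?Y \<longlonglongrightarrow> (\<Sum>i\<in>UNIV. LINT x|torus. U i x * c x * partial i c x)"
      by (intro tendsto_sum trilinear_limit U_approx L3_approx_sper c sper_partial)
    have "(\<Sum>i\<in>UNIV. LINT x|torus. U i x * partial i (\<lambda>x. c x * c x) x) = 0"
      by (intro div_weak sper_intros c)
    moreover have "(LINT x|torus. U i x * partial i (\<lambda>x. c x * c x) x) = 2 * (LINT x|torus. U i x * c x * partial i c x)" for i
    proof -
      have "(\<lambda>x. U i x * partial i (\<lambda>x. c x * c x) x) = (\<lambda>x. 2 * (U i x * c x * partial i c x))"
        using c by (simp add: fun_eq_iff partial_mult sper_def)
      then show ?thesis by simp
    qed
    ultimately have "(\<Sum>i\<in>UNIV. LINT x|torus. U i x * c x * partial i c x) = 0"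
      by (simp flip: sum_distrib_left)
    then show "\<bar>(\<Sum>i\<in>UNIV. LINT x|torus. U i x * c x * partial i c x) - 0\<bar> \<le> e" using e by simp
    show "\<bar>?X N - ?Y N\<bar> \<le> e" for N
    proof -
      have half: "(LINT x|torus. U i x * w x * partial i (mol N w) x) - (LINT x|torus. U i x * c x * mol N (partial i c) x)
        = (transport_form N i (U i) (\<lambda>x. w x - c x) w + transport_form N i (U i) (\<lambda>x. w x - c x) c) / 2" for i
      proof -
        have "(LINT x|torus. U i x * c x * mol N (partial i c) x) = transport_form N i (U i) c c / 2"
          using partial_mol_wpart[OF wpart_sper[OF c]] by (simp add: transport_form_def)
        moreover have "(LINT x|torus. U i x * w x * partial i (mol N w) x) = transport_form N i (U i) w w / 2"
          by (simp add: transport_form_def)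
        moreover have "transport_form N i (U i) w w - transport_form N i (U i) c c
          = transport_form N i (U i) (\<lambda>x. w x - c x) w + transport_form N i (U i) (\<lambda>x. w x - c x) c"
          unfolding transport_form_diff[OF U_L3 C(1) Lc(1) C(1)] transport_form_diff[OF U_L3 C(1) Lc(1) Lc(1)]
          using transport_form_commute by simp
        ultimately show ?thesis by simp
      qed
      have bd: "\<bar>(transport_form N i (U i) (\<lambda>x. w x - c x) w + transport_form N i (U i) (\<lambda>x. w x - c x) c) / 2\<bar>
        \<le> pi * (\<Sum>l\<in>UNIV. N3 (D l i)) * (N3 (\<lambda>x. w x - c x) * (N3 w + N3 c))" for i
        using transport_form_bound[OF W13 apr w, of N i i] transport_form_bound[OF W13 apr L3_approx_sper[OF c], of N i i]
        by (simp add: algebra_simps)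
      have "\<bar>?X N - ?Y N\<bar> \<le> (\<Sum>i\<in>UNIV. pi * (\<Sum>l\<in>UNIV. N3 (D l i)) * (N3 (\<lambda>x. w x - c x) * (N3 w + N3 c)))"
        unfolding sum_subtractf[symmetric] half by (rule order_trans[OF sum_abs sum_mono[OF bd]])
      also have "\<dots> = K * N3 (\<lambda>x. C m x - w x) * (N3 w + N3 (C m))"
        unfolding K_def c_def N3_diff_commute[of w "C m"] by (simp only: sum_distrib_right mult.assoc)
      finally show ?thesis using m by simp
    qed
  qed
qed

lemma transport_bound:
  assumes "L3_approx w"
  shows "\<bar>\<Sum>i\<in>UNIV. LINT x|torus. U i x * w x * partial i (mol N w) x\<bar>
    \<le> (\<Sum>i\<in>UNIV. pi * (\<Sum>l\<in>UNIV. N3 (D l i)) * N3 w * N3 w)"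
proof (rule order_trans[OF sum_abs sum_mono])
  fix i
  have "(LINT x|torus. U i x * w x * partial i (mol N w) x) = transport_form N i (U i) w w / 2"
    by (simp add: transport_form_def)
  then show "\<bar>LINT x|torus. U i x * w x * partial i (mol N w) x\<bar> \<le> pi * (\<Sum>l\<in>UNIV. N3 (D l i)) * N3 w * N3 w"
    using transport_form_bound[OF W13 assms assms, of N i i] by simp
qed

text \<open>The derivative of a divergence-free field is divergence-free, so this is an integration by parts in
  which no second derivative of the field appears.\<close>

lemma derivative_transport:
  assumes \<phi>: "sper \<phi>"
  shows "(\<Sum>i\<in>UNIV. LINT x|torus. D k i x * U j x * partial i \<phi> x) = - (\<Sum>i\<in>UNIV. LINT x|torus. D k i x * D i j x * \<phi> x)"
proof -
  obtain F where F: "L3 (U j)" "\<And>i. L3 (D i j)" "\<And>m. sper (F m)" "(\<lambda>m. N3 (\<lambda>x. F m x - U j x)) \<longlonglongrightarrow> 0"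
    "\<And>i. (\<lambda>m. N3 (\<lambda>x. partial i (F m) x - D i j x)) \<longlonglongrightarrow> 0"
    using W13E[OF W13[of j]] by blast
  note L = sper_L3[OF \<phi>] sper_L3[OF sper_partial[OF \<phi>]] sper_L3[OF F(3)] sper_L3[OF sper_partial[OF F(3)]]
  have z: "(\<Sum>i\<in>UNIV. (LINT x|torus. D k i x * F m x * partial i \<phi> x) + (LINT x|torus. D k i x * partial i (F m) x * \<phi> x)) = 0" for m
  proof -
    have "(LINT x|torus. D k i x * partial i (\<lambda>x. F m x * \<phi> x) x)
      = (LINT x|torus. D k i x * F m x * partial i \<phi> x) + (LINT x|torus. D k i x * partial i (F m) x * \<phi> x)" for i
    proof -
      have "(\<lambda>x. D k i x * partial i (\<lambda>x. F m x * \<phi> x) x) = (\<lambda>x. D k i x * F m x * partial i \<phi> x + D k i x * partial i (F m) x * \<phi> x)"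
        using F(3) \<phi> by (simp add: fun_eq_iff partial_mult sper_def algebra_simps)
      moreover have "integrable torus (\<lambda>x. D k i x * F m x * partial i \<phi> x)" "integrable torus (\<lambda>x. D k i x * partial i (F m) x * \<phi> x)"
        by (intro L3_mult3_integrable D_L3 L)+
      ultimately show ?thesis by simp
    qed
    moreover have "(\<Sum>i\<in>UNIV. LINT x|torus. D k i x * partial i (\<lambda>x. F m x * \<phi> x) x) = 0"
      by (intro div_weak_derivative sper_intros F \<phi>)
    ultimately show ?thesis by simp
  qed
  have "(\<lambda>m. \<Sum>i\<in>UNIV. (LINT x|torus. D k i x * F m x * partial i \<phi> x) + (LINT x|torus. D k i x * partial i (F m) x * \<phi> x))
     \<longlonglongrightarrow> (\<Sum>i\<in>UNIV. (LINT x|torus. D k i x * U j x * partial i \<phi> x) + (LINT x|torus. D k i x * D i j x * \<phi> x))"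
    by (intro tendsto_sum tendsto_add LINT_mult3_lim[OF D_L3 L(3) L(2) D_L3 F(1) L(2) N3_zero_lim F(4) N3_zero_lim]
        LINT_mult3_lim[OF D_L3 L(4) L(1) D_L3 F(2) L(1) N3_zero_lim F(5) N3_zero_lim])
  from LIMSEQ_unique[OF this[unfolded z] tendsto_const] show ?thesis by (simp add: sum.distrib)
qed

lemma self_transport_zero: "(\<Sum>i\<in>UNIV. LINT x|torus. U i x * U j x * D i j x) = 0"
proof -
  obtain F where F: "L3 (U j)" "\<And>i. L3 (D i j)" "\<And>m. sper (F m)" "(\<lambda>m. N3 (\<lambda>x. F m x - U j x)) \<longlonglongrightarrow> 0"
    "\<And>i. (\<lambda>m. N3 (\<lambda>x. partial i (F m) x - D i j x)) \<longlonglongrightarrow> 0"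
    using W13E[OF W13[of j]] by blast
  have z: "(\<Sum>i\<in>UNIV. LINT x|torus. U i x * F m x * partial i (F m) x) = 0" for m
  proof -
    have "(LINT x|torus. U i x * partial i (\<lambda>x. F m x * F m x) x) = 2 * (LINT x|torus. U i x * F m x * partial i (F m) x)" for i
    proof -
      have "(\<lambda>x. U i x * partial i (\<lambda>x. F m x * F m x) x) = (\<lambda>x. 2 * (U i x * F m x * partial i (F m) x))"
        using F(3) by (simp add: fun_eq_iff partial_mult sper_def)
      then show ?thesis by simp
    qed
    moreover have "(\<Sum>i\<in>UNIV. LINT x|torus. U i x * partial i (\<lambda>x. F m x * F m x) x) = 0"
      by (intro div_weak sper_intros F)
    ultimately show ?thesis by (simp flip: sum_distrib_left)
  qed
  have "(\<lambda>m. \<Sum>i\<in>UNIV. LINT x|torus. U i x * F m x * partial i (F m) x) \<longlonglongrightarrow> (\<Sum>i\<in>UNIV. LINT x|torus. U i x * U j x * D i j x)"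
    by (intro tendsto_sum LINT_mult3_lim[OF U_L3 sper_L3[OF F(3)] sper_L3[OF sper_partial[OF F(3)]] U_L3 F(1) F(2) N3_zero_lim F(4) F(5)])
  from LIMSEQ_unique[OF this[unfolded z] tendsto_const] show ?thesis by simp
qed

end

section \<open>The energy flux at a fixed time\<close>

text \<open>The spatial part of the weak formulation for the test field \<open>e\<close> times the \<open>j\<close>-th unit vector, with the
  two terms in \<open>\<partial>\<^sub>k u\<^sub>i \<partial>\<^sub>k u\<^sub>j\<close> combined.\<close>

definition flux_density ::
  "real \<Rightarrow> (3 \<Rightarrow> real^3 \<Rightarrow> real) \<Rightarrow> (3 \<Rightarrow> 3 \<Rightarrow> real^3 \<Rightarrow> real) \<Rightarrow> (real^3 \<Rightarrow> real) \<Rightarrow> 3 \<Rightarrow> (real^3 \<Rightarrow> real) \<Rightarrow> real^3 \<Rightarrow> real" where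
  "flux_density \<alpha> U D q j e x =
     (\<Sum>i\<in>UNIV. U i x * U j x * partial i e x)
   + \<alpha>\<^sup>2 * (\<Sum>i\<in>UNIV. \<Sum>k\<in>UNIV. D k i x * D k j x * partial i e x
        + U i x * D k j x * partial i (partial k e) x + D k i x * U j x * partial i (partial k e) x)
   + partial j e x * q x"

definition flux ::
  "real \<Rightarrow> (3 \<Rightarrow> real^3 \<Rightarrow> real) \<Rightarrow> (3 \<Rightarrow> 3 \<Rightarrow> real^3 \<Rightarrow> real) \<Rightarrow> (real^3 \<Rightarrow> real) \<Rightarrow> 3 \<Rightarrow> (real^3 \<Rightarrow> real) \<Rightarrow> real" where
  "flux \<alpha> U D q j e = (LINT x|torus. flux_density \<alpha> U D q j e x)"

lemma flux_expand:
  assumes e: "sper e" and int: "\<And>i. integrable torus (\<lambda>x. U i x * U j x)"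
    "\<And>i k. integrable torus (\<lambda>x. D k i x * D k j x)" "\<And>i k. integrable torus (\<lambda>x. U i x * D k j x)"
    "\<And>i k. integrable torus (\<lambda>x. D k i x * U j x)" and q: "integrable torus q"
  shows "integrable torus (flux_density \<alpha> U D q j e)"
    "flux \<alpha> U D q j e = (\<Sum>i\<in>UNIV. LINT x|torus. U i x * U j x * partial i e x)
   + \<alpha>\<^sup>2 * (\<Sum>i\<in>UNIV. \<Sum>k\<in>UNIV. (LINT x|torus. D k i x * D k j x * partial i e x)
        + (LINT x|torus. U i x * D k j x * partial i (partial k e) x) + (LINT x|torus. D k i x * U j x * partial i (partial k e) x))
   + (LINT x|torus. partial j e x * q x)"
proof -
  have m: "integrable torus (\<lambda>x. a x * b x * f x)" if "integrable torus (\<lambda>x. a x * b x)" "sper f" for a b f :: "real^3 \<Rightarrow> real"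
    using integrable_cper_mult[OF sper_cper[OF that(2)] that(1)] by (simp add: mult_ac)
  have i1: "integrable torus (\<lambda>x. U i x * U j x * partial i e x)"
    "integrable torus (\<lambda>x. D k i x * D k j x * partial i e x)"
    "integrable torus (\<lambda>x. U i x * D k j x * partial i (partial k e) x)"
    "integrable torus (\<lambda>x. D k i x * U j x * partial i (partial k e) x)" for i k
    by (intro m int sper_partial e)+
  have i2: "integrable torus (\<lambda>x. partial j e x * q x)"
    by (rule integrable_cper_mult[OF sper_cper[OF sper_partial[OF e]] q])
  show "integrable torus (flux_density \<alpha> U D q j e)" unfolding flux_density_def[abs_def]
    using i1 i2 by (intro Bochner_Integration.integrable_add Bochner_Integration.integrable_sum integrable_mult_right)
  show "flux \<alpha> U D q j e = (\<Sum>i\<in>UNIV. LINT x|torus. U i x * U j x * partial i e x)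
   + \<alpha>\<^sup>2 * (\<Sum>i\<in>UNIV. \<Sum>k\<in>UNIV. (LINT x|torus. D k i x * D k j x * partial i e x)
        + (LINT x|torus. U i x * D k j x * partial i (partial k e) x) + (LINT x|torus. D k i x * U j x * partial i (partial k e) x))
   + (LINT x|torus. partial j e x * q x)" unfolding flux_def flux_density_def
    using i1 i2
    by (simp only: Bochner_Integration.integral_add Bochner_Integration.integral_sum Bochner_Integration.integrable_add
        Bochner_Integration.integrable_sum integrable_mult_right Bochner_Integration.integral_mult_right_zero)
qed

context divergence_free_W13 begin

text \<open>In the term with \<open>\<partial>\<^sub>k u\<^sub>i u\<^sub>j \<partial>\<^sub>i \<partial>\<^sub>k\<close> one derivative is moved onto \<open>u\<^sub>j\<close>. In the term with
  \<open>u\<^sub>i \<partial>\<^sub>k u\<^sub>j \<partial>\<^sub>i \<partial>\<^sub>k\<close> both derivatives stay: it is the transport of \<open>\<partial>\<^sub>k u\<^sub>j\<close> by the velocity. The pressure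
  drops out because the mollified velocity is divergence-free.\<close>

lemma total_flux:
  assumes q: "integrable torus q"
  shows "(\<Sum>j\<in>UNIV. flux \<alpha> U D q j (mol N (U j))) =
     (\<Sum>j\<in>UNIV. \<Sum>i\<in>UNIV. LINT x|torus. U i x * U j x * mol N (D i j) x)
   + \<alpha>\<^sup>2 * ((\<Sum>j\<in>UNIV. \<Sum>i\<in>UNIV. \<Sum>k\<in>UNIV. LINT x|torus. D k i x * D k j x * mol N (D i j) x)
        + (\<Sum>j\<in>UNIV. \<Sum>k\<in>UNIV. \<Sum>i\<in>UNIV. LINT x|torus. U i x * D k j x * partial i (mol N (D k j)) x)
        - (\<Sum>j\<in>UNIV. \<Sum>k\<in>UNIV. \<Sum>i\<in>UNIV. LINT x|torus. D k i x * D i j x * mol N (D k j) x))"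
proof -
  have iU: "integrable torus (U i)" and iD: "integrable torus (D k i)" for i k
    using L3_integrable U_L3 D_L3 by blast+
  have p: "partial k (mol N (U j)) = mol N (D k j)" for j k
    using partial_mol_wpart[OF U_wpart] by auto
  have sp: "sper (mol N (U j))" for j by (rule sper_mol[OF iU])
  have f: "flux \<alpha> U D q j (mol N (U j)) = (\<Sum>i\<in>UNIV. LINT x|torus. U i x * U j x * mol N (D i j) x)
    + \<alpha>\<^sup>2 * ((\<Sum>i\<in>UNIV. \<Sum>k\<in>UNIV. LINT x|torus. D k i x * D k j x * mol N (D i j) x)
        + (\<Sum>k\<in>UNIV. \<Sum>i\<in>UNIV. LINT x|torus. U i x * D k j x * partial i (mol N (D k j)) x)
        - (\<Sum>k\<in>UNIV. \<Sum>i\<in>UNIV. LINT x|torus. D k i x * D i j x * mol N (D k j) x))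
    + (LINT x|torus. mol N (D j j) x * q x)" for j
  proof -
    have "(\<Sum>i\<in>UNIV. \<Sum>k\<in>UNIV. (LINT x|torus. D k i x * U j x * partial i (mol N (D k j)) x))
        = (\<Sum>k\<in>UNIV. \<Sum>i\<in>UNIV. LINT x|torus. D k i x * U j x * partial i (mol N (D k j)) x)"
      by (rule sum.swap)
    also have "\<dots> = - (\<Sum>k\<in>UNIV. \<Sum>i\<in>UNIV. LINT x|torus. D k i x * D i j x * mol N (D k j) x)"
      unfolding derivative_transport[OF sper_mol[OF iD]] by (simp add: sum_negf)
    finally have a: "(\<Sum>i\<in>UNIV. \<Sum>k\<in>UNIV. (LINT x|torus. D k i x * U j x * partial i (mol N (D k j)) x))
        = - (\<Sum>k\<in>UNIV. \<Sum>i\<in>UNIV. LINT x|torus. D k i x * D i j x * mol N (D k j) x)" .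
    have b: "(\<Sum>i\<in>UNIV. \<Sum>k\<in>UNIV. (LINT x|torus. U i x * D k j x * partial i (mol N (D k j)) x))
        = (\<Sum>k\<in>UNIV. \<Sum>i\<in>UNIV. LINT x|torus. U i x * D k j x * partial i (mol N (D k j)) x)"
      by (rule sum.swap)
    show ?thesis
      unfolding flux_expand(2)[OF sp L3_mult_integrable[OF U_L3 U_L3] L3_mult_integrable[OF D_L3 D_L3]
          L3_mult_integrable[OF U_L3 D_L3] L3_mult_integrable[OF D_L3 U_L3] q] p sum.distrib a b by simp
  qed
  have "(\<Sum>j\<in>UNIV. LINT x|torus. mol N (D j j) x * q x) = 0"
  proof -
    have "(\<Sum>j\<in>UNIV. mol N (D j j) x) = 0" for x
    proof -
      have i: "integrable torus (\<lambda>y. kern N (x - y) * D j j y)" for j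
        by (rule integrable_cper_mult[OF cper_kern_reflect iD])
      have "(\<Sum>j\<in>UNIV. mol N (D j j) x) = (LINT y|torus. (\<Sum>j\<in>UNIV. kern N (x - y) * D j j y))"
        unfolding mol_def using i by simp
      also have "\<dots> = (LINT y|torus. 0)"
      proof (rule integral_cong_AE)
        show "(\<lambda>y. \<Sum>j\<in>UNIV. kern N (x - y) * D j j y) \<in> borel_measurable torus"
          using i by (intro borel_measurable_integrable Bochner_Integration.integrable_sum)
        show "AE y in torus. (\<Sum>j\<in>UNIV. kern N (x - y) * D j j y) = 0"
          using div by (auto simp flip: sum_distrib_left)
      qed simp
      finally show ?thesis by simp
    qed
    moreover have "integrable torus (\<lambda>x. mol N (D j j) x * q x)" for j
      by (rule integrable_cper_mult[OF sper_cper[OF sper_mol[OF iD]] q])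
    ultimately show ?thesis
      by (simp flip: Bochner_Integration.integral_sum sum_distrib_right)
  qed
  then show ?thesis unfolding f sum.distrib by (simp add: sum_distrib_left sum.distrib sum_subtractf right_diff_distrib distrib_left)
qed

text \<open>In the limit the transport terms vanish and the two cubic expressions in the gradient are the same up
  to the names of the indices, with opposite signs.\<close>

theorem total_flux_tendsto:
  assumes q: "integrable torus q"
  shows "(\<lambda>N. \<Sum>j\<in>UNIV. flux \<alpha> U D q j (mol N (U j))) \<longlonglongrightarrow> 0"
proof -
  let ?X = "\<Sum>j\<in>UNIV. \<Sum>i\<in>UNIV. \<Sum>k\<in>UNIV. LINT x|torus. D k i x * D k j x * D i j x"
  have "(\<lambda>N. \<Sum>j\<in>UNIV. flux \<alpha> U D q j (mol N (U j))) \<longlonglongrightarrow>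
     (\<Sum>j\<in>UNIV. \<Sum>i\<in>UNIV. LINT x|torus. U i x * U j x * D i j x)
   + \<alpha>\<^sup>2 * (?X + (\<Sum>j\<in>(UNIV::3 set). \<Sum>k\<in>(UNIV::3 set). 0)
        - (\<Sum>j\<in>UNIV. \<Sum>k\<in>UNIV. \<Sum>i\<in>UNIV. LINT x|torus. D k i x * D i j x * D k j x))"
    unfolding total_flux[OF q]
    by (intro tendsto_add tendsto_diff tendsto_mult tendsto_const tendsto_sum trilinear_limit U_approx D_approx transport_limit)
  also have "(\<Sum>j\<in>UNIV. \<Sum>i\<in>UNIV. LINT x|torus. U i x * U j x * D i j x) = 0"
    by (simp add: self_transport_zero)
  also have "(\<Sum>j\<in>UNIV. \<Sum>k\<in>UNIV. \<Sum>i\<in>UNIV. LINT x|torus. D k i x * D i j x * D k j x) = ?X"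
  proof -
    have "(\<Sum>k\<in>UNIV. \<Sum>i\<in>UNIV. LINT x|torus. D k i x * D i j x * D k j x)
      = (\<Sum>i\<in>UNIV. \<Sum>k\<in>UNIV. LINT x|torus. D k i x * D i j x * D k j x)" for j
      by (rule sum.swap)
    then show ?thesis by (simp only: mult_ac)
  qed
  finally show ?thesis by simp
qed

text \<open>Hoelder's inequality bounds the trilinear terms and the commutator estimate the transport terms; the
  constant counts them.\<close>

theorem total_flux_bound:
  assumes q: "integrable torus q" and M: "\<And>i. N3 (U i) \<le> M" "\<And>k i. N3 (D k i) \<le> M"
  shows "\<bar>\<Sum>j\<in>UNIV. flux \<alpha> U D q j (mol N (U j))\<bar> \<le> (9 + 400 * \<alpha>\<^sup>2) * M ^ 3"
proof -
  have M0: "M \<ge> 0" using M(1)[of 1] N3_nonneg[of "U 1"] by simp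
  have cube: "a * b * c \<le> M ^ 3" if "0 \<le> a" "a \<le> M" "0 \<le> b" "b \<le> M" "0 \<le> c" "c \<le> M" for a b c
    using that M0 by (simp add: power3_eq_cube mult_mono)
  have tri: "\<bar>LINT x|torus. a x * b x * mol N c x\<bar> \<le> M ^ 3"
    if "L3_approx a" "L3_approx b" "L3_approx c" "N3 a \<le> M" "N3 b \<le> M" "N3 c \<le> M" for a b c
    using trilinear_bound[OF that(1-3), of N] cube[of "N3 a" "N3 b" "N3 c"] that N3_nonneg by (meson order_trans)
  have sum_bd: "\<bar>\<Sum>i\<in>(UNIV::3 set). f i\<bar> \<le> 3 * B" if "\<And>i. \<bar>f i\<bar> \<le> B" for f :: "3 \<Rightarrow> real" and B
    using order_trans[OF sum_abs[of f UNIV] sum_mono[of UNIV "\<lambda>i. \<bar>f i\<bar>" "\<lambda>_. B"]] that by simp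
  have A: "\<bar>\<Sum>j\<in>UNIV. \<Sum>i\<in>UNIV. LINT x|torus. U i x * U j x * mol N (D i j) x\<bar> \<le> 3 * (3 * M ^ 3)"
    by (intro sum_bd tri U_approx D_approx M)
  have B: "\<bar>\<Sum>j\<in>UNIV. \<Sum>i\<in>UNIV. \<Sum>k\<in>UNIV. LINT x|torus. D k i x * D k j x * mol N (D i j) x\<bar> \<le> 3 * (3 * (3 * M ^ 3))"
    by (intro sum_bd tri U_approx D_approx M)
  have C: "\<bar>\<Sum>j\<in>UNIV. \<Sum>k\<in>UNIV. \<Sum>i\<in>UNIV. LINT x|torus. D k i x * D i j x * mol N (D k j) x\<bar> \<le> 3 * (3 * (3 * M ^ 3))"
    by (intro sum_bd tri U_approx D_approx M)
  have E: "\<bar>\<Sum>j\<in>UNIV. \<Sum>k\<in>UNIV. \<Sum>i\<in>UNIV. LINT x|torus. U i x * D k j x * partial i (mol N (D k j)) x\<bar> \<le> 3 * (3 * (9 * pi * M ^ 3))"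
  proof (intro sum_bd)
    fix j k
    have "\<bar>\<Sum>i\<in>UNIV. LINT x|torus. U i x * D k j x * partial i (mol N (D k j)) x\<bar>
       \<le> (\<Sum>i\<in>UNIV. \<Sum>l\<in>UNIV. pi * (N3 (D l i) * N3 (D k j) * N3 (D k j)))"
      using transport_bound[OF D_approx[of k j], of N] by (simp add: sum_distrib_left sum_distrib_right mult.assoc)
    also have "\<dots> \<le> (\<Sum>i\<in>(UNIV::3 set). \<Sum>l\<in>(UNIV::3 set). pi * M ^ 3)"
      by (intro sum_mono mult_left_mono cube M N3_nonneg) auto
    finally show "\<bar>\<Sum>i\<in>UNIV. LINT x|torus. U i x * D k j x * partial i (mol N (D k j)) x\<bar> \<le> 9 * pi * M ^ 3" by simp
  qed
  let ?S = "27 * M ^ 3 + 81 * pi * M ^ 3 + 27 * M ^ 3"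
  have "\<bar>\<Sum>j\<in>UNIV. flux \<alpha> U D q j (mol N (U j))\<bar> \<le> 9 * M ^ 3 + \<alpha>\<^sup>2 * ?S"
    unfolding total_flux[OF q]
  proof (rule order_trans[OF abs_triangle_ineq add_mono])
    show "\<bar>\<Sum>j\<in>UNIV. \<Sum>i\<in>UNIV. LINT x|torus. U i x * U j x * mol N (D i j) x\<bar> \<le> 9 * M ^ 3" using A by simp
  qed (use B C E in \<open>auto simp: abs_mult intro!: mult_left_mono\<close>)
  also have "\<dots> \<le> 9 * M ^ 3 + \<alpha>\<^sup>2 * (400 * M ^ 3)"
  proof -
    have p: "81 * pi * M ^ 3 \<le> 81 * 4 * M ^ 3" using M0 pi_less_4 by (intro mult_right_mono) auto
    have "M ^ 3 \<ge> 0" using M0 by simp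
    with p have "?S \<le> 400 * M ^ 3" by linarith
    then show ?thesis by (intro add_left_mono mult_left_mono) auto
  qed
  finally show ?thesis by (simp add: algebra_simps)
qed

end

section \<open>The Bernstein inequality\<close>

lemma cis_sum_zero:
  fixes d :: int and M :: nat
  assumes "M > 0" "\<bar>d\<bar> < int M" "d \<noteq> 0"
  shows "(\<Sum>r<M. cis (2 * pi * of_int d * real r / real M)) = 0"
proof -
  let ?z = "cis (2 * pi * of_int d / real M)"
  have pw: "cis (2 * pi * of_int d * real r / real M) = ?z ^ r" for r
    by (simp add: Complex.DeMoivre mult_ac)
  have "?z \<noteq> 1"
  proof
    assume "?z = 1"
    then have "cos (2 * pi * of_int d / real M) = 1" by (simp add: complex_eq_iff)
    then obtain m :: int where "2 * pi * of_int d / real M = of_int m * 2 * pi"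
      using cos_one_2pi_int[of "2 * pi * of_int d / real M"] by (auto simp: mult_ac)
    then have "real_of_int d = of_int m * real M" using assms(1) by (simp add: field_simps)
    then have d: "d = m * int M" by (metis of_int_eq_iff of_int_mult of_int_of_nat_eq)
    then have "\<bar>m\<bar> \<ge> 1" using assms(3) by auto
    then have "int M \<le> \<bar>d\<bar>" unfolding d abs_mult using mult_right_mono[of 1 "\<bar>m\<bar>" "int M"] by simp
    then show False using assms(2) by simp
  qed
  moreover have "?z ^ M = 1"
  proof -
    have "?z ^ M = cis (2 * pi * of_int d)" using assms(1) by (simp add: Complex.DeMoivre)
    also have "\<dots> = 1" by (rule cis_multiple_2pi) simp
    finally show ?thesis .
  qed
  ultimately have "(\<Sum>r<M. ?z ^ r) = 0" by (simp add: geometric_sum)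
  then show ?thesis by (simp only: pw)
qed

lemma card_difference:
  fixes n :: nat and d :: int
  shows "card {(a, b). a < n \<and> b < n \<and> int a - int b = d} = nat (int n - \<bar>d\<bar>)"
proof (cases "d \<ge> 0")
  case True
  have "{(a, b). a < n \<and> b < n \<and> int a - int b = d} = (\<lambda>b. (b + nat d, b)) ` {..<n - nat d}"
    using True by (auto simp: image_iff)
  moreover have "inj_on (\<lambda>b. (b + nat d, b)) {..<n - nat d}" by (auto simp: inj_on_def)
  ultimately show ?thesis using True by (simp add: card_image nat_diff_distrib')
next
  case False
  have "{(a, b). a < n \<and> b < n \<and> int a - int b = d} = (\<lambda>a. (a, a + nat (- d))) ` {..<n - nat (- d)}"
    using False by (auto simp: image_iff)
  moreover have "inj_on (\<lambda>a. (a, a + nat (- d))) {..<n - nat (- d)}" by (auto simp: inj_on_def)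
  ultimately show ?thesis using False by (simp add: card_image nat_diff_distrib')
qed

text \<open>On trigonometric polynomials of degree at most \<open>n\<close> differentiation is a finite combination of translations,
  with weights whose absolute values add up to at most \<open>4 \<pi> n\<close>. The weights are a Fejer kernel modulated by
  \<open>sin (2 \<pi> n r / 4 n)\<close>, sampled at \<open>4 n\<close> points: the modulation shifts the tent-shaped symbol of the Fejer kernel
  to \<open>\<plusminus>n\<close>, and the difference of the two shifted tents is linear on \<open>[-n, n]\<close>.\<close>

definition bernstein_weight :: "nat \<Rightarrow> nat \<Rightarrow> real" where
  "bernstein_weight n r = - (pi / real n) * (cmod (\<Sum>a<n. cis (2 * pi * real a * real r / real (4 * n))))\<^sup>2
     * sin (2 * pi * real n * real r / real (4 * n))"

lemma fejer_expand:
  "complex_of_real ((cmod (\<Sum>a<n. cis (2 * pi * real a * t)))\<^sup>2) =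
    (\<Sum>(a, b)\<in>{..<n} \<times> {..<n}. cis (2 * pi * of_int (int a - int b) * t))"
proof -
  have "complex_of_real ((cmod (\<Sum>a<n. cis (2 * pi * real a * t)))\<^sup>2)
     = (\<Sum>a<n. cis (2 * pi * real a * t)) * (\<Sum>b<n. cis (- (2 * pi * real b * t)))"
    unfolding complex_norm_square by (simp add: cis_cnj)
  also have "\<dots> = (\<Sum>(a, b)\<in>{..<n} \<times> {..<n}. cis (2 * pi * real a * t) * cis (- (2 * pi * real b * t)))"
    by (rule sum_product[unfolded sum.cartesian_product])
  also have "\<dots> = (\<Sum>(a, b)\<in>{..<n} \<times> {..<n}. cis (2 * pi * of_int (int a - int b) * t))"
    by (intro sum.cong refl) (auto simp: cis_mult algebra_simps)
  finally show ?thesis .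
qed

text \<open>Orthogonality of the characters of \<open>\<int>/4n\<close>; all frequencies that occur are smaller than \<open>4 n\<close>, so none is
  aliased to zero.\<close>

lemma fejer_multiplier:
  assumes n: "n \<ge> 1" and d: "\<bar>d\<bar> \<le> 2 * int n"
  shows "(\<Sum>r<4*n. complex_of_real ((cmod (\<Sum>a<n. cis (2 * pi * real a * real r / real (4 * n))))\<^sup>2)
       * cis (- (2 * pi * of_int d * real r / real (4 * n))))
    = of_nat (4 * n * nat (int n - \<bar>d\<bar>))"
proof -
  let ?M = "4 * n"
  let ?A = "{..<n} \<times> {..<n}"
  have "(\<Sum>r<?M. complex_of_real ((cmod (\<Sum>a<n. cis (2 * pi * real a * real r / real ?M)))\<^sup>2)
       * cis (- (2 * pi * of_int d * real r / real ?M)))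
    = (\<Sum>r<?M. \<Sum>p\<in>?A. cis (2 * pi * of_int (int (fst p) - int (snd p) - d) * real r / real ?M))"
  proof (rule sum.cong[OF refl])
    fix r
    show "complex_of_real ((cmod (\<Sum>a<n. cis (2 * pi * real a * real r / real ?M)))\<^sup>2)
       * cis (- (2 * pi * of_int d * real r / real ?M))
      = (\<Sum>p\<in>?A. cis (2 * pi * of_int (int (fst p) - int (snd p) - d) * real r / real ?M))"
      using fejer_expand[of "real r / real ?M" n]
      by (simp add: sum_distrib_right case_prod_unfold cis_mult)
        (intro sum.cong refl, simp add: diff_divide_distrib add_divide_distrib algebra_simps)
  qed
  also have "\<dots> = (\<Sum>p\<in>?A. \<Sum>r<?M. cis (2 * pi * of_int (int (fst p) - int (snd p) - d) * real r / real ?M))"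
    by (rule sum.swap)
  also have "\<dots> = (\<Sum>p\<in>?A. if int (fst p) - int (snd p) = d then of_nat ?M else 0)"
  proof (rule sum.cong[OF refl])
    fix p assume p: "p \<in> ?A"
    show "(\<Sum>r<?M. cis (2 * pi * of_int (int (fst p) - int (snd p) - d) * real r / real ?M))
      = (if int (fst p) - int (snd p) = d then of_nat ?M else 0)"
    proof (cases "int (fst p) - int (snd p) = d")
      case False
      have "\<bar>int (fst p) - int (snd p) - d\<bar> < int ?M" using p d n by (auto simp: mem_Times_iff)
      then show ?thesis using cis_sum_zero[of ?M "int (fst p) - int (snd p) - d"] False n by simp
    qed simp
  qed
  also have "\<dots> = (\<Sum>p\<in>{(a, b). a < n \<and> b < n \<and> int a - int b = d}. of_nat ?M)"
    by (rule sum.mono_neutral_cong_right) auto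
  also have "\<dots> = of_nat (?M * nat (int n - \<bar>d\<bar>))"
    by (simp add: card_difference)
  finally show ?thesis .
qed

lemma bernstein_weight_sum:
  assumes "n \<ge> 1" shows "(\<Sum>r<4*n. \<bar>bernstein_weight n r\<bar>) \<le> 4 * pi * real n"
proof -
  let ?S = "\<lambda>r. (cmod (\<Sum>a<n. cis (2 * pi * real a * real r / real (4 * n))))\<^sup>2"
  have "complex_of_real (\<Sum>r<4*n. ?S r) = complex_of_real (real (4 * n * n))"
    using fejer_multiplier[OF assms, of 0] by simp
  then have S: "(\<Sum>r<4*n. ?S r) = real (4 * n * n)" by (simp only: of_real_eq_iff)
  have "(\<Sum>r<4*n. \<bar>bernstein_weight n r\<bar>) \<le> (\<Sum>r<4*n. pi / real n * ?S r)"
  proof (rule sum_mono)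
    fix r
    have "\<bar>bernstein_weight n r\<bar> = pi / real n * ?S r * \<bar>sin (2 * pi * real n * real r / real (4 * n))\<bar>"
      by (simp add: bernstein_weight_def abs_mult)
    also have "\<dots> \<le> pi / real n * ?S r * 1" by (intro mult_left_mono abs_sin_le_one) simp
    finally show "\<bar>bernstein_weight n r\<bar> \<le> pi / real n * ?S r" by simp
  qed
  also have "\<dots> = 4 * pi * real n" unfolding sum_distrib_left[symmetric] S using assms by simp
  finally show ?thesis .
qed

lemma bernstein_weight_multiplier:
  assumes n: "n \<ge> 1" and k: "\<bar>k\<bar> \<le> int n"
  shows "(\<Sum>r<4*n. complex_of_real (bernstein_weight n r) * cis (- (2 * pi * of_int k * real r / real (4 * n))))
    = 2 * pi * \<i> * of_int k"
proof -
  let ?M = "4 * n"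
  let ?S = "\<lambda>r. complex_of_real ((cmod (\<Sum>a<n. cis (2 * pi * real a * real r / real ?M)))\<^sup>2)"
  have s: "complex_of_real (sin x) = - (\<i> / 2) * (cis x - cis (- x))" for x
    by (simp add: complex_eq_iff)
  have "(\<Sum>r<?M. complex_of_real (bernstein_weight n r) * cis (- (2 * pi * of_int k * real r / real ?M)))
    = (\<Sum>r<?M. \<i> * pi / (2 * of_nat n) * (?S r * cis (- (2 * pi * of_int (k - int n) * real r / real ?M))
        - ?S r * cis (- (2 * pi * of_int (k + int n) * real r / real ?M))))"
  proof (rule sum.cong[OF refl])
    fix r
    let ?x = "2 * pi * real n * real r / real ?M" and ?y = "- (2 * pi * of_int k * real r / real ?M)"
    have bw: "complex_of_real (bernstein_weight n r) = - (pi / of_nat n) * ?S r * (- (\<i> / 2) * (cis ?x - cis (- ?x)))"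
      unfolding bernstein_weight_def of_real_mult s by simp
    have alg: "- (p / N) * S * (- (\<i> / 2) * (X - Y)) * Z = \<i> * p / (2 * N) * (S * (X * Z) - S * (Y * Z))"
      for p N S X Y Z :: complex by (cases "N = 0") (simp_all add: field_simps)
    have "complex_of_real (bernstein_weight n r) * cis ?y
       = \<i> * pi / (2 * of_nat n) * (?S r * (cis ?x * cis ?y) - ?S r * (cis (- ?x) * cis ?y))"
      unfolding bw of_real_minus of_real_divide of_real_of_nat_eq by (rule alg)
    also have "cis ?x * cis ?y = cis (- (2 * pi * of_int (k - int n) * real r / real ?M))"
      unfolding cis_mult by (rule arg_cong[where f = cis]) (simp add: diff_divide_distrib algebra_simps)
    also have "cis (- ?x) * cis ?y = cis (- (2 * pi * of_int (k + int n) * real r / real ?M))"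
      unfolding cis_mult by (rule arg_cong[where f = cis]) (simp add: add_divide_distrib algebra_simps)
    finally show "complex_of_real (bernstein_weight n r) * cis ?y
       = \<i> * pi / (2 * of_nat n) * (?S r * cis (- (2 * pi * of_int (k - int n) * real r / real ?M))
        - ?S r * cis (- (2 * pi * of_int (k + int n) * real r / real ?M)))" .
  qed
  also have "\<dots> = \<i> * pi / (2 * of_nat n) * (of_nat (?M * nat (int n - \<bar>k - int n\<bar>)) - of_nat (?M * nat (int n - \<bar>k + int n\<bar>)))"
    unfolding sum_distrib_left[symmetric] sum_subtractf
    using fejer_multiplier[OF n, of "k - int n"] fejer_multiplier[OF n, of "k + int n"] k by simp
  also have "of_nat (?M * nat (int n - \<bar>k - int n\<bar>)) - of_nat (?M * nat (int n - \<bar>k + int n\<bar>)) = complex_of_real (real ?M * of_int k)"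
  proof -
    have "real (nat (int n - \<bar>k - int n\<bar>)) - real (nat (int n - \<bar>k + int n\<bar>)) = of_int k"
      using k by (cases "k \<ge> 0") auto
    then have "real (?M * nat (int n - \<bar>k - int n\<bar>)) - real (?M * nat (int n - \<bar>k + int n\<bar>)) = real ?M * of_int k"
      unfolding of_nat_mult[of ?M] right_diff_distrib[symmetric] by (simp only:)
    moreover have "of_nat X - of_nat Y = complex_of_real (real X - real Y)" for X Y by simp
    ultimately show ?thesis by (simp only:)
  qed
  also have "\<i> * pi / (2 * of_nat n) * complex_of_real (real ?M * of_int k) = 2 * pi * \<i> * of_int k"
    using n by simp
  finally show ?thesis .
qed

lemma bernstein_wave:
  assumes n: "n \<ge> 1" and k: "\<bar>k $ i\<bar> \<le> int n"
  shows "partial i (wave k \<tau>) x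
    = (\<Sum>r<4*n. bernstein_weight n r * wave k \<tau> (x + (- (real r / real (4 * n))) *\<^sub>R axis i 1))"
proof -
  let ?A = "2 * pi * (freq k \<bullet> x) + \<tau>"
  have w: "wave k \<tau> (x + (- t) *\<^sub>R axis i 1) = Re (cis ?A * cis (- (2 * pi * of_int (k $ i) * t)))" for t
  proof -
    have eq: "2 * pi * (freq k \<bullet> (x + (- t) *\<^sub>R axis i 1)) + \<tau> = ?A + - (2 * pi * of_int (k $ i) * t)"
      by (simp add: inner_add_right inner_axis freq_def algebra_simps)
    show ?thesis by (simp only: wave_def cis_mult eq cis.simps)
  qed
  have "(\<Sum>r<4*n. bernstein_weight n r * wave k \<tau> (x + (- (real r / real (4 * n))) *\<^sub>R axis i 1))
    = (\<Sum>r<4*n. Re (cis ?A * (complex_of_real (bernstein_weight n r) * cis (- (2 * pi * of_int (k $ i) * real r / real (4 * n))))))"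
  proof (rule sum.cong[OF refl])
    fix r
    show "bernstein_weight n r * wave k \<tau> (x + (- (real r / real (4 * n))) *\<^sub>R axis i 1)
      = Re (cis ?A * (complex_of_real (bernstein_weight n r) * cis (- (2 * pi * of_int (k $ i) * real r / real (4 * n)))))"
      unfolding w by (simp add: algebra_simps)
  qed
  also have "\<dots> = Re (cis ?A * (2 * pi * \<i> * of_int (k $ i)))"
    unfolding Re_sum[symmetric] sum_distrib_left[symmetric] bernstein_weight_multiplier[OF n k] ..
  also have "\<dots> = - 2 * pi * of_int (k $ i) * sin ?A" by simp
  also have "\<dots> = partial i (wave k \<tau>) x"
    unfolding partial_wave wave_def add.assoc[symmetric] cos_add[of ?A "pi / 2"] by simp
  finally show ?thesis by simp
qed

theorem bernstein_N3:
  assumes n: "n \<ge> 1" and A: "\<And>m. m \<in> A \<Longrightarrow> \<bar>k m $ i\<bar> \<le> int n"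
    and g: "g = (\<lambda>x. \<Sum>m\<in>A. c m * wave (k m) (\<tau> m) x)"
  shows "N3 (partial i g) \<le> 4 * pi * real n * N3 g"
proof -
  let ?z = "\<lambda>r. (- (real r / real (4 * n))) *\<^sub>R axis i (1::real)"
  have sg: "sper g" unfolding g by (intro sper_intros)
  have "partial i g x = (\<Sum>r<4*n. bernstein_weight n r * g (x + ?z r))" for x
  proof -
    have "partial i g x = (\<Sum>m\<in>A. c m * partial i (wave (k m) (\<tau> m)) x)"
      unfolding g by (subst partial_sum) (auto intro: smooth_cmult smooth_wave simp: partial_cmult smooth_wave)
    also have "\<dots> = (\<Sum>m\<in>A. \<Sum>r<4*n. bernstein_weight n r * (c m * wave (k m) (\<tau> m) (x + ?z r)))"
      by (intro sum.cong refl) (simp only: bernstein_wave[OF n A] sum_distrib_left mult_ac)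
    also have "\<dots> = (\<Sum>r<4*n. \<Sum>m\<in>A. bernstein_weight n r * (c m * wave (k m) (\<tau> m) (x + ?z r)))"
      by (rule sum.swap)
    finally show ?thesis unfolding g by (simp only: sum_distrib_left)
  qed
  then have "N3 (partial i g) = N3 (\<lambda>x. \<Sum>r<4*n. bernstein_weight n r * g (x + ?z r))" by presburger
  also have "\<dots> \<le> (\<Sum>r<4*n. N3 (\<lambda>x. bernstein_weight n r * g (x + ?z r)))"
    by (intro minkowski3_sum L3_cmult sper_L3 sper_intros sg)
  also have "\<dots> = (\<Sum>r<4*n. \<bar>bernstein_weight n r\<bar> * N3 g)"
    by (simp only: N3_cmult N3_translation[OF sper_cper[OF sg]])
  also have "\<dots> \<le> 4 * pi * real n * N3 g"
    unfolding sum_distrib_right[symmetric] by (intro mult_right_mono bernstein_weight_sum n N3_nonneg)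
  finally show ?thesis .
qed

section \<open>Completeness\<close>

text \<open>The argument of Riesz and Fischer.\<close>

lemma L3_series:
  assumes L: "\<And>j. L3 (F j)" and sm: "summable (\<lambda>j. N3 (F j))"
  obtains g where "L3 g" "(\<lambda>n. N3 (\<lambda>x. (\<Sum>j<n. F j x) - g x)) \<longlonglongrightarrow> 0"
proof -
  let ?T = "\<Sum>j. N3 (F j)"
  note [measurable] = L[THEN L3_measurable]
  define h where "h n x = (\<Sum>j<n. \<bar>F j x\<bar>)" for n x
  have Lh: "L3 (h n)" for n unfolding h_def by (intro L3_sum L3_abs L)
  have hpos: "h n x \<ge> 0" for n x unfolding h_def by (intro sum_nonneg) auto
  have hm: "h n x \<le> h m x" if "n \<le> m" for n m x
    unfolding h_def using that by (intro sum_mono2) auto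
  have hN: "(LINT x|torus. h n x ^ 3) \<le> ?T ^ 3" for n
  proof -
    have "N3 (h n) \<le> (\<Sum>j<n. N3 (F j))" unfolding h_def
      using minkowski3_sum[of "{..<n}" "\<lambda>j x. \<bar>F j x\<bar>"] L3_abs[OF L] by (simp add: N3_abs)
    also have "\<dots> \<le> ?T" by (rule sum_le_suminf[OF sm]) (auto simp: N3_nonneg)
    finally have "N3 (h n) ^ 3 \<le> ?T ^ 3" by (intro power_mono N3_nonneg)
    then show ?thesis unfolding N3_cube using hpos by simp
  qed
  have ih: "integrable torus (\<lambda>x. h n x ^ 3)" for n using Lh[of n] hpos by (simp add: L3_def)
  \<comment> \<open>The limit of the partial sums of absolute values is finite almost everywhere and cube-integrable.\<close>
  have mono: "AE x in torus. mono (\<lambda>n. h n x ^ 3)"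
    by (rule AE_I2, rule monoI, rule power_mono[OF hm hpos])
  have conv: "AE x in torus. summable (\<lambda>j. \<bar>F j x\<bar>)"
  proof -
    let ?H = "\<lambda>x. SUP n. ennreal (h n x ^ 3)"
    have "(\<integral>\<^sup>+x. ?H x \<partial>torus) = (SUP n. \<integral>\<^sup>+x. ennreal (h n x ^ 3) \<partial>torus)"
    proof (rule nn_integral_monotone_convergence_SUP)
      show "incseq (\<lambda>n x. ennreal (h n x ^ 3))"
        unfolding incseq_def le_fun_def by (intro allI impI ennreal_leI power_mono[OF hm hpos])
      show "(\<lambda>x. ennreal (h n x ^ 3)) \<in> borel_measurable torus" for n
        using ih[of n] by measurable
    qed
    also have "\<dots> \<le> ennreal (?T ^ 3)"
      by (rule SUP_least) (simp add: nn_integral_eq_integral[OF ih] hpos hN ennreal_leI)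
    finally have "(\<integral>\<^sup>+x. ?H x \<partial>torus) \<noteq> \<infinity>" 
      using ennreal_less_top[of "?T ^ 3"] by (metis infinity_ennreal_def not_le)
    then have "AE x in torus. ?H x \<noteq> \<infinity>"
    proof (rule nn_integral_PInf_AE[rotated])
      have "(\<lambda>x. ennreal (h n x ^ 3)) \<in> borel_measurable torus" for n using ih[of n] by measurable
      then show "?H \<in> borel_measurable torus" by (intro borel_measurable_SUP) auto
    qed
    then show ?thesis
    proof eventually_elim
      fix x assume "?H x \<noteq> \<infinity>"
      then obtain B where B: "?H x = ennreal B" "B \<ge> 0"
        by (metis ennreal_cases infinity_ennreal_def)
      have "h n x \<le> B + 1" for n
      proof (rule ccontr)
        assume "\<not> h n x \<le> B + 1"
        then have gt: "h n x > B + 1" by simp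
        have "ennreal (h n x ^ 3) \<le> ennreal B" unfolding B(1)[symmetric] by (rule SUP_upper) simp
        then have "h n x ^ 3 \<le> B" using B(2) by simp
        moreover have "h n x * 1 \<le> h n x * (h n x)\<^sup>2" using gt B(2) by (intro mult_left_mono) (auto intro: one_le_power)
        ultimately show False using gt by (simp add: power3_eq_cube power2_eq_square)
      qed
      have "(\<Sum>j\<le>n. \<bar>F j x\<bar>) \<le> B + 1" for n
        using \<open>h (Suc n) x \<le> B + 1\<close> by (simp add: h_def lessThan_Suc_atMost)
      then show "summable (\<lambda>j. \<bar>F j x\<bar>)"
        by (intro bounded_imp_summable[of "\<lambda>j. \<bar>F j x\<bar>" "B + 1"]) simp_all
    qed
  qed
  define G where "G x = (\<Sum>j. \<bar>F j x\<bar>)" for x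
  define g where "g x = (\<Sum>j. F j x)" for x
  have mG: "G \<in> borel_measurable torus" unfolding G_def by measurable
  have mg: "g \<in> borel_measurable torus" unfolding g_def by measurable
  have hG: "AE x in torus. (\<lambda>n. h n x ^ 3) \<longlonglongrightarrow> G x ^ 3"
    using conv
  proof eventually_elim
    fix x assume "summable (\<lambda>j. \<bar>F j x\<bar>)"
    from tendsto_power[OF summable_LIMSEQ[OF this], of 3]
    show "(\<lambda>n. h n x ^ 3) \<longlonglongrightarrow> G x ^ 3" by (simp add: h_def G_def)
  qed
  have inc: "incseq (\<lambda>n. LINT x|torus. h n x ^ 3)"
    by (rule incseq_SucI, rule integral_mono[OF ih ih]) (intro power_mono hm hpos, simp)
  obtain l where l: "(\<lambda>n. LINT x|torus. h n x ^ 3) \<longlonglongrightarrow> l"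
    using incseq_convergent[OF inc allI[OF hN]] by metis
  have iG: "integrable torus (\<lambda>x. G x ^ 3)"
    by (rule integrable_monotone_convergence[OF ih mono hG l]) (use mG in measurable)
  have le: "AE x in torus. \<forall>n. \<bar>(\<Sum>j<n. F j x) - g x\<bar> ^ 3 \<le> G x ^ 3"
    using conv
  proof eventually_elim
    fix x assume s: "summable (\<lambda>j. \<bar>F j x\<bar>)"
    show "\<forall>n. \<bar>(\<Sum>j<n. F j x) - g x\<bar> ^ 3 \<le> G x ^ 3"
    proof (rule allI, rule power_mono)
      fix n
      have "g x - (\<Sum>j<n. F j x) = (\<Sum>j. F (j + n) x)"
        unfolding g_def using suminf_split_initial_segment[OF summable_rabs_cancel[OF s], of n] by simp
      then have "\<bar>(\<Sum>j<n. F j x) - g x\<bar> = \<bar>\<Sum>j. F (j + n) x\<bar>" by simp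
      also have "\<dots> \<le> (\<Sum>j. \<bar>F (j + n) x\<bar>)" by (rule summable_rabs) (use s in \<open>simp add: summable_iff_shift[of "\<lambda>j. \<bar>F j x\<bar>"]\<close>)
      also have "\<dots> \<le> G x" unfolding G_def
        using suminf_split_initial_segment[OF s, of n] sum_nonneg[of "{..<n}" "\<lambda>j. \<bar>F j x\<bar>"] by simp
      finally show "\<bar>(\<Sum>j<n. F j x) - g x\<bar> \<le> G x" .
    qed simp
  qed
  have lim: "(\<lambda>n. LINT x|torus. \<bar>(\<Sum>j<n. F j x) - g x\<bar> ^ 3) \<longlonglongrightarrow> (LINT x|torus. 0)"
  proof (rule integral_dominated_convergence[OF _ _ iG])
    show "(\<lambda>x. \<bar>(\<Sum>j<n. F j x) - g x\<bar> ^ 3) \<in> borel_measurable torus" for n using mg by measurable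
    show "AE x in torus. norm (\<bar>(\<Sum>j<n. F j x) - g x\<bar> ^ 3) \<le> G x ^ 3" for n
      using le by eventually_elim simp
    show "AE x in torus. (\<lambda>n. \<bar>(\<Sum>j<n. F j x) - g x\<bar> ^ 3) \<longlonglongrightarrow> 0"
    proof (rule AE_mp[OF conv AE_I2], rule impI)
      fix x assume "summable (\<lambda>j. \<bar>F j x\<bar>)"
      then have "(\<lambda>n. \<Sum>j<n. F j x) \<longlonglongrightarrow> g x" unfolding g_def
        by (rule summable_LIMSEQ[OF summable_rabs_cancel])
      then have "(\<lambda>n. \<bar>(\<Sum>j<n. F j x) - g x\<bar> ^ 3) \<longlonglongrightarrow> \<bar>g x - g x\<bar> ^ 3"
        by (intro tendsto_power tendsto_rabs tendsto_diff tendsto_const)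
      then show "(\<lambda>n. \<bar>(\<Sum>j<n. F j x) - g x\<bar> ^ 3) \<longlonglongrightarrow> 0" by simp
    qed
  qed simp
  have Lg: "L3 g"
  proof -
    have "integrable torus (\<lambda>x. \<bar>g x\<bar> ^ 3)"
    proof (rule Bochner_Integration.integrable_bound[OF iG])
      show "(\<lambda>x. \<bar>g x\<bar> ^ 3) \<in> borel_measurable torus" using mg by measurable
      show "AE x in torus. norm (\<bar>g x\<bar> ^ 3) \<le> norm (G x ^ 3)"
        using le by eventually_elim (auto dest: spec[of _ 0])
    qed
    then show ?thesis using mg by (simp add: L3_def)
  qed
  show thesis
  proof (rule that[OF Lg])
    show "(\<lambda>n. N3 (\<lambda>x. (\<Sum>j<n. F j x) - g x)) \<longlonglongrightarrow> 0"
      using tendsto_real_root[OF lim, of 3] by (simp add: N3_def)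
  qed
qed

section \<open>Besov functions have a cube-integrable gradient\<close>

abbreviation fcoeff :: "(real^3 \<Rightarrow> real) \<Rightarrow> int^3 \<Rightarrow> real \<Rightarrow> real" where
  "fcoeff g k \<tau> \<equiv> (LINT y|torus. wave k \<tau> y * g y)"

definition freqs :: "real \<Rightarrow> (int^3) set" where
  "freqs R = {k. norm (freq k) \<le> R}"

abbreviation phases :: "real set" where "phases \<equiv> {0, - pi / 2}"

text \<open>The real part of a component of a dyadic block, as a finite sum of waves.\<close>

definition real_block :: "(real^3 \<Rightarrow> real) \<Rightarrow> nat \<Rightarrow> (real^3 \<Rightarrow> real) \<Rightarrow> real^3 \<Rightarrow> real" where
  "real_block \<theta> j g x = (\<Sum>p\<in>freqs (2 ^ Suc j) \<times> phases.
     (dyadic_symbol \<theta> j (freq (fst p)) * fcoeff g (fst p) (snd p)) * wave (fst p) (snd p) x)"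

lemma freqs_component: "k \<in> freqs R \<Longrightarrow> \<bar>real_of_int (k $ i)\<bar> \<le> R"
  using component_le_norm_cart[of "freq k" i] by (simp add: freqs_def freq_def)

lemma finite_freqs: "finite (freqs R)"
proof -
  let ?I = "{- \<lceil>R\<rceil>..\<lceil>R\<rceil>}"
  have "(\<lambda>k. (k $ 1, k $ 2, k $ 3)) ` freqs R \<subseteq> ?I \<times> ?I \<times> ?I"
  proof (clarsimp, intro conjI)
    fix k assume k: "k \<in> freqs R"
    have "- \<lceil>R\<rceil> \<le> k $ i" "k $ i \<le> \<lceil>R\<rceil>" for i
      using freqs_component[OF k, of i] by linarith+
    then show "- \<lceil>R\<rceil> \<le> k $ 1" "k $ 1 \<le> \<lceil>R\<rceil>" "- \<lceil>R\<rceil> \<le> k $ 2" "k $ 2 \<le> \<lceil>R\<rceil>" "- \<lceil>R\<rceil> \<le> k $ 3" "k $ 3 \<le> \<lceil>R\<rceil>"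
      by blast+
  qed
  then have "finite ((\<lambda>k. (k $ 1, k $ 2, k $ 3)) ` freqs R)" by (rule finite_subset) simp
  moreover have "inj_on (\<lambda>k. (k $ 1, k $ 2, k $ 3)) (freqs R)"
    by (auto simp: inj_on_def vec_eq_iff forall_3)
  ultimately show ?thesis by (rule finite_imageD)
qed

lemma dyadic_symbol_support:
  assumes "dyadic_cutoff \<theta>" "k \<notin> freqs (2 ^ Suc j)" shows "dyadic_symbol \<theta> j (freq k) = 0"
proof -
  have n: "norm (freq k) > 2 ^ Suc j" using assms(2) by (simp add: freqs_def)
  have z: "\<theta> (freq k /\<^sub>R 2 ^ m) = 0" if "m \<le> j" for m
  proof -
    have "(2::real) ^ Suc m \<le> 2 ^ Suc j" using that by (intro power_increasing) auto
    then have "2 ^ Suc m \<le> norm (freq k)" using n by linarith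
    then have "2 \<le> norm (freq k /\<^sub>R 2 ^ m)" by (simp add: field_simps)
    then show ?thesis using assms(1) by (simp add: dyadic_cutoff_def)
  qed
  show ?thesis using z[of 0] z[of j] z[of "j - 1"] by (simp add: dyadic_symbol_def)
qed

lemma sum_dyadic_symbol: "(\<Sum>j<Suc J. dyadic_symbol \<theta> j \<xi>) = \<theta> (\<xi> /\<^sub>R 2 ^ J)"
  by (induction J) (simp_all add: dyadic_symbol_def)

lemma sper_real_block: "sper (real_block \<theta> j g)"
  unfolding real_block_def[abs_def] by (intro sper_intros)

lemma character_wave: "character k x = Complex (wave k 0 x) (wave k (- pi / 2) x)"
proof -
  have "(\<Sum>i\<in>UNIV. of_int (k $ i) * x $ i) = freq k \<bullet> x" by (simp add: inner_vec_def freq_def)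
  then show ?thesis
    using cos_diff[of "2 * pi * (freq k \<bullet> x)" "pi / 2"] by (simp add: character_def wave_def complex_eq_iff)
qed

lemma fourier_coeff_wave:
  assumes g: "integrable torus (\<lambda>x. f x $ c)"
  shows "fourier_coeff f k $ c = Complex (fcoeff (\<lambda>x. f x $ c) k 0) (- fcoeff (\<lambda>x. f x $ c) k (- pi / 2))"
proof -
  have i: "integrable torus (\<lambda>x. wave k \<tau> x * f x $ c)" for \<tau>
    by (rule integrable_cper_mult[OF sper_cper[OF sper_intros(2)] g])
  have "complex_of_real (f x $ c) * cnj (character k x)
     = complex_of_real (wave k 0 x * f x $ c) - \<i> * complex_of_real (wave k (- pi / 2) x * f x $ c)" for x
    by (simp add: character_wave complex_eq_iff)
  then have "fourier_coeff f k $ c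
     = (LINT x|torus. complex_of_real (wave k 0 x * f x $ c) - \<i> * complex_of_real (wave k (- pi / 2) x * f x $ c))"
    by (simp only: fourier_coeff_def vec_lambda_beta)
  also have "\<dots> = complex_of_real (fcoeff (\<lambda>x. f x $ c) k 0) - \<i> * complex_of_real (fcoeff (\<lambda>x. f x $ c) k (- pi / 2))"
    using i by (simp only: Bochner_Integration.integral_diff integrable_of_real integrable_mult_right
        Bochner_Integration.integral_mult_right_zero integral_complex_of_real)
  finally show ?thesis by (simp add: complex_eq_iff)
qed

lemma Re_dyadic_block:
  assumes \<theta>: "dyadic_cutoff \<theta>" and g: "integrable torus (\<lambda>x. f x $ c)"
  shows "Re (dyadic_block \<theta> j f x $ c) = real_block \<theta> j (\<lambda>x. f x $ c) x"
proof -
  let ?K = "freqs (2 ^ Suc j)"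
  let ?t = "\<lambda>k. (complex_of_real (dyadic_symbol \<theta> j (freq k)) * character k x) *s fourier_coeff f k"
  have "dyadic_block \<theta> j f x = infsum ?t UNIV" by (simp add: dyadic_block_def freq_def)
  also have "\<dots> = infsum ?t ?K"
    by (rule infsum_cong_neutral) (auto simp: dyadic_symbol_support[OF \<theta>])
  also have "\<dots> = sum ?t ?K" by (rule infsum_finite[OF finite_freqs])
  finally have "dyadic_block \<theta> j f x $ c = (\<Sum>k\<in>?K. (complex_of_real (dyadic_symbol \<theta> j (freq k)) * character k x) * fourier_coeff f k $ c)"
    by (simp add: sum_component)
  then have "Re (dyadic_block \<theta> j f x $ c)
    = (\<Sum>k\<in>?K. Re ((complex_of_real (dyadic_symbol \<theta> j (freq k)) * character k x) * fourier_coeff f k $ c))" by simp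
  also have "\<dots> = (\<Sum>k\<in>?K. \<Sum>\<tau>\<in>phases. (dyadic_symbol \<theta> j (freq k) * fcoeff (\<lambda>x. f x $ c) k \<tau>) * wave k \<tau> x)"
    by (intro sum.cong refl) (simp add: fourier_coeff_wave[OF g] character_wave algebra_simps)
  finally show ?thesis unfolding real_block_def by (simp only: sum.cartesian_product case_prod_unfold)
qed

lemma Lp3_N3:
  assumes h: "Lp_norm 3 h < \<infinity>" and g: "g \<in> borel_measurable torus" and le: "\<And>x. \<bar>g x\<bar> \<le> norm (h x)"
  shows "L3 g" "N3 g \<le> enn2real (Lp_norm 3 h)"
proof -
  let ?n = "\<integral>\<^sup>+x. ennreal (norm (h x) powr 3) \<partial>torus"
  have eq: "Lp_norm 3 h = ennpowr ?n (1 / 3)" using h by (auto simp: Lp_norm_def split: if_splits)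
  have fin: "?n < \<infinity>"
  proof (rule ccontr)
    assume "\<not> ?n < \<infinity>"
    then have "?n = \<infinity>" by (metis infinity_ennreal_def less_top)
    then show False using h unfolding eq ennpowr_def by simp
  qed
  have val: "enn2real (Lp_norm 3 h) = enn2real ?n powr (1 / 3)"
    unfolding eq using fin by (auto simp: ennpowr_def)
  have le3: "(\<integral>\<^sup>+x. ennreal (\<bar>g x\<bar> ^ 3) \<partial>torus) \<le> ?n"
    by (rule nn_integral_mono) (auto intro!: ennreal_leI power_mono le)
  have m: "(\<lambda>x. \<bar>g x\<bar> ^ 3) \<in> borel_measurable torus" using g by measurable
  have int: "integrable torus (\<lambda>x. \<bar>g x\<bar> ^ 3)"
    using m le3 fin by (intro integrableI_bounded) (auto simp: power_abs intro: le_less_trans)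
  then show "L3 g" using g by (simp add: L3_def)
  have "(LINT x|torus. \<bar>g x\<bar> ^ 3) = enn2real (\<integral>\<^sup>+x. ennreal (\<bar>g x\<bar> ^ 3) \<partial>torus)"
    by (rule integral_eq_nn_integral[OF m]) auto
  also have "\<dots> \<le> enn2real ?n" using le3 fin by (intro enn2real_mono) auto
  finally have "N3 g ^ 3 \<le> (enn2real ?n powr (1 / 3)) ^ 3"
    unfolding N3_cube by (simp add: powr_powr flip: powr_numeral)
  then have "N3 g \<le> enn2real ?n powr (1 / 3)"
    using power_le_imp_le_base[of "N3 g" 2 "enn2real ?n powr (1 / 3)"] by (simp add: numeral_3_eq_3)
  then show "N3 g \<le> enn2real (Lp_norm 3 h)" unfolding val .
qed

lemma besov_block_bound:
  assumes \<theta>: "dyadic_cutoff \<theta>" and fin: "besov_infinity_norm \<theta> s 3 f < \<infinity>"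
  shows "integrable torus (\<lambda>x. f x $ c)"
    and "N3 (real_block \<theta> j (\<lambda>x. f x $ c)) \<le> enn2real (besov_infinity_norm \<theta> s 3 f) * 2 powr (- (real j * s))"
proof -
  let ?B = "besov_infinity_norm \<theta> s 3 f" and ?h = "dyadic_block \<theta> j f"
  have ti: "torus_integrable f" using fin by (auto simp: besov_infinity_norm_def split: if_splits)
  then show g: "integrable torus (\<lambda>x. f x $ c)"
    by (auto simp: torus_integrable_def intro: integrable_bounded_linear[OF bounded_linear_vec_nth])
  have le: "ennreal (2 powr (real j * s)) * Lp_norm 3 ?h \<le> ?B"
    using ti by (auto simp: besov_infinity_norm_def intro: SUP_upper2)
  then have "ennreal (2 powr (real j * s)) * Lp_norm 3 ?h < \<infinity>" using fin by (rule le_less_trans)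
  then have Lf: "Lp_norm 3 ?h < \<infinity>"
    by (auto simp: ennreal_mult_less_top less_top)
  have "norm (?h x $ c) \<le> norm (?h x)" for x by (rule Finite_Cartesian_Product.norm_nth_le)
  then have "\<bar>real_block \<theta> j (\<lambda>x. f x $ c) x\<bar> \<le> norm (?h x)" for x
    unfolding Re_dyadic_block[OF \<theta> g, symmetric] using abs_Re_le_cmod order_trans by blast
  from Lp3_N3(2)[OF Lf L3_measurable[OF sper_L3[OF sper_real_block]] this]
  have N: "N3 (real_block \<theta> j (\<lambda>x. f x $ c)) \<le> enn2real (Lp_norm 3 ?h)" .
  have "2 powr (real j * s) * enn2real (Lp_norm 3 ?h) \<le> enn2real ?B"
    using enn2real_mono[OF le] fin by (simp add: enn2real_mult)
  then have "enn2real (Lp_norm 3 ?h) \<le> enn2real ?B * 2 powr (- (real j * s))"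
    by (simp add: powr_minus field_simps)
  with N show "N3 (real_block \<theta> j (\<lambda>x. f x $ c)) \<le> enn2real ?B * 2 powr (- (real j * s))" by linarith
qed

lemma wave_mean: "(LINT x|torus. wave k \<tau> x) = (if k = 0 then cos \<tau> else 0)"
proof (cases "k = 0")
  case True
  then have "wave k \<tau> x = cos \<tau>" for x by (simp add: wave_def freq_def inner_vec_def)
  then show ?thesis using True measure_torus by simp
next
  case False
  then obtain i where i: "k $ i \<noteq> 0" by (auto simp: vec_eq_iff)
  have "wave k \<tau> x = (1 / (2 * pi * of_int (k $ i))) * partial i (wave k (\<tau> - pi / 2)) x" for x
    using i by (simp add: partial_wave)
  then have "(LINT x|torus. wave k \<tau> x) = (1 / (2 * pi * of_int (k $ i))) * (LINT x|torus. partial i (wave k (\<tau> - pi / 2)) x)"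
    by (simp only: Bochner_Integration.integral_mult_right_zero)
  then show ?thesis using False torus_partial_zero[OF sper_intros(2)] by simp
qed

lemma wave_orthogonality:
  "(LINT x|torus. wave q \<sigma> x * wave k \<tau> x) = (if k = - q then cos (\<sigma> + \<tau>) / 2 else 0) + (if k = q then cos (\<sigma> - \<tau>) / 2 else 0)"
proof -
  have freq_add: "freq (q + k) = freq q + freq k" "freq (q - k) = freq q - freq k"
    by (auto simp: freq_def vec_eq_iff)
  have "wave q \<sigma> x * wave k \<tau> x = wave (q + k) (\<sigma> + \<tau>) x / 2 + wave (q - k) (\<sigma> - \<tau>) x / 2" for x
  proof -
    have cc: "cos a * cos b = cos (a + b) / 2 + cos (a - b) / 2" for a b :: real
      by (simp add: cos_add cos_diff add_divide_distrib diff_divide_distrib)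
    have e: "2 * pi * ((freq q + freq k) \<bullet> x) + (\<sigma> + \<tau>) = (2 * pi * (freq q \<bullet> x) + \<sigma>) + (2 * pi * (freq k \<bullet> x) + \<tau>)"
      "2 * pi * ((freq q - freq k) \<bullet> x) + (\<sigma> - \<tau>) = (2 * pi * (freq q \<bullet> x) + \<sigma>) - (2 * pi * (freq k \<bullet> x) + \<tau>)"
      by (simp_all add: inner_add_left inner_diff_left algebra_simps)
    show ?thesis by (simp only: wave_def cc freq_add e)
  qed
  then have "(LINT x|torus. wave q \<sigma> x * wave k \<tau> x)
     = (LINT x|torus. wave (q + k) (\<sigma> + \<tau>) x) / 2 + (LINT x|torus. wave (q - k) (\<sigma> - \<tau>) x) / 2"
    using cper_integrable[OF sper_cper[OF sper_intros(2)]] by simp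
  moreover have "q + k = 0 \<longleftrightarrow> k = - q" "q - k = 0 \<longleftrightarrow> k = q" by (auto simp: add_eq_0_iff)
  ultimately show ?thesis by (simp add: wave_mean)
qed

text \<open>The dyadic symbols telescope to \<open>\<theta>(2\<^sup>-\<^sup>J \<xi>)\<close>, which is \<open>1\<close> at the frequency \<open>q\<close>. Real waves are not
  orthogonal for \<open>q\<close> and \<open>- q\<close>, hence both frequencies contribute.\<close>

lemma block_sum_coeff:
  assumes \<theta>: "dyadic_cutoff \<theta>" and g: "integrable torus g" and J: "norm (freq q) \<le> 2 ^ J"
  shows "(LINT x|torus. wave q \<sigma> x * (\<Sum>j<Suc J. real_block \<theta> j g x)) = fcoeff g q \<sigma>"
proof -
  let ?K = "freqs (2 ^ Suc J)"
  let ?c = "\<lambda>k. \<theta> (freq k /\<^sub>R 2 ^ J)"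
  have fm: "freq (- q) = - freq q" by (simp add: freq_def vec_eq_iff)
  have "(2::real) ^ J \<le> 2 ^ Suc J" by (intro power_increasing) auto
  then have qK: "q \<in> ?K" "- q \<in> ?K" using J unfolding freqs_def mem_Collect_eq fm norm_minus_cancel by linarith+
  have c1: "?c q = 1" "?c (- q) = 1"
    using \<theta> J unfolding dyadic_cutoff_def fm by (simp_all add: field_simps)
  have w0: "wave (- q) 0 = wave q 0" unfolding wave_def[abs_def] fm by simp
  have w1: "wave (- q) (- pi / 2) = (\<lambda>x. - wave q (- pi / 2) x)"
  proof
    fix x
    show "wave (- q) (- pi / 2) x = - wave q (- pi / 2) x"
      using cos_diff[of "2 * pi * (freq q \<bullet> x)" "pi / 2"] cos_diff[of "- (2 * pi * (freq q \<bullet> x))" "pi / 2"]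
      unfolding wave_def fm by simp
  qed
  have sub: "freqs (2 ^ Suc j) \<subseteq> ?K" if "j < Suc J" for j
  proof -
    have "(2::real) ^ Suc j \<le> 2 ^ Suc J" using that by (intro power_increasing) auto
    then show ?thesis unfolding freqs_def by (auto intro: order_trans)
  qed
  have ext: "real_block \<theta> j g x = (\<Sum>p\<in>?K \<times> phases. (dyadic_symbol \<theta> j (freq (fst p)) * fcoeff g (fst p) (snd p)) * wave (fst p) (snd p) x)"
    if "j < Suc J" for j x
    unfolding real_block_def
  proof (rule sum.mono_neutral_left)
    show "freqs (2 ^ Suc j) \<times> phases \<subseteq> ?K \<times> phases" using sub[OF that] by blast
    show "\<forall>p\<in>?K \<times> phases - freqs (2 ^ Suc j) \<times> phases.
        (dyadic_symbol \<theta> j (freq (fst p)) * fcoeff g (fst p) (snd p)) * wave (fst p) (snd p) x = 0"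
    proof
      fix p assume "p \<in> ?K \<times> phases - freqs (2 ^ Suc j) \<times> phases"
      then have "fst p \<notin> freqs (2 ^ Suc j)" by (metis DiffE mem_Times_iff)
      from dyadic_symbol_support[OF \<theta> this]
      show "(dyadic_symbol \<theta> j (freq (fst p)) * fcoeff g (fst p) (snd p)) * wave (fst p) (snd p) x = 0"
        by simp
    qed
  qed (simp add: finite_freqs)
  have S: "(\<Sum>j<Suc J. real_block \<theta> j g x) = (\<Sum>p\<in>?K \<times> phases. (?c (fst p) * fcoeff g (fst p) (snd p)) * wave (fst p) (snd p) x)" for x
  proof -
    have "(\<Sum>j<Suc J. real_block \<theta> j g x) = (\<Sum>j<Suc J. \<Sum>p\<in>?K \<times> phases. (dyadic_symbol \<theta> j (freq (fst p)) * fcoeff g (fst p) (snd p)) * wave (fst p) (snd p) x)"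
      by (intro sum.cong refl ext) simp
    also have "\<dots> = (\<Sum>p\<in>?K \<times> phases. \<Sum>j<Suc J. (dyadic_symbol \<theta> j (freq (fst p)) * fcoeff g (fst p) (snd p)) * wave (fst p) (snd p) x)"
      by (rule sum.swap)
    finally show ?thesis by (simp only: sum_distrib_right[symmetric] sum_dyadic_symbol)
  qed
  have iw: "integrable torus (\<lambda>x. wave q \<sigma> x * wave k \<tau> x)" for k \<tau>
    by (intro cper_integrable sper_cper sper_intros)
  have "(LINT x|torus. wave q \<sigma> x * (\<Sum>j<Suc J. real_block \<theta> j g x))
     = (LINT x|torus. (\<Sum>p\<in>?K \<times> phases. (?c (fst p) * fcoeff g (fst p) (snd p)) * (wave q \<sigma> x * wave (fst p) (snd p) x)))"
    unfolding S by (simp only: sum_distrib_left) (simp only: mult_ac)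
  also have "\<dots> = (\<Sum>p\<in>?K \<times> phases. (?c (fst p) * fcoeff g (fst p) (snd p)) * (LINT x|torus. wave q \<sigma> x * wave (fst p) (snd p) x))"
    using iw by (simp only: Bochner_Integration.integral_sum integrable_mult_right Bochner_Integration.integral_mult_right_zero)
  also have "\<dots> = (\<Sum>k\<in>?K. \<Sum>\<tau>\<in>phases. (?c k * fcoeff g k \<tau>) * ((if k = - q then cos (\<sigma> + \<tau>) / 2 else 0) + (if k = q then cos (\<sigma> - \<tau>) / 2 else 0)))"
    unfolding wave_orthogonality by (simp only: sum.cartesian_product case_prod_unfold)
  also have "\<dots> = (\<Sum>k\<in>?K. (if k = - q then ?c k * (\<Sum>\<tau>\<in>phases. fcoeff g k \<tau> * (cos (\<sigma> + \<tau>) / 2)) else 0)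
      + (if k = q then ?c k * (\<Sum>\<tau>\<in>phases. fcoeff g k \<tau> * (cos (\<sigma> - \<tau>) / 2)) else 0))"
  proof (intro sum.cong refl)
    have gen: "(\<Sum>\<tau>\<in>phases. (c * F \<tau>) * ((if A then X \<tau> else 0) + (if E then Y \<tau> else 0)))
       = (if A then c * (\<Sum>\<tau>\<in>phases. F \<tau> * X \<tau>) else 0) + (if E then c * (\<Sum>\<tau>\<in>phases. F \<tau> * Y \<tau>) else 0)"
      for c :: real and F X Y :: "real \<Rightarrow> real" and A E
      by (cases A; cases E) (simp_all add: algebra_simps)
    show "(\<Sum>\<tau>\<in>phases. (?c k * fcoeff g k \<tau>) * ((if k = - q then cos (\<sigma> + \<tau>) / 2 else 0) + (if k = q then cos (\<sigma> - \<tau>) / 2 else 0)))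
      = (if k = - q then ?c k * (\<Sum>\<tau>\<in>phases. fcoeff g k \<tau> * (cos (\<sigma> + \<tau>) / 2)) else 0)
      + (if k = q then ?c k * (\<Sum>\<tau>\<in>phases. fcoeff g k \<tau> * (cos (\<sigma> - \<tau>) / 2)) else 0)" for k
      by (rule gen)
  qed
  also have "\<dots> = ?c (- q) * (\<Sum>\<tau>\<in>phases. fcoeff g (- q) \<tau> * (cos (\<sigma> + \<tau>) / 2)) + ?c q * (\<Sum>\<tau>\<in>phases. fcoeff g q \<tau> * (cos (\<sigma> - \<tau>) / 2))"
    unfolding sum.distrib sum.delta[OF finite_freqs] using qK by (simp only: if_True)
  also have "\<dots> = cos \<sigma> * fcoeff g q 0 - sin \<sigma> * fcoeff g q (- pi / 2)"
    unfolding c1 using w0 w1 by (simp add: cos_add cos_diff field_simps)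
  also have "\<dots> = fcoeff g q \<sigma>"
  proof -
    have "wave q \<sigma> y * g y = cos \<sigma> * (wave q 0 y * g y) - sin \<sigma> * (wave q (- pi / 2) y * g y)" for y
      using cos_diff[of "2 * pi * (freq q \<bullet> y)" "pi / 2"]
      by (simp add: wave_def cos_add algebra_simps)
    then show ?thesis using integrable_cper_mult[OF sper_cper[OF sper_intros(2)] g] by simp
  qed
  finally show ?thesis .
qed

text \<open>By Bernstein's inequality the gradient of the \<open>j\<close>-th block has norm at most a constant times \<open>2\<^sup>j 2\<^sup>-\<^sup>j\<^sup>s\<close>, so
  the blocks and their gradients form convergent series for \<open>s > 1\<close>. Uniqueness of Fourier
  coefficients identifies the sum of the blocks with the function.\<close>

theorem besov_W13:
  assumes \<theta>: "dyadic_cutoff \<theta>" and s: "s > 1"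
  obtains C where "C \<ge> 0"
    "\<And>f c. besov_infinity_norm \<theta> s 3 f < \<infinity> \<Longrightarrow>
      \<exists>D. W13 (\<lambda>x. f x $ c) D \<and> N3 (\<lambda>x. f x $ c) \<le> C * enn2real (besov_infinity_norm \<theta> s 3 f) \<and>
        (\<forall>i. N3 (D i) \<le> C * enn2real (besov_infinity_norm \<theta> s 3 f))"
proof -
  define r where "r = 2 powr (1 - s)"
  have r: "0 < r" "r < 1" using s powr_less_mono[of "1 - s" 0 2] by (auto simp: r_def)
  have rj: "2 ^ j * 2 powr (- (real j * s)) = r ^ j" for j
  proof -
    have "2 ^ j * 2 powr (- (real j * s)) = 2 powr (real j) * 2 powr (- (real j * s))" by (simp add: powr_realpow)
    also have "\<dots> = 2 powr ((1 - s) * real j)" by (simp add: powr_add[symmetric] algebra_simps)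
    also have "\<dots> = r ^ j" by (simp add: r_def powr_powr[symmetric] powr_realpow)
    finally show ?thesis .
  qed
  let ?C = "8 * pi / (1 - r)"
  show thesis
  proof (rule that)
    show "?C \<ge> 0" using r by simp
    fix f :: "real^3 \<Rightarrow> real^3" and c
    assume fin: "besov_infinity_norm \<theta> s 3 f < \<infinity>"
    define B where "B = enn2real (besov_infinity_norm \<theta> s 3 f)"
    define g where "g = (\<lambda>x. f x $ c)"
    have B: "B \<ge> 0" by (simp add: B_def)
    have g: "integrable torus g" unfolding g_def by (rule besov_block_bound(1)[OF \<theta> fin])
    define P where "P j = real_block \<theta> j g" for j
    have P: "sper (P j)" for j unfolding P_def by (rule sper_real_block)
    have PN: "N3 (P j) \<le> B * 2 powr (- (real j * s))" for j
      unfolding P_def g_def B_def by (rule besov_block_bound(2)[OF \<theta> fin])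
    have PN': "N3 (P j) \<le> 8 * pi * B * r ^ j" for j
    proof -
      have "N3 (P j) \<le> B * (1 * 2 powr (- (real j * s)))" using PN by simp
      also have "\<dots> \<le> B * (2 ^ j * 2 powr (- (real j * s)))"
        using B by (intro mult_left_mono mult_right_mono) auto
      also have "\<dots> = 1 * (B * r ^ j)" unfolding rj by simp
      also have "\<dots> \<le> (8 * pi) * (B * r ^ j)" using B r pi_ge_two by (intro mult_right_mono) auto
      finally show ?thesis by (simp add: mult_ac)
    qed
    have DN: "N3 (partial i (P j)) \<le> 8 * pi * B * r ^ j" for i j
    proof -
      have "N3 (partial i (P j)) \<le> 4 * pi * real (2 ^ Suc j) * N3 (P j)"
      proof (rule bernstein_N3)
        show "P j = (\<lambda>x. \<Sum>p\<in>freqs (2 ^ Suc j) \<times> phases.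
            (dyadic_symbol \<theta> j (freq (fst p)) * fcoeff g (fst p) (snd p)) * wave (fst p) (snd p) x)"
          by (simp add: P_def real_block_def fun_eq_iff)
        fix p assume "p \<in> freqs (2 ^ Suc j) \<times> phases"
        then have "\<bar>real_of_int (fst p $ i)\<bar> \<le> 2 ^ Suc j" using freqs_component[of "fst p" _ i] by auto
        then have "real_of_int \<bar>fst p $ i\<bar> \<le> real_of_int (int (2 ^ Suc j))" by simp
        then show "\<bar>fst p $ i\<bar> \<le> int (2 ^ Suc j)" by (simp only: of_int_le_iff)
      qed simp
      also have "\<dots> \<le> 4 * pi * real (2 ^ Suc j) * (B * 2 powr (- (real j * s)))"
        by (intro mult_left_mono PN) auto
      also have "\<dots> = 8 * pi * B * (2 ^ j * 2 powr (- (real j * s)))" by (simp add: mult_ac)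
      finally show ?thesis unfolding rj .
    qed
    have sg: "summable (\<lambda>j. 8 * pi * B * r ^ j)" using r by (intro summable_mult summable_geometric) auto
    have sg': "(\<Sum>j. 8 * pi * B * r ^ j) = ?C * B"
      using r by (subst suminf_mult) (auto intro: summable_geometric simp: suminf_geometric)
    have sP: "summable (\<lambda>j. N3 (P j))" "summable (\<lambda>j. N3 (partial i (P j)))" for i
    proof -
      have n: "norm (N3 (P j)) \<le> 8 * pi * B * r ^ j" "norm (N3 (partial i (P j))) \<le> 8 * pi * B * r ^ j" for i j
        using PN'[of j] DN[of i j] N3_nonneg by simp_all
      show "summable (\<lambda>j. N3 (P j))" by (rule summable_comparison_test'[OF sg, of 0, OF n(1)])
      show "summable (\<lambda>j. N3 (partial i (P j)))" for i by (rule summable_comparison_test'[OF sg, of 0, OF n(2)])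
    qed
    have part: "(\<Sum>j<n. N3 (F j)) \<le> ?C * B" if "\<And>j. N3 (F j) \<le> 8 * pi * B * r ^ j" for F n
    proof -
      have "(\<Sum>j<n. N3 (F j)) \<le> (\<Sum>j<n. 8 * pi * B * r ^ j)" by (intro sum_mono that)
      also have "\<dots> \<le> (\<Sum>j. 8 * pi * B * r ^ j)" using B r by (intro sum_le_suminf[OF sg]) auto
      finally show ?thesis unfolding sg' .
    qed
    have bound: "N3 h \<le> ?C * B"
      if "\<And>j. L3 (F j)" "\<And>j. N3 (F j) \<le> 8 * pi * B * r ^ j" "L3 h" "(\<lambda>n. N3 (\<lambda>x. (\<Sum>j<n. F j x) - h x)) \<longlonglongrightarrow> 0" for F h
    proof (rule LIMSEQ_le_const2)
      show "(\<lambda>n. N3 (\<lambda>x. \<Sum>j<n. F j x)) \<longlonglongrightarrow> N3 h" by (intro N3_lim L3_sum that)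
      have "N3 (\<lambda>x. \<Sum>j<n. F j x) \<le> ?C * B" for n
        using minkowski3_sum[of "{..<n}" F] that(1) part[OF that(2), of n] by simp
      then show "\<exists>N. \<forall>n\<ge>N. N3 (\<lambda>x. \<Sum>j<n. F j x) \<le> ?C * B" by blast
    qed
    obtain g' where g': "L3 g'" "(\<lambda>n. N3 (\<lambda>x. (\<Sum>j<n. P j x) - g' x)) \<longlonglongrightarrow> 0"
      by (rule L3_series[OF sper_L3[OF P] sP(1)]; rule that; assumption)
    have "\<exists>h. L3 h \<and> (\<lambda>n. N3 (\<lambda>x. (\<Sum>j<n. partial i (P j) x) - h x)) \<longlonglongrightarrow> 0" for i
      by (rule L3_series[OF sper_L3[OF sper_partial[OF P]] sP(2)[of i]]) (rule exI, rule conjI)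
    then have "\<forall>i. \<exists>h. L3 h \<and> (\<lambda>n. N3 (\<lambda>x. (\<Sum>j<n. partial i (P j) x) - h x)) \<longlonglongrightarrow> 0" ..
    from choice[OF this] obtain D
      where "\<forall>i. L3 (D i) \<and> (\<lambda>n. N3 (\<lambda>x. (\<Sum>j<n. partial i (P j) x) - D i x)) \<longlonglongrightarrow> 0" ..
    then have D: "\<And>i. L3 (D i)" "\<And>i. (\<lambda>n. N3 (\<lambda>x. (\<Sum>j<n. partial i (P j) x) - D i x)) \<longlonglongrightarrow> 0"
      by auto
    have ae: "AE x in torus. g' x = g x"
    proof -
      have "AE x in torus. g' x - g x = 0"
      proof (rule fourier_unique)
        show "integrable torus (\<lambda>x. g' x - g x)" using L3_integrable[OF g'(1)] g by simp
        fix q \<sigma>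
        have 1: "(\<lambda>n. LINT x|torus. wave q \<sigma> x * (\<Sum>j<n. P j x)) \<longlonglongrightarrow> fcoeff g' q \<sigma>"
          by (rule LINT_mult_lim[OF sper_L3[OF sper_intros(2)] _ g'(1,2)]) (intro L3_sum sper_L3 P)
        obtain m where m: "norm (freq q) < 2 ^ m" using real_arch_pow[of 2 "norm (freq q)"] by auto
        have "(LINT x|torus. wave q \<sigma> x * (\<Sum>j<n. P j x)) = fcoeff g q \<sigma>" if n: "n \<ge> Suc m" for n
        proof -
          obtain J where J: "n = Suc J" "m \<le> J" using n by (cases n) auto
          have "(2::real) ^ m \<le> 2 ^ J" using J by (intro power_increasing) auto
          with m have "norm (freq q) \<le> 2 ^ J" by linarith
          from block_sum_coeff[OF \<theta> g this] show ?thesis unfolding P_def J(1) .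
        qed
        then have "eventually (\<lambda>n. (LINT x|torus. wave q \<sigma> x * (\<Sum>j<n. P j x)) = fcoeff g q \<sigma>) sequentially"
          by (rule eventually_sequentiallyI)
        from LIMSEQ_unique[OF 1 tendsto_eventually[OF this]]
        show "(LINT x|torus. wave q \<sigma> x * (g' x - g x)) = 0"
          using integrable_cper_mult[OF sper_cper[OF sper_intros(2)] g]
            integrable_cper_mult[OF sper_cper[OF sper_intros(2)] L3_integrable[OF g'(1)]]
          by (simp add: right_diff_distrib)
      qed
      then show ?thesis by auto
    qed
    note Lg = L3_cong_AE[OF g'(1) borel_measurable_integrable[OF g] ae]
    have gconv: "(\<lambda>n. N3 (\<lambda>x. (\<Sum>j<n. P j x) - g x)) \<longlonglongrightarrow> 0"
    proof -
      have "N3 (\<lambda>x. (\<Sum>j<n. P j x) - g x) = N3 (\<lambda>x. (\<Sum>j<n. P j x) - g' x)" for n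
      proof (rule L3_cong_AE(2))
        show "L3 (\<lambda>x. (\<Sum>j<n. P j x) - g' x)" by (intro L3_diff L3_sum sper_L3 P g')
        show "(\<lambda>x. (\<Sum>j<n. P j x) - g x) \<in> borel_measurable torus"
          by (intro L3_measurable L3_diff L3_sum sper_L3 P Lg)
        show "AE x in torus. (\<Sum>j<n. P j x) - g' x = (\<Sum>j<n. P j x) - g x" using ae by auto
      qed
      then show ?thesis using g'(2) by simp
    qed
    have "W13 g D" unfolding W13_def
    proof (intro conjI allI exI[of _ "\<lambda>n x. \<Sum>j<n. P j x"])
      show "sper (\<lambda>x. \<Sum>j<n. P j x)" for n by (intro sper_intros P)
      have "partial i (\<lambda>x. \<Sum>j<n. P j x) x = (\<Sum>j<n. partial i (P j) x)" for i n x
        using P by (intro partial_sum) (simp add: sper_def)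
      then show "(\<lambda>n. N3 (\<lambda>x. partial i (\<lambda>x. \<Sum>j<n. P j x) x - D i x)) \<longlonglongrightarrow> 0" for i
        using D(2)[of i] by simp
    qed (use Lg D gconv in auto)
    moreover have "N3 g \<le> ?C * B" by (rule bound[OF sper_L3[OF P] PN' Lg(1) gconv])
    moreover have "N3 (D i) \<le> ?C * B" for i by (rule bound[OF sper_L3[OF sper_partial[OF P]] DN D])
    ultimately show "\<exists>D. W13 (\<lambda>x. f x $ c) D \<and> N3 (\<lambda>x. f x $ c) \<le> ?C * enn2real (besov_infinity_norm \<theta> s 3 f) \<and>
        (\<forall>i. N3 (D i) \<le> ?C * enn2real (besov_infinity_norm \<theta> s 3 f))"
      unfolding g_def B_def by (intro exI[of _ D] conjI allI)
  qed
qed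

section \<open>Distributional derivatives in time\<close>

text \<open>The step function below is defined by cases, and smoothness may be checked near each point.\<close>

lemma Ck_local:
  assumes "\<And>x. \<exists>U g. open U \<and> x \<in> U \<and> Ck n g \<and> (\<forall>y\<in>U. f y = g y)"
  shows "Ck n f"
  using assms
proof (induction n arbitrary: f)
  case 0
  have "isCont f x" for x
  proof -
    obtain U g where U: "open U" "x \<in> U" "Ck 0 g" "\<forall>y\<in>U. f y = g y" using 0[of x] by blast
    have "isCont g x" using U(3) by (simp add: continuous_on_eq_continuous_at)
    moreover have "eventually (\<lambda>y. f y = g y) (nhds x)" using U(1,2,4) unfolding eventually_nhds by blast
    ultimately show ?thesis using isCont_cong by blast
  qed
  then show ?case by (simp add: continuous_at_imp_continuous_on)
next
  case (Suc n)
  have d: "(f has_derivative frechet_derivative g (at y)) (at y)"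
    if "open U" "y \<in> U" "Ck (Suc n) g" "\<forall>y\<in>U. f y = g y" for U g y
  proof (rule has_derivative_transform_within_open[OF Ck_has_derivative[OF that(3)] that(1,2)])
    show "g z = f z" if "z \<in> U" for z using that \<open>\<forall>y\<in>U. f y = g y\<close> by simp
  qed
  show ?case
  proof (rule Ck_SucI)
    fix x
    obtain U g where U: "open U" "x \<in> U" "Ck (Suc n) g" "\<forall>y\<in>U. f y = g y" using Suc.prems[of x] by blast
    show "(f has_derivative frechet_derivative f (at x)) (at x)"
      using d[OF U] frechet_derivative_at[OF d[OF U]] by simp
  next
    fix v
    show "Ck n (\<lambda>x. frechet_derivative f (at x) v)"
    proof (rule Suc.IH)
      fix x
      obtain U g where U: "open U" "x \<in> U" "Ck (Suc n) g" "\<forall>y\<in>U. f y = g y" using Suc.prems[of x] by blast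
      have "frechet_derivative f (at y) v = frechet_derivative g (at y) v" if "y \<in> U" for y
        using frechet_derivative_at[OF d[OF U(1) that U(3,4)]] by simp
      then have "open U \<and> x \<in> U \<and> Ck n (\<lambda>x. frechet_derivative g (at x) v)
          \<and> (\<forall>y\<in>U. frechet_derivative f (at y) v = frechet_derivative g (at y) v)"
        using U(1,2) Ck_Suc_derivative[OF U(3)] by blast
      then show "\<exists>U g'. open U \<and> x \<in> U \<and> Ck n g' \<and> (\<forall>y\<in>U. frechet_derivative f (at y) v = g' y)"
        by (intro exI[of _ U] exI[of _ "\<lambda>x. frechet_derivative g (at x) v"])
    qed
  qed
qed

text \<open>The dyadic cutoff restricted to a half-line provides a smooth step function, hence enough test
  functions of time.\<close>

definition step :: "(real^3 \<Rightarrow> real) \<Rightarrow> real \<Rightarrow> real" where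
  "step \<theta> t = (if t \<le> 0 then 0 else 1 - \<theta> (t *\<^sub>R axis 1 1))"

lemma step_values:
  assumes "dyadic_cutoff \<theta>"
  shows "t \<le> 1 \<Longrightarrow> step \<theta> t = 0" "t \<ge> 2 \<Longrightarrow> step \<theta> t = 1"
  using assms by (auto simp: step_def dyadic_cutoff_def)

lemma smooth_step:
  assumes "dyadic_cutoff \<theta>" shows "smooth (step \<theta>)"
  unfolding smooth_def
proof
  fix n
  have s: "smooth \<theta>" using assms by (simp add: dyadic_cutoff_def)
  have bl: "bounded_linear (\<lambda>t::real. t *\<^sub>R axis 1 (1::real) :: real^3)" by (rule bounded_linear_scaleR_left)
  have "smooth (\<lambda>t. 1 - \<theta> (t *\<^sub>R axis 1 1))"
    using smooth_diff[OF smooth_const smooth_comp_affine[OF bl s, of 0]] by simp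
  then have g: "Ck n (\<lambda>t. 1 - \<theta> (t *\<^sub>R axis 1 1))" by (simp add: smooth_def)
  show "Ck n (step \<theta>)"
  proof (rule Ck_local)
    fix x :: real
    show "\<exists>U g. open U \<and> x \<in> U \<and> Ck n g \<and> (\<forall>y\<in>U. step \<theta> y = g y)"
    proof (cases "x < 1")
      case True
      then show ?thesis using step_values(1)[OF assms] Ck_const[of n 0]
        by (intro exI[of _ "{..<1}"] exI[of _ "\<lambda>_. 0"]) auto
    next
      case False
      then show ?thesis using g
        by (intro exI[of _ "{0<..}"] exI[of _ "\<lambda>t. 1 - \<theta> (t *\<^sub>R axis 1 1)"]) (auto simp: step_def)
    qed
  qed
qed

definition time_test :: "real \<Rightarrow> (real \<Rightarrow> real) \<Rightarrow> bool" where
  "time_test T \<phi> \<longleftrightarrow> smooth \<phi> \<and> (\<exists>a b. 0 < a \<and> b < T \<and> (\<forall>t. t \<notin> {a..b} \<longrightarrow> \<phi> t = 0))"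

text \<open>The values off the interval are fixed so that primitives from \<open>0\<close> make sense for all times.\<close>

definition tbounded :: "real \<Rightarrow> (real \<Rightarrow> real) \<Rightarrow> bool" where
  "tbounded T f \<longleftrightarrow> f \<in> borel_measurable lebesgue \<and> (\<exists>M. \<forall>t. \<bar>f t\<bar> \<le> M) \<and> (\<forall>t. t \<notin> {0..T} \<longrightarrow> f t = 0)"

abbreviation prim :: "(real \<Rightarrow> real) \<Rightarrow> real \<Rightarrow> real" where
  "prim f t \<equiv> integral {0..t} f"

lemma tboundedE:
  assumes "tbounded T f"
  obtains M where "M \<ge> 0" "\<And>t. \<bar>f t\<bar> \<le> M" "f \<in> borel_measurable lebesgue" "\<And>t. t \<notin> {0..T} \<Longrightarrow> f t = 0"
proof -
  obtain M where M: "\<forall>t. \<bar>f t\<bar> \<le> M" and f: "f \<in> borel_measurable lebesgue" "\<And>t. t \<notin> {0..T} \<Longrightarrow> f t = 0"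
    using assms unfolding tbounded_def by blast
  have "0 \<le> M" using M[rule_format, of 0] by linarith
  from that[OF this M[rule_format] f] show thesis .
qed

lemma bounded_integrable_on:
  fixes f :: "real \<Rightarrow> real"
  assumes "f \<in> borel_measurable lebesgue" "\<And>t. \<bar>f t\<bar> \<le> M" shows "f integrable_on {a..b}"
proof (rule measurable_bounded_by_integrable_imp_integrable)
  show "f \<in> borel_measurable (lebesgue_on {a..b})" using assms(1) by (rule measurable_restrict_space1)
  show "(\<lambda>_. M) integrable_on {a..b}" by (rule integrable_const_ivl)
qed (use assms in auto)

lemma tbounded_integrable_on: "tbounded T f \<Longrightarrow> f integrable_on {a..b}"
proof -
  assume "tbounded T f"
  then obtain M where "\<And>t. \<bar>f t\<bar> \<le> M" "f \<in> borel_measurable lebesgue"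
    by (rule tboundedE) (rule that; assumption)
  then show ?thesis by (intro bounded_integrable_on)
qed

lemma tbounded_integrable:
  assumes "tbounded T f" shows "integrable (lebesgue_on {0<..<T}) f" "(LINT t|lebesgue_on {0<..<T}. f t) = prim f T"
proof -
  obtain M where M: "\<And>t. \<bar>f t\<bar> \<le> M" "f \<in> borel_measurable lebesgue" by (rule tboundedE[OF assms]; rule that; assumption)
  have "finite_measure (lebesgue_on {0<..<T})" by (rule finite_measure_lebesgue_on) simp
  then show i: "integrable (lebesgue_on {0<..<T}) f"
    by (rule finite_measure.integrable_const_bound[where B = M])
      (use M in \<open>auto intro: measurable_restrict_space1\<close>)
  have "(LINT t|lebesgue_on {0<..<T}. f t) = integral {0<..<T} f"
    by (rule lebesgue_integral_eq_integral[OF i]) simp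
  also have "\<dots> = prim f T" using integral_open_interval[of 0 T f] by (simp add: box_real)
  finally show "(LINT t|lebesgue_on {0<..<T}. f t) = prim f T" .
qed

lemma prim_diff:
  assumes f: "tbounded T f" and "0 \<le> s" "s \<le> t"
  shows "prim f t - prim f s = integral {s..t} f"
  using Henstock_Kurzweil_Integration.integral_combine[OF assms(2,3) tbounded_integrable_on[OF f]] by simp

lemma integral_abs_le:
  fixes f :: "real \<Rightarrow> real"
  assumes "f integrable_on {s..t}" "s \<le> t" "\<And>r. r \<in> {s..t} \<Longrightarrow> \<bar>f r\<bar> \<le> M"
  shows "\<bar>integral {s..t} f\<bar> \<le> M * (t - s)"
proof -
  have "0 \<le> M" using assms(3)[of s] assms(2) by fastforce
  then have "norm (integral (cbox s t) f) \<le> M * measure lborel (cbox s t)"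
  proof (rule has_integral_bound)
    show "(f has_integral integral (cbox s t) f) (cbox s t)" using integrable_integral[OF assms(1)] by simp
    show "norm (f r) \<le> M" if "r \<in> cbox s t" for r using assms(3) that by simp
  qed
  then show ?thesis using assms(2) by simp
qed

lemma prim_Lipschitz:
  assumes f: "tbounded T f"
  obtains M where "M \<ge> 0" "\<And>t. \<bar>f t\<bar> \<le> M" "\<And>s t. \<bar>prim f t - prim f s\<bar> \<le> M * \<bar>t - s\<bar>"
proof -
  obtain M where M: "M \<ge> 0" "\<And>t. \<bar>f t\<bar> \<le> M" by (rule tboundedE[OF f]; rule that; assumption)
  have pos: "\<bar>prim f t - prim f s\<bar> \<le> M * (t - s)" if "0 \<le> s" "s \<le> t" for s t
    unfolding prim_diff[OF f that] by (intro integral_abs_le tbounded_integrable_on[OF f] M that)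
  have le: "\<bar>prim f t - prim f s\<bar> \<le> M * (t - s)" if "s \<le> t" for s t
  proof (cases "0 \<le> s")
    case True then show ?thesis using pos that by blast
  next
    case neg: False
    then have s: "prim f s = 0" by simp
    show ?thesis
    proof (cases "0 \<le> t")
      case True
      have "\<bar>prim f t - prim f 0\<bar> \<le> M * (t - 0)" by (rule pos) (use True in auto)
      also have "\<dots> \<le> M * (t - s)" using neg M(1) by (intro mult_left_mono) auto
      finally show ?thesis using s by simp
    next
      case False
      then show ?thesis using s that M(1) by simp
    qed
  qed
  have "\<bar>prim f t - prim f s\<bar> \<le> M * \<bar>t - s\<bar>" for s t
    using le[of s t] le[of t s] by (cases "s \<le> t") (auto simp: abs_minus_commute)
  from that[OF M this] show thesis .
qed

lemma prim_continuous:
  assumes f: "tbounded T f" shows "continuous_on UNIV (prim f)"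
proof -
  obtain M where M: "M \<ge> 0" "\<And>s t. \<bar>prim f t - prim f s\<bar> \<le> M * \<bar>t - s\<bar>" by (rule prim_Lipschitz[OF f]; rule that; assumption)
  have "M-lipschitz_on UNIV (prim f)"
    by (rule lipschitz_onI) (use M in \<open>auto simp: dist_real_def\<close>)
  then show ?thesis by (rule lipschitz_on_continuous_on)
qed

lemma tbounded_add:
  assumes "tbounded T f" "tbounded T h" shows "tbounded T (\<lambda>t. f t + h t)"
proof -
  obtain M where M: "\<And>t. \<bar>f t\<bar> \<le> M" "f \<in> borel_measurable lebesgue" "\<And>t. t \<notin> {0..T} \<Longrightarrow> f t = 0"
    by (rule tboundedE[OF assms(1)]; rule that; assumption)
  obtain M' where M': "\<And>t. \<bar>h t\<bar> \<le> M'" "h \<in> borel_measurable lebesgue" "\<And>t. t \<notin> {0..T} \<Longrightarrow> h t = 0"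
    by (rule tboundedE[OF assms(2)]; rule that; assumption)
  have "\<bar>f t + h t\<bar> \<le> M + M'" for t using M(1)[of t] M'(1)[of t] by linarith
  then have "\<exists>K. \<forall>t. \<bar>f t + h t\<bar> \<le> K" by (intro exI[of _ "M + M'"] allI)
  moreover have "(\<lambda>t. f t + h t) \<in> borel_measurable lebesgue" by (rule borel_measurable_add[OF M(2) M'(2)])
  ultimately show ?thesis unfolding tbounded_def using M(3) M'(3) by simp
qed

lemma tbounded_mult_bounded:
  assumes f: "tbounded T f" and h: "h \<in> borel_measurable lebesgue" "\<And>t. t \<in> {0..T} \<Longrightarrow> \<bar>h t\<bar> \<le> M'"
  shows "tbounded T (\<lambda>t. f t * h t)"
proof -
  obtain M where M: "M \<ge> 0" "\<And>t. \<bar>f t\<bar> \<le> M" "f \<in> borel_measurable lebesgue" "\<And>t. t \<notin> {0..T} \<Longrightarrow> f t = 0"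
    by (rule tboundedE[OF f]; rule that; assumption)
  have "\<bar>f t * h t\<bar> \<le> M * \<bar>M'\<bar>" for t
  proof (cases "t \<in> {0..T}")
    case True
    then show ?thesis unfolding abs_mult using M h(2)[OF True] by (intro mult_mono) auto
  next
    case False
    then show ?thesis using M by simp
  qed
  then show ?thesis unfolding tbounded_def
    using borel_measurable_times[OF M(3) h(1)] M(4) by (intro conjI exI[of _ "M * \<bar>M'\<bar>"]) auto
qed

lemma tbounded_mult_prim:
  assumes f: "tbounded T f" and h: "tbounded T h" shows "tbounded T (\<lambda>t. f t * prim h t)"
proof -
  obtain M where M: "M \<ge> 0" "\<And>s t. \<bar>prim h t - prim h s\<bar> \<le> M * \<bar>t - s\<bar>" by (rule prim_Lipschitz[OF h]; rule that; assumption)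
  show ?thesis
  proof (rule tbounded_mult_bounded[OF f, of _ "M * T"])
    show "prim h \<in> borel_measurable lebesgue"
      using prim_continuous[OF h] by (intro measurable_completion) (simp add: borel_measurable_continuous_onI)
    show "\<bar>prim h t\<bar> \<le> M * T" if "t \<in> {0..T}" for t
      using M(2)[of t 0] that mult_left_mono[of t T M] M(1) by simp
  qed
qed

lemma quadratic_imp_constant:
  fixes D :: "real \<Rightarrow> real"
  assumes "\<And>s t. 0 \<le> s \<Longrightarrow> s \<le> t \<Longrightarrow> \<bar>D t - D s\<bar> \<le> K * (t - s)\<^sup>2" "0 \<le> t" shows "D t = D 0"
proof -
  have sym: "\<bar>D t - D s\<bar> \<le> K * (t - s)\<^sup>2" if "0 \<le> s" "0 \<le> t" for s t
    using assms(1)[of s t] assms(1)[of t s] that by (cases "s \<le> t") (auto simp: abs_minus_commute power2_commute)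
  have "(D has_field_derivative 0) (at x within {0..})" if x: "x \<in> {0..}" for x
    unfolding has_field_derivative_iff
  proof (rule Lim_null_comparison)
    show "eventually (\<lambda>y. norm ((D y - D x) / (y - x)) \<le> K * \<bar>y - x\<bar>) (at x within {0..})"
    proof (unfold eventually_at_filter, rule always_eventually, intro allI impI)
      fix y assume y: "y \<noteq> x" "y \<in> {0..}"
      have "\<bar>D y - D x\<bar> \<le> (K * \<bar>y - x\<bar>) * \<bar>y - x\<bar>"
        using sym[of x y] x y by (simp add: power2_eq_square mult.assoc)
      then show "norm ((D y - D x) / (y - x)) \<le> K * \<bar>y - x\<bar>"
        using y by (simp add: abs_divide divide_le_eq)
    qed
    have "((\<lambda>y. K * \<bar>y - x\<bar>) \<longlongrightarrow> K * \<bar>x - x\<bar>) (at x within {0..})"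
      by (intro tendsto_mult tendsto_const tendsto_rabs tendsto_diff tendsto_ident_at)
    then show "((\<lambda>y. K * \<bar>y - x\<bar>) \<longlongrightarrow> 0) (at x within {0..})" by simp
  qed
  then obtain c where "\<And>x. x \<in> {0..} \<Longrightarrow> D x = c"
    using has_field_derivative_zero_constant[of "{0..}" D] by auto
  then show ?thesis using assms(2) by simp
qed

text \<open>Primitives of bounded functions are Lipschitz continuous, so the difference of the two sides varies
  at most quadratically on small intervals and is therefore constant.\<close>

theorem prim_mult:
  assumes f: "tbounded T f" and h: "tbounded T h" and t: "0 \<le> t"
  shows "prim f t * prim h t = prim (\<lambda>s. f s * prim h s + h s * prim f s) t"
proof -
  obtain M where M: "M \<ge> 0" "\<And>t. \<bar>f t\<bar> \<le> M" "\<And>s t. \<bar>prim f t - prim f s\<bar> \<le> M * \<bar>t - s\<bar>"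
    by (rule prim_Lipschitz[OF f]; rule that; assumption)
  obtain M' where M': "M' \<ge> 0" "\<And>t. \<bar>h t\<bar> \<le> M'" "\<And>s t. \<bar>prim h t - prim h s\<bar> \<le> M' * \<bar>t - s\<bar>"
    by (rule prim_Lipschitz[OF h]; rule that; assumption)
  let ?p = "\<lambda>s. f s * prim h s + h s * prim f s"
  have p: "tbounded T ?p" by (intro tbounded_add tbounded_mult_prim f h)
  define D where "D t = prim f t * prim h t - prim ?p t" for t
  have "\<bar>D t - D s\<bar> \<le> (3 * M * M') * (t - s)\<^sup>2" if st: "0 \<le> s" "s \<le> t" for s t
  proof -
    note int = tbounded_integrable_on[OF tbounded_mult_prim[OF f h], of s t]
      tbounded_integrable_on[OF tbounded_mult_prim[OF h f], of s t]
      tbounded_integrable_on[OF f, of s t] tbounded_integrable_on[OF h, of s t]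
    have 1: "integral {s..t} f * prim h s - integral {s..t} (\<lambda>r. f r * prim h r) = - integral {s..t} (\<lambda>r. f r * (prim h r - prim h s))"
      using int by (simp add: right_diff_distrib integral_diff integrable_on_mult_left)
    have 2: "integral {s..t} h * prim f s - integral {s..t} (\<lambda>r. h r * prim f r) = - integral {s..t} (\<lambda>r. h r * (prim f r - prim f s))"
      using int by (simp add: right_diff_distrib integral_diff integrable_on_mult_left)
    have b: "\<bar>integral {s..t} (\<lambda>r. f r * (prim h r - prim h s))\<bar> \<le> (M * (M' * (t - s))) * (t - s)"
    proof (rule integral_abs_le[OF _ st(2)])
      show "(\<lambda>r. f r * (prim h r - prim h s)) integrable_on {s..t}"
        using integrable_diff[OF int(1) integrable_on_mult_left[OF int(3), of "prim h s"]] by (simp add: right_diff_distrib)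
      fix r assume r: "r \<in> {s..t}"
      have "M' * \<bar>r - s\<bar> \<le> M' * (t - s)" using r M'(1) by (intro mult_left_mono) auto
      then have "\<bar>prim h r - prim h s\<bar> \<le> M' * (t - s)" using M'(3)[of r s] by linarith
      then show "\<bar>f r * (prim h r - prim h s)\<bar> \<le> M * (M' * (t - s))"
        unfolding abs_mult using M by (intro mult_mono) auto
    qed
    have c: "\<bar>integral {s..t} (\<lambda>r. h r * (prim f r - prim f s))\<bar> \<le> (M' * (M * (t - s))) * (t - s)"
    proof (rule integral_abs_le[OF _ st(2)])
      show "(\<lambda>r. h r * (prim f r - prim f s)) integrable_on {s..t}"
        using integrable_diff[OF int(2) integrable_on_mult_left[OF int(4), of "prim f s"]] by (simp add: right_diff_distrib)
      fix r assume r: "r \<in> {s..t}"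
      have "M * \<bar>r - s\<bar> \<le> M * (t - s)" using r M(1) by (intro mult_left_mono) auto
      then have "\<bar>prim f r - prim f s\<bar> \<le> M * (t - s)" using M(3)[of r s] by linarith
      then show "\<bar>h r * (prim f r - prim f s)\<bar> \<le> M' * (M * (t - s))"
        unfolding abs_mult using M' by (intro mult_mono) auto
    qed
    have d: "\<bar>(prim f t - prim f s) * (prim h t - prim h s)\<bar> \<le> (M * (t - s)) * (M' * (t - s))"
      unfolding abs_mult using M(3)[of t s] M'(3)[of t s] st M(1) by (intro mult_mono) auto
    have "prim ?p t - prim ?p s = integral {s..t} (\<lambda>r. f r * prim h r) + integral {s..t} (\<lambda>r. h r * prim f r)"
      unfolding prim_diff[OF p st] by (rule integral_add[OF int(1,2)])
    then have "D t - D s = (prim f t - prim f s) * (prim h t - prim h s)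
       + ((prim f t - prim f s) * prim h s - integral {s..t} (\<lambda>r. f r * prim h r))
       + ((prim h t - prim h s) * prim f s - integral {s..t} (\<lambda>r. h r * prim f r))"
      unfolding D_def by (simp add: algebra_simps)
    also have "\<dots> = (prim f t - prim f s) * (prim h t - prim h s)
       - integral {s..t} (\<lambda>r. f r * (prim h r - prim h s)) - integral {s..t} (\<lambda>r. h r * (prim f r - prim f s))"
      using 1 2 unfolding prim_diff[OF f st] prim_diff[OF h st] by simp
    finally have "\<bar>D t - D s\<bar> \<le> (M * (t - s)) * (M' * (t - s)) + (M * (M' * (t - s))) * (t - s) + (M' * (M * (t - s))) * (t - s)"
      using b c d by linarith
    then show ?thesis by (simp add: power2_eq_square algebra_simps)
  qed
  from quadratic_imp_constant[OF this t] show ?thesis by (simp add: D_def)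
qed

lemma time_test_tbounded:
  assumes "time_test T \<phi>" shows "tbounded T \<phi>"
proof -
  obtain a b where ab: "0 < a" "b < T" "\<And>t. t \<notin> {a..b} \<Longrightarrow> \<phi> t = 0" and s: "smooth \<phi>"
    using assms by (auto simp: time_test_def)
  have "compact (\<phi> ` {a..b})" by (intro compact_continuous_image smooth_continuous[OF s]) simp
  then obtain M where M: "\<forall>y\<in>\<phi> ` {a..b}. norm y \<le> M" using compact_imp_bounded bounded_iff by blast
  have "\<bar>\<phi> t\<bar> \<le> \<bar>M\<bar>" for t
  proof (cases "t \<in> {a..b}")
    case True
    then have "norm (\<phi> t) \<le> M" using M by blast
    then show ?thesis by simp
  qed (simp add: ab(3))
  moreover have "\<phi> \<in> borel_measurable lebesgue"
    using smooth_continuous[OF s, of UNIV] by (intro measurable_completion) (simp add: borel_measurable_continuous_onI)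
  moreover have "\<phi> t = 0" if "t \<notin> {0..T}" for t using ab that by auto
  ultimately show ?thesis unfolding tbounded_def by (intro conjI exI[of _ "\<bar>M\<bar>"] allI impI)
qed

text \<open>Products of rescaled and shifted smooth steps are test functions that converge to the indicators of
  intervals.\<close>

lemma AE_zero_if_test_integrals_zero:
  assumes \<theta>: "dyadic_cutoff \<theta>" and d: "integrable (lebesgue_on {0<..<T}) d"
    and zero: "\<And>\<phi>. time_test T \<phi> \<Longrightarrow> (LINT t|lebesgue_on {0<..<T}. \<phi> t * d t) = 0"
  shows "AE t in lebesgue_on {0<..<T}. d t = 0"
proof -
  let ?g = "\<lambda>t. indicat_real {0<..<T} t *\<^sub>R d t"
  have g: "integrable lebesgue ?g" using d by (simp add: integrable_restrict_space)
  have mid: "(LINT t|lebesgue_on {0<..<T}. indicat_real {a<..<b} t * d t) = 0" if ab: "0 \<le> a" "b \<le> T" for a b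
  proof -
    define \<Psi> where "\<Psi> n t = step \<theta> (real (Suc n) * (t - a)) * step \<theta> (real (Suc n) * (b - t))" for n t
    have sm: "smooth (\<lambda>t. step \<theta> (m * t + c))" for m c
      using smooth_comp_affine[OF bounded_linear_mult_right smooth_step[OF \<theta>]] .
    have \<Psi>s: "smooth (\<Psi> n)" for n
    proof -
      have "\<Psi> n = (\<lambda>t. step \<theta> (real (Suc n) * t + (- real (Suc n) * a)) * step \<theta> ((- real (Suc n)) * t + real (Suc n) * b))"
        by (simp add: \<Psi>_def fun_eq_iff right_diff_distrib del: of_nat_Suc)
      then show ?thesis by (simp only:) (intro smooth_mult sm)
    qed
    have z: "\<Psi> n t = 0" if "t \<notin> {a + 1 / real (Suc n)..b - 1 / real (Suc n)}" for n t
    proof -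
      have "real (Suc n) * (t - a) \<le> 1 \<or> real (Suc n) * (b - t) \<le> 1"
        using that by (auto simp: not_le field_simps simp del: of_nat_Suc)
      then show ?thesis using step_values(1)[OF \<theta>] by (auto simp: \<Psi>_def)
    qed
    have tt: "time_test T (\<Psi> n)" for n
      unfolding time_test_def using \<Psi>s z[of _ n] ab
      by (intro conjI exI[of _ "a + 1 / real (Suc n)"] exI[of _ "b - 1 / real (Suc n)"]) (auto simp: add_nonneg_pos diff_less_eq add_pos_nonneg simp del: of_nat_Suc intro: le_less_trans)
    obtain K where K: "\<And>t. \<bar>step \<theta> t\<bar> \<le> K"
    proof -
      have "compact (step \<theta> ` {1..2})" by (intro compact_continuous_image smooth_continuous[OF smooth_step[OF \<theta>]]) simp
      then obtain M where M: "\<forall>y\<in>step \<theta> ` {1..2}. norm y \<le> M" using compact_imp_bounded bounded_iff by blast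
      have "\<bar>step \<theta> t\<bar> \<le> max 1 M" for t
      proof (cases "t \<in> {1..2}")
        case True
        then have "norm (step \<theta> t) \<le> M" using M by blast
        then show ?thesis by simp
      next
        case False
        then have "t \<le> 1 \<or> t \<ge> 2" by auto
        then show ?thesis using step_values[OF \<theta>, of t] by auto
      qed
      then show thesis by (rule that)
    qed
    have K0: "K \<ge> 0" using K[of 0] by simp
    have lim: "(\<lambda>n. \<Psi> n t) \<longlonglongrightarrow> indicat_real {a<..<b} t" for t
    proof (cases "t \<in> {a<..<b}")
      case True
      then have "\<exists>n::nat. 2 < real n * (t - a)" "\<exists>n::nat. 2 < real n * (b - t)"
        using reals_Archimedean3[of "t - a"] reals_Archimedean3[of "b - t"] by simp_all
      then obtain n1 n2 :: nat where n: "2 < real n1 * (t - a)" "2 < real n2 * (b - t)" by blast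
      have "\<Psi> n t = 1" if "n \<ge> max n1 n2" for n
      proof -
        have "real n1 * (t - a) \<le> real (Suc n) * (t - a)" "real n2 * (b - t) \<le> real (Suc n) * (b - t)"
          using that True by (auto intro!: mult_right_mono)
        then have "real (Suc n) * (t - a) \<ge> 2" "real (Suc n) * (b - t) \<ge> 2" using n by linarith+
        then show ?thesis unfolding \<Psi>_def using step_values(2)[OF \<theta>] by simp
      qed
      then have "eventually (\<lambda>n. \<Psi> n t = 1) sequentially" by (rule eventually_sequentiallyI)
      then show ?thesis using True by (simp add: tendsto_eventually)
    next
      case False
      have "t \<notin> {a + 1 / real (Suc n)..b - 1 / real (Suc n)}" for n
      proof
        assume A: "t \<in> {a + 1 / real (Suc n)..b - 1 / real (Suc n)}"
        have "1 / real (Suc n) > 0" by simp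
        then have "t \<in> {a<..<b}" using A unfolding atLeastAtMost_iff greaterThanLessThan_iff by linarith
        then show False using False by simp
      qed
      then have "\<Psi> n t = 0" for n using z by blast
      then show ?thesis using False by simp
    qed
    have "(\<lambda>n. LINT t|lebesgue_on {0<..<T}. \<Psi> n t * d t) \<longlonglongrightarrow> (LINT t|lebesgue_on {0<..<T}. indicat_real {a<..<b} t * d t)"
    proof (rule integral_dominated_convergence[where w = "\<lambda>t. K * K * \<bar>d t\<bar>"])
      have "indicat_real {a<..<b} \<in> borel_measurable lebesgue" by (intro borel_measurable_indicator) simp
      then have "indicat_real {a<..<b} \<in> borel_measurable (lebesgue_on {0<..<T})" by (rule measurable_restrict_space1)
      then show "(\<lambda>t. indicat_real {a<..<b} t * d t) \<in> borel_measurable (lebesgue_on {0<..<T})"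
        by (rule borel_measurable_times[OF _ borel_measurable_integrable[OF d]])
      have "\<Psi> n \<in> borel_measurable lebesgue" for n
        using time_test_tbounded[OF tt] by (simp add: tbounded_def)
      then have "\<Psi> n \<in> borel_measurable (lebesgue_on {0<..<T})" for n by (rule measurable_restrict_space1)
      then show "(\<lambda>t. \<Psi> n t * d t) \<in> borel_measurable (lebesgue_on {0<..<T})" for n
        by (rule borel_measurable_times[OF _ borel_measurable_integrable[OF d]])
      show "integrable (lebesgue_on {0<..<T}) (\<lambda>t. K * K * \<bar>d t\<bar>)" using d by simp
      show "AE t in lebesgue_on {0<..<T}. (\<lambda>n. \<Psi> n t * d t) \<longlonglongrightarrow> indicat_real {a<..<b} t * d t"
        by (intro AE_I2 tendsto_mult lim tendsto_const)
      show "AE t in lebesgue_on {0<..<T}. norm (\<Psi> n t * d t) \<le> K * K * \<bar>d t\<bar>" for n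
        unfolding \<Psi>_def real_norm_def abs_mult using K K0
        by (intro AE_I2 mult_right_mono mult_mono) auto
    qed
    from LIMSEQ_unique[OF this[unfolded zero[OF tt]] tendsto_const] show ?thesis by simp
  qed
  have "AE t in lebesgue. ?g t = 0"
  proof (rule AE_zero_if_box_integrals_zero[OF g])
    fix c e :: real
    have "(LINT t|lebesgue. indicator (box c e) t * ?g t) = (LINT t|lebesgue. indicator {0<..<T} t *\<^sub>R (indicat_real {max c 0<..<min e T} t * d t))"
      by (intro Bochner_Integration.integral_cong refl) (auto simp: indicator_def box_real)
    also have "\<dots> = 0" using mid[of "max c 0" "min e T"] by (simp add: integral_restrict_space)
    finally show "(LINT t|lebesgue. indicator (box c e) t * ?g t) = 0" .
  qed
  then have "AE t in lebesgue. t \<in> {0<..<T} \<longrightarrow> d t = 0"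
    by eventually_elim (auto simp: indicator_def)
  then show ?thesis by (simp add: AE_restrict_space_iff)
qed

text \<open>A test function is the derivative of a test function precisely if its integral vanishes.\<close>

lemma time_test_prim:
  assumes \<psi>: "time_test T \<psi>" and T: "T > 0" and zero: "prim \<psi> T = 0"
  shows "time_test T (prim \<psi>)" "\<And>t. (prim \<psi> has_real_derivative \<psi> t) (at t)"
proof -
  obtain a b where ab: "0 < a" "b < T" "\<And>t. t \<notin> {a..b} \<Longrightarrow> \<psi> t = 0" and s: "smooth \<psi>"
    using \<psi> by (auto simp: time_test_def)
  have tb: "tbounded T \<psi>" by (rule time_test_tbounded[OF \<psi>])
  have z1: "prim \<psi> t = 0" if "t < a" for t
    using that ab by (intro integral_unique has_integral_is_0) auto
  have z2: "prim \<psi> t = 0" if t: "t > b" for t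
  proof (cases "t < a")
    case False
    have "integral {min t T..max t T} \<psi> = 0"
    proof (intro integral_unique has_integral_is_0)
      fix x assume "x \<in> {min t T..max t T}"
      then have "b < x" using t ab(2) by (auto simp: min_le_iff_disj)
      then show "\<psi> x = 0" by (intro ab(3)) auto
    qed
    moreover have "prim \<psi> (max t T) - prim \<psi> (min t T) = integral {min t T..max t T} \<psi>"
      using False ab T by (intro prim_diff[OF tb]) auto
    ultimately have "prim \<psi> t = prim \<psi> T" by (cases "t \<le> T") (auto simp: max_def min_def)
    then show ?thesis using zero by simp
  qed (rule z1)
  have deriv: "(prim \<psi> has_real_derivative \<psi> t) (at t)" for t
  proof (cases "t < a")
    case True
    have "((\<lambda>_. 0) has_real_derivative 0) (at t)" by simp
    then have "(prim \<psi> has_real_derivative 0) (at t)"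
      by (rule has_field_derivative_transform_within_open[of _ _ _ "{..<a}"]) (use True z1 in auto)
    then show ?thesis using ab(3) True by simp
  next
    case False
    have "(prim \<psi> has_real_derivative \<psi> t) (at t within {0..t + 1})"
      using False ab(1) by (intro integral_has_real_derivative smooth_continuous[OF s]) auto
    moreover have "t \<in> interior {0..t + 1}" using False ab(1) by simp
    ultimately show ?thesis by (simp only: at_within_interior)
  qed
  then show "\<And>t. (prim \<psi> has_real_derivative \<psi> t) (at t)" .
  have "Ck n (prim \<psi>)" for n
  proof (cases n)
    case 0
    then show ?thesis using prim_continuous[OF tb] by simp
  next
    case (Suc m)
    have "Ck (Suc m) (prim \<psi>)"
    proof (rule Ck_SucI)
      show "(prim \<psi> has_derivative (\<lambda>h. \<psi> t * h)) (at t)" for t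
        using deriv[of t] by (simp add: has_field_derivative_def)
      have "smooth (\<lambda>t. v * \<psi> t)" for v by (rule smooth_cmult[OF s])
      then show "Ck m (\<lambda>t. \<psi> t * v)" for v by (simp add: smooth_def mult.commute)
    qed
    then show ?thesis using Suc by simp
  qed
  then have "smooth (prim \<psi>)" by (simp add: smooth_def)
  moreover have "prim \<psi> t = 0" if "t \<notin> {a..b}" for t
    using that z1[of t] z2[of t] by (cases "t < a") auto
  ultimately show "time_test T (prim \<psi>)"
    unfolding time_test_def using ab(1,2) by (intro conjI exI[of _ a] exI[of _ b] allI impI)
qed

lemma time_test_mult_tbounded:
  assumes "time_test T \<phi>" "tbounded T f" shows "tbounded T (\<lambda>t. \<phi> t * f t)"
proof -
  obtain M where M: "\<And>t. \<bar>f t\<bar> \<le> M" "f \<in> borel_measurable lebesgue"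
    by (rule tboundedE[OF assms(2)]; rule that; assumption)
  show ?thesis by (rule tbounded_mult_bounded[OF time_test_tbounded[OF assms(1)] M(2) M(1)])
qed

text \<open>The difference of \<open>A\<close> and a primitive of \<open>B\<close> is orthogonal to every test function of mean zero.
  Subtracting from an arbitrary test function a multiple of one with nonzero mean shows that it is
  constant.\<close>

theorem weak_time_derivative:
  assumes \<theta>: "dyadic_cutoff \<theta>" and T: "T > 0" and A: "tbounded T A" and B: "tbounded T B"
    and weak: "\<And>\<phi> \<phi>'. time_test T \<phi> \<Longrightarrow> (\<And>t. (\<phi> has_real_derivative \<phi>' t) (at t)) \<Longrightarrow>
      (LINT t|lebesgue_on {0<..<T}. \<phi>' t * A t + \<phi> t * B t) = 0"
  obtains c where "AE t in lebesgue_on {0<..<T}. A t = c + prim B t"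
proof -
  let ?M = "lebesgue_on {0<..<T}"
  define R where "R t = A t - prim B t" for t
  note mt = tbounded_integrable[OF time_test_mult_tbounded]
  have pB: "prim B \<in> borel_measurable lebesgue"
    using prim_continuous[OF B] by (intro measurable_completion) (simp add: borel_measurable_continuous_onI)
  have psiB: "tbounded T (\<lambda>t. \<psi> t * prim B t)" if "time_test T \<psi>" for \<psi>
    by (rule tbounded_mult_prim[OF time_test_tbounded[OF that] B])
  have psiR: "integrable ?M (\<lambda>t. \<psi> t * R t)" if "time_test T \<psi>" for \<psi>
    using mt(1)[OF that A] tbounded_integrable(1)[OF psiB[OF that]] by (simp add: R_def right_diff_distrib)
  have zero_mean: "(LINT t|?M. \<psi> t * R t) = 0" if \<psi>: "time_test T \<psi>" "prim \<psi> T = 0" for \<psi>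
  proof -
    note \<phi> = time_test_prim[OF \<psi>(1) T \<psi>(2)]
    have tb\<psi>: "tbounded T \<psi>" by (rule time_test_tbounded[OF \<psi>(1)])
    have t2: "tbounded T (\<lambda>t. B t * prim \<psi> t)" by (rule tbounded_mult_prim[OF B tb\<psi>])
    have "prim \<psi> T * prim B T = prim (\<lambda>s. \<psi> s * prim B s + B s * prim \<psi> s) T"
      by (rule prim_mult[OF tb\<psi> B less_imp_le[OF T]])
    also have "\<dots> = (LINT t|?M. \<psi> t * prim B t + B t * prim \<psi> t)"
      by (rule tbounded_integrable(2)[symmetric, OF tbounded_add[OF psiB[OF \<psi>(1)] t2]])
    also have "\<dots> = (LINT t|?M. \<psi> t * prim B t) + (LINT t|?M. B t * prim \<psi> t)"
      by (rule Bochner_Integration.integral_add[OF tbounded_integrable(1)[OF psiB[OF \<psi>(1)]] tbounded_integrable(1)[OF t2]])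
    finally have 1: "(LINT t|?M. \<psi> t * prim B t) = - (LINT t|?M. B t * prim \<psi> t)" using \<psi>(2) by simp
    have "(LINT t|?M. \<psi> t * A t + prim \<psi> t * B t) = 0" by (rule weak[OF \<phi>])
    then have "(LINT t|?M. \<psi> t * A t) + (LINT t|?M. prim \<psi> t * B t) = 0"
      using mt(1)[OF \<psi>(1) A] mt(1)[OF \<phi>(1) B] by simp
    then show ?thesis using 1 mt(1)[OF \<psi>(1) A] tbounded_integrable(1)[OF psiB[OF \<psi>(1)]]
      by (simp add: R_def right_diff_distrib mult.commute)
  qed
  have fm: "finite_measure ?M" by (rule finite_measure_lebesgue_on) simp
  have "\<exists>\<psi>. time_test T \<psi> \<and> prim \<psi> T \<noteq> 0"
  proof (rule ccontr)
    assume "\<nexists>\<psi>. time_test T \<psi> \<and> prim \<psi> T \<noteq> 0"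
    then have z: "prim \<phi> T = 0" if "time_test T \<phi>" for \<phi> using that by blast
    have "AE t in ?M. (1::real) = 0"
    proof (rule AE_zero_if_test_integrals_zero[OF \<theta> finite_measure.integrable_const[OF fm]])
      fix \<phi> assume "time_test T \<phi>"
      then show "(LINT t|?M. \<phi> t * 1) = 0"
        using tbounded_integrable(2)[OF time_test_tbounded] z by simp
    qed
    then have "eventually (\<lambda>_. False) (ae_filter ?M)" by simp
    then have "emeasure ?M (space ?M) = 0" by (simp only: eventually_False ae_filter_eq_bot_iff)
    then show False using T by (simp add: emeasure_restrict_space)
  qed
  then obtain \<psi> where \<psi>: "time_test T \<psi>" "prim \<psi> T \<noteq> 0" by blast
  define c where "c = (LINT t|?M. \<psi> t * R t) / prim \<psi> T"
  have "AE t in ?M. R t - c = 0"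
  proof (rule AE_zero_if_test_integrals_zero[OF \<theta>])
    have iB: "integrable ?M (prim B)"
    proof -
      obtain K where K: "\<And>s t. \<bar>prim B t - prim B s\<bar> \<le> K * \<bar>t - s\<bar>" "K \<ge> 0"
        by (rule prim_Lipschitz[OF B]; rule that; assumption)
      show ?thesis
      proof (rule finite_measure.integrable_const_bound[OF fm, where B = "K * T"])
        show "AE t in ?M. norm (prim B t) \<le> K * T"
        proof (rule AE_I2)
          fix t assume "t \<in> space ?M"
          then have "K * \<bar>t - 0\<bar> \<le> K * T" using K(2) by (intro mult_left_mono) auto
          then show "norm (prim B t) \<le> K * T" using K(1)[of t 0] by simp
        qed
        show "prim B \<in> borel_measurable ?M" using pB by (rule measurable_restrict_space1)
      qed
    qed
    show "integrable ?M (\<lambda>t. R t - c)"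
      unfolding R_def by (intro Bochner_Integration.integrable_diff tbounded_integrable(1)[OF A] iB
          finite_measure.integrable_const[OF fm])
    fix \<eta> assume \<eta>: "time_test T \<eta>"
    let ?m = "prim \<eta> T / prim \<psi> T"
    have tb: "tbounded T \<eta>" "tbounded T \<psi>" using \<eta> \<psi>(1) time_test_tbounded by blast+
    have "time_test T (\<lambda>t. \<eta> t - ?m * \<psi> t)"
    proof -
      obtain a b where ab: "0 < a" "b < T" "\<And>t. t \<notin> {a..b} \<Longrightarrow> \<eta> t = 0" "smooth \<eta>"
        using \<eta> by (auto simp: time_test_def)
      obtain a' b' where ab': "0 < a'" "b' < T" "\<And>t. t \<notin> {a'..b'} \<Longrightarrow> \<psi> t = 0" "smooth \<psi>"
        using \<psi>(1) by (auto simp: time_test_def)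
      have "smooth (\<lambda>t. \<eta> t - ?m * \<psi> t)" by (intro smooth_diff smooth_cmult ab(4) ab'(4))
      moreover have "\<eta> t - ?m * \<psi> t = 0" if "t \<notin> {min a a'..max b b'}" for t
      proof -
        have "t \<notin> {a..b}" "t \<notin> {a'..b'}" using that by auto
        then show ?thesis using ab(3) ab'(3) by simp
      qed
      moreover have "0 < min a a'" "max b b' < T" using ab ab' by auto
      ultimately show ?thesis unfolding time_test_def by blast
    qed
    moreover have "prim (\<lambda>t. \<eta> t - ?m * \<psi> t) T = 0"
      using \<psi>(2) tbounded_integrable_on[OF tb(1)] tbounded_integrable_on[OF tb(2)]
      by (simp add: integral_diff integrable_on_mult_right)
    ultimately have "(LINT t|?M. (\<eta> t - ?m * \<psi> t) * R t) = 0" by (rule zero_mean)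
    then have "(LINT t|?M. \<eta> t * R t) = ?m * (LINT t|?M. \<psi> t * R t)"
      using psiR[OF \<eta>] psiR[OF \<psi>(1)] by (simp add: left_diff_distrib mult.assoc)
    also have "\<dots> = c * prim \<eta> T" by (simp add: c_def)
    also have "\<dots> = (LINT t|?M. c * \<eta> t)" using tbounded_integrable(2)[OF tb(1)] by simp
    finally show "(LINT t|?M. \<eta> t * (R t - c)) = 0"
      using psiR[OF \<eta>] tbounded_integrable(1)[OF tb(1)] by (simp add: right_diff_distrib mult.commute)
  qed
  then have "AE t in ?M. A t = c + prim B t" by eventually_elim (simp add: R_def)
  then show thesis by (rule that)
qed

section \<open>The energy norm and weak continuity of the nonlinear terms\<close>

definition L2 :: "(real^3 \<Rightarrow> real) \<Rightarrow> bool" where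
  "L2 f \<longleftrightarrow> f \<in> borel_measurable torus \<and> integrable torus (\<lambda>x. (f x)\<^sup>2)"

lemma abs_mult_le_squares:
  fixes a b :: real
  assumes "d > 0" shows "\<bar>a * b\<bar> \<le> d * a\<^sup>2 + b\<^sup>2 / d"
proof -
  have "0 \<le> (d * \<bar>a\<bar> - \<bar>b\<bar>)\<^sup>2" by simp
  then have "2 * (d * (\<bar>a\<bar> * \<bar>b\<bar>)) \<le> d\<^sup>2 * a\<^sup>2 + b\<^sup>2"
    by (simp add: power2_diff power_mult_distrib mult_ac)
  moreover have "0 \<le> d * (\<bar>a\<bar> * \<bar>b\<bar>)" using assms by simp
  moreover have "d * (d * a\<^sup>2 + b\<^sup>2 / d) = d\<^sup>2 * a\<^sup>2 + b\<^sup>2"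
    using assms by (simp add: power2_eq_square distrib_left)
  ultimately have "d * \<bar>a * b\<bar> \<le> d * (d * a\<^sup>2 + b\<^sup>2 / d)"
    unfolding abs_mult by linarith
  then show ?thesis using assms mult_le_cancel_left_pos by blast
qed

lemma L2_mult_integrable:
  assumes "L2 a" "L2 b" shows "integrable torus (\<lambda>x. a x * b x)"
proof (rule Bochner_Integration.integrable_bound)
  show "integrable torus (\<lambda>x. 1 * (a x)\<^sup>2 + (b x)\<^sup>2 / 1)" using assms by (simp add: L2_def)
  show "(\<lambda>x. a x * b x) \<in> borel_measurable torus"
    using assms unfolding L2_def by (intro borel_measurable_times) auto
  show "AE x in torus. norm (a x * b x) \<le> norm (1 * (a x)\<^sup>2 + (b x)\<^sup>2 / 1)"
    using abs_mult_le_squares[of 1] by (intro AE_I2) (auto intro: order_trans[OF _ abs_ge_self])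
qed

lemma L2_integrable: "L2 a \<Longrightarrow> integrable torus a"
  unfolding L2_def by (blast intro: torus.square_integrable_imp_integrable)

lemma L2_diff: assumes "L2 a" "L2 b" shows "L2 (\<lambda>x. a x - b x)"
proof -
  have "integrable torus (\<lambda>x. (a x)\<^sup>2 - 2 * (a x * b x) + (b x)\<^sup>2)"
    using assms L2_mult_integrable[OF assms] by (simp add: L2_def)
  moreover have "(\<lambda>x. (a x - b x)\<^sup>2) = (\<lambda>x. (a x)\<^sup>2 - 2 * (a x * b x) + (b x)\<^sup>2)"
    by (simp add: fun_eq_iff power2_diff)
  moreover have "(\<lambda>x. a x - b x) \<in> borel_measurable torus"
    using assms unfolding L2_def by (intro borel_measurable_diff) auto
  ultimately show ?thesis by (simp add: L2_def)
qed

text \<open>Young's inequality with a free parameter replaces the Cauchy-Schwarz inequality; the parameter is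
  chosen when passing to the limit.\<close>

lemma L2_product_bound:
  assumes L: "L2 a" "L2 b" "L2 a'" "L2 b'" and \<eta>: "cper \<eta>" "\<And>x. \<bar>\<eta> x\<bar> \<le> B" and d: "d > 0"
  shows "\<bar>(LINT x|torus. a' x * b' x * \<eta> x) - (LINT x|torus. a x * b x * \<eta> x)\<bar>
    \<le> B * ((LINT x|torus. (a' x - a x)\<^sup>2) + (LINT x|torus. (b' x - b x)\<^sup>2)
        + d * ((LINT x|torus. (a x)\<^sup>2) + (LINT x|torus. (b x)\<^sup>2))
        + ((LINT x|torus. (a' x - a x)\<^sup>2) + (LINT x|torus. (b' x - b x)\<^sup>2)) / d)"
proof -
  have B: "B \<ge> 0" using \<eta>(2)[of 0] by linarith
  have m: "integrable torus (\<lambda>x. f x * g x * \<eta> x)" if "L2 f" "L2 g" for f g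
    using integrable_cper_mult[OF \<eta>(1) L2_mult_integrable[OF that]] by (simp add: mult_ac)
  note da = L2_diff[OF L(3,1)] and db = L2_diff[OF L(4,2)]
  have sq: "integrable torus (\<lambda>x. (a' x - a x)\<^sup>2)" "integrable torus (\<lambda>x. (b' x - b x)\<^sup>2)"
    "integrable torus (\<lambda>x. (a x)\<^sup>2)" "integrable torus (\<lambda>x. (b x)\<^sup>2)"
    using da db L by (simp_all add: L2_def)
  let ?G = "\<lambda>x. B * ((a' x - a x)\<^sup>2 + (b' x - b x)\<^sup>2 + d * ((a x)\<^sup>2 + (b x)\<^sup>2) + ((a' x - a x)\<^sup>2 + (b' x - b x)\<^sup>2) / d)"
  have ptw: "\<bar>a' x * b' x * \<eta> x - a x * b x * \<eta> x\<bar> \<le> ?G x" for x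
  proof -
    define p q where "p = a' x - a x" and "q = b' x - b x"
    have "a' x * b' x - a x * b x = p * q + (a x * q + b x * p)" by (simp add: p_def q_def algebra_simps)
    then have "\<bar>a' x * b' x - a x * b x\<bar> \<le> \<bar>p * q\<bar> + (\<bar>a x * q\<bar> + \<bar>b x * p\<bar>)" by (simp add: abs_triangle_ineq order_trans[OF abs_triangle_ineq])
    also have "\<dots> \<le> (1 * p\<^sup>2 + q\<^sup>2 / 1) + ((d * (a x)\<^sup>2 + q\<^sup>2 / d) + (d * (b x)\<^sup>2 + p\<^sup>2 / d))"
      by (intro add_mono abs_mult_le_squares d) simp
    also have "\<dots> = p\<^sup>2 + q\<^sup>2 + d * ((a x)\<^sup>2 + (b x)\<^sup>2) + (p\<^sup>2 + q\<^sup>2) / d" by (simp add: distrib_left add_divide_distrib)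
    finally have le: "\<bar>a' x * b' x - a x * b x\<bar> \<le> p\<^sup>2 + q\<^sup>2 + d * ((a x)\<^sup>2 + (b x)\<^sup>2) + (p\<^sup>2 + q\<^sup>2) / d" .
    have "\<bar>a' x * b' x * \<eta> x - a x * b x * \<eta> x\<bar> = \<bar>\<eta> x\<bar> * \<bar>a' x * b' x - a x * b x\<bar>"
      by (simp add: abs_mult[symmetric] algebra_simps)
    also have "\<dots> \<le> B * (p\<^sup>2 + q\<^sup>2 + d * ((a x)\<^sup>2 + (b x)\<^sup>2) + (p\<^sup>2 + q\<^sup>2) / d)"
      by (intro mult_mono \<eta> le B) auto
    finally show ?thesis by (simp add: p_def q_def)
  qed
  have "(LINT x|torus. a' x * b' x * \<eta> x) - (LINT x|torus. a x * b x * \<eta> x) = (LINT x|torus. a' x * b' x * \<eta> x - a x * b x * \<eta> x)"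
    using m[OF L(3,4)] m[OF L(1,2)] by simp
  then have "\<bar>(LINT x|torus. a' x * b' x * \<eta> x) - (LINT x|torus. a x * b x * \<eta> x)\<bar> \<le> (LINT x|torus. \<bar>a' x * b' x * \<eta> x - a x * b x * \<eta> x\<bar>)"
    using integral_abs_bound by simp
  also have "\<dots> \<le> (LINT x|torus. ?G x)"
    using m[OF L(3,4)] m[OF L(1,2)] sq by (intro integral_mono ptw) auto
  also have "\<dots> = B * ((LINT x|torus. (a' x - a x)\<^sup>2) + (LINT x|torus. (b' x - b x)\<^sup>2)
        + d * ((LINT x|torus. (a x)\<^sup>2) + (LINT x|torus. (b x)\<^sup>2))
        + ((LINT x|torus. (a' x - a x)\<^sup>2) + (LINT x|torus. (b' x - b x)\<^sup>2)) / d)"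
    using sq by simp
  finally show ?thesis .
qed

lemma L2_product_tendsto:
  assumes L: "\<And>n. L2 (A n)" "\<And>n. L2 (B n)" "L2 a" "L2 b" and \<eta>: "cper \<eta>"
    and lim: "(\<lambda>n. LINT x|torus. (A n x - a x)\<^sup>2) \<longlonglongrightarrow> 0" "(\<lambda>n. LINT x|torus. (B n x - b x)\<^sup>2) \<longlonglongrightarrow> 0"
  shows "(\<lambda>n. LINT x|torus. A n x * B n x * \<eta> x) \<longlonglongrightarrow> (LINT x|torus. a x * b x * \<eta> x)"
proof -
  obtain K where K: "K > 0" "\<And>x. \<bar>\<eta> x\<bar> \<le> K" using cper_bounded[OF \<eta>] by metis
  define e where "e n = (LINT x|torus. (A n x - a x)\<^sup>2) + (LINT x|torus. (B n x - b x)\<^sup>2)" for n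
  define S where "S = (LINT x|torus. (a x)\<^sup>2) + (LINT x|torus. (b x)\<^sup>2)"
  have e0: "e n \<ge> 0" for n unfolding e_def by simp
  have e: "e \<longlonglongrightarrow> 0" unfolding e_def using tendsto_add[OF lim] by simp
  \<comment> \<open>The free parameter is chosen of the order of the square root of the error.\<close>
  define d where "d n = sqrt (e n) + inverse (real (Suc n))" for n
  have d: "d n > 0" for n unfolding d_def using e0[of n] by (intro add_nonneg_pos) auto
  have ed: "e n / d n \<le> sqrt (e n)" for n
  proof -
    have "e n = sqrt (e n) * sqrt (e n)" using e0 by simp
    also have "\<dots> \<le> sqrt (e n) * d n" using e0[of n] by (intro mult_left_mono) (auto simp: d_def)
    finally show ?thesis using d[of n] by (simp add: divide_le_eq)
  qed
  have se: "(\<lambda>n. sqrt (e n)) \<longlonglongrightarrow> 0" using tendsto_real_sqrt[OF e] by simp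
  have dl: "d \<longlonglongrightarrow> 0" unfolding d_def using tendsto_add[OF se LIMSEQ_inverse_real_of_nat] by simp
  have bd: "(\<lambda>n. K * (e n + d n * S + sqrt (e n))) \<longlonglongrightarrow> K * (0 + 0 * S + 0)"
    by (intro tendsto_mult tendsto_add tendsto_const e dl se)
  show ?thesis
  proof (rule LIM_zero_cancel, rule Lim_null_comparison)
    show "(\<lambda>n. K * (e n + d n * S + sqrt (e n))) \<longlonglongrightarrow> 0" using bd by simp
    show "eventually (\<lambda>n. norm ((LINT x|torus. A n x * B n x * \<eta> x) - (LINT x|torus. a x * b x * \<eta> x)) \<le> K * (e n + d n * S + sqrt (e n))) sequentially"
    proof (rule always_eventually, rule allI)
      fix n
      have "\<bar>(LINT x|torus. A n x * B n x * \<eta> x) - (LINT x|torus. a x * b x * \<eta> x)\<bar> \<le> K * (e n + d n * S + e n / d n)"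
        unfolding e_def S_def by (rule L2_product_bound[OF L(3,4) L(1,2) \<eta> K(2) d])
      also have "\<dots> \<le> K * (e n + d n * S + sqrt (e n))"
        using ed[of n] K(1) by (intro mult_left_mono add_left_mono) auto
      finally show "norm ((LINT x|torus. A n x * B n x * \<eta> x) - (LINT x|torus. a x * b x * \<eta> x)) \<le> K * (e n + d n * S + sqrt (e n))"
        by simp
    qed
  qed
qed

lemma L2_const: "L2 (\<lambda>x. c)"
  by (simp add: L2_def)

lemma norm2_vec3: "(norm (v::real^3))\<^sup>2 = (\<Sum>j\<in>UNIV. (v $ j)\<^sup>2)"
  unfolding power2_norm_eq_inner inner_vec_def by (simp add: power2_eq_square)

lemma Lp2_norm_eq:
  fixes h :: "real^3 \<Rightarrow> real^3"
  assumes "Lp_norm 2 h < \<infinity>"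
  shows "L2 (\<lambda>x. h x $ j)" "(Lp_norm 2 h)\<^sup>2 = ennreal (\<Sum>j\<in>UNIV. LINT x|torus. (h x $ j)\<^sup>2)"
proof -
  let ?n = "\<integral>\<^sup>+x. ennreal (norm (h x) powr 2) \<partial>torus"
  have tm: "torus_measurable h" and eq: "Lp_norm 2 h = ennpowr ?n (1 / 2)"
    using assms by (auto simp: Lp_norm_def split: if_splits)
  have m: "(\<lambda>x. h x $ j) \<in> borel_measurable torus" for j
  proof -
    have "h \<in> borel_measurable torus" using tm by (auto simp: torus_measurable_def intro: measurable_restrict_space1)
    then have "(\<lambda>x. h x \<bullet> axis j 1) \<in> borel_measurable torus" by (intro borel_measurable_inner) auto
    then show ?thesis by (simp add: inner_axis)
  qed
  have fin: "?n < \<infinity>"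
  proof (rule ccontr)
    assume "\<not> ?n < \<infinity>"
    then have "?n = \<infinity>" by (metis infinity_ennreal_def less_top)
    then show False using assms unfolding eq ennpowr_def by simp
  qed
  have n: "?n = (\<Sum>j\<in>UNIV. \<integral>\<^sup>+x. ennreal ((h x $ j)\<^sup>2) \<partial>torus)"
  proof -
    have "ennreal (norm (h x) powr 2) = (\<Sum>j\<in>UNIV. ennreal ((h x $ j)\<^sup>2))" for x
      by (simp add: norm2_vec3 sum_ennreal)
    then have "?n = (\<integral>\<^sup>+x. (\<Sum>j\<in>UNIV. ennreal ((h x $ j)\<^sup>2)) \<partial>torus)" by (simp only:)
    also have "\<dots> = (\<Sum>j\<in>UNIV. \<integral>\<^sup>+x. ennreal ((h x $ j)\<^sup>2) \<partial>torus)"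
      using m by (intro nn_integral_sum) measurable
    finally show ?thesis .
  qed
  have i: "integrable torus (\<lambda>x. (h x $ j)\<^sup>2)" for j
  proof (rule integrableI_bounded)
    show "(\<lambda>x. (h x $ j)\<^sup>2) \<in> borel_measurable torus" using m by measurable
    have "(\<integral>\<^sup>+x. ennreal ((h x $ j)\<^sup>2) \<partial>torus) \<le> ?n"
      unfolding n by (rule member_le_sum) auto
    then show "(\<integral>\<^sup>+x. ennreal (norm ((h x $ j)\<^sup>2)) \<partial>torus) < \<infinity>" using fin by (simp add: le_less_trans)
  qed
  then show "L2 (\<lambda>x. h x $ j)" using m by (simp add: L2_def)
  have n': "?n = ennreal (\<Sum>j\<in>UNIV. LINT x|torus. (h x $ j)\<^sup>2)"
    unfolding n by (simp add: nn_integral_eq_integral[OF i] sum_ennreal)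
  have pos: "0 \<le> (\<Sum>j\<in>UNIV. LINT x|torus. (h x $ j)\<^sup>2)" by (intro sum_nonneg) simp
  have "Lp_norm 2 h = ennreal (sqrt (\<Sum>j\<in>UNIV. LINT x|torus. (h x $ j)\<^sup>2))"
    unfolding eq n' ennpowr_def using pos by (simp add: powr_half_sqrt)
  then show "(Lp_norm 2 h)\<^sup>2 = ennreal (\<Sum>j\<in>UNIV. LINT x|torus. (h x $ j)\<^sup>2)"
    using pos by (simp add: ennreal_power)
qed

abbreviation component :: "(real^3 \<Rightarrow> real^3) \<Rightarrow> 3 \<Rightarrow> real^3 \<Rightarrow> real" where
  "component w \<equiv> (\<lambda>i x. w x $ i)"

abbreviation grad :: "(real^3 \<Rightarrow> real^3) \<Rightarrow> 3 \<Rightarrow> 3 \<Rightarrow> real^3 \<Rightarrow> real" where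
  "grad w \<equiv> (\<lambda>k i x. weak_partial k w x $ i)"

definition energy :: "real \<Rightarrow> (3 \<Rightarrow> real^3 \<Rightarrow> real) \<Rightarrow> (3 \<Rightarrow> 3 \<Rightarrow> real^3 \<Rightarrow> real) \<Rightarrow> real" where
  "energy \<alpha> U D = (\<Sum>j\<in>UNIV. LINT x|torus. (U j x)\<^sup>2) + \<alpha>\<^sup>2 * (\<Sum>k\<in>UNIV. \<Sum>j\<in>UNIV. LINT x|torus. (D k j x)\<^sup>2)"

lemma energy_nonneg: "energy \<alpha> U D \<ge> 0"
  unfolding energy_def by (intro add_nonneg_nonneg mult_nonneg_nonneg sum_nonneg) auto

lemma H1_norm_facts:
  assumes \<alpha>: "\<alpha> > 0" and fin: "H1_norm \<alpha> w < \<infinity>"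
  shows "has_weak_partial k w (weak_partial k w)" "wpart k (component w j) (grad w k j)"
    "L2 (component w j)" "L2 (grad w k j)" "H1_norm \<alpha> w = ennreal (sqrt (energy \<alpha> (component w) (grad w)))"
proof -
  let ?X = "(Lp_norm 2 w)\<^sup>2 + ennreal (\<alpha>\<^sup>2) * (\<Sum>i\<in>UNIV. (Lp_norm 2 (weak_partial i w))\<^sup>2)"
  have ex: "\<forall>i. \<exists>g. has_weak_partial i w g" and eq: "H1_norm \<alpha> w = ennpowr ?X (1 / 2)"
    using fin by (auto simp: H1_norm_def split: if_splits)
  show h: "has_weak_partial k w (weak_partial k w)" for k
    unfolding weak_partial_def by (rule someI_ex[OF ex[rule_format]])
  show "wpart k (component w j) (grad w k j)" by (rule has_weak_partial_component[OF h])
  have X: "?X < \<infinity>"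
  proof (rule ccontr)
    assume "\<not> ?X < \<infinity>"
    then have "?X = \<infinity>" by (metis infinity_ennreal_def less_top)
    then show False using fin unfolding eq ennpowr_def by simp
  qed
  then have "(Lp_norm 2 w)\<^sup>2 < \<infinity>" "ennreal (\<alpha>\<^sup>2) * (\<Sum>i\<in>UNIV. (Lp_norm 2 (weak_partial i w))\<^sup>2) < \<infinity>"
    by (auto simp: ennreal_add_eq_top less_top)
  then have Lw: "Lp_norm 2 w < \<infinity>" and "(\<Sum>i\<in>UNIV. (Lp_norm 2 (weak_partial i w))\<^sup>2) < \<infinity>"
    using \<alpha> by (auto simp: power_less_top_ennreal ennreal_mult_less_top)
  then have "(Lp_norm 2 (weak_partial k w))\<^sup>2 < \<infinity>" for k
    using member_le_sum[of k UNIV "\<lambda>i. (Lp_norm 2 (weak_partial i w))\<^sup>2"] by (auto intro: le_less_trans)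
  then have Lg: "Lp_norm 2 (weak_partial k w) < \<infinity>" for k
    by (simp add: power_less_top_ennreal)
  show "L2 (component w j)" "L2 (grad w k j)" using Lp2_norm_eq(1)[OF Lw] Lp2_norm_eq(1)[OF Lg] by auto
  have "?X = ennreal (energy \<alpha> (component w) (grad w))"
    unfolding energy_def Lp2_norm_eq(2)[OF Lw] Lp2_norm_eq(2)[OF Lg]
    by (simp add: sum_nonneg ennreal_plus ennreal_mult)
  then show "H1_norm \<alpha> w = ennreal (sqrt (energy \<alpha> (component w) (grad w)))"
    unfolding eq ennpowr_def using energy_nonneg by (simp add: powr_half_sqrt)
qed

lemma wpart_diff:
  assumes "wpart i f g" "wpart i f' g'" shows "wpart i (\<lambda>x. f x - f' x) (\<lambda>x. g x - g' x)"
proof -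
  note i = wpartD(1,2)[OF assms(1)] wpartD(1,2)[OF assms(2)]
  have "(LINT x|torus. \<phi> x * (h x - h' x)) = (LINT x|torus. \<phi> x * h x) - (LINT x|torus. \<phi> x * h' x)"
    if "sper \<phi>" "integrable torus h" "integrable torus h'" for \<phi> h h'
    using integrable_cper_mult[OF sper_cper[OF that(1)] that(2)] integrable_cper_mult[OF sper_cper[OF that(1)] that(3)]
    by (simp add: right_diff_distrib)
  then show ?thesis
    using i wpartD(3)[OF assms(1)] wpartD(3)[OF assms(2)] by (simp add: wpart_def sper_partial)
qed

text \<open>Weak derivatives are chosen without regard to linearity; their uniqueness identifies the gradient of
  the difference with the difference of the gradients almost everywhere.\<close>

lemma H1_convergence:
  assumes \<alpha>: "\<alpha> > 0" and fin: "H1_norm \<alpha> w < \<infinity>" "\<And>n. H1_norm \<alpha> (\<sigma> n) < \<infinity>"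
    and lim: "(\<lambda>n. H1_norm \<alpha> (\<lambda>x. w x - \<sigma> n x)) \<longlonglongrightarrow> 0"
  shows "(\<lambda>n. LINT x|torus. (component (\<sigma> n) j x - component w j x)\<^sup>2) \<longlonglongrightarrow> 0"
    and "(\<lambda>n. LINT x|torus. (grad (\<sigma> n) k j x - grad w k j x)\<^sup>2) \<longlonglongrightarrow> 0"
proof -
  let ?d = "\<lambda>n x. w x - \<sigma> n x"
  have ev: "eventually (\<lambda>n. H1_norm \<alpha> (?d n) < \<infinity>) sequentially"
    using order_tendstoD(2)[OF lim, of \<infinity>] by simp
  let ?E = "\<lambda>n. energy \<alpha> (component (?d n)) (grad (?d n))"
  have "(\<lambda>n. enn2real (H1_norm \<alpha> (?d n))) \<longlonglongrightarrow> 0"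
    using tendsto_enn2real[OF lim[folded ennreal_0]] by simp
  then have "(\<lambda>n. (enn2real (H1_norm \<alpha> (?d n)))\<^sup>2) \<longlonglongrightarrow> 0\<^sup>2" by (intro tendsto_power)
  moreover have "eventually (\<lambda>n. (enn2real (H1_norm \<alpha> (?d n)))\<^sup>2 = ?E n) sequentially"
    using ev by eventually_elim (simp add: H1_norm_facts(5)[OF \<alpha>] energy_nonneg)
  ultimately have E: "?E \<longlonglongrightarrow> 0" using tendsto_cong by force
  have c1: "(LINT x|torus. (component (\<sigma> n) j x - component w j x)\<^sup>2) \<le> ?E n" for n
  proof -
    have "(LINT x|torus. (component (\<sigma> n) j x - component w j x)\<^sup>2) = (LINT x|torus. (component (?d n) j x)\<^sup>2)"
      by (simp add: power2_commute)
    also have "\<dots> \<le> (\<Sum>j\<in>UNIV. LINT x|torus. (component (?d n) j x)\<^sup>2)" by (rule member_le_sum) auto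
    also have "\<dots> \<le> ?E n" unfolding energy_def by (simp add: sum_nonneg)
    finally show ?thesis .
  qed
  show "(\<lambda>n. LINT x|torus. (component (\<sigma> n) j x - component w j x)\<^sup>2) \<longlonglongrightarrow> 0"
    by (rule Lim_null_comparison[OF always_eventually E]) (use c1 in simp)
  have c2: "(LINT x|torus. (grad (\<sigma> n) k j x - grad w k j x)\<^sup>2) \<le> ?E n / \<alpha>\<^sup>2" if f: "H1_norm \<alpha> (?d n) < \<infinity>" for n
  proof -
    have "wpart k (\<lambda>x. component w j x - component (\<sigma> n) j x) (grad (?d n) k j)"
      using H1_norm_facts(2)[OF \<alpha> f, of k j] by simp
    then have "AE x in torus. grad (?d n) k j x = grad w k j x - grad (\<sigma> n) k j x"
      by (rule wpart_unique[OF _ wpart_diff[OF H1_norm_facts(2)[OF \<alpha> fin(1)] H1_norm_facts(2)[OF \<alpha> fin(2)]]])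
    moreover have "L2 (grad (\<sigma> n) k j)" "L2 (grad w k j)" "L2 (grad (?d n) k j)"
      by (intro H1_norm_facts(4)[OF \<alpha>] fin f)+
    ultimately have "(LINT x|torus. (grad (\<sigma> n) k j x - grad w k j x)\<^sup>2) = (LINT x|torus. (grad (?d n) k j x)\<^sup>2)"
      using L2_diff by (intro integral_cong_AE) (auto simp: L2_def power2_commute)
    also have "\<dots> \<le> (\<Sum>j\<in>UNIV. LINT x|torus. (grad (?d n) k j x)\<^sup>2)"
      by (rule member_le_sum[of j UNIV "\<lambda>j. LINT x|torus. (grad (?d n) k j x)\<^sup>2"]) auto
    also have "\<dots> \<le> (\<Sum>k\<in>UNIV. \<Sum>j\<in>UNIV. LINT x|torus. (grad (?d n) k j x)\<^sup>2)"
      by (rule member_le_sum[of k UNIV "\<lambda>k. \<Sum>j\<in>UNIV. LINT x|torus. (grad (?d n) k j x)\<^sup>2"]) (auto intro: sum_nonneg)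
    also have "\<dots> \<le> ?E n / \<alpha>\<^sup>2"
      unfolding energy_def using \<alpha> by (simp add: field_simps sum_nonneg)
    finally show ?thesis .
  qed
  have "(\<lambda>n. ?E n / \<alpha>\<^sup>2) \<longlonglongrightarrow> 0" using tendsto_divide[OF E tendsto_const[of "\<alpha>\<^sup>2"]] \<alpha> by simp
  moreover have "eventually (\<lambda>n. norm (LINT x|torus. (grad (\<sigma> n) k j x - grad w k j x)\<^sup>2) \<le> ?E n / \<alpha>\<^sup>2) sequentially"
    using ev by eventually_elim (use c2 in simp)
  ultimately show "(\<lambda>n. LINT x|torus. (grad (\<sigma> n) k j x - grad w k j x)\<^sup>2) \<longlonglongrightarrow> 0"
    by (rule Lim_null_comparison[rotated])
qed

lemma Lp1_norm_facts:
  fixes q :: "real^3 \<Rightarrow> real"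
  assumes "Lp_norm 1 q < \<infinity>"
  shows "integrable torus q" "Lp_norm 1 q = ennreal (LINT x|torus. \<bar>q x\<bar>)"
proof -
  let ?n = "\<integral>\<^sup>+x. ennreal (norm (q x) powr 1) \<partial>torus"
  have tm: "torus_measurable q" and eq: "Lp_norm 1 q = ennpowr ?n (1 / 1)"
    using assms by (auto simp: Lp_norm_def split: if_splits)
  have m: "q \<in> borel_measurable torus" using tm by (auto simp: torus_measurable_def intro: measurable_restrict_space1)
  have fin: "?n < \<infinity>"
  proof (rule ccontr)
    assume "\<not> ?n < \<infinity>"
    then have "?n = \<infinity>" by (metis infinity_ennreal_def less_top)
    then show False using assms unfolding eq ennpowr_def by simp
  qed
  then show i: "integrable torus q" using m by (intro integrableI_bounded) auto
  have "?n = ennreal (LINT x|torus. \<bar>q x\<bar>)"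
    using nn_integral_eq_integral[of torus "\<lambda>x. \<bar>q x\<bar>"] i by simp
  then show "Lp_norm 1 q = ennreal (LINT x|torus. \<bar>q x\<bar>)"
    unfolding eq ennpowr_def by (simp add: powr_one)
qed

lemma L1_convergence:
  assumes fin: "Lp_norm 1 q < \<infinity>" "\<And>n. Lp_norm 1 (\<tau> n) < \<infinity>"
    and lim: "(\<lambda>n. Lp_norm 1 (\<lambda>x. q x - \<tau> n x)) \<longlonglongrightarrow> 0" and \<eta>: "cper \<eta>"
  shows "(\<lambda>n. LINT x|torus. \<eta> x * \<tau> n x) \<longlonglongrightarrow> (LINT x|torus. \<eta> x * q x)"
proof -
  obtain K where K: "K > 0" "\<And>x. \<bar>\<eta> x\<bar> \<le> K" using cper_bounded[OF \<eta>] by metis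
  have ev: "eventually (\<lambda>n. Lp_norm 1 (\<lambda>x. q x - \<tau> n x) < \<infinity>) sequentially"
    using order_tendstoD(2)[OF lim, of \<infinity>] by simp
  have l: "(\<lambda>n. K * enn2real (Lp_norm 1 (\<lambda>x. q x - \<tau> n x))) \<longlonglongrightarrow> 0"
    using tendsto_mult[OF tendsto_const[of K] tendsto_enn2real[OF lim[folded ennreal_0]]] by simp
  show ?thesis
  proof (rule LIM_zero_cancel, rule Lim_null_comparison[OF _ l])
    show "eventually (\<lambda>n. norm ((LINT x|torus. \<eta> x * \<tau> n x) - (LINT x|torus. \<eta> x * q x)) \<le> K * enn2real (Lp_norm 1 (\<lambda>x. q x - \<tau> n x))) sequentially"
      using ev
    proof eventually_elim
      fix n assume f: "Lp_norm 1 (\<lambda>x. q x - \<tau> n x) < \<infinity>"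
      have i: "integrable torus q" "integrable torus (\<tau> n)" using Lp1_norm_facts(1) fin by blast+
      have "(LINT x|torus. \<eta> x * \<tau> n x) - (LINT x|torus. \<eta> x * q x) = (LINT x|torus. \<eta> x * (\<tau> n x - q x))"
        using integrable_cper_mult[OF \<eta> i(1)] integrable_cper_mult[OF \<eta> i(2)] by (simp add: right_diff_distrib)
      then have "\<bar>(LINT x|torus. \<eta> x * \<tau> n x) - (LINT x|torus. \<eta> x * q x)\<bar> \<le> (LINT x|torus. \<bar>\<eta> x * (\<tau> n x - q x)\<bar>)"
        using integral_abs_bound by simp
      also have "\<dots> \<le> (LINT x|torus. K * \<bar>q x - \<tau> n x\<bar>)"
      proof (rule integral_mono)
        show "integrable torus (\<lambda>x. \<bar>\<eta> x * (\<tau> n x - q x)\<bar>)"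
          by (intro integrable_abs integrable_cper_mult \<eta> Bochner_Integration.integrable_diff i)
        show "integrable torus (\<lambda>x. K * \<bar>q x - \<tau> n x\<bar>)" using i by simp
        show "\<bar>\<eta> x * (\<tau> n x - q x)\<bar> \<le> K * \<bar>q x - \<tau> n x\<bar>" for x
          unfolding abs_mult abs_minus_commute[of "\<tau> n x"] by (intro mult_right_mono K) simp
      qed
      also have "\<dots> = K * enn2real (Lp_norm 1 (\<lambda>x. q x - \<tau> n x))"
        unfolding Lp1_norm_facts(2)[OF f] by simp
      finally show "norm ((LINT x|torus. \<eta> x * \<tau> n x) - (LINT x|torus. \<eta> x * q x)) \<le> K * enn2real (Lp_norm 1 (\<lambda>x. q x - \<tau> n x))"
        by simp
    qed
  qed
qed

text \<open>The pairing of \<open>v = u - \<alpha>\<^sup>2 \<Delta>u\<close> with \<open>e\<close> times the \<open>j\<close>-th unit vector; its time derivative is the flux.\<close>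

definition moment :: "real \<Rightarrow> (3 \<Rightarrow> real^3 \<Rightarrow> real) \<Rightarrow> (3 \<Rightarrow> 3 \<Rightarrow> real^3 \<Rightarrow> real) \<Rightarrow> 3 \<Rightarrow> (real^3 \<Rightarrow> real) \<Rightarrow> real" where
  "moment \<alpha> U D j e = (LINT x|torus. U j x * e x + \<alpha>\<^sup>2 * (\<Sum>k\<in>UNIV. D k j x * partial k e x))"

lemma moment_expand:
  assumes e: "sper e" and i: "\<And>j. integrable torus (U j)" "\<And>k j. integrable torus (D k j)"
  shows "integrable torus (\<lambda>x. U j x * e x + \<alpha>\<^sup>2 * (\<Sum>k\<in>UNIV. D k j x * partial k e x))"
    "moment \<alpha> U D j e = (LINT x|torus. U j x * e x) + \<alpha>\<^sup>2 * (\<Sum>k\<in>UNIV. LINT x|torus. D k j x * partial k e x)"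
proof -
  have m: "integrable torus (\<lambda>x. f x * g x)" if "sper g" "integrable torus f" for f g
    using integrable_cper_mult[OF sper_cper[OF that(1)] that(2)] by (simp add: mult.commute)
  have ii: "integrable torus (\<lambda>x. U j x * e x)" "integrable torus (\<lambda>x. D k j x * partial k e x)" for k
    by (intro m sper_partial e i)+
  show "integrable torus (\<lambda>x. U j x * e x + \<alpha>\<^sup>2 * (\<Sum>k\<in>UNIV. D k j x * partial k e x))"
    using ii by simp
  show "moment \<alpha> U D j e = (LINT x|torus. U j x * e x) + \<alpha>\<^sup>2 * (\<Sum>k\<in>UNIV. LINT x|torus. D k j x * partial k e x)"
    unfolding moment_def using ii by simp
qed

lemma moment_flux_convergence:
  assumes \<alpha>: "\<alpha> > 0" and e: "sper e"
    and fin: "H1_norm \<alpha> w < \<infinity>" "\<And>n. H1_norm \<alpha> (\<sigma> n) < \<infinity>" "Lp_norm 1 q < \<infinity>" "\<And>n. Lp_norm 1 (\<tau> n) < \<infinity>"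
    and lim: "(\<lambda>n. H1_norm \<alpha> (\<lambda>x. w x - \<sigma> n x)) \<longlonglongrightarrow> 0" "(\<lambda>n. Lp_norm 1 (\<lambda>x. q x - \<tau> n x)) \<longlonglongrightarrow> 0"
  shows "(\<lambda>n. moment \<alpha> (component (\<sigma> n)) (grad (\<sigma> n)) j e) \<longlonglongrightarrow> moment \<alpha> (component w) (grad w) j e"
    and "(\<lambda>n. flux \<alpha> (component (\<sigma> n)) (grad (\<sigma> n)) (\<tau> n) j e) \<longlonglongrightarrow> flux \<alpha> (component w) (grad w) q j e"
proof -
  note c = H1_convergence[OF \<alpha> fin(1,2) lim(1)]
  have L: "L2 (component w j)" "L2 (grad w k j)" "L2 (component (\<sigma> n) j)" "L2 (grad (\<sigma> n) k j)" for n k j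
    using H1_norm_facts(3,4)[OF \<alpha> fin(1)] H1_norm_facts(3,4)[OF \<alpha> fin(2)] by auto
  have one: "(\<lambda>n. LINT x|torus. A n x * \<eta> x) \<longlonglongrightarrow> (LINT x|torus. a x * \<eta> x)"
    if "\<And>n. L2 (A n)" "L2 a" "(\<lambda>n. LINT x|torus. (A n x - a x)\<^sup>2) \<longlonglongrightarrow> 0" "cper \<eta>" for A a \<eta>
    using L2_product_tendsto[OF that(1) L2_const[of 1] that(2) L2_const[of 1] that(4,3)] by simp
  show "(\<lambda>n. moment \<alpha> (component (\<sigma> n)) (grad (\<sigma> n)) j e) \<longlonglongrightarrow> moment \<alpha> (component w) (grad w) j e"
    unfolding moment_expand(2)[OF e L2_integrable[OF L(1)] L2_integrable[OF L(2)]]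
      moment_expand(2)[OF e L2_integrable[OF L(3)] L2_integrable[OF L(4)]]
    by (intro tendsto_add tendsto_mult tendsto_const tendsto_sum one[OF L(3) L(1) c(1)] one[OF L(4) L(2) c(2)]
        sper_cper sper_partial e)
  have p: "cper (partial i e)" "cper (partial i (partial k e))" for i k by (intro sper_cper sper_partial e)+
  show "(\<lambda>n. flux \<alpha> (component (\<sigma> n)) (grad (\<sigma> n)) (\<tau> n) j e) \<longlonglongrightarrow> flux \<alpha> (component w) (grad w) q j e"
    unfolding flux_expand(2)[OF e L2_mult_integrable[OF L(1) L(1)] L2_mult_integrable[OF L(2) L(2)]
        L2_mult_integrable[OF L(1) L(2)] L2_mult_integrable[OF L(2) L(1)] Lp1_norm_facts(1)[OF fin(3)]]
      flux_expand(2)[OF e L2_mult_integrable[OF L(3) L(3)] L2_mult_integrable[OF L(4) L(4)]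
        L2_mult_integrable[OF L(3) L(4)] L2_mult_integrable[OF L(4) L(3)] Lp1_norm_facts(1)[OF fin(4)]]
    by (intro tendsto_add tendsto_mult tendsto_const tendsto_sum L1_convergence[OF fin(3,4) lim(2) p(1)]
        L2_product_tendsto[OF L(3) L(3) L(1) L(1) p(1) c(1) c(1)]
        L2_product_tendsto[OF L(4) L(4) L(2) L(2) p(1) c(2) c(2)]
        L2_product_tendsto[OF L(3) L(4) L(1) L(2) p(2) c(1) c(2)]
        L2_product_tendsto[OF L(4) L(3) L(2) L(1) p(2) c(2) c(1)])
qed

section \<open>Separated test functions\<close>

lemma axis_collapse:
  fixes f :: "3 \<Rightarrow> real"
  shows "(\<Sum>l\<in>UNIV. f l * ((c *\<^sub>R axis j 1 :: real^3) $ l)) = f j * c"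
proof -
  have "f l * ((c *\<^sub>R axis j 1 :: real^3) $ l) = (if l = j then f j * c else 0)" for l by (simp add: axis_def)
  then show ?thesis by (simp only:) simp
qed

lemma axis_collapse2:
  fixes f :: "3 \<Rightarrow> 3 \<Rightarrow> real"
  shows "(\<Sum>l\<in>UNIV. \<Sum>k\<in>UNIV. f k l * ((c k *\<^sub>R axis j 1 :: real^3) $ l)) = (\<Sum>k\<in>UNIV. f k j * c k)"
  by (subst sum.swap) (simp only: axis_collapse)

lemma axis_collapse_diagonal: "(\<Sum>i\<in>UNIV. (c i *\<^sub>R axis j 1 :: real^3) $ i) = c j"
proof -
  have "(c i *\<^sub>R axis j 1 :: real^3) $ i = (if i = j then c j else 0)" for i by (simp add: axis_def)
  then show ?thesis by (simp only:) simp
qed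

text \<open>Products of a function of time, a function of space and a constant vector are the only test functions
  used: the spatial factors run through the finitely many waves of the mollification kernel.\<close>

lemma separated_test_function:
  fixes v :: "'b::real_normed_vector"
  assumes "time_test T \<phi>" "sper e"
  shows "test_function T (\<lambda>t x. (\<phi> t * e x) *\<^sub>R v)"
proof -
  obtain a b where ab: "0 < a" "b < T" "\<And>t. t \<notin> {a..b} \<Longrightarrow> \<phi> t = 0" and s: "smooth \<phi>"
    using assms(1) unfolding time_test_def by blast
  have e: "smooth e" "periodic e" using assms(2) by (auto simp: sper_def)
  have "smooth (\<lambda>p::real \<times> (real^3). \<phi> (fst p))" "smooth (\<lambda>p::real \<times> (real^3). e (snd p))"
    using smooth_comp_affine[OF bounded_linear_fst s, of 0] smooth_comp_affine[OF bounded_linear_snd e(1), of 0] by simp_all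
  then have "smooth (\<lambda>p::real \<times> (real^3). (\<phi> (fst p) * e (snd p)) *\<^sub>R v)"
    by (intro smooth_scaleR smooth_mult smooth_const)
  then have "smooth (\<lambda>(t, x). (\<phi> t * e x) *\<^sub>R v)" by (simp add: case_prod_beta')
  moreover have "\<forall>t. periodic (\<lambda>x. (\<phi> t * e x) *\<^sub>R v)" using e(2) by (simp add: periodic_def)
  moreover have "\<exists>a b. 0 < a \<and> b < T \<and> (\<forall>t x. t \<notin> {a..b} \<longrightarrow> (\<phi> t * e x) *\<^sub>R v = 0)"
    using ab by (intro exI[of _ a] exI[of _ b]) auto
  ultimately show ?thesis unfolding test_function_def by blast
qed

lemma partial_separated:
  assumes "sper e" shows "partial i (\<lambda>x. (a * e x) *\<^sub>R v) = (\<lambda>x. (a * partial i e x) *\<^sub>R v)"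
proof
  fix x
  have e: "smooth e" using assms by (simp add: sper_def)
  show "partial i (\<lambda>x. (a * e x) *\<^sub>R v) x = (a * partial i e x) *\<^sub>R v"
    unfolding partial_scaleR_const[OF smooth_cmult[OF e]] partial_cmult[OF e] ..
qed

lemma time_deriv_separated:
  assumes "(\<phi> has_real_derivative \<phi>') (at t)"
  shows "time_deriv (\<lambda>t x. (\<phi> t * e x) *\<^sub>R v) t = (\<lambda>x. (\<phi>' * e x) *\<^sub>R v)"
proof
  fix x
  have "((\<lambda>t. (\<phi> t * e x) *\<^sub>R v) has_vector_derivative (\<phi> t * e x) *\<^sub>R 0 + (\<phi>' * e x) *\<^sub>R v) (at t)"
    by (rule has_vector_derivative_scaleR[OF DERIV_cmult_right[OF assms] has_vector_derivative_const])
  then show "time_deriv (\<lambda>t x. (\<phi> t * e x) *\<^sub>R v) t x = (\<phi>' * e x) *\<^sub>R v"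
    unfolding time_deriv_def by (simp add: vector_derivative_at)
qed

lemma clark_integrand_separated:
  assumes e: "sper e" and \<phi>: "(\<phi> has_real_derivative \<phi>') (at t)"
  shows "clark_integrand \<alpha> u p (\<lambda>t x. (\<phi> t * e x) *\<^sub>R axis j 1) t x
    = \<phi>' * (component (u t) j x * e x + \<alpha>\<^sup>2 * (\<Sum>k\<in>UNIV. grad (u t) k j x * partial k e x))
    + \<phi> t * flux_density \<alpha> (component (u t)) (grad (u t)) (p t) j e x"
proof -
  have pull: "(\<Sum>i\<in>A. f i * (c * g i)) = c * (\<Sum>i\<in>A. f i * g i)" for c :: real and f g and A :: "3 set"
    by (simp add: sum_distrib_left mult_ac)
  have pull1: "f * (c * g) = c * (f * g)" for c f g :: real by simp
  show ?thesis
    unfolding clark_integrand_def Let_def time_deriv_separated[OF \<phi>] partial_separated[OF e]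
      partial_separated[OF sper_partial[OF e]] axis_collapse axis_collapse2 axis_collapse_diagonal flux_density_def
    unfolding pull sum_distrib_left[symmetric] sum.distrib
    by (simp add: algebra_simps)
qed

lemma clark_integral_separated:
  assumes \<alpha>: "\<alpha> > 0" and e: "sper e" and \<phi>: "(\<phi> has_real_derivative \<phi>') (at t)"
    and fin: "H1_norm \<alpha> (u t) < \<infinity>" "Lp_norm 1 (p t) < \<infinity>"
  shows "(LINT x|torus. clark_integrand \<alpha> u p (\<lambda>t x. (\<phi> t * e x) *\<^sub>R axis j 1) t x)
    = \<phi>' * moment \<alpha> (component (u t)) (grad (u t)) j e + \<phi> t * flux \<alpha> (component (u t)) (grad (u t)) (p t) j e"
proof -
  have lin: "(LINT x|torus. a * f x + b * g x) = a * (LINT x|torus. f x) + b * (LINT x|torus. g x)"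
    if "integrable torus f" "integrable torus g" for a b :: real and f g using that by simp
  note L = H1_norm_facts(3,4)[OF \<alpha> fin(1)]
  show ?thesis
    unfolding clark_integrand_separated[OF e \<phi>] moment_def flux_def
    by (rule lin[OF moment_expand(1)[OF e L2_integrable[OF L(1)] L2_integrable[OF L(2)]]
      flux_expand(1)[OF e L2_mult_integrable[OF L(1) L(1)] L2_mult_integrable[OF L(2) L(2)]
        L2_mult_integrable[OF L(1) L(2)] L2_mult_integrable[OF L(2) L(1)] Lp1_norm_facts(1)[OF fin(2)]]])
qed

section \<open>Measurability and bounds in time\<close>

lemma measurable_AE_limit:
  fixes F :: "nat \<Rightarrow> real \<Rightarrow> real"
  assumes F: "\<And>n. F n \<in> borel_measurable (lebesgue_on {0<..<T})"
    and lim: "AE t in lebesgue_on {0<..<T}. (\<lambda>n. F n t) \<longlonglongrightarrow> f t"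
  shows "f \<in> borel_measurable (lebesgue_on {0<..<T})"
proof -
  let ?i = "\<lambda>t. indicat_real {0<..<T} t"
  have "(\<lambda>t. lim (\<lambda>n. ?i t *\<^sub>R F n t)) \<in> borel_measurable lebesgue"
    using F by (intro borel_measurable_lim_metric) (simp add: borel_measurable_restrict_space_iff)
  moreover have "AE t in lebesgue. t \<in> {0<..<T} \<longrightarrow> (\<lambda>n. F n t) \<longlonglongrightarrow> f t"
    using lim by (simp add: AE_restrict_space_iff)
  then have "AE t in lebesgue. lim (\<lambda>n. ?i t *\<^sub>R F n t) = ?i t *\<^sub>R f t"
  proof (rule AE_mp[OF _ AE_I2], intro impI)
    fix t assume "t \<in> {0<..<T} \<longrightarrow> (\<lambda>n. F n t) \<longlonglongrightarrow> f t"
    then have "(\<lambda>n. ?i t *\<^sub>R F n t) \<longlonglongrightarrow> ?i t *\<^sub>R f t" by (cases "t \<in> {0<..<T}") auto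
    then show "lim (\<lambda>n. ?i t *\<^sub>R F n t) = ?i t *\<^sub>R f t" by (rule limI)
  qed
  ultimately have "(\<lambda>t. ?i t *\<^sub>R f t) \<in> borel_measurable lebesgue" by (rule borel_measurable_AE)
  then show ?thesis by (simp add: borel_measurable_restrict_space_iff)
qed

lemma measurable_AE_cong:
  fixes f g :: "real \<Rightarrow> real"
  assumes "f \<in> borel_measurable (lebesgue_on {0<..<T})" "AE t in lebesgue_on {0<..<T}. f t = g t"
  shows "g \<in> borel_measurable (lebesgue_on {0<..<T})"
proof (rule measurable_AE_limit[of "\<lambda>n. f"])
  show "AE t in lebesgue_on {0<..<T}. (\<lambda>n. f t) \<longlonglongrightarrow> g t" using assms(2) by eventually_elim simp
qed (rule assms(1))

text \<open>A functional that is sequentially continuous on a Bochner space turns a strongly measurable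
  map into a measurable function of time, since it may be evaluated on the approximating simple
  functions.\<close>

lemma strongly_measurable_functional:
  fixes u :: "real \<Rightarrow> real^3 \<Rightarrow> 'b::real_normed_vector" and q :: "real \<Rightarrow> real^3 \<Rightarrow> 'c::real_normed_vector"
    and F :: "(real^3 \<Rightarrow> 'b) \<Rightarrow> (real^3 \<Rightarrow> 'c) \<Rightarrow> real"
  assumes u: "strongly_measurable N T u" and q: "strongly_measurable N' T q"
    and fin: "AE t in lebesgue_on {0<..<T}. N (u t) < \<infinity> \<and> N' (q t) < \<infinity>"
    and F: "\<And>w \<sigma> r \<tau>. N w < \<infinity> \<Longrightarrow> (\<And>n::nat. N (\<sigma> n) < \<infinity>) \<Longrightarrow> N' r < \<infinity> \<Longrightarrow> (\<And>n. N' (\<tau> n) < \<infinity>) \<Longrightarrow>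
      (\<lambda>n. N (\<lambda>x. w x - \<sigma> n x)) \<longlonglongrightarrow> 0 \<Longrightarrow> (\<lambda>n. N' (\<lambda>x. r x - \<tau> n x)) \<longlonglongrightarrow> 0 \<Longrightarrow>
      (\<lambda>n. F (\<sigma> n) (\<tau> n)) \<longlonglongrightarrow> F w r"
  shows "(\<lambda>t. F (u t) (q t)) \<in> borel_measurable (lebesgue_on {0<..<T})"
proof -
  obtain \<sigma> where \<sigma>: "\<And>n. simple_function (lebesgue_on {0<..<T}) (\<sigma> n)" "\<And>n t. t \<in> {0<..<T} \<Longrightarrow> N (\<sigma> n t) < \<infinity>"
    "AE t in lebesgue_on {0<..<T}. (\<lambda>n. N (\<lambda>x. u t x - \<sigma> n t x)) \<longlonglongrightarrow> 0"
    using u unfolding strongly_measurable_def by blast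
  obtain \<tau> where \<tau>: "\<And>n. simple_function (lebesgue_on {0<..<T}) (\<tau> n)" "\<And>n t. t \<in> {0<..<T} \<Longrightarrow> N' (\<tau> n t) < \<infinity>"
    "AE t in lebesgue_on {0<..<T}. (\<lambda>n. N' (\<lambda>x. q t x - \<tau> n t x)) \<longlonglongrightarrow> 0"
    using q unfolding strongly_measurable_def by blast
  show ?thesis
  proof (rule measurable_AE_limit)
    show "(\<lambda>t. F (\<sigma> n t) (\<tau> n t)) \<in> borel_measurable (lebesgue_on {0<..<T})" for n
      by (rule borel_measurable_simple_function[OF simple_function_compose2[OF \<sigma>(1) \<tau>(1)]])
    show "AE t in lebesgue_on {0<..<T}. (\<lambda>n. F (\<sigma> n t) (\<tau> n t)) \<longlonglongrightarrow> F (u t) (q t)"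
      using \<sigma>(3) \<tau>(3) fin AE_space
    proof eventually_elim
      case (elim t)
      then have "t \<in> {0<..<T}" by simp
      then show ?case using elim by (intro F \<sigma>(2) \<tau>(2)) auto
    qed
  qed
qed

lemma tbounded_modification:
  assumes f: "f \<in> borel_measurable (lebesgue_on {0<..<T})" and M: "AE t in lebesgue_on {0<..<T}. \<bar>f t\<bar> \<le> M"
  obtains g where "tbounded T g" "AE t in lebesgue_on {0<..<T}. g t = f t"
proof
  let ?g = "\<lambda>t. indicat_real {0<..<T} t *\<^sub>R (if \<bar>f t\<bar> \<le> M then f t else 0)"
  have "(\<lambda>t. if \<bar>f t\<bar> \<le> M then f t else 0) \<in> borel_measurable (lebesgue_on {0<..<T})" using f by measurable
  then have "?g \<in> borel_measurable lebesgue" by (simp add: borel_measurable_restrict_space_iff)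
  moreover have "\<forall>t. \<bar>?g t\<bar> \<le> \<bar>M\<bar>" by (auto simp: indicator_def)
  moreover have "\<forall>t. t \<notin> {0..T} \<longrightarrow> ?g t = 0" by (auto simp: indicator_def)
  ultimately show "tbounded T ?g" unfolding tbounded_def by blast
  show "AE t in lebesgue_on {0<..<T}. ?g t = f t"
    using M AE_space by eventually_elim simp
qed

lemma H1_bound_facts:
  assumes \<alpha>: "\<alpha> > 0" and C: "C \<ge> 0" and le: "H1_norm \<alpha> w \<le> ennreal C"
  shows "H1_norm \<alpha> w < \<infinity>" "(LINT x|torus. (component w j x)\<^sup>2) \<le> C\<^sup>2 + C\<^sup>2 / \<alpha>\<^sup>2"
    "(LINT x|torus. (grad w k j x)\<^sup>2) \<le> C\<^sup>2 + C\<^sup>2 / \<alpha>\<^sup>2"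
proof -
  show f: "H1_norm \<alpha> w < \<infinity>" using le by (simp add: le_less_trans)
  have "sqrt (energy \<alpha> (component w) (grad w)) \<le> C"
    using le C unfolding H1_norm_facts(5)[OF \<alpha> f] by simp
  then have E: "energy \<alpha> (component w) (grad w) \<le> C\<^sup>2" by (rule sqrt_le_D)
  have "(LINT x|torus. (component w j x)\<^sup>2) \<le> (\<Sum>j\<in>UNIV. LINT x|torus. (component w j x)\<^sup>2)"
    by (rule member_le_sum[of j UNIV "\<lambda>j. LINT x|torus. (component w j x)\<^sup>2"]) auto
  also have "\<dots> \<le> energy \<alpha> (component w) (grad w)" unfolding energy_def by (simp add: sum_nonneg)
  also note E
  also have "C\<^sup>2 \<le> C\<^sup>2 + C\<^sup>2 / \<alpha>\<^sup>2" by simp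
  finally show "(LINT x|torus. (component w j x)\<^sup>2) \<le> C\<^sup>2 + C\<^sup>2 / \<alpha>\<^sup>2" .
  have "(LINT x|torus. (grad w k j x)\<^sup>2) \<le> (\<Sum>j\<in>UNIV. LINT x|torus. (grad w k j x)\<^sup>2)"
    by (rule member_le_sum[of j UNIV "\<lambda>j. LINT x|torus. (grad w k j x)\<^sup>2"]) auto
  also have "\<dots> \<le> (\<Sum>k\<in>UNIV. \<Sum>j\<in>UNIV. LINT x|torus. (grad w k j x)\<^sup>2)"
    by (rule member_le_sum[of k UNIV "\<lambda>k. \<Sum>j\<in>UNIV. LINT x|torus. (grad w k j x)\<^sup>2"]) (auto intro: sum_nonneg)
  also have "\<dots> \<le> energy \<alpha> (component w) (grad w) / \<alpha>\<^sup>2"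
    unfolding energy_def using \<alpha> by (simp add: field_simps sum_nonneg)
  also have "\<dots> \<le> C\<^sup>2 / \<alpha>\<^sup>2" using E by (simp add: divide_right_mono)
  also have "\<dots> \<le> C\<^sup>2 + C\<^sup>2 / \<alpha>\<^sup>2" by simp
  finally show "(LINT x|torus. (grad w k j x)\<^sup>2) \<le> C\<^sup>2 + C\<^sup>2 / \<alpha>\<^sup>2" .
qed

lemma LINT_L2_bound:
  assumes L: "L2 a" "L2 b" and \<eta>: "cper \<eta>" "\<And>x. \<bar>\<eta> x\<bar> \<le> B"
    and Q: "(LINT x|torus. (a x)\<^sup>2) \<le> Q" "(LINT x|torus. (b x)\<^sup>2) \<le> Q'"
  shows "\<bar>LINT x|torus. a x * b x * \<eta> x\<bar> \<le> B * (Q + Q')"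
proof -
  have B: "B \<ge> 0" using \<eta>(2)[of 0] by linarith
  have i: "integrable torus (\<lambda>x. a x * b x * \<eta> x)"
    using integrable_cper_mult[OF \<eta>(1) L2_mult_integrable[OF L]] by (simp add: mult_ac)
  have sq: "integrable torus (\<lambda>x. (a x)\<^sup>2)" "integrable torus (\<lambda>x. (b x)\<^sup>2)" using L by (simp_all add: L2_def)
  have "\<bar>LINT x|torus. a x * b x * \<eta> x\<bar> \<le> (LINT x|torus. \<bar>a x * b x * \<eta> x\<bar>)" by (rule integral_abs_bound)
  also have "\<dots> \<le> (LINT x|torus. B * ((a x)\<^sup>2 + (b x)\<^sup>2))"
  proof (rule integral_mono)
    show "integrable torus (\<lambda>x. \<bar>a x * b x * \<eta> x\<bar>)" using i by (rule integrable_abs)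
    show "integrable torus (\<lambda>x. B * ((a x)\<^sup>2 + (b x)\<^sup>2))" using sq by simp
    fix x
    have "\<bar>a x * b x\<bar> * \<bar>\<eta> x\<bar> \<le> ((a x)\<^sup>2 + (b x)\<^sup>2) * B"
      using abs_mult_le_squares[of 1 "a x" "b x"] by (intro mult_mono \<eta>) auto
    then show "\<bar>a x * b x * \<eta> x\<bar> \<le> B * ((a x)\<^sup>2 + (b x)\<^sup>2)" by (simp add: abs_mult mult_ac)
  qed
  also have "\<dots> = B * ((LINT x|torus. (a x)\<^sup>2) + (LINT x|torus. (b x)\<^sup>2))" using sq by simp
  also have "\<dots> \<le> B * (Q + Q')" using Q B by (intro mult_left_mono add_mono)
  finally show ?thesis .
qed

lemma LINT_L2_bound1:
  assumes L: "L2 a" and \<eta>: "cper \<eta>" "\<And>x. \<bar>\<eta> x\<bar> \<le> B" and Q: "(LINT x|torus. (a x)\<^sup>2) \<le> Q"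
  shows "\<bar>LINT x|torus. a x * \<eta> x\<bar> \<le> B * (Q + 1)"
proof -
  have "(LINT x|torus. (1::real)\<^sup>2) = 1" using measure_torus by simp
  then show ?thesis using LINT_L2_bound[OF L L2_const[of 1] \<eta> Q, of 1] by simp
qed

lemma abs_sum3_le:
  fixes f :: "3 \<Rightarrow> real"
  assumes "\<And>i. \<bar>f i\<bar> \<le> K" shows "\<bar>\<Sum>i\<in>UNIV. f i\<bar> \<le> 3 * K"
proof -
  have "\<bar>\<Sum>i\<in>UNIV. f i\<bar> \<le> (\<Sum>i\<in>UNIV. \<bar>f i\<bar>)" by (rule sum_abs)
  also have "\<dots> \<le> of_nat (card (UNIV :: 3 set)) * K" by (rule sum_bounded_above) (rule assms)
  finally show ?thesis by simp
qed

lemma sper_bounded2: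
  assumes e: "sper e"
  obtains B where "B > 0" "\<And>x. \<bar>e x\<bar> \<le> B" "\<And>i x. \<bar>partial i e x\<bar> \<le> B" "\<And>i k x. \<bar>partial i (partial k e) x\<bar> \<le> B"
proof -
  have b: "\<exists>B>0. \<forall>x. \<bar>f x\<bar> \<le> B" if "sper f" for f using cper_bounded[OF sper_cper[OF that]] by metis
  obtain B0 where B0: "B0 > 0" "\<And>x. \<bar>e x\<bar> \<le> B0" using b[OF e] by blast
  have "\<forall>i. \<exists>B. B > 0 \<and> (\<forall>x. \<bar>partial i e x\<bar> \<le> B)" using b[OF sper_partial[OF e]] by simp
  from choice[OF this] obtain B1 where B1: "\<And>i. B1 i > 0" "\<And>i x. \<bar>partial i e x\<bar> \<le> B1 i" by auto
  have "\<forall>q. \<exists>B. B > 0 \<and> (\<forall>x. \<bar>partial (fst q) (partial (snd q) e) x\<bar> \<le> B)"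
    using b[OF sper_partial[OF sper_partial[OF e]]] by simp
  from choice[OF this] obtain B2 where "\<forall>q. B2 q > 0 \<and> (\<forall>x. \<bar>partial (fst q) (partial (snd q) e) x\<bar> \<le> B2 q)" ..
  then have B2: "\<And>q. B2 q > 0" "\<And>q x. \<bar>partial (fst q) (partial (snd q) e) x\<bar> \<le> B2 q" by blast+
  let ?B = "B0 + (\<Sum>i\<in>UNIV. B1 i) + (\<Sum>q\<in>UNIV. B2 q)"
  have p: "0 \<le> (\<Sum>i\<in>UNIV. B1 i)" "0 \<le> (\<Sum>q\<in>UNIV. B2 q)"
    using less_imp_le[OF B1(1)] less_imp_le[OF B2(1)] by (auto intro!: sum_nonneg)
  have m: "B1 i \<le> (\<Sum>i\<in>UNIV. B1 i)" "B2 q \<le> (\<Sum>q\<in>UNIV. B2 q)" for i q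
    using less_imp_le[OF B1(1)] less_imp_le[OF B2(1)] by (auto intro!: member_le_sum)
  show thesis
  proof (rule that)
    show "?B > 0" using B0 p by linarith
    show "\<bar>e x\<bar> \<le> ?B" for x using B0(2)[of x] p by linarith
    show "\<bar>partial i e x\<bar> \<le> ?B" for i x using B1(2)[of i x] m(1)[of i] B0(1) p by linarith
    show "\<bar>partial i (partial k e) x\<bar> \<le> ?B" for i k x using B2(2)[of "(i, k)" x] m(2)[of "(i, k)"] B0(1) p by simp
  qed
qed

lemma moment_flux_bounded:
  assumes \<alpha>: "\<alpha> > 0" and e: "sper e" and C: "C \<ge> 0"
  obtains K where "\<And>w q. H1_norm \<alpha> w \<le> ennreal C \<Longrightarrow> Lp_norm 1 q \<le> ennreal C \<Longrightarrow>
      \<bar>moment \<alpha> (component w) (grad w) j e\<bar> \<le> K \<and> \<bar>flux \<alpha> (component w) (grad w) q j e\<bar> \<le> K"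
proof -
  obtain B where B: "B > 0" "\<And>x. \<bar>e x\<bar> \<le> B" "\<And>i x. \<bar>partial i e x\<bar> \<le> B" "\<And>i k x. \<bar>partial i (partial k e) x\<bar> \<le> B"
    by (rule sper_bounded2[OF e]; rule that; assumption)
  define Q where "Q = C\<^sup>2 + C\<^sup>2 / \<alpha>\<^sup>2"
  define K where "K = B * (2 * Q + 1 + C)"
  have Q: "Q \<ge> 0" unfolding Q_def by simp
  have K: "B * (Q + Q) \<le> K" "B * (Q + 1) \<le> K" "B * C \<le> K" "0 \<le> K"
    unfolding K_def using B(1) Q C by (auto intro!: mult_left_mono mult_nonneg_nonneg)
  have c: "cper e" "cper (partial i e)" "cper (partial i (partial k e))" for i k by (intro sper_cper sper_partial e)+
  show thesis
  proof (rule that)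
    fix w :: "real^3 \<Rightarrow> real^3" and q :: "real^3 \<Rightarrow> real" assume h: "H1_norm \<alpha> w \<le> ennreal C" and q: "Lp_norm 1 q \<le> ennreal C"
    note f = H1_bound_facts[OF \<alpha> C h, folded Q_def]
    note L = H1_norm_facts(3,4)[OF \<alpha> f(1)]
    have fq: "Lp_norm 1 q < \<infinity>" using q by (simp add: le_less_trans)
    have lq: "(LINT x|torus. \<bar>q x\<bar>) \<le> C" using q C unfolding Lp1_norm_facts(2)[OF fq] by simp
    note iq = Lp1_norm_facts(1)[OF fq]
    have t1: "\<bar>LINT x|torus. component w j x * e x\<bar> \<le> K" "\<bar>LINT x|torus. grad w k j x * partial k e x\<bar> \<le> K" for k
      by (rule order_trans[OF LINT_L2_bound1[OF L(1) c(1) B(2) f(2)] K(2)],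
          rule order_trans[OF LINT_L2_bound1[OF L(2) c(2) B(3) f(3)] K(2)])
    have "\<bar>\<Sum>k\<in>UNIV. LINT x|torus. grad w k j x * partial k e x\<bar> \<le> 3 * K" by (rule abs_sum3_le) (rule t1)
    then have "\<alpha>\<^sup>2 * \<bar>\<Sum>k\<in>UNIV. LINT x|torus. grad w k j x * partial k e x\<bar> \<le> \<alpha>\<^sup>2 * (3 * K)" by (rule mult_left_mono) simp
    moreover have "\<bar>X + \<alpha>\<^sup>2 * Y\<bar> \<le> \<bar>X\<bar> + \<alpha>\<^sup>2 * \<bar>Y\<bar>" for X Y
      using abs_triangle_ineq[of X "\<alpha>\<^sup>2 * Y"] by (simp add: abs_mult)
    ultimately have m: "\<bar>moment \<alpha> (component w) (grad w) j e\<bar> \<le> K + \<alpha>\<^sup>2 * (3 * K)"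
      unfolding moment_expand(2)[OF e L2_integrable[OF L(1)] L2_integrable[OF L(2)]]
      using t1(1) by (smt (verit))
    have t2: "\<bar>LINT x|torus. component w i x * component w j x * partial i e x\<bar> \<le> K"
      "\<bar>LINT x|torus. grad w k i x * grad w k j x * partial i e x\<bar> \<le> K"
      "\<bar>LINT x|torus. component w i x * grad w k j x * partial i (partial k e) x\<bar> \<le> K"
      "\<bar>LINT x|torus. grad w k i x * component w j x * partial i (partial k e) x\<bar> \<le> K" for i k
      by (rule order_trans[OF LINT_L2_bound[OF L(1) L(1) c(2) B(3) f(2) f(2)] K(1)],
          rule order_trans[OF LINT_L2_bound[OF L(2) L(2) c(2) B(3) f(3) f(3)] K(1)],
          rule order_trans[OF LINT_L2_bound[OF L(1) L(2) c(3) B(4) f(2) f(3)] K(1)],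
          rule order_trans[OF LINT_L2_bound[OF L(2) L(1) c(3) B(4) f(3) f(2)] K(1)])
    have t3: "\<bar>LINT x|torus. partial j e x * q x\<bar> \<le> K"
    proof -
      have "\<bar>LINT x|torus. partial j e x * q x\<bar> \<le> (LINT x|torus. \<bar>partial j e x * q x\<bar>)" by (rule integral_abs_bound)
      also have "\<dots> \<le> (LINT x|torus. B * \<bar>q x\<bar>)"
      proof (rule integral_mono)
        show "integrable torus (\<lambda>x. \<bar>partial j e x * q x\<bar>)" by (rule integrable_abs[OF integrable_cper_mult[OF c(2) iq]])
        show "integrable torus (\<lambda>x. B * \<bar>q x\<bar>)" using iq by simp
        show "\<bar>partial j e x * q x\<bar> \<le> B * \<bar>q x\<bar>" for x unfolding abs_mult by (intro mult_right_mono B(3)) simp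
      qed
      also have "\<dots> \<le> B * C" using lq B(1) by simp
      also note K(3)
      finally show ?thesis .
    qed
    have s1: "\<bar>\<Sum>i\<in>UNIV. LINT x|torus. component w i x * component w j x * partial i e x\<bar> \<le> 3 * K" by (rule abs_sum3_le) (rule t2)
    have "\<bar>\<Sum>i\<in>UNIV. \<Sum>k\<in>UNIV. (LINT x|torus. grad w k i x * grad w k j x * partial i e x)
        + (LINT x|torus. component w i x * grad w k j x * partial i (partial k e) x)
        + (LINT x|torus. grad w k i x * component w j x * partial i (partial k e) x)\<bar> \<le> 3 * (3 * (K + K + K))"
      by (intro abs_sum3_le order_trans[OF abs_triangle_ineq] add_mono t2)
    then have s2: "\<alpha>\<^sup>2 * \<bar>\<Sum>i\<in>UNIV. \<Sum>k\<in>UNIV. (LINT x|torus. grad w k i x * grad w k j x * partial i e x)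
        + (LINT x|torus. component w i x * grad w k j x * partial i (partial k e) x)
        + (LINT x|torus. grad w k i x * component w j x * partial i (partial k e) x)\<bar> \<le> \<alpha>\<^sup>2 * (3 * (3 * (K + K + K)))"
      by (rule mult_left_mono) simp
    have tri: "\<bar>X + \<alpha>\<^sup>2 * Y + Z\<bar> \<le> \<bar>X\<bar> + \<alpha>\<^sup>2 * \<bar>Y\<bar> + \<bar>Z\<bar>" for X Y Z
      using abs_triangle_ineq[of "X + \<alpha>\<^sup>2 * Y" Z] abs_triangle_ineq[of X "\<alpha>\<^sup>2 * Y"] by (simp add: abs_mult)
    have fl: "\<bar>flux \<alpha> (component w) (grad w) q j e\<bar> \<le> 3 * K + \<alpha>\<^sup>2 * (3 * (3 * (K + K + K))) + K"
      unfolding flux_expand(2)[OF e L2_mult_integrable[OF L(1) L(1)] L2_mult_integrable[OF L(2) L(2)]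
        L2_mult_integrable[OF L(1) L(2)] L2_mult_integrable[OF L(2) L(1)] iq]
      by (rule order_trans[OF tri add_mono[OF add_mono[OF s1 s2] t3]])
    have "0 \<le> \<alpha>\<^sup>2 * K" "\<alpha>\<^sup>2 * (3 * K) = 3 * (\<alpha>\<^sup>2 * K)" "\<alpha>\<^sup>2 * (3 * (3 * (K + K + K))) = 27 * (\<alpha>\<^sup>2 * K)"
      using K(4) by simp_all
    then show "\<bar>moment \<alpha> (component w) (grad w) j e\<bar> \<le> 4 * K + 27 * (\<alpha>\<^sup>2 * K) \<and> \<bar>flux \<alpha> (component w) (grad w) q j e\<bar> \<le> 4 * K + 27 * (\<alpha>\<^sup>2 * K)"
      using m fl K(4) by linarith
  qed
qed

lemma time_test_derivative_measurable:
  assumes "time_test T \<phi>" "\<And>t. (\<phi> has_real_derivative \<phi>' t) (at t)" and S: "S \<in> sets lebesgue"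
  shows "\<phi> \<in> borel_measurable (lebesgue_on S)" "\<phi>' \<in> borel_measurable (lebesgue_on S)"
proof -
  have s: "smooth \<phi>" using assms(1) by (simp add: time_test_def)
  have "frechet_derivative \<phi> (at t) 1 = \<phi>' t" for t
    using frechet_derivative_at[OF has_field_derivative_imp_has_derivative[OF assms(2)[of t]]] by (metis mult.right_neutral)
  then have "smooth \<phi>'" using smooth_frechet_derivative[OF s, of 1] by simp
  then show "\<phi> \<in> borel_measurable (lebesgue_on S)" "\<phi>' \<in> borel_measurable (lebesgue_on S)"
    using s S by (auto intro!: continuous_imp_measurable_on_sets_lebesgue smooth_continuous)
qed

section \<open>The mollified energy\<close>

lemma linear_functional_sum:
  fixes \<Phi> :: "(real^3 \<Rightarrow> real) \<Rightarrow> real" and M :: nat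
  assumes zero: "\<Phi> (\<lambda>x. 0) = 0"
    and lin: "\<And>f g a. sper f \<Longrightarrow> sper g \<Longrightarrow> \<Phi> (\<lambda>x. f x + a * g x) = \<Phi> f + a * \<Phi> g"
    and b: "\<And>m. sper (b m)"
  shows "\<Phi> (\<lambda>x. \<Sum>m<M. a m * b m x) = (\<Sum>m<M. a m * \<Phi> (b m))"
proof (induction M)
  case (Suc M)
  have "sper (\<lambda>x. \<Sum>m<M. a m * b m x)" by (rule sper_intros(7)) (rule sper_cmult[OF b])
  from lin[OF this b[of M], of "a M"] Suc show ?case by simp
qed (simp add: zero)

lemma partial_linear:
  assumes "sper f" "sper g"
  shows "partial i (\<lambda>x. f x + a * g x) = (\<lambda>x. partial i f x + a * partial i g x)"
proof
  fix x
  have s: "smooth f" "smooth g" using assms by (simp_all add: sper_def)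
  show "partial i (\<lambda>x. f x + a * g x) x = partial i f x + a * partial i g x"
    unfolding partial_add[OF s(1) smooth_cmult[OF s(2)]] partial_cmult[OF s(2)] ..
qed

lemma partial_zero: "partial i (\<lambda>x. 0::real) = (\<lambda>x. 0)"
  by (rule ext) simp

lemma LINT_lincomb:
  fixes a :: real
  assumes "integrable torus F" "integrable torus G"
  shows "(LINT x|torus. F x + a * G x) = (LINT x|torus. F x) + a * (LINT x|torus. G x)"
  using assms by simp

lemma moment_linear:
  assumes i: "\<And>j. integrable torus (U j)" "\<And>k j. integrable torus (D k j)" and s: "sper f" "sper g"
  shows "moment \<alpha> U D j (\<lambda>x. f x + a * g x) = moment \<alpha> U D j f + a * moment \<alpha> U D j g"
proof -
  have "U j x * (f x + a * g x) + \<alpha>\<^sup>2 * (\<Sum>k\<in>UNIV. D k j x * (partial k f x + a * partial k g x))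
    = (U j x * f x + \<alpha>\<^sup>2 * (\<Sum>k\<in>UNIV. D k j x * partial k f x))
    + a * (U j x * g x + \<alpha>\<^sup>2 * (\<Sum>k\<in>UNIV. D k j x * partial k g x))" for x
    by (simp add: sum.distrib sum_distrib_left algebra_simps)
  then show ?thesis
    unfolding moment_def partial_linear[OF s]
    by (simp only:) (rule LINT_lincomb[OF moment_expand(1)[OF s(1) i] moment_expand(1)[OF s(2) i]])
qed

lemma flux_density_linear:
  assumes s: "sper f" "sper g"
  shows "flux_density \<alpha> U D q j (\<lambda>x. f x + a * g x) x = flux_density \<alpha> U D q j f x + a * flux_density \<alpha> U D q j g x"
  unfolding flux_density_def partial_linear[OF s] partial_linear[OF sper_partial[OF s(1)] sper_partial[OF s(2)]]
  by (simp add: sum.distrib sum_distrib_left algebra_simps)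

lemma flux_linear:
  assumes i: "\<And>e. sper e \<Longrightarrow> integrable torus (flux_density \<alpha> U D q j e)" and s: "sper f" "sper g"
  shows "flux \<alpha> U D q j (\<lambda>x. f x + a * g x) = flux \<alpha> U D q j f + a * flux \<alpha> U D q j g"
  unfolding flux_def flux_density_linear[OF s] by (rule LINT_lincomb[OF i[OF s(1)] i[OF s(2)]])

lemma wave_reduce: "wave k \<tau> x = cos \<tau> * wave k 0 x - sin \<tau> * wave k (- pi / 2) x"
proof -
  have "cos (y + - pi / 2) = sin y" for y :: real using cos_diff[of y "pi / 2"] by simp
  then show ?thesis unfolding wave_def by (simp add: cos_add)
qed

text \<open>Waves are eigenfunctions of \<open>1 - \<alpha>\<^sup>2 \<Delta>\<close>, so that the moment of a wave determines the Fourier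
  coefficient of the velocity.\<close>

lemma moment_wave:
  assumes w: "\<And>k j. wpart k (U j) (D k j)"
  shows "moment \<alpha> U D j (wave q \<tau>)
    = (1 + \<alpha>\<^sup>2 * (\<Sum>k\<in>UNIV. (2 * pi * of_int (q $ k))\<^sup>2)) * (LINT x|torus. wave q \<tau> x * U j x)"
proof -
  let ?L = "LINT x|torus. wave q \<tau> x * U j x"
  have "(LINT x|torus. D k j x * partial k (wave q \<tau>) x) = (2 * pi * of_int (q $ k))\<^sup>2 * ?L" for k
  proof -
    let ?c = "2 * pi * of_int (q $ k) :: real"
    have half: "wave q (\<tau> + pi / 2 + pi / 2) x = - wave q \<tau> x" for x
    proof -
      have "2 * pi * (freq q \<bullet> x) + (\<tau> + pi / 2 + pi / 2) = (2 * pi * (freq q \<bullet> x) + \<tau>) + pi" by simp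
      then show ?thesis unfolding wave_def by (simp only: cos_periodic_pi)
    qed
    have "partial k (wave q \<tau>) = (\<lambda>x. ?c * wave q (\<tau> + pi / 2) x)" by (rule ext) (rule partial_wave)
    then have 2: "partial k (partial k (wave q \<tau>)) x = - (?c\<^sup>2 * wave q \<tau> x)" for x
      unfolding \<open>partial k (wave q \<tau>) = _\<close> partial_cmult[OF smooth_wave] partial_wave half
      by (simp add: power2_eq_square)
    have "(LINT x|torus. D k j x * partial k (wave q \<tau>) x) = (LINT x|torus. partial k (wave q \<tau>) x * D k j x)"
      by (simp add: mult.commute)
    also have "\<dots> = - (LINT x|torus. partial k (partial k (wave q \<tau>)) x * U j x)"
      using wpartD(3)[OF w sper_partial[OF sper_intros(2)], of k k q \<tau> j] by simp
    also have "\<dots> = ?c\<^sup>2 * ?L" unfolding 2 by (simp add: mult.assoc)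
    finally show ?thesis .
  qed
  then show ?thesis
    unfolding moment_expand(2)[OF sper_intros(2) wpartD(1)[OF w] wpartD(2)[OF w]]
    by (simp add: mult.commute[of "U j _"] sum_distrib_right distrib_right mult.assoc)
qed

text \<open>Integration by parts turns this into the pairing of the velocity and its gradient with their
  mollifications. In the present form its time derivative is read off from the equation.\<close>

definition mol_energy :: "real \<Rightarrow> nat \<Rightarrow> (3 \<Rightarrow> real^3 \<Rightarrow> real) \<Rightarrow> (3 \<Rightarrow> 3 \<Rightarrow> real^3 \<Rightarrow> real) \<Rightarrow> real" where
  "mol_energy \<alpha> N U D = (\<Sum>j\<in>UNIV. moment \<alpha> U D j (mol N (U j)))"

lemma mol_energy_tendsto:
  assumes W: "\<And>i. W13 (U i) (\<lambda>k. D k i)"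
  shows "(\<lambda>N. mol_energy \<alpha> N U D) \<longlonglongrightarrow> energy \<alpha> U D"
proof -
  have wp: "wpart k (U j) (D k j)" for k j using W13_wpart[OF W[of j], of k] .
  have ap: "L3_approx (U j)" "L3_approx (D k j)" for k j using W13_approx(1)[OF W[of j]] W13_approx(2)[OF W[of j], of k] by simp_all
  have one: "(\<lambda>N. LINT x|torus. a x * mol N a x) \<longlonglongrightarrow> (LINT x|torus. (a x)\<^sup>2)" if "L3_approx a" for a
    using trilinear_limit[OF L3_approx_sper[OF sper_intros(1)] that that, of 1] by (simp add: power2_eq_square)
  have eq: "moment \<alpha> U D j (mol N (U j)) = (LINT x|torus. U j x * mol N (U j) x)
    + \<alpha>\<^sup>2 * (\<Sum>k\<in>UNIV. LINT x|torus. D k j x * mol N (D k j) x)" for N j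
    unfolding moment_expand(2)[OF sper_mol[OF wpartD(1)[OF wp]] wpartD(1)[OF wp] wpartD(2)[OF wp]] partial_mol_wpart[OF wp] ..
  have "(\<lambda>N. mol_energy \<alpha> N U D) \<longlonglongrightarrow>
    (\<Sum>j\<in>UNIV. (LINT x|torus. (U j x)\<^sup>2) + \<alpha>\<^sup>2 * (\<Sum>k\<in>UNIV. LINT x|torus. (D k j x)\<^sup>2))"
    unfolding mol_energy_def eq by (intro tendsto_sum tendsto_add tendsto_mult tendsto_const one ap)
  also have "(\<Sum>j\<in>UNIV. (LINT x|torus. (U j x)\<^sup>2) + \<alpha>\<^sup>2 * (\<Sum>k\<in>UNIV. LINT x|torus. (D k j x)\<^sup>2)) = energy \<alpha> U D"
    unfolding energy_def sum.distrib sum_distrib_left[symmetric] by (subst sum.swap) (rule refl)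
  finally show ?thesis .
qed

lemma W13_AE_cong:
  assumes W: "W13 v D" and ae: "\<And>i. AE x in torus. D i x = E i x" and m: "\<And>i. E i \<in> borel_measurable torus"
  shows "W13 v E"
proof -
  obtain F where F: "L3 v" "\<And>i. L3 (D i)" "\<And>m. sper (F m)" "(\<lambda>m. N3 (\<lambda>x. F m x - v x)) \<longlonglongrightarrow> 0"
    "\<And>i. (\<lambda>m. N3 (\<lambda>x. partial i (F m) x - D i x)) \<longlonglongrightarrow> 0"
    by (rule W13E[OF W]; rule that; assumption)
  have E: "L3 (E i)" for i by (rule L3_cong_AE(1)[OF F(2) m ae])
  have "N3 (\<lambda>x. partial i (F m) x - E i x) = N3 (\<lambda>x. partial i (F m) x - D i x)" for i m
  proof (rule L3_cong_AE(2))
    have L: "L3 (partial i (F m))" by (intro sper_L3 sper_partial F)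
    show "L3 (\<lambda>x. partial i (F m) x - D i x)" by (rule L3_diff[OF L F(2)])
    show "(\<lambda>x. partial i (F m) x - E i x) \<in> borel_measurable torus" by (rule L3_measurable[OF L3_diff[OF L E]])
    show "AE x in torus. partial i (F m) x - D i x = partial i (F m) x - E i x" using ae[of i] by eventually_elim simp
  qed
  then have "(\<lambda>m. N3 (\<lambda>x. partial i (F m) x - E i x)) \<longlonglongrightarrow> 0" for i using F(5)[of i] by simp
  then show ?thesis unfolding W13_def using F(1,3,4) E by blast
qed

section \<open>Besov regularity at almost every time\<close>

lemma besov_gradient_bound:
  assumes \<theta>: "dyadic_cutoff \<theta>" and s: "s > 1" and \<alpha>: "\<alpha> > 0"
  obtains C where "C \<ge> 0"
    "\<And>w i. H1_norm \<alpha> w < \<infinity> \<Longrightarrow> besov_infinity_norm \<theta> s 3 w < \<infinity> \<Longrightarrow>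
      W13 (component w i) (\<lambda>k. grad w k i) \<and> N3 (component w i) \<le> C * enn2real (besov_infinity_norm \<theta> s 3 w) \<and>
      (\<forall>k. N3 (grad w k i) \<le> C * enn2real (besov_infinity_norm \<theta> s 3 w))"
proof -
  obtain C where C: "C \<ge> 0" "\<And>f c. besov_infinity_norm \<theta> s 3 f < \<infinity> \<Longrightarrow>
      \<exists>D. W13 (\<lambda>x. f x $ c) D \<and> N3 (\<lambda>x. f x $ c) \<le> C * enn2real (besov_infinity_norm \<theta> s 3 f) \<and>
        (\<forall>i. N3 (D i) \<le> C * enn2real (besov_infinity_norm \<theta> s 3 f))"
    by (rule besov_W13[OF \<theta> s]; rule that; assumption)
  show thesis
  proof (rule that[OF C(1)])
    fix w :: "real^3 \<Rightarrow> real^3" and i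
    assume h: "H1_norm \<alpha> w < \<infinity>" and b: "besov_infinity_norm \<theta> s 3 w < \<infinity>"
    obtain D where D: "W13 (component w i) D" "N3 (component w i) \<le> C * enn2real (besov_infinity_norm \<theta> s 3 w)"
      "\<And>k. N3 (D k) \<le> C * enn2real (besov_infinity_norm \<theta> s 3 w)" using C(2)[OF b, of i] by blast
    have ae: "AE x in torus. D k x = grad w k i x" for k
      by (rule wpart_unique[OF W13_wpart[OF D(1)] H1_norm_facts(2)[OF \<alpha> h]])
    have m: "grad w k i \<in> borel_measurable torus" for k using H1_norm_facts(4)[OF \<alpha> h] by (simp add: L2_def)
    have "N3 (grad w k i) = N3 (D k)" for k by (rule L3_cong_AE(2)[OF W13_L3(2)[OF D(1)] m ae])
    then show "W13 (component w i) (\<lambda>k. grad w k i) \<and> N3 (component w i) \<le> C * enn2real (besov_infinity_norm \<theta> s 3 w) \<and>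
      (\<forall>k. N3 (grad w k i) \<le> C * enn2real (besov_infinity_norm \<theta> s 3 w))"
      using W13_AE_cong[OF D(1) ae m] D(2,3) by simp
  qed
qed

text \<open>Integrability of the Besov norm does not make it finite almost everywhere, because it is not known
  to be measurable in time. Strong measurability does provide, at almost every time, an element of
  the space at finite distance, and the two parts have gradients separately.\<close>

lemma W13_if_near_besov:
  assumes \<theta>: "dyadic_cutoff \<theta>" and s: "s > 1" and \<alpha>: "\<alpha> > 0" and h: "H1_norm \<alpha> w < \<infinity>"
    and b: "besov_infinity_norm \<theta> s 3 \<sigma> < \<infinity>" "besov_infinity_norm \<theta> s 3 (\<lambda>x. w x - \<sigma> x) < \<infinity>"
  shows "W13 (component w i) (\<lambda>k. grad w k i)"
proof -
  obtain C where C: "\<And>f c. besov_infinity_norm \<theta> s 3 f < \<infinity> \<Longrightarrow>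
      \<exists>D. W13 (\<lambda>x. f x $ c) D \<and> N3 (\<lambda>x. f x $ c) \<le> C * enn2real (besov_infinity_norm \<theta> s 3 f) \<and>
        (\<forall>i. N3 (D i) \<le> C * enn2real (besov_infinity_norm \<theta> s 3 f))"
    by (rule besov_W13[OF \<theta> s]; rule that; assumption)
  obtain D where D: "W13 (\<lambda>x. \<sigma> x $ i) D" using C[OF b(1), of i] by blast
  obtain E where E: "W13 (\<lambda>x. (w x - \<sigma> x) $ i) E" using C[OF b(2), of i] by blast
  have W: "W13 (component w i) (\<lambda>k x. D k x + E k x)" using W13_add[OF D E] by simp
  show ?thesis
  proof (rule W13_AE_cong[OF W])
    show "AE x in torus. D k x + E k x = grad w k i x" for k
      using wpart_unique[OF W13_wpart[OF W] H1_norm_facts(2)[OF \<alpha> h]] .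
    show "grad w k i \<in> borel_measurable torus" for k using H1_norm_facts(4)[OF \<alpha> h] by (simp add: L2_def)
  qed
qed

section \<open>Evolution of the Fourier modes of a weak solution\<close>

locale clark_solution =
  fixes \<alpha> T s :: real and u :: "real \<Rightarrow> real^3 \<Rightarrow> real^3" and p :: "real \<Rightarrow> real^3 \<Rightarrow> real" and \<theta> :: "real^3 \<Rightarrow> real"
  assumes \<alpha>: "\<alpha> > 0" and T: "T > 0" and s: "s > 1" and \<theta>: "dyadic_cutoff \<theta>"
    and sol: "clark_weak_solution \<alpha> T u p" and besov: "in_Bochner_Lq (besov_infinity_norm \<theta> s 3) T 3 u"
begin

abbreviation "time \<equiv> lebesgue_on {0<..<T}"
abbreviation "moment_at t j e \<equiv> moment \<alpha> (component (u t)) (grad (u t)) j e"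
abbreviation "flux_at t j e \<equiv> flux \<alpha> (component (u t)) (grad (u t)) (p t) j e"

lemma strongly_measurable_solution: "strongly_measurable (H1_norm \<alpha>) T u" "strongly_measurable (Lp_norm 1) T p"
  using sol by (auto simp: clark_weak_solution_def in_Bochner_Linfinity_def)

lemma norm_bound:
  obtains C where "C \<ge> 0" "AE t in time. H1_norm \<alpha> (u t) \<le> ennreal C \<and> Lp_norm 1 (p t) \<le> ennreal C"
proof -
  obtain C1 C2 where C: "AE t in time. H1_norm \<alpha> (u t) \<le> ennreal C1" "AE t in time. Lp_norm 1 (p t) \<le> ennreal C2"
    using sol unfolding clark_weak_solution_def in_Bochner_Linfinity_def by blast
  let ?C = "max 0 (max C1 C2)"
  have le: "ennreal C1 \<le> ennreal ?C" "ennreal C2 \<le> ennreal ?C" by (rule ennreal_leI, simp)+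
  show thesis
  proof (rule that)
    show "AE t in time. H1_norm \<alpha> (u t) \<le> ennreal ?C \<and> Lp_norm 1 (p t) \<le> ennreal ?C"
      using C by eventually_elim (use le order_trans in blast)
  qed simp
qed

lemma finite_norms: "AE t in time. H1_norm \<alpha> (u t) < \<infinity> \<and> Lp_norm 1 (p t) < \<infinity>"
proof -
  obtain C where "AE t in time. H1_norm \<alpha> (u t) \<le> ennreal C \<and> Lp_norm 1 (p t) \<le> ennreal C" by (rule norm_bound)
  then show ?thesis by eventually_elim (auto intro: le_less_trans)
qed

lemma moment_flux_measurable:
  assumes e: "sper e"
  shows "(\<lambda>t. moment_at t j e) \<in> borel_measurable time" "(\<lambda>t. flux_at t j e) \<in> borel_measurable time"
proof -
  show "(\<lambda>t. moment_at t j e) \<in> borel_measurable time"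
  proof (rule strongly_measurable_functional[OF strongly_measurable_solution finite_norms,
        where F = "\<lambda>w q. moment \<alpha> (component w) (grad w) j e"])
    fix w r and \<sigma> :: "nat \<Rightarrow> real^3 \<Rightarrow> real^3" and \<tau> :: "nat \<Rightarrow> real^3 \<Rightarrow> real"
    assume a: "H1_norm \<alpha> w < \<infinity>" "\<And>n. H1_norm \<alpha> (\<sigma> n) < \<infinity>" "Lp_norm 1 r < \<infinity>" "\<And>n. Lp_norm 1 (\<tau> n) < \<infinity>"
      "(\<lambda>n. H1_norm \<alpha> (\<lambda>x. w x - \<sigma> n x)) \<longlonglongrightarrow> 0" "(\<lambda>n. Lp_norm 1 (\<lambda>x. r x - \<tau> n x)) \<longlonglongrightarrow> 0"
    show "(\<lambda>n. moment \<alpha> (component (\<sigma> n)) (grad (\<sigma> n)) j e) \<longlonglongrightarrow> moment \<alpha> (component w) (grad w) j e"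
      by (rule moment_flux_convergence(1)[OF \<alpha> e a])
  qed
  show "(\<lambda>t. flux_at t j e) \<in> borel_measurable time"
  proof (rule strongly_measurable_functional[OF strongly_measurable_solution finite_norms,
        where F = "\<lambda>w q. flux \<alpha> (component w) (grad w) q j e"])
    fix w r and \<sigma> :: "nat \<Rightarrow> real^3 \<Rightarrow> real^3" and \<tau> :: "nat \<Rightarrow> real^3 \<Rightarrow> real"
    assume a: "H1_norm \<alpha> w < \<infinity>" "\<And>n. H1_norm \<alpha> (\<sigma> n) < \<infinity>" "Lp_norm 1 r < \<infinity>" "\<And>n. Lp_norm 1 (\<tau> n) < \<infinity>"
      "(\<lambda>n. H1_norm \<alpha> (\<lambda>x. w x - \<sigma> n x)) \<longlonglongrightarrow> 0" "(\<lambda>n. Lp_norm 1 (\<lambda>x. r x - \<tau> n x)) \<longlonglongrightarrow> 0"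
    show "(\<lambda>n. flux \<alpha> (component (\<sigma> n)) (grad (\<sigma> n)) (\<tau> n) j e) \<longlonglongrightarrow> flux \<alpha> (component w) (grad w) r j e"
      by (rule moment_flux_convergence(2)[OF \<alpha> e a])
  qed
qed

lemma moment_evolution:
  assumes e: "sper e"
  obtains c B where "tbounded T B" "AE t in time. moment_at t j e = c + prim B t \<and> flux_at t j e = B t"
proof -
  obtain C where C: "C \<ge> 0" "AE t in time. H1_norm \<alpha> (u t) \<le> ennreal C \<and> Lp_norm 1 (p t) \<le> ennreal C"
    by (rule norm_bound; rule that; assumption)
  obtain K where K: "\<And>w q. H1_norm \<alpha> w \<le> ennreal C \<Longrightarrow> Lp_norm 1 q \<le> ennreal C \<Longrightarrow>
      \<bar>moment \<alpha> (component w) (grad w) j e\<bar> \<le> K \<and> \<bar>flux \<alpha> (component w) (grad w) q j e\<bar> \<le> K"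
    by (rule moment_flux_bounded[OF \<alpha> e C(1), of j]; rule that; assumption)
  have bd: "AE t in time. \<bar>moment_at t j e\<bar> \<le> K" "AE t in time. \<bar>flux_at t j e\<bar> \<le> K"
    using C(2) by (eventually_elim, use K in blast)+
  obtain A where A: "tbounded T A" "AE t in time. A t = moment_at t j e"
    by (rule tbounded_modification[OF moment_flux_measurable(1)[OF e] bd(1)]; rule that; assumption)
  obtain B where B: "tbounded T B" "AE t in time. B t = flux_at t j e"
    by (rule tbounded_modification[OF moment_flux_measurable(2)[OF e] bd(2)]; rule that; assumption)
  have weak: "(LINT t|time. \<phi>' t * A t + \<phi> t * B t) = 0"
    if \<phi>: "time_test T \<phi>" "\<And>t. (\<phi> has_real_derivative \<phi>' t) (at t)" for \<phi> \<phi>'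
  proof -
    let ?\<psi> = "\<lambda>t x. (\<phi> t * e x) *\<^sub>R axis j (1::real) :: real^3"
    let ?I = "\<lambda>t. LINT x|torus. clark_integrand \<alpha> u p ?\<psi> t x"
    have "test_function T ?\<psi>" by (rule separated_test_function[OF \<phi>(1) e])
    then have zero: "(LINT t|time. ?I t) = 0" using sol unfolding clark_weak_solution_def by blast
    have ae: "AE t in time. \<phi>' t * A t + \<phi> t * B t = ?I t"
      using A(2) B(2) finite_norms
    proof eventually_elim
      case (elim t)
      show ?case unfolding clark_integral_separated[where u = u and p = p and t = t, OF \<alpha> e \<phi>(2) conjunct1[OF elim(3)] conjunct2[OF elim(3)]] elim(1,2) ..
    qed
    have m: "(\<lambda>t. \<phi>' t * A t + \<phi> t * B t) \<in> borel_measurable time"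
      by (intro borel_measurable_add borel_measurable_times time_test_derivative_measurable[OF \<phi>]
          borel_measurable_integrable tbounded_integrable(1) A B) simp_all
    show ?thesis using integral_cong_AE[OF m measurable_AE_cong[OF m ae] ae] zero by simp
  qed
  obtain c where c: "AE t in time. A t = c + prim B t"
    by (rule weak_time_derivative[OF \<theta> T A(1) B(1) weak])
  show thesis
  proof (rule that[OF B(1)])
    show "AE t in time. moment_at t j e = c + prim B t \<and> flux_at t j e = B t"
      using c A(2) B(2) by eventually_elim simp
  qed
qed

text \<open>The exceptional set of times depends on \<open>e\<close>; countably many waves \<open>e\<close> will suffice.\<close>

lemma weak_divergence:
  assumes e: "sper e"
  shows "AE t in time. (\<Sum>i\<in>UNIV. LINT x|torus. component (u t) i x * partial i e x) = 0"
proof -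
  let ?d = "\<lambda>t. \<Sum>i\<in>UNIV. LINT x|torus. component (u t) i x * partial i e x"
  have ce: "cper (partial i e)" for i by (rule sper_cper[OF sper_partial[OF e]])
  have m: "?d \<in> borel_measurable time"
  proof (rule strongly_measurable_functional[OF strongly_measurable_solution finite_norms,
        where F = "\<lambda>w q. \<Sum>i\<in>UNIV. LINT x|torus. component w i x * partial i e x"])
    fix w r and \<sigma> :: "nat \<Rightarrow> real^3 \<Rightarrow> real^3" and \<tau> :: "nat \<Rightarrow> real^3 \<Rightarrow> real"
    assume a: "H1_norm \<alpha> w < \<infinity>" "\<And>n. H1_norm \<alpha> (\<sigma> n) < \<infinity>" "(\<lambda>n. H1_norm \<alpha> (\<lambda>x. w x - \<sigma> n x)) \<longlonglongrightarrow> 0"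
    have "(\<lambda>n. LINT x|torus. component (\<sigma> n) i x * 1 * partial i e x) \<longlonglongrightarrow> (LINT x|torus. component w i x * 1 * partial i e x)" for i
      by (rule L2_product_tendsto[OF H1_norm_facts(3)[OF \<alpha> a(2)] L2_const H1_norm_facts(3)[OF \<alpha> a(1)] L2_const ce
            H1_convergence(1)[OF \<alpha> a]]) simp
    then show "(\<lambda>n. \<Sum>i\<in>UNIV. LINT x|torus. component (\<sigma> n) i x * partial i e x)
        \<longlonglongrightarrow> (\<Sum>i\<in>UNIV. LINT x|torus. component w i x * partial i e x)"
      by (intro tendsto_sum) simp
  qed
  obtain C where C: "C \<ge> 0" "AE t in time. H1_norm \<alpha> (u t) \<le> ennreal C \<and> Lp_norm 1 (p t) \<le> ennreal C"
    by (rule norm_bound; rule that; assumption)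
  obtain B where B: "\<And>i x. \<bar>partial i e x\<bar> \<le> B" by (rule sper_bounded2[OF e]; rule that; assumption)
  have "AE t in time. \<bar>?d t\<bar> \<le> 3 * (B * (C\<^sup>2 + C\<^sup>2 / \<alpha>\<^sup>2 + 1))"
    using C(2)
  proof eventually_elim
    case (elim t)
    note f = H1_bound_facts[OF \<alpha> C(1) conjunct1[OF elim]]
    show ?case by (intro abs_sum3_le LINT_L2_bound1[OF H1_norm_facts(3)[OF \<alpha> f(1)] ce B f(2)])
  qed
  from tbounded_modification[OF m this] obtain g where g: "tbounded T g" "AE t in time. g t = ?d t" .
  have "AE t in time. g t = 0"
  proof (rule AE_zero_if_test_integrals_zero[OF \<theta> tbounded_integrable(1)[OF g(1)]])
    fix \<phi> assume \<phi>: "time_test T \<phi>"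
    let ?I = "\<lambda>t. LINT x|torus. (\<Sum>i\<in>UNIV. u t x $ i * partial i (\<lambda>x. \<phi> t * e x) x)"
    have "test_function T (\<lambda>t x. \<phi> t * e x)" using separated_test_function[OF \<phi> e, of "1::real"] by simp
    then have zero: "(LINT t|time. ?I t) = 0" using sol unfolding clark_weak_solution_def by blast
    have ae: "AE t in time. \<phi> t * g t = ?I t"
      using g(2) finite_norms
    proof eventually_elim
      case (elim t)
      have i: "integrable torus (\<lambda>x. component (u t) i x * partial i e x)" for i
        using integrable_cper_mult[OF ce L2_integrable[OF H1_norm_facts(3)[OF \<alpha> conjunct1[OF elim(2)]]]] by (simp add: mult.commute)
      have "(\<Sum>i\<in>UNIV. u t x $ i * partial i (\<lambda>x. \<phi> t * e x) x) = \<phi> t * (\<Sum>i\<in>UNIV. component (u t) i x * partial i e x)" for x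
        using e by (simp add: sper_def partial_cmult sum_distrib_left mult.left_commute)
      then show ?case using elim(1) i by simp
    qed
    have m: "(\<lambda>t. \<phi> t * g t) \<in> borel_measurable time"
      by (rule borel_measurable_integrable[OF tbounded_integrable(1)[OF time_test_mult_tbounded[OF \<phi> g(1)]]])
    show "(LINT t|time. \<phi> t * g t) = 0" using integral_cong_AE[OF m measurable_AE_cong[OF m ae] ae] zero by simp
  qed
  with g(2) show ?thesis by eventually_elim simp
qed

lemma divergence_free: "AE t in time. AE x in torus. (\<Sum>i\<in>UNIV. grad (u t) i i x) = 0"
proof -
  have "AE t in time. \<forall>k. (\<Sum>i\<in>UNIV. LINT x|torus. component (u t) i x * partial i (wave k \<tau>) x) = 0" for \<tau>
    unfolding AE_all_countable using weak_divergence[OF sper_intros(2)] by blast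
  from this[of 0] this[of "- pi / 2"] finite_norms show ?thesis
  proof eventually_elim
    case (elim t)
    note h = conjunct1[OF elim(3)]
    note w = H1_norm_facts(2)[OF \<alpha> h]
    let ?D = "\<lambda>x. \<Sum>i\<in>UNIV. grad (u t) i i x"
    have iD: "integrable torus ?D" using wpartD(2)[OF w] by simp
    have z: "(LINT x|torus. wave k \<tau> x * ?D x) = - (\<Sum>i\<in>UNIV. LINT x|torus. component (u t) i x * partial i (wave k \<tau>) x)" for k \<tau>
    proof -
      have "(LINT x|torus. wave k \<tau> x * ?D x) = (\<Sum>i\<in>UNIV. LINT x|torus. wave k \<tau> x * grad (u t) i i x)"
        unfolding sum_distrib_left
        by (rule Bochner_Integration.integral_sum) (rule integrable_cper_mult[OF sper_cper[OF sper_intros(2)] wpartD(2)[OF w]])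
      also have "\<dots> = (\<Sum>i\<in>UNIV. - (LINT x|torus. partial i (wave k \<tau>) x * component (u t) i x))"
        using wpartD(3)[OF w sper_intros(2)] by simp
      finally show ?thesis by (simp add: sum_negf mult.commute)
    qed
    show ?case
    proof (rule fourier_unique[OF iD])
      fix k \<tau>
      have i: "integrable torus (\<lambda>x. wave k \<tau> x * ?D x)" for \<tau>
        by (rule integrable_cper_mult[OF sper_cper[OF sper_intros(2)] iD])
      have "wave k \<tau> x * ?D x = cos \<tau> * (wave k 0 x * ?D x) - sin \<tau> * (wave k (- pi / 2) x * ?D x)" for x
        unfolding wave_reduce[of k \<tau>] by (simp only: left_diff_distrib mult.assoc)
      then have "(LINT x|torus. wave k \<tau> x * ?D x)
          = (LINT x|torus. cos \<tau> * (wave k 0 x * ?D x) - sin \<tau> * (wave k (- pi / 2) x * ?D x))" by (simp only:)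
      also have "\<dots> = cos \<tau> * (LINT x|torus. wave k 0 x * ?D x) - sin \<tau> * (LINT x|torus. wave k (- pi / 2) x * ?D x)"
        by (subst Bochner_Integration.integral_diff) (simp_all only: integrable_mult_right i Bochner_Integration.integral_mult_right_zero)
      also have "\<dots> = 0" unfolding z using elim(1,2) by simp
      finally show "(LINT x|torus. wave k \<tau> x * ?D x) = 0" .
    qed
  qed
qed

lemma W13_solution: "AE t in time. \<forall>i. W13 (component (u t) i) (\<lambda>k. grad (u t) k i)"
proof -
  obtain \<sigma> :: "nat \<Rightarrow> real \<Rightarrow> real^3 \<Rightarrow> real^3" where \<sigma>: "\<And>n t. t \<in> {0<..<T} \<Longrightarrow> besov_infinity_norm \<theta> s 3 (\<sigma> n t) < \<infinity>"
    "AE t in time. (\<lambda>n. besov_infinity_norm \<theta> s 3 (\<lambda>x. u t x - \<sigma> n t x)) \<longlonglongrightarrow> 0"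
    using besov unfolding in_Bochner_Lq_def strongly_measurable_def by blast
  from \<sigma>(2) finite_norms AE_space show ?thesis
  proof eventually_elim
    case (elim t)
    have "eventually (\<lambda>n. besov_infinity_norm \<theta> s 3 (\<lambda>x. u t x - \<sigma> n t x) < \<infinity>) sequentially"
      using order_tendstoD(2)[OF elim(1), of \<infinity>] by simp
    then obtain n where n: "besov_infinity_norm \<theta> s 3 (\<lambda>x. u t x - \<sigma> n t x) < \<infinity>"
      by (auto simp: eventually_sequentially)
    have "t \<in> {0<..<T}" using elim(3) by simp
    from W13_if_near_besov[OF \<theta> s \<alpha> conjunct1[OF elim(2)] \<sigma>(1)[OF this] n] show ?case by blast
  qed
qed

end

section \<open>Conservation of energy\<close>

lemma tbounded_cmult:
  assumes "tbounded T f" shows "tbounded T (\<lambda>t. c * f t)"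
  using tbounded_mult_bounded[OF assms, of "\<lambda>_. c" "\<bar>c\<bar>"] by (simp add: mult.commute)

lemma tbounded_sum:
  "finite A \<Longrightarrow> (\<And>i. i \<in> A \<Longrightarrow> tbounded T (f i)) \<Longrightarrow> tbounded T (\<lambda>t. \<Sum>i\<in>A. f i t)"
proof (induction A rule: finite_induct)
  case empty
  show ?case unfolding tbounded_def by auto
next
  case (insert i A)
  then show ?case by (simp add: tbounded_add)
qed

lemma prim_square:
  assumes B: "tbounded T B" and t: "0 \<le> t"
  shows "prim (\<lambda>t. a * (2 * (c * B t + B t * prim B t))) t = a * ((c + prim B t)\<^sup>2 - c\<^sup>2)"
proof -
  let ?p = "\<lambda>t. B t * prim B t"
  note i = tbounded_integrable_on[OF B, of 0 t] tbounded_integrable_on[OF tbounded_mult_prim[OF B B], of 0 t]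
  have "prim B t * prim B t = prim (\<lambda>t. ?p t + ?p t) t" by (rule prim_mult[OF B B t])
  also have "\<dots> = 2 * prim ?p t" using integral_add[OF i(2) i(2)] by simp
  finally have sq: "2 * prim ?p t = (prim B t)\<^sup>2" by (simp add: power2_eq_square)
  have "prim (\<lambda>t. a * (2 * (c * B t + B t * prim B t))) t = a * (2 * prim (\<lambda>t. c * B t + ?p t) t)"
    by (simp only: Henstock_Kurzweil_Integration.integral_mult_right)
  also have "prim (\<lambda>t. c * B t + ?p t) t = c * prim B t + prim ?p t"
    using integral_add[OF integrable_on_cmult_left[OF i(1), of c] i(2)] by simp
  finally show ?thesis using sq by (simp add: power2_sum algebra_simps)
qed

lemma abs_prim_le:
  assumes H: "tbounded T H" and t: "t \<in> {0<..<T}"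
  shows "ennreal \<bar>prim H t\<bar> \<le> (\<integral>\<^sup>+r. ennreal \<bar>H r\<bar> \<partial>lebesgue_on {0<..<T})"
proof -
  obtain M where M: "\<And>t. \<bar>H t\<bar> \<le> M" "H \<in> borel_measurable lebesgue" "\<And>t. t \<notin> {0..T} \<Longrightarrow> H t = 0"
    by (rule tboundedE[OF H]; rule that; assumption)
  have tb: "tbounded T (\<lambda>t. \<bar>H t\<bar>)" unfolding tbounded_def using M by auto
  have "\<bar>prim H t\<bar> \<le> prim (\<lambda>t. \<bar>H t\<bar>) t"
    using integral_norm_bound_integral[OF tbounded_integrable_on[OF H] tbounded_integrable_on[OF tb], of 0 t] by simp
  also have "\<dots> \<le> prim (\<lambda>t. \<bar>H t\<bar>) T"
    using t by (intro integral_subset_le tbounded_integrable_on[OF tb]) auto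
  also have "\<dots> = (LINT r|lebesgue_on {0<..<T}. \<bar>H r\<bar>)" by (rule tbounded_integrable(2)[OF tb, symmetric])
  finally have "ennreal \<bar>prim H t\<bar> \<le> ennreal (LINT r|lebesgue_on {0<..<T}. \<bar>H r\<bar>)" by (rule ennreal_leI)
  also have "\<dots> = (\<integral>\<^sup>+r. ennreal \<bar>H r\<bar> \<partial>lebesgue_on {0<..<T})"
    using nn_integral_eq_integral[OF tbounded_integrable(1)[OF tb]] by simp
  finally show ?thesis .
qed

context clark_solution
begin

text \<open>The kernel has finitely many frequencies, so the mollified energy is a finite sum of squares of
  Fourier modes. Each mode is a primitive by the weak formulation, and the product rule for
  primitives replaces a regularisation in time.\<close>

lemma mol_energy_evolution:
  obtains c H where "tbounded T H"
    "AE t in time. mol_energy \<alpha> N (component (u t)) (grad (u t)) = c + prim H t \<and>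
      H t = 2 * (\<Sum>j\<in>UNIV. flux_at t j (mol N (component (u t) j)))"
proof -
  obtain a :: "nat \<Rightarrow> real" and k \<tau> and M :: nat where mol: "\<And>f x. integrable torus f \<Longrightarrow>
      mol N f x = (\<Sum>m<M. a m * (LINT y|torus. wave (k m) (\<tau> m) y * f y) * wave (k m) (\<tau> m) x)"
    by (rule mol_expansion[of N]; rule that; assumption)
  define b where "b m = wave (k m) (\<tau> m)" for m
  \<comment> \<open>The eigenvalue of \<open>1 - \<alpha>\<^sup>2 \<Delta>\<close> on \<open>b m\<close>.\<close>
  define \<mu> where "\<mu> m = 1 + \<alpha>\<^sup>2 * (\<Sum>i\<in>UNIV. (2 * pi * of_int (k m $ i))\<^sup>2)" for m
  have b: "sper (b m)" for m unfolding b_def by (rule sper_intros)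
  have \<mu>: "\<mu> m > 0" for m unfolding \<mu>_def by (intro add_pos_nonneg mult_nonneg_nonneg sum_nonneg) auto
  have "\<forall>q::3 \<times> nat. \<exists>g. tbounded T (snd g) \<and>
    (AE t in time. moment_at t (fst q) (b (snd q)) = fst g + prim (snd g) t \<and> flux_at t (fst q) (b (snd q)) = snd g t)"
  proof
    fix q :: "3 \<times> nat"
    obtain c B where "tbounded T B"
      "AE t in time. moment_at t (fst q) (b (snd q)) = c + prim B t \<and> flux_at t (fst q) (b (snd q)) = B t"
      by (rule moment_evolution[OF b]; rule that; assumption)
    then show "\<exists>g. tbounded T (snd g) \<and>
      (AE t in time. moment_at t (fst q) (b (snd q)) = fst g + prim (snd g) t \<and> flux_at t (fst q) (b (snd q)) = snd g t)"
      by (intro exI[of _ "(c, B)"]) simp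
  qed
  from choice[OF this] obtain g where g: "\<forall>q::3 \<times> nat. tbounded T (snd (g q)) \<and>
    (AE t in time. moment_at t (fst q) (b (snd q)) = fst (g q) + prim (snd (g q)) t \<and> flux_at t (fst q) (b (snd q)) = snd (g q) t)" ..
  define c0 B where "c0 j m = fst (g (j, m))" and "B j m = snd (g (j, m))" for j m
  have B: "tbounded T (B j m)" for j m unfolding B_def using g by blast
  have ev: "AE t in time. \<forall>q::3 \<times> nat. moment_at t (fst q) (b (snd q)) = fst (g q) + prim (snd (g q)) t \<and>
      flux_at t (fst q) (b (snd q)) = snd (g q) t"
    unfolding AE_all_countable using g by blast
  define h where "h j m t = a m / \<mu> m * (2 * (c0 j m * B j m t + B j m t * prim (B j m) t))" for j m t
  define H where "H t = (\<Sum>j\<in>UNIV. \<Sum>m<M. h j m t)" for t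
  define c where "c = (\<Sum>j\<in>UNIV. \<Sum>m<M. a m / \<mu> m * (c0 j m)\<^sup>2)"
  have h: "tbounded T (h j m)" for j m
    unfolding h_def[abs_def] by (intro tbounded_cmult tbounded_add tbounded_mult_prim B)
  have H: "tbounded T H" unfolding H_def[abs_def] by (intro tbounded_sum h) simp_all
  have pH: "prim H t = (\<Sum>j\<in>UNIV. \<Sum>m<M. a m / \<mu> m * ((c0 j m + prim (B j m) t)\<^sup>2 - (c0 j m)\<^sup>2))" if "0 \<le> t" for t
  proof -
    have "prim H t = (\<Sum>j\<in>UNIV. prim (\<lambda>t. \<Sum>m<M. h j m t) t)"
      unfolding H_def[abs_def] by (intro integral_sum tbounded_integrable_on[where T = T] tbounded_sum h) simp_all
    also have "\<dots> = (\<Sum>j\<in>UNIV. \<Sum>m<M. prim (h j m) t)"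
      by (intro sum.cong refl integral_sum tbounded_integrable_on[where T = T] h) simp_all
    also have "\<dots> = (\<Sum>j\<in>UNIV. \<Sum>m<M. a m / \<mu> m * ((c0 j m + prim (B j m) t)\<^sup>2 - (c0 j m)\<^sup>2))"
      unfolding h_def[abs_def] by (simp only: prim_square[OF B that])
    finally show ?thesis .
  qed
  show thesis
  proof (rule that[OF H])
    show "AE t in time. mol_energy \<alpha> N (component (u t)) (grad (u t)) = c + prim H t \<and>
      H t = 2 * (\<Sum>j\<in>UNIV. flux_at t j (mol N (component (u t) j)))"
      using ev finite_norms AE_space
    proof eventually_elim
      case (elim t)
      note fin = conjunct1[OF elim(2)] conjunct2[OF elim(2)]
      note w = H1_norm_facts(2)[OF \<alpha> fin(1)]
      note L = H1_norm_facts(3,4)[OF \<alpha> fin(1)]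
      have t: "0 \<le> t" using elim(3) by simp
      define A where "A j m = c0 j m + prim (B j m) t" for j m
      have m1: "moment_at t j (b m) = A j m" and f1: "flux_at t j (b m) = B j m t" for j m
        using elim(1)[rule_format, of "(j, m)"] by (simp_all add: A_def c0_def B_def)
      have coeff: "(LINT y|torus. wave (k m) (\<tau> m) y * component (u t) j y) = A j m / \<mu> m" for j m
        using m1[of j m] moment_wave[where U = "component (u t)" and D = "grad (u t)", OF w, of \<alpha> j "k m" "\<tau> m"] \<mu>[of m]
        unfolding b_def \<mu>_def[symmetric] by (simp add: field_simps)
      have e: "mol N (component (u t) j) = (\<lambda>x. \<Sum>m<M. (a m * (A j m / \<mu> m)) * b m x)" for j
        unfolding mol[OF wpartD(1)[OF w], abs_def] coeff b_def ..
      have "moment_at t j (mol N (component (u t) j)) = (\<Sum>m<M. (a m * (A j m / \<mu> m)) * moment_at t j (b m))" for j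
        unfolding e
        by (rule linear_functional_sum[OF _ moment_linear[OF wpartD(1)[OF w] wpartD(2)[OF w]] b])
          (simp add: moment_def partial_zero)
      then have "mol_energy \<alpha> N (component (u t)) (grad (u t)) = (\<Sum>j\<in>UNIV. \<Sum>m<M. a m / \<mu> m * (A j m)\<^sup>2)"
        unfolding mol_energy_def m1 by (simp add: power2_eq_square mult_ac)
      also have "\<dots> = c + prim H t"
        unfolding c_def pH[OF t] A_def[symmetric] by (simp add: sum_subtractf right_diff_distrib)
      finally have 1: "mol_energy \<alpha> N (component (u t)) (grad (u t)) = c + prim H t" .
      have "flux_at t j (mol N (component (u t) j)) = (\<Sum>m<M. (a m * (A j m / \<mu> m)) * flux_at t j (b m))" for j
        unfolding e
      proof (rule linear_functional_sum[OF _ flux_linear b])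
        show "flux_at t j (\<lambda>x. 0) = 0" by (simp add: flux_def flux_density_def partial_zero)
        show "integrable torus (flux_density \<alpha> (component (u t)) (grad (u t)) (p t) j e)" if "sper e" for e
          by (rule flux_expand(1)[OF that L2_mult_integrable[OF L(1) L(1)] L2_mult_integrable[OF L(2) L(2)]
            L2_mult_integrable[OF L(1) L(2)] L2_mult_integrable[OF L(2) L(1)] Lp1_norm_facts(1)[OF fin(2)]])
      qed
      then have "2 * (\<Sum>j\<in>UNIV. flux_at t j (mol N (component (u t) j))) = (\<Sum>j\<in>UNIV. \<Sum>m<M. a m / \<mu> m * (2 * (A j m * B j m t)))"
        unfolding f1 by (simp add: sum_distrib_left mult_ac)
      also have "\<dots> = H t"
        unfolding H_def h_def A_def by (simp add: algebra_simps)
      finally show ?case using 1 by simp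
    qed
  qed
qed

lemma flux_vanishes:
  "AE t in time. (\<lambda>N. \<Sum>j\<in>UNIV. flux_at t j (mol N (component (u t) j))) \<longlonglongrightarrow> 0"
  using W13_solution divergence_free finite_norms
proof eventually_elim
  case (elim t)
  interpret divergence_free_W13 "component (u t)" "grad (u t)"
    by unfold_locales (use elim in auto)
  show ?case by (rule total_flux_tendsto[OF Lp1_norm_facts(1)[OF conjunct2[OF elim(3)]]])
qed

text \<open>Where the Besov norm is infinite the bound holds trivially, so the norm need not be finite almost
  everywhere.\<close>

lemma flux_dominated:
  obtains K where "K > 0"
    "AE t in time. \<forall>N. ennreal (\<bar>2 * (\<Sum>j\<in>UNIV. flux_at t j (mol N (component (u t) j)))\<bar> / K)
      \<le> ennpowr (besov_infinity_norm \<theta> s 3 (u t)) 3"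
proof -
  obtain C where C: "C \<ge> 0" "\<And>w i. H1_norm \<alpha> w < \<infinity> \<Longrightarrow> besov_infinity_norm \<theta> s 3 w < \<infinity> \<Longrightarrow>
      W13 (component w i) (\<lambda>k. grad w k i) \<and> N3 (component w i) \<le> C * enn2real (besov_infinity_norm \<theta> s 3 w) \<and>
      (\<forall>k. N3 (grad w k i) \<le> C * enn2real (besov_infinity_norm \<theta> s 3 w))"
    by (rule besov_gradient_bound[OF \<theta> s \<alpha>]; rule that; assumption)
  \<comment> \<open>The summand \<open>1\<close> makes the constant positive if \<open>C = 0\<close>.\<close>
  define K where "K = 2 * (9 + 400 * \<alpha>\<^sup>2) * C ^ 3 + 1"
  have K: "K > 0" unfolding K_def using C(1) by (intro add_nonneg_pos) auto
  show thesis
  proof (rule that[OF K])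
    show "AE t in time. \<forall>N. ennreal (\<bar>2 * (\<Sum>j\<in>UNIV. flux_at t j (mol N (component (u t) j)))\<bar> / K)
      \<le> ennpowr (besov_infinity_norm \<theta> s 3 (u t)) 3"
      using W13_solution divergence_free finite_norms
    proof eventually_elim
      case (elim t)
      interpret divergence_free_W13 "component (u t)" "grad (u t)"
        by unfold_locales (use elim in auto)
      let ?n = "besov_infinity_norm \<theta> s 3 (u t)"
      show ?case
      proof (cases "?n < \<infinity>")
        case False
        then have "?n = \<infinity>" by (metis infinity_ennreal_def less_top)
        then show ?thesis by (simp add: ennpowr_def)
      next
        case True
        define r where "r = enn2real ?n"
        have r: "r \<ge> 0" unfolding r_def by simp
        note bd = C(2)[OF conjunct1[OF elim(3)] True, folded r_def]
        have le: "\<bar>\<Sum>j\<in>UNIV. flux_at t j (mol N (component (u t) j))\<bar> \<le> (9 + 400 * \<alpha>\<^sup>2) * (C * r) ^ 3" for N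
          by (rule total_flux_bound[OF Lp1_norm_facts(1)[OF conjunct2[OF elim(3)]]]) (use bd in auto)
        have le': "\<bar>2 * (\<Sum>j\<in>UNIV. flux_at t j (mol N (component (u t) j)))\<bar> / K \<le> r ^ 3" for N
        proof -
          have "\<bar>2 * (\<Sum>j\<in>UNIV. flux_at t j (mol N (component (u t) j)))\<bar> \<le> 2 * ((9 + 400 * \<alpha>\<^sup>2) * (C * r) ^ 3)"
            using le[of N] unfolding abs_mult by simp
          also have "\<dots> = (K - 1) * r ^ 3" by (simp add: K_def power_mult_distrib)
          also have "\<dots> \<le> K * r ^ 3" using r by (intro mult_right_mono) auto
          finally show ?thesis using K by (simp add: divide_le_eq mult.commute)
        qed
        have "ennpowr ?n 3 = ennreal (r ^ 3)" using True r unfolding ennpowr_def r_def by (simp add: powr_numeral)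
        then show ?thesis using le' ennreal_leI by (metis (no_types, lifting))
      qed
    qed
  qed
qed

text \<open>The flux of the mollified energy tends to zero in \<open>L\<^sup>1\<close> in time by dominated convergence, while the
  mollified energy converges to the energy at almost every time. Hence the initial constants of
  the mollified energies converge, and their limit is the energy at almost every time.\<close>

theorem energy_constant:
  obtains E where "AE t in time. energy \<alpha> (component (u t)) (grad (u t)) = E"
proof -
  have "\<forall>N. \<exists>g. tbounded T (snd g) \<and> (AE t in time. mol_energy \<alpha> N (component (u t)) (grad (u t)) = fst g + prim (snd g) t \<and>
      snd g t = 2 * (\<Sum>j\<in>UNIV. flux_at t j (mol N (component (u t) j))))"
  proof
    fix N
    obtain c H where "tbounded T H" "AE t in time. mol_energy \<alpha> N (component (u t)) (grad (u t)) = c + prim H t \<and>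
      H t = 2 * (\<Sum>j\<in>UNIV. flux_at t j (mol N (component (u t) j)))"
      by (rule mol_energy_evolution[of N]; rule that; assumption)
    then show "\<exists>g. tbounded T (snd g) \<and> (AE t in time. mol_energy \<alpha> N (component (u t)) (grad (u t)) = fst g + prim (snd g) t \<and>
      snd g t = 2 * (\<Sum>j\<in>UNIV. flux_at t j (mol N (component (u t) j))))" by (intro exI[of _ "(c, H)"]) simp
  qed
  from choice[OF this] obtain g where g: "\<forall>N. tbounded T (snd (g N)) \<and> (AE t in time. mol_energy \<alpha> N (component (u t)) (grad (u t)) = fst (g N) + prim (snd (g N)) t \<and>
      snd (g N) t = 2 * (\<Sum>j\<in>UNIV. flux_at t j (mol N (component (u t) j))))" ..
  define c H where "c N = fst (g N)" and "H N = snd (g N)" for N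
  have H: "tbounded T (H N)" for N unfolding H_def using g by blast
  have ev: "AE t in time. \<forall>N. mol_energy \<alpha> N (component (u t)) (grad (u t)) = c N + prim (H N) t \<and>
      H N t = 2 * (\<Sum>j\<in>UNIV. flux_at t j (mol N (component (u t) j)))"
    unfolding AE_all_countable c_def H_def using g by blast
  have Hm: "H N \<in> borel_measurable time" for N by (rule borel_measurable_integrable[OF tbounded_integrable(1)[OF H]])
  obtain K where K: "K > 0" and dom: "AE t in time. \<forall>N. ennreal (\<bar>2 * (\<Sum>j\<in>UNIV. flux_at t j (mol N (component (u t) j)))\<bar> / K)
      \<le> ennpowr (besov_infinity_norm \<theta> s 3 (u t)) 3"
    by (rule flux_dominated; rule that; assumption)
  \<comment> \<open>The Besov norm itself need not be measurable in time, but the supremum of the fluxes is.\<close>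
  define h where "h t = (SUP N. ennreal (\<bar>H N t\<bar> / K))" for t
  have hm: "h \<in> borel_measurable time" unfolding h_def[abs_def] using Hm by measurable
  have "AE t in time. h t \<le> ennpowr (besov_infinity_norm \<theta> s 3 (u t)) 3"
    using ev dom by eventually_elim (auto simp: h_def intro: SUP_least)
  then have "(\<integral>\<^sup>+t. h t \<partial>time) \<le> (\<integral>\<^sup>+t. ennpowr (besov_infinity_norm \<theta> s 3 (u t)) 3 \<partial>time)" by (rule nn_integral_mono_AE)
  also have "\<dots> < \<infinity>" using besov by (simp add: in_Bochner_Lq_def)
  finally have hfin: "(\<integral>\<^sup>+t. h t \<partial>time) < \<infinity>" .
  have "(\<lambda>N. \<integral>\<^sup>+t. ennreal (\<bar>H N t\<bar> / K) \<partial>time) \<longlonglongrightarrow> (\<integral>\<^sup>+t. 0 \<partial>time)"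
  proof (rule nn_integral_dominated_convergence[where w = h])
    show "(\<lambda>t. ennreal (\<bar>H N t\<bar> / K)) \<in> borel_measurable time" for N using Hm by measurable
    show "AE t in time. ennreal (\<bar>H N t\<bar> / K) \<le> h t" for N unfolding h_def by (intro AE_I2 SUP_upper) simp
    show "AE t in time. (\<lambda>N. ennreal (\<bar>H N t\<bar> / K)) \<longlonglongrightarrow> 0"
      using ev flux_vanishes
    proof eventually_elim
      case (elim t)
      have "(\<lambda>N. 2 * (\<Sum>j\<in>UNIV. flux_at t j (mol N (component (u t) j)))) \<longlonglongrightarrow> 2 * 0" by (rule tendsto_mult[OF tendsto_const elim(2)])
      then have "(\<lambda>N. H N t) \<longlonglongrightarrow> 0" using elim(1) by simp
      then have "(\<lambda>N. \<bar>H N t\<bar> / K) \<longlonglongrightarrow> 0" using tendsto_divide[OF tendsto_rabs tendsto_const[of K]] K by fastforce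
      then show ?case using tendsto_ennrealI by fastforce
    qed
  qed (use hm hfin in simp_all)
  then have lim: "(\<lambda>N. \<integral>\<^sup>+t. ennreal (\<bar>H N t\<bar> / K) \<partial>time) \<longlonglongrightarrow> 0" by simp
  have prim0: "(\<lambda>N. prim (H N) t) \<longlonglongrightarrow> 0" if t: "t \<in> {0<..<T}" for t
  proof -
    have eq: "(\<integral>\<^sup>+r. ennreal \<bar>H N r\<bar> \<partial>time) = ennreal K * (\<integral>\<^sup>+r. ennreal (\<bar>H N r\<bar> / K) \<partial>time)" for N
    proof -
      have "ennreal \<bar>H N r\<bar> = ennreal K * ennreal (\<bar>H N r\<bar> / K)" for r
        using K by (simp add: ennreal_mult[symmetric])
      then show ?thesis using Hm by (simp add: nn_integral_cmult)
    qed
    have "(\<lambda>N. ennreal K * (\<integral>\<^sup>+r. ennreal (\<bar>H N r\<bar> / K) \<partial>time)) \<longlonglongrightarrow> ennreal K * 0"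
      by (rule ennreal_tendsto_cmult[OF _ lim]) simp
    then have up: "(\<lambda>N. \<integral>\<^sup>+r. ennreal \<bar>H N r\<bar> \<partial>time) \<longlonglongrightarrow> 0" unfolding eq by simp
    have "(\<lambda>N. ennreal \<bar>prim (H N) t\<bar>) \<longlonglongrightarrow> 0"
      by (rule tendsto_sandwich[OF _ _ tendsto_const up]) (use abs_prim_le[OF H t] in auto)
    then have "(\<lambda>N. enn2real (ennreal \<bar>prim (H N) t\<bar>)) \<longlonglongrightarrow> 0"
      using tendsto_enn2real[of "\<lambda>N. ennreal \<bar>prim (H N) t\<bar>" 0 sequentially] by simp
    then show ?thesis by (simp add: tendsto_rabs_zero_iff)
  qed
  have lim: "AE t in time. c \<longlonglongrightarrow> energy \<alpha> (component (u t)) (grad (u t))"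
    using ev W13_solution AE_space
  proof eventually_elim
    case (elim t)
    have "(\<lambda>N. mol_energy \<alpha> N (component (u t)) (grad (u t))) \<longlonglongrightarrow> energy \<alpha> (component (u t)) (grad (u t))"
      by (rule mol_energy_tendsto) (rule elim(2)[rule_format])
    moreover have "(\<lambda>N. prim (H N) t) \<longlonglongrightarrow> 0" using elim(3) by (intro prim0) simp
    ultimately have "(\<lambda>N. mol_energy \<alpha> N (component (u t)) (grad (u t)) - prim (H N) t) \<longlonglongrightarrow> energy \<alpha> (component (u t)) (grad (u t)) - 0"
      by (rule tendsto_diff)
    then show ?case using elim(1) by simp
  qed
  show thesis
  proof (rule that)
    show "AE t in time. energy \<alpha> (component (u t)) (grad (u t)) = lim c"
      using lim by eventually_elim (rule limI[symmetric])
  qed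
qed

end

theorem theoremB6:
  fixes \<alpha> T s :: real
    and u :: "real \<Rightarrow> real^3 \<Rightarrow> real^3"
    and p :: "real \<Rightarrow> real^3 \<Rightarrow> real"
    and \<theta> :: "real^3 \<Rightarrow> real"
  assumes "\<alpha> > 0" and "T > 0" and "s > 1"
    and "dyadic_cutoff \<theta>"
    and "clark_weak_solution \<alpha> T u p"
    and "in_Bochner_Lq (besov_infinity_norm \<theta> s 3) T 3 u"
  shows "AE t1 in lebesgue_on {0<..<T}. AE t2 in lebesgue_on {0<..<T}.
           H1_norm \<alpha> (u t1) = H1_norm \<alpha> (u t2)"
proof -
  interpret clark_solution \<alpha> T s u p \<theta> by unfold_locales (use assms in auto)
  obtain E where "AE t in time. energy \<alpha> (component (u t)) (grad (u t)) = E" by (rule energy_constant)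
  with finite_norms have *: "AE t in time. H1_norm \<alpha> (u t) = ennreal (sqrt E)"
  proof eventually_elim
    case (elim t)
    show ?case unfolding H1_norm_facts(5)[OF \<open>\<alpha> > 0\<close> conjunct1[OF elim(1)]] elim(2) ..
  qed
  from * show ?thesis
  proof eventually_elim
    case (elim t1)
    from * show ?case by eventually_elim (simp add: elim)
  qed
qed

end
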